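(* If $\sigma\in\mathrm{Stab}(\mathrm{Vect}_\Gamma)$ belongs to the closure of the subset $\mathrm{Stab}^{an}(\mathrm{Vect}_\Gamma)$ of analytic stability data in the topological space $\mathrm{Stab}(\mathrm{Vect}_\Gamma)$, then $\sigma$ is analytic.
   Context: Let $\Gamma$ be a free abelian group of finite rank $n$, $\Gamma_{\mathbb{R}}=\Gamma\otimes\mathbb{R}$, and $\mathfrak{g}=\mathrm{Vect}_\Gamma=\bigoplus_{\gamma}\mathfrak{g}_\gamma$ the $\Gamma$-graded complex Lie algebra of algebraic vector fields on the torus $\mathbf{T}_\Gamma=\mathrm{Hom}(\Gamma,\mathbb{C}^* )$ with monomials $x^\gamma$; $\mathfrak{g}_\gamma$ is spanned by $x^\gamma x_i\partial_{x_i}$, $1\le i\le n$. Sectors and groups. An admissible sector is $V=\{re^{i\theta}: r>0,\theta\in S\}\subset\mathbb{R}^2=\mathbb{C}$, $S\subset\mathbb{R}$ non-empty connected of length $<\pi$ (strict case), or an open interval of length $\pi$ (open half-plane); $V$ is open/closed/semiclosed if $S$ is. A strict cone is one containing no straight line. For a closed strict convex cone $C\subset\Gamma_{\mathbb{R}}$: $\mathfrak{g}_C=\prod_{\gamma\in C\cap\Gamma-\{0\}}\mathfrak{g}_\gamma$, $G_C=\exp(\mathfrak{g}_C)$. For a homomorphism $Z:\Gamma\to\mathbb{C}$ (central charge), with $\mathbb{R}$-linear extension $Z_{\mathbb{R}}$, and an open admissible $V$: $G_V=G_{V,Z}=\varinjlim_C G_C$ over closed strict convex cones $C$ with $Z_{\mathbb{R}}(C-\{0\})\subset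 V$ and $C\cap\mathrm{Ker}\,Z_{\mathbb{R}}=\{0\}$. Stability data. Stability data $\sigma$ on $\mathfrak{g}$ are a central charge $Z$ and elements $a(\gamma)\in\mathfrak{g}_\gamma$, $\gamma\in\Gamma-\{0\}$, such that there is a non-trivial quadratic form $Q$ on $\Gamma_{\mathbb{R}}$, negative definite on $\mathrm{Ker}\,Z_{\mathbb{R}}$, with $Q(\gamma)\ge 0$ whenever $a(\gamma)\ne0$. $\mathrm{Stab}(\mathfrak{g})$ is the set of all stability data. For a ray $l$ (vertex $0$ removed) $A_l=\exp\bigl(\sum_{Z(\gamma)\in l}a(\gamma)\bigr)$, and for a strict admissible sector $V$, $A_V=\prod_{l\subset V}A_l$ is the clockwise ordered product over rays $l\subset V$, an element of $G_C$ with $C$ the closed convex hull of $\{u: Q(u)\ge0, Z_{\mathbb{R}}(u)\in V\}$. Cyclic covers and representatives. An open cyclic cover of $\mathbb{R}^2-\{0\}$ is a family $(V_i)_{i\in J}$, $J$ a finite cyclically ordered set, of open admissible sectors covering $\mathbb{R}^2-\{0\}$ and going once around clockwise: with $\theta_j^\pm$ the angles (increasing clockwise) of the right ($+$) and left ($-$) boundary rays of $V_j$, $\theta_j^-\le\theta_{j+1}^-\le\theta_j^+\le\theta_{j+1}^+$ and $V_j\cap V_{j+1}\neq\emptyset$. For fixed $Z$, $\mathcal{M}_{(V_i)}$ is the quotient set of $\prod_{i\in J}G_{V_i}$ by the free action of $\prod_{i\in J}G_{V_i\cap V_{i+1}}$, where $h\in G_{V_i\cap V_{i+1}}$ acts by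 $(g_i,g_{i+1})\mapsto(g_ih^{-1},hg_{i+1})$. The set of stability data with central charge $Z$ is identified with $\mathcal{M}_{(V_i)}$: to $\sigma$ corresponds the class of $(A_{V_i'})_{i\in J}$ for any clockwise ordered disjoint decomposition $\mathbb{R}^2-\{0\}=\bigsqcup_i V_i'$ into semiclosed admissible sectors with closures (in $\mathbb{R}^2-\{0\}$) contained in $V_i$. Any element of this class is called a representative $(g_{V_i})_{i\in J}$ of $\sigma$. Topology on $\mathrm{Stab}(\mathfrak{g})$. Let $\sigma$ have central charge $Z$ and a representative $(g_{V_i})$, with $g_{V_i}\in G_{C_i}$, $C_i$ closed strict convex cones with $Z_{\mathbb{R}}(C_i-\{0\})\subset V_i$. For $Z'$ close to $Z$ one still has $Z'_{\mathbb{R}}(C_i-\{0\})\subset V_i$, so $(g_{V_i})$ represents stability data with central charge $Z'$. A basis of neighborhoods of $\sigma$ consists of the sets of all such stability data (same representative) with $Z'$ ranging over members of a basis of small neighborhoods of $Z$ in $\mathrm{Hom}(\Gamma,\mathbb{C})$. Analyticity. A series $\sum_{\mu\in C\cap\Gamma}c_\mu x^\mu$ ($C$ closed strict convex) is analytic if it converges absolutely at some point of $\mathbf{T}_\Gamma$. An element $g\in G_C$ is analytic if the series $g(x^\gamma)/x^\gamma=1+\sum_{\mu\in C\cap\Gamma-\{0\}}c_{\gamma\mu}x^\mu$ is analytic for all $\gamma\in\Gamma$; an element of $G_V$ is analytic if it is the image of an analytic element of some $G_C$ in the limit. Stability data $\sigma$ are called analytic if there exist an open cyclic cover $(V_i)_{i\in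 J}$ and a representative $(g_{V_i})_{i\in J}$ of $\sigma$ with all $g_{V_i}$ analytic. $\mathrm{Stab}^{an}(\mathrm{Vect}_\Gamma)\subset\mathrm{Stab}(\mathrm{Vect}_\Gamma)$ is the subset of analytic stability data. *)

theory Defs
  imports "HOL-Analysis.Analysis" "HOL-Library.Groups_Big_Fun"
begin

text \<open>
  The lattice \<open>\<Gamma>\<close> is \<open>int ^ 'n\<close>, so that \<open>\<Gamma>\<close> tensored with the reals is \<open>real ^ 'n\<close>, the torus
  \<open>Hom(\<Gamma>, \<complex>*)\<close> consists of the vectors in \<open>complex ^ 'n\<close> with non-zero coordinates, and
  \<open>Hom(\<Gamma>, \<complex>)\<close>, with its usual topology, is \<open>complex ^ 'n\<close> (a homomorphism is given by its values
  on the standard basis).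
\<close>

definition rvec :: "int ^ 'n \<Rightarrow> real ^ 'n" where
  "rvec \<gamma> = (\<chi> i. real_of_int (\<gamma> $ i))"

definition charge_real :: "complex ^ 'n::finite \<Rightarrow> real ^ 'n \<Rightarrow> complex" where
  "charge_real Z u = (\<Sum>i\<in>UNIV. complex_of_real (u $ i) * Z $ i)"

definition charge :: "complex ^ 'n::finite \<Rightarrow> int ^ 'n \<Rightarrow> complex" where
  "charge Z \<gamma> = charge_real Z (rvec \<gamma>)"


subsection \<open>Sectors\<close>

text \<open>Angles increase clockwise, hence the sign.\<close>

definition sector :: "real set \<Rightarrow> complex set" where
  "sector S = {complex_of_real r * cis (- \<theta>) | r \<theta>. 0 < r \<and> \<theta> \<in> S}"

definition admissible_angles :: "real set \<Rightarrow> bool" where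
  "admissible_angles S \<longleftrightarrow> S \<noteq> {} \<and> connected S \<and>
     ((\<exists>a b. S \<subseteq> {a..b} \<and> b - a < pi) \<or> (\<exists>a. S = {a<..<a + pi}))"


subsection \<open>Formal vector fields and the groups \<open>G_C\<close>, \<open>G_V\<close>\<close>

text \<open>
  The component of degree \<open>\<gamma>\<close> of \<open>Vect_\<Gamma>\<close> is \<open>complex ^ 'n\<close>, where \<open>v\<close> stands for the vector field
  \<open>x^\<gamma> (\<Sum>i. v_i x_i \<partial>/\<partial>x_i)\<close>; a family \<open>\<xi>\<close> of such \<open>v\<close> is a formal sum of homogeneous vector fields.

  An operator \<open>T\<close> on formal series is encoded by its coefficients: \<open>T \<gamma> \<mu>\<close> is the coefficient of
  \<open>x^\<mu>\<close> in \<open>T(x^\<gamma>) / x^\<gamma>\<close>. All operators below are supported, in the variable \<open>\<mu>\<close>, on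
  a strict cone, which makes the sums over function bodies finite.

  Vector fields act faithfully as derivations, so the pro-unipotent group
  \<open>G_C = exp(g_C)\<close> is realised as the group of automorphisms of formal series
  that are exponentials of elements of \<open>g_C\<close>, with composition as multiplication.
\<close>

type_synonym 'n vfield = "(int, 'n) vec \<Rightarrow> (complex, 'n) vec"
type_synonym 'n oper = "(int, 'n) vec \<Rightarrow> (int, 'n) vec \<Rightarrow> complex"

definition vf_op :: "'n::finite vfield \<Rightarrow> 'n oper" where
  "vf_op \<xi> \<gamma> \<mu> = (\<Sum>i\<in>UNIV. \<xi> \<mu> $ i * of_int (\<gamma> $ i))"

definition op_id :: "'n::finite oper" where
  "op_id \<gamma> \<mu> = (if \<mu> = 0 then 1 else 0)"

definition op_comp :: "'n::finite oper \<Rightarrow> 'n oper \<Rightarrow> 'n oper" where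
  "op_comp S T \<gamma> \<rho> = Sum_any (\<lambda>\<mu>. T \<gamma> \<mu> * S (\<gamma> + \<mu>) (\<rho> - \<mu>))"

definition vf_exp :: "'n::finite vfield \<Rightarrow> 'n oper" where
  "vf_exp \<xi> \<gamma> \<mu> = Sum_any (\<lambda>k. (op_comp (vf_op \<xi>) ^^ k) op_id \<gamma> \<mu> / fact k)"

definition strict_closed_cone :: "(real ^ 'n::finite) set \<Rightarrow> bool" where
  "strict_closed_cone C \<longleftrightarrow> closed C \<and> convex_cone C \<and>
     \<not> (\<exists>u v. v \<noteq> 0 \<and> range (\<lambda>t. u + t *\<^sub>R v) \<subseteq> C)"

definition lie_cone :: "(real ^ 'n::finite) set \<Rightarrow> 'n vfield set" where
  "lie_cone C = {\<xi>. \<forall>\<gamma>. \<xi> \<gamma> \<noteq> 0 \<longrightarrow> \<gamma> \<noteq> 0 \<and> rvec \<gamma> \<in> C}"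

definition group_cone :: "(real ^ 'n::finite) set \<Rightarrow> 'n oper set" where
  "group_cone C = vf_exp ` lie_cone C"

definition cones_over :: "complex ^ 'n::finite \<Rightarrow> complex set \<Rightarrow> (real ^ 'n) set set" where
  "cones_over Z V = {C. strict_closed_cone C \<and> charge_real Z ` (C - {0}) \<subseteq> V \<and>
                        C \<inter> {u. charge_real Z u = 0} = {0}}"

text \<open>The transition maps of the inductive systems are inclusions, so the limits are unions.\<close>

definition lie_sector :: "complex ^ 'n::finite \<Rightarrow> complex set \<Rightarrow> 'n vfield set" where
  "lie_sector Z V = (\<Union>C\<in>cones_over Z V. lie_cone C)"

definition group_sector :: "complex ^ 'n::finite \<Rightarrow> complex set \<Rightarrow> 'n oper set" where
  "group_sector Z V = (\<Union>C\<in>cones_over Z V. group_cone C)"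


subsection \<open>Stability data\<close>

definition quadratic_form :: "('v::real_vector \<Rightarrow> real) \<Rightarrow> bool" where
  "quadratic_form Q \<longleftrightarrow> (\<exists>B. bilinear B \<and> (\<forall>u. Q u = B u u))"

text \<open>
  The elements \<open>a \<gamma>\<close> are only given for \<open>\<gamma> \<noteq> 0\<close>; the value at \<open>0\<close> is normalised to \<open>0\<close>.
\<close>

type_synonym 'n stability_data = "(complex, 'n) vec \<times> 'n vfield"

definition Stab :: "'n::finite stability_data set" where
  "Stab = {(Z, a). a 0 = 0 \<and>
     (\<exists>Q :: real ^ 'n \<Rightarrow> real. quadratic_form Q \<and> Q \<noteq> (\<lambda>_. 0) \<and>
        (\<forall>u. u \<noteq> 0 \<and> charge_real Z u = 0 \<longrightarrow> Q u < 0) \<and>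
        (\<forall>\<gamma>. a \<gamma> \<noteq> 0 \<longrightarrow> 0 \<le> Q (rvec \<gamma>)))}"

definition A_ray :: "'n::finite stability_data \<Rightarrow> real \<Rightarrow> 'n oper" where
  "A_ray \<sigma> \<theta> =
     vf_exp (\<lambda>\<gamma>. if charge (fst \<sigma>) \<gamma> \<in> sector {\<theta>} then snd \<sigma> \<gamma> else 0)"

text \<open>
  The clockwise ordered product over all rays in \<open>sector S\<close>: each coefficient of the product over a
  finite set \<open>F\<close> of rays is eventually constant as \<open>F\<close> increases, and the constant is the
  coefficient of the infinite product. The factor with the smallest clockwise angle is leftmost.
\<close>

definition A_finite :: "'n::finite stability_data \<Rightarrow> real set \<Rightarrow> 'n oper" where
  "A_finite \<sigma> F = foldr op_comp (map (A_ray \<sigma>) (sorted_list_of_set F)) op_id"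

definition A_sector :: "'n::finite stability_data \<Rightarrow> real set \<Rightarrow> 'n oper" where
  "A_sector \<sigma> S \<gamma> \<mu> =
     (THE c. \<forall>\<^sub>F F in finite_subsets_at_top S. A_finite \<sigma> F \<gamma> \<mu> = c)"


subsection \<open>Cyclic covers and representatives\<close>

text \<open>
  A family over a finite cyclically ordered set with \<open>m\<close> elements is an \<open>m\<close>-periodic family
  over the integers. The boundary angles of the sectors are lifted to the real line; going once
  around corresponds to adding \<open>2 * pi\<close>.
\<close>

definition cyclic_family :: "nat \<Rightarrow> (int \<Rightarrow> 'b) \<Rightarrow> bool" where
  "cyclic_family m f \<longleftrightarrow> (\<forall>i. f (i + int m) = f i)"

definition open_cyclic_cover :: "nat \<Rightarrow> (int \<Rightarrow> complex set) \<Rightarrow> bool" where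
  "open_cyclic_cover m V \<longleftrightarrow> 0 < m \<and> cyclic_family m V \<and>
     (\<Union>i. V i) = - {0} \<and> (\<forall>i. V i \<inter> V (i + 1) \<noteq> {}) \<and>
     (\<exists>lo hi :: int \<Rightarrow> real. \<forall>i.
        V i = sector {lo i<..<hi i} \<and> admissible_angles {lo i<..<hi i} \<and>
        lo i \<le> lo (i + 1) \<and> lo (i + 1) \<le> hi i \<and> hi i \<le> hi (i + 1) \<and>
        lo (i + int m) = lo i + 2 * pi \<and> hi (i + int m) = hi i + 2 * pi)"

text \<open>
  The sets \<open>sector (S i)\<close> form a clockwise ordered decomposition of the punctured plane into
  semiclosed sectors. Disjointness forces all of them to be closed on the same side.
\<close>

definition sector_decomposition ::
    "nat \<Rightarrow> (int \<Rightarrow> complex set) \<Rightarrow> (int \<Rightarrow> real set) \<Rightarrow> bool" where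
  "sector_decomposition m V S \<longleftrightarrow>
     (\<exists>t :: int \<Rightarrow> real. (\<forall>i. t (i + int m) = t i + 2 * pi) \<and>
        ((\<forall>i. S i = {t i..<t (i + 1)}) \<or> (\<forall>i. S i = {t i<..t (i + 1)}))) \<and>
     (\<forall>i. admissible_angles (S i) \<and> closure (sector (S i)) - {0} \<subseteq> V i)"

text \<open>
  The action of \<open>(exp (\<eta> i))\<close>, where \<open>exp (\<eta> i)\<close> belongs to the group of \<open>V i \<inter> V (i + 1)\<close>.
\<close>

definition gauge_act :: "(int \<Rightarrow> 'n::finite vfield) \<Rightarrow> (int \<Rightarrow> 'n oper) \<Rightarrow> int \<Rightarrow> 'n oper" where
  "gauge_act \<eta> g i = op_comp (vf_exp (\<eta> (i - 1))) (op_comp (g i) (vf_exp (\<lambda>\<gamma>. - \<eta> i \<gamma>)))"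

definition representative ::
    "'n::finite stability_data \<Rightarrow> nat \<Rightarrow> (int \<Rightarrow> complex set) \<Rightarrow> (int \<Rightarrow> 'n oper) \<Rightarrow> bool" where
  "representative \<sigma> m V g \<longleftrightarrow>
     cyclic_family m g \<and> (\<forall>i. g i \<in> group_sector (fst \<sigma>) (V i)) \<and>
     (\<exists>S \<eta>. sector_decomposition m V S \<and> cyclic_family m \<eta> \<and>
        (\<forall>i. \<eta> i \<in> lie_sector (fst \<sigma>) (V i \<inter> V (i + 1))) \<and>
        g = gauge_act \<eta> (\<lambda>i. A_sector \<sigma> (S i)))"


subsection \<open>Topology\<close>

text \<open>
  A basic open set is given by a representative \<open>g\<close>, cones \<open>C i\<close> supporting it, and an open set \<open>U\<close>
  of central charges so small that each \<open>C i\<close> remains over \<open>V i\<close>. It is a basic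
  neighbourhood of each of its points.
\<close>

definition basic_opens :: "'n::finite stability_data set set" where
  "basic_opens = {{\<sigma> \<in> Stab. fst \<sigma> \<in> U \<and> representative \<sigma> m V g} | U m V g.
     open U \<and> open_cyclic_cover m V \<and> cyclic_family m g \<and>
     (\<exists>C. cyclic_family m C \<and>
        (\<forall>i. g i \<in> group_cone (C i) \<and> (\<forall>Z\<in>U. C i \<in> cones_over Z (V i))))}"

definition Stab_topology :: "'n::finite stability_data topology" where
  "Stab_topology = topology_generated_by basic_opens"


subsection \<open>Analyticity\<close>

definition torus_monomial :: "complex ^ 'n::finite \<Rightarrow> int ^ 'n \<Rightarrow> complex" where
  "torus_monomial x \<mu> = (\<Prod>i\<in>UNIV. (x $ i) powi (\<mu> $ i))"

definition analytic_series :: "(int ^ 'n::finite \<Rightarrow> complex) \<Rightarrow> bool" where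
  "analytic_series c \<longleftrightarrow> (\<exists>x :: complex ^ 'n. (\<forall>i. x $ i \<noteq> 0) \<and>
     (\<lambda>\<mu>. norm (c \<mu> * torus_monomial x \<mu>)) summable_on UNIV)"

definition analytic_element :: "'n::finite oper \<Rightarrow> bool" where
  "analytic_element g \<longleftrightarrow> (\<forall>\<gamma>. analytic_series (g \<gamma>))"

definition Stab_an :: "'n::finite stability_data set" where
  "Stab_an = {\<sigma> \<in> Stab. \<exists>m V g. open_cyclic_cover m V \<and> representative \<sigma> m V g \<and>
     (\<forall>i. analytic_element (g i))}"

end

theory Submission
  imports Defs
begin

text \<open>
  Two facts carry the proof. First, if an analytic automorphism factors as \<open>g = a b\<close> with \<open>a\<close> and
  \<open>b\<close> supported in disjoint additively closed parts of a strict cone, then \<open>a\<close> and \<open>b\<close> are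
  analytic. A direct majorant for the factorisation diverges, since composition loses derivatives;
  but \<open>a\<^sup>-\<^sup>1\<close> and \<open>b\<close> solve linear equations for the degree derivation, whose right-hand sides are
  vector fields bounded in terms of \<open>g\<close>, and dividing by the degree recovers the lost derivative.

  Second, factorisations along a ray are unique, so a gauge transformation between two
  representatives is built from factors of these representatives. Hence, for analytic \<open>\<tau>\<close>, all the
  \<open>A_V\<close> of \<open>\<tau>\<close> are analytic. If moreover \<open>\<tau>\<close> has the same representative as \<open>\<sigma>\<close> and a nearby
  central charge, then the gauge transformation from this representative to \<open>(A_V)\<close> of \<open>\<tau>\<close> is
  supported in cones that are still admissible for the central charge of \<open>\<sigma>\<close>; so \<open>(A_V)\<close> of
  \<open>\<tau>\<close> is an analytic representative of \<open>\<sigma>\<close>.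
\<close>

subsection \<open>Graded operators\<close>

text \<open>Every strict cone is handled through one integral linear form \<open>l\<close> that
  dominates the l1 norm on its lattice points. This makes all convolutions finite, reduces
  convergence on the torus to one radius, and lets multiplication by the degree pay for a factor
  \<open>l1\<close>, that is, for one derivative. Group elements are treated as multiplicative
  operators with prescribed support.

  The obstacle in the topology is that a gauge transformation for the nearby charge is only known to
  be supported in some cone for that charge, and this cone may reach beyond those admissible for the
  charge of \<sigma>. Shrinking the neighbourhood gives no control, since the cone is chosen after
  the neighbourhood. The support must be read off from the common representative alone, by factoring
  it. A cover by four half-planes is used because the bisector of an overlap tells which of its two
  bounding linear forms is larger, so that one bound implies both.\<close>

definition deg :: "int ^ 'n::finite \<Rightarrow> int ^ 'n \<Rightarrow> int" where
  "deg l \<mu> = (\<Sum>i\<in>UNIV. l $ i * \<mu> $ i)"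

definition l1 :: "int ^ 'n::finite \<Rightarrow> int" where
  "l1 \<mu> = (\<Sum>i\<in>UNIV. \<bar>\<mu> $ i\<bar>)"

definition op_on :: "(int ^ 'n::finite) set \<Rightarrow> 'n oper \<Rightarrow> bool" where
  "op_on A T \<longleftrightarrow> (\<forall>\<gamma> \<mu>. T \<gamma> \<mu> \<noteq> 0 \<longrightarrow> \<mu> \<in> insert 0 A)"

definition add_closed :: "(int ^ 'n::finite) set \<Rightarrow> bool" where
  "add_closed A \<longleftrightarrow> (\<forall>a\<in>A. \<forall>b\<in>A. a + b \<in> A)"

definition lie_on :: "(int ^ 'n::finite) set \<Rightarrow> 'n vfield set" where
  "lie_on A = {\<xi>. \<forall>\<mu>. \<xi> \<mu> \<noteq> 0 \<longrightarrow> \<mu> \<in> A}"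

definition multiplicative :: "'n::finite oper \<Rightarrow> bool" where
  "multiplicative T \<longleftrightarrow>
     (\<forall>\<gamma> \<delta> \<rho>. T (\<gamma> + \<delta>) \<rho> = Sum_any (\<lambda>\<mu>. T \<gamma> \<mu> * T \<delta> (\<rho> - \<mu>)))"

text \<open>The group is described by support and multiplicativity instead of by exponentials, so
  that intersecting two groups amounts to intersecting the supports. For suitable supports
  \<open>auts_eq\<close> shows that its elements are exactly the exponentials.\<close>

definition auts :: "(int ^ 'n::finite) set \<Rightarrow> 'n oper set" where
  "auts A = {T. op_on A T \<and> (\<forall>\<gamma>. T \<gamma> 0 = 1) \<and> multiplicative T}"

lemma deg_add: "deg l (a + b) = deg l a + deg l b"
  by (simp add: deg_def sum.distrib algebra_simps)

lemma deg_diff: "deg l (a - b) = deg l a - deg l b"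
  by (simp add: deg_def sum_subtractf algebra_simps)

lemma deg_0 [simp]: "deg l 0 = 0"
  by (simp add: deg_def)

lemma l1_0 [simp]: "l1 0 = 0"
  by (simp add: l1_def)

lemma l1_nonneg [simp]: "0 \<le> l1 \<mu>"
  by (simp add: l1_def sum_nonneg)

lemma l1_add: "l1 (a + b) \<le> l1 a + l1 b"
  by (simp add: l1_def flip: sum.distrib) (rule sum_mono, simp)

lemma l1_eq_0 [simp]: "l1 \<mu> = 0 \<longleftrightarrow> \<mu> = 0"
  by (simp add: l1_def sum_nonneg_eq_0_iff vec_eq_iff)

lemma abs_le_l1: "\<bar>\<mu> $ i\<bar> \<le> l1 \<mu>"
  unfolding l1_def by (rule member_le_sum) auto

lemma finite_l1_le: "finite {\<mu> :: int ^ 'n::finite. l1 \<mu> \<le> N}"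
proof (rule finite_subset)
  show "finite (vec_lambda ` (PiE (UNIV :: 'n set) (\<lambda>_. {-N..N})))"
    by (intro finite_imageI finite_PiE) auto
  show "{\<mu> :: int ^ 'n. l1 \<mu> \<le> N} \<subseteq> vec_lambda ` (PiE (UNIV :: 'n set) (\<lambda>_. {-N..N}))"
  proof
    fix \<mu> :: "int ^ 'n" assume "\<mu> \<in> {\<mu>. l1 \<mu> \<le> N}"
    then have "\<bar>\<mu> $ i\<bar> \<le> N" for i
      using abs_le_l1 [of \<mu> i] by simp
    then have "(\<lambda>i. \<mu> $ i) \<in> PiE (UNIV :: 'n set) (\<lambda>_. {-N..N})"
      by (auto simp: abs_le_iff minus_le_iff)
    then show "\<mu> \<in> vec_lambda ` (PiE (UNIV :: 'n set) (\<lambda>_. {-N..N}))"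
      by (metis image_eqI vec_nth_inverse)
  qed
qed

text \<open>Additivity in \<gamma> is what makes a family of coefficients come from a vector field:
  the components are the values at the basis vectors, in the form that \<open>vf_op\<close>
  uses.\<close>

lemma additive_int_vec:
  fixes f :: "int ^ 'n::finite \<Rightarrow> complex"
  assumes add: "\<And>\<gamma> \<delta>. f (\<gamma> + \<delta>) = f \<gamma> + f \<delta>"
  shows "f \<gamma> = (\<Sum>i\<in>UNIV. f (axis i 1) * of_int (\<gamma> $ i))"
proof -
  have f0: "f 0 = 0"
    using add [of 0 0] by simp
  have fneg: "f (- x) = - f x" for x
    using add [of x "- x"] f0 by (simp add: eq_neg_iff_add_eq_0 add.commute)
  have fnat: "f (axis i (int k)) = f (axis i 1) * of_nat k" for i k
  proof (induction k)
    case 0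
    have "axis i (int 0) = 0"
      by (simp add: axis_def vec_eq_iff)
    then show ?case
      by (simp only: f0) simp
  next
    case (Suc k)
    have "axis i (int (Suc k)) = axis i (int k) + axis i 1"
      by (simp add: axis_def vec_eq_iff)
    then show ?case
      using Suc by (simp add: add algebra_simps)
  qed
  have fint: "f (axis i k) = f (axis i 1) * of_int k" for i k
  proof (cases "0 \<le> k")
    case True
    then show ?thesis
      using fnat [of i "nat k"] by simp
  next
    case False
    have "axis i k = - axis i (int (nat (- k)))"
      using False by (simp add: axis_def vec_eq_iff)
    then show ?thesis
      using fnat [of i "nat (- k)"] False by (simp add: fneg)
  qed
  have fsum: "finite I \<Longrightarrow> f (\<Sum>i\<in>I. g i) = (\<Sum>i\<in>I. f (g i))" for g and I :: "'n set"
    by (induction I rule: finite_induct) (simp_all add: f0 add)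
  have "\<gamma> = (\<Sum>i\<in>UNIV. axis i (\<gamma> $ i))"
    by (simp add: vec_eq_iff axis_def)
  then have "f \<gamma> = f (\<Sum>i\<in>UNIV. axis i (\<gamma> $ i))"
    by (rule arg_cong)
  also have "\<dots> = (\<Sum>i\<in>UNIV. f (axis i (\<gamma> $ i)))"
    by (simp add: fsum)
  also have "\<dots> = (\<Sum>i\<in>UNIV. f (axis i 1) * of_int (\<gamma> $ i))"
    by (rule sum.cong [OF refl], rule fint)
  finally show ?thesis .
qed

lemma op_on_mono: "op_on A T \<Longrightarrow> A \<subseteq> B \<Longrightarrow> op_on B T"
  unfolding op_on_def by blast

lemma op_on_comp:
  assumes "add_closed A" "op_on A S" "op_on A T"
  shows "op_on A (op_comp S T)"
  unfolding op_on_def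
proof (intro allI impI)
  fix \<gamma> \<rho> assume "op_comp S T \<gamma> \<rho> \<noteq> 0"
  then obtain \<mu> where "T \<gamma> \<mu> * S (\<gamma> + \<mu>) (\<rho> - \<mu>) \<noteq> 0"
    unfolding op_comp_def by (rule Sum_any.not_neutral_obtains_not_neutral)
  then have "\<mu> \<in> insert 0 A" "\<rho> - \<mu> \<in> insert 0 A"
    using assms unfolding op_on_def by (metis mult_eq_0_iff)+
  moreover have "\<rho> = \<mu> + (\<rho> - \<mu>)"
    by simp
  ultimately show "\<rho> \<in> insert 0 A"
    using assms(1) unfolding add_closed_def
    by (metis add.commute add.right_neutral insert_iff)
qed

lemma op_on_id [simp]: "op_on A op_id"
  by (simp add: op_on_def op_id_def)

lemma op_on_vf_op: "\<xi> \<in> lie_on A \<Longrightarrow> op_on A (vf_op \<xi>)"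
  unfolding op_on_def lie_on_def vf_op_def
  by (metis (mono_tags, lifting) insertI2 mem_Collect_eq mult_zero_left sum.neutral zero_index)

lemma auts_Int: "auts A \<inter> auts B = auts (A \<inter> B)"
  unfolding auts_def op_on_def by blast

lemma auts_mono: "A \<subseteq> B \<Longrightarrow> auts A \<subseteq> auts B"
  unfolding auts_def op_on_def by blast

lemma auts_empty: "T \<in> auts {} \<Longrightarrow> T = op_id"
  by (auto simp: auts_def op_on_def op_id_def fun_eq_iff)

section \<open>Convolution on the lattice points dominated by an integral linear form\<close>

locale grading =
  fixes l :: "int ^ 'n::finite"
begin

abbreviation d :: "int ^ 'n \<Rightarrow> int" where "d \<equiv> deg l"

text \<open>The inequality is stronger than positivity of the degree: it leaves finitely many points
  in each degree, and later it bounds the factor \<open>l1 \<mu>\<close> produced by differentiating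
  \<open>x^\<mu>\<close>.\<close>

definition M :: "(int ^ 'n) set" where
  "M = {\<mu>. l1 \<mu> \<le> d \<mu>}"

definition D :: "int ^ 'n \<Rightarrow> (int ^ 'n) set" where
  "D \<rho> = {\<mu> \<in> M. \<rho> - \<mu> \<in> M}"

lemma M_0 [simp]: "0 \<in> M"
  by (simp add: M_def)

lemma M_add: "a \<in> M \<Longrightarrow> b \<in> M \<Longrightarrow> a + b \<in> M"
  using l1_add [of a b] by (simp add: M_def deg_add)

lemma add_closed_M: "add_closed M"
  by (simp add: add_closed_def M_add)

lemma d_nonneg: "\<mu> \<in> M \<Longrightarrow> 0 \<le> d \<mu>"
  unfolding M_def mem_Collect_eq using l1_nonneg [of \<mu>] by linarith

lemma d_pos: "\<mu> \<in> M \<Longrightarrow> \<mu> \<noteq> 0 \<Longrightarrow> 1 \<le> d \<mu>"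
  unfolding M_def mem_Collect_eq using l1_nonneg [of \<mu>] l1_eq_0 [of \<mu>] by linarith

lemma finite_box: "finite {\<mu> \<in> M. d \<mu> \<le> N}"
  by (rule finite_subset [OF _ finite_l1_le [of N]]) (auto simp: M_def)

lemma D_deg: "\<mu> \<in> D \<rho> \<Longrightarrow> d \<mu> \<le> d \<rho>"
  using d_nonneg [of "\<rho> - \<mu>"] by (simp add: D_def deg_diff)

lemma D_deg': "\<mu> \<in> D \<rho> \<Longrightarrow> \<mu> \<noteq> \<rho> \<Longrightarrow> d \<mu> < d \<rho>"
  using d_pos [of "\<rho> - \<mu>"] by (simp add: D_def deg_diff)

lemma finite_D [simp]: "finite (D \<rho>)"
  by (rule finite_subset [OF _ finite_box [of "d \<rho>"]]) (use D_deg D_def in auto)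

lemma D_M: "\<mu> \<in> D \<rho> \<Longrightarrow> \<rho> \<in> M"
  using M_add [of \<mu> "\<rho> - \<mu>"] by (simp add: D_def)

lemma D_notM: "\<rho> \<notin> M \<Longrightarrow> D \<rho> = {}"
  using D_M by blast

lemma D_0I: "\<rho> \<in> M \<Longrightarrow> 0 \<in> D \<rho>"
  by (simp add: D_def)

lemma D_selfI: "\<rho> \<in> M \<Longrightarrow> \<rho> \<in> D \<rho>"
  by (simp add: D_def)

lemma D_0 [simp]: "D 0 = {0}"
proof -
  have "\<mu> = 0" if "\<mu> \<in> D 0" for \<mu>
    using that D_deg [OF that] d_pos [of \<mu>] by (auto simp: D_def)
  then show ?thesis
    using D_0I [of 0] by auto
qed

lemma conv_comm:
  fixes F :: "int ^ 'n \<Rightarrow> int ^ 'n \<Rightarrow> 'b::comm_monoid_add"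
  shows "(\<Sum>\<mu>\<in>D \<rho>. F \<mu> (\<rho> - \<mu>)) = (\<Sum>\<mu>\<in>D \<rho>. F (\<rho> - \<mu>) \<mu>)"
  by (rule sum.reindex_bij_witness [of _ "\<lambda>\<mu>. \<rho> - \<mu>" "\<lambda>\<mu>. \<rho> - \<mu>"]) (auto simp: D_def)

lemma D_trans: "\<mu> \<in> D \<rho> \<Longrightarrow> \<nu> \<in> D \<mu> \<Longrightarrow> \<nu> \<in> D \<rho>"
  using M_add [of "\<mu> - \<nu>" "\<rho> - \<mu>"] by (simp add: D_def)

lemma D_diff: "\<mu> \<in> D \<rho> \<Longrightarrow> \<nu> \<in> D \<mu> \<Longrightarrow> \<mu> - \<nu> \<in> D (\<rho> - \<nu>)"
  by (simp add: D_def)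

lemma D_sum: "\<nu> \<in> D \<rho> \<Longrightarrow> \<kappa> \<in> D (\<rho> - \<nu>) \<Longrightarrow> \<nu> + \<kappa> \<in> D \<rho>"
  using M_add [of \<nu> \<kappa>] by (simp add: D_def diff_diff_eq)

lemma D_addI: "a \<in> M \<Longrightarrow> b \<in> M \<Longrightarrow> a \<in> D (a + b)"
  by (simp add: D_def)

lemma conv_assoc:
  fixes F :: "int ^ 'n \<Rightarrow> int ^ 'n \<Rightarrow> int ^ 'n \<Rightarrow> 'b::comm_monoid_add"
  shows "(\<Sum>\<mu>\<in>D \<rho>. \<Sum>\<nu>\<in>D \<mu>. F \<nu> (\<mu> - \<nu>) (\<rho> - \<mu>))
       = (\<Sum>\<nu>\<in>D \<rho>. \<Sum>\<kappa>\<in>D (\<rho> - \<nu>). F \<nu> \<kappa> (\<rho> - \<nu> - \<kappa>))"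
proof -
  have 1: "\<nu> \<in> D (\<nu> + \<kappa>)" if "\<nu> \<in> D \<rho>" "\<kappa> \<in> D (\<rho> - \<nu>)" for \<nu> \<kappa>
    using that by (intro D_addI) (simp_all add: D_def)
  have "(\<Sum>(\<mu>, \<nu>)\<in>Sigma (D \<rho>) D. F \<nu> (\<mu> - \<nu>) (\<rho> - \<mu>))
      = (\<Sum>(\<nu>, \<kappa>)\<in>Sigma (D \<rho>) (\<lambda>\<nu>. D (\<rho> - \<nu>)). F \<nu> \<kappa> (\<rho> - \<nu> - \<kappa>))"
    by (rule sum.reindex_bij_witness
          [of _ "\<lambda>(\<nu>, \<kappa>). (\<nu> + \<kappa>, \<nu>)" "\<lambda>(\<mu>, \<nu>). (\<nu>, \<mu> - \<nu>)"])
       (use 1 in \<open>auto simp: diff_diff_eq intro: D_trans D_diff D_sum\<close>)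
  then show ?thesis
    by (simp add: sum.Sigma)
qed

lemma conv_swap:
  fixes F :: "int ^ 'n \<Rightarrow> int ^ 'n \<Rightarrow> int ^ 'n \<Rightarrow> 'b::comm_monoid_add"
  shows "(\<Sum>\<mu>\<in>D \<rho>. \<Sum>\<nu>\<in>D \<mu>. F \<nu> (\<mu> - \<nu>) (\<rho> - \<mu>))
       = (\<Sum>\<sigma>\<in>D \<rho>. \<Sum>\<nu>\<in>D \<sigma>. F \<nu> (\<rho> - \<sigma>) (\<sigma> - \<nu>))"
proof -
  have "(\<Sum>\<mu>\<in>D \<rho>. \<Sum>\<nu>\<in>D \<mu>. F \<nu> (\<mu> - \<nu>) (\<rho> - \<mu>))
      = (\<Sum>\<nu>\<in>D \<rho>. \<Sum>\<kappa>\<in>D (\<rho> - \<nu>). F \<nu> \<kappa> (\<rho> - \<nu> - \<kappa>))"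
    by (rule conv_assoc)
  also have "\<dots> = (\<Sum>\<nu>\<in>D \<rho>. \<Sum>\<kappa>\<in>D (\<rho> - \<nu>). F \<nu> (\<rho> - \<nu> - \<kappa>) \<kappa>)"
    by (intro sum.cong refl conv_comm)
  also have "\<dots> = (\<Sum>\<sigma>\<in>D \<rho>. \<Sum>\<nu>\<in>D \<sigma>. F \<nu> (\<rho> - \<sigma>) (\<sigma> - \<nu>))"
    using conv_assoc [of "\<lambda>a b c. F a c b" \<rho>] by simp
  finally show ?thesis .
qed

text \<open>The four indices form a two by two array with total \<rho>; the sum is organised by rows
  on one side and by columns on the other. This exchange is behind the multiplicativity of a
  composite.\<close>

lemma conv_exchange:
  fixes F :: "int ^ 'n \<Rightarrow> int ^ 'n \<Rightarrow> int ^ 'n \<Rightarrow> int ^ 'n \<Rightarrow> 'b::comm_monoid_add"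
  shows "(\<Sum>\<mu>\<in>D \<rho>. \<Sum>a\<in>D \<mu>. \<Sum>b\<in>D (\<rho> - \<mu>). F a (\<mu> - a) b (\<rho> - \<mu> - b))
       = (\<Sum>\<sigma>\<in>D \<rho>. \<Sum>a\<in>D \<sigma>. \<Sum>c\<in>D (\<rho> - \<sigma>). F a c (\<sigma> - a) (\<rho> - \<sigma> - c))"
proof -
  have 1: "a + b \<in> D \<rho>" "a \<in> D (a + b)" "\<mu> - a \<in> D (\<rho> - (a + b))"
    if "\<mu> \<in> D \<rho>" "a \<in> D \<mu>" "b \<in> D (\<rho> - \<mu>)" for \<mu> a b
  proof -
    have m: "a \<in> M" "b \<in> M" "\<mu> - a \<in> M" "\<rho> - \<mu> - b \<in> M"
      using that by (simp_all add: D_def)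
    have "a + b - a = b"
      and eq: "\<rho> - (a + b) = (\<mu> - a) + (\<rho> - \<mu> - b)"
        "\<rho> - (a + b) - (\<mu> - a) = \<rho> - \<mu> - b"
      by (simp_all add: algebra_simps)
    then show "a + b \<in> D \<rho>" "a \<in> D (a + b)" "\<mu> - a \<in> D (\<rho> - (a + b))"
      using m M_add [of a b] M_add [of "\<mu> - a" "\<rho> - \<mu> - b"] unfolding D_def mem_Collect_eq eq(2)
      by (simp_all only: eq(1) simp_thms)
  qed
  have "(\<Sum>(\<mu>, a, b)\<in>Sigma (D \<rho>) (\<lambda>\<mu>. D \<mu> \<times> D (\<rho> - \<mu>)). F a (\<mu> - a) b (\<rho> - \<mu> - b))
      = (\<Sum>(\<sigma>, a, c)\<in>Sigma (D \<rho>) (\<lambda>\<mu>. D \<mu> \<times> D (\<rho> - \<mu>)). F a c (\<sigma> - a) (\<rho> - \<sigma> - c))"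
    by (rule sum.reindex_bij_witness
          [of _ "\<lambda>(\<sigma>, a, c). (a + c, a, \<sigma> - a)" "\<lambda>(\<mu>, a, b). (a + b, a, \<mu> - a)"])
       (use 1 in \<open>auto simp: algebra_simps\<close>)
  then show ?thesis
    by (simp add: sum.Sigma sum.cartesian_product)
qed

section \<open>Composition of operators and automorphisms\<close>

abbreviation M_op :: "'n oper \<Rightarrow> bool" where "M_op \<equiv> op_on M"

lemma M_opD: "M_op T \<Longrightarrow> T \<gamma> \<mu> \<noteq> 0 \<Longrightarrow> \<mu> \<in> M"
  by (metis M_0 insertE op_on_def)

lemma M_op_zero: "M_op T \<Longrightarrow> \<mu> \<notin> M \<Longrightarrow> T \<gamma> \<mu> = 0"
  using M_opD by blast

lemma op_comp_eq:
  assumes "M_op S" "M_op T"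
  shows "op_comp S T \<gamma> \<rho> = (\<Sum>\<mu>\<in>D \<rho>. T \<gamma> \<mu> * S (\<gamma> + \<mu>) (\<rho> - \<mu>))"
  unfolding op_comp_def
proof (rule Sum_any.expand_superset [OF finite_D])
  show "{\<mu>. T \<gamma> \<mu> * S (\<gamma> + \<mu>) (\<rho> - \<mu>) \<noteq> 0} \<subseteq> D \<rho>"
    unfolding D_def using M_opD [OF assms(1)] M_opD [OF assms(2)] by auto
qed

lemma Sum_any_D:
  fixes f :: "int ^ 'n \<Rightarrow> complex"
  assumes "\<And>\<mu>. f \<mu> \<noteq> 0 \<Longrightarrow> \<mu> \<in> M" "\<And>\<mu>. g \<mu> \<noteq> 0 \<Longrightarrow> \<mu> \<in> M"
  shows "Sum_any (\<lambda>\<mu>. f \<mu> * g (\<rho> - \<mu>)) = (\<Sum>\<mu>\<in>D \<rho>. f \<mu> * g (\<rho> - \<mu>))"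
proof (rule Sum_any.expand_superset [OF finite_D])
  show "{\<mu>. f \<mu> * g (\<rho> - \<mu>) \<noteq> 0} \<subseteq> D \<rho>"
    unfolding D_def using assms by auto
qed

lemma M_op_comp: "M_op S \<Longrightarrow> M_op T \<Longrightarrow> M_op (op_comp S T)"
  by (rule op_on_comp [OF add_closed_M])

lemma op_comp_assoc:
  assumes "M_op S" "M_op T" "M_op U"
  shows "op_comp (op_comp S T) U = op_comp S (op_comp T U)"
proof (intro ext)
  fix \<gamma> \<rho>
  have "op_comp (op_comp S T) U \<gamma> \<rho>
      = (\<Sum>\<mu>\<in>D \<rho>. \<Sum>\<nu>\<in>D (\<rho> - \<mu>). U \<gamma> \<mu> * (T (\<gamma> + \<mu>) \<nu> * S (\<gamma> + \<mu> + \<nu>) (\<rho> - \<mu> - \<nu>)))"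
    using assms by (simp add: op_comp_eq M_op_comp sum_distrib_left)
  also have "\<dots> = (\<Sum>\<mu>\<in>D \<rho>. \<Sum>\<nu>\<in>D \<mu>. U \<gamma> \<nu> * (T (\<gamma> + \<nu>) (\<mu> - \<nu>) * S (\<gamma> + \<nu> + (\<mu> - \<nu>)) (\<rho> - \<mu>)))"
    by (rule conv_assoc [symmetric])
  also have "\<dots> = op_comp S (op_comp T U) \<gamma> \<rho>"
    using assms by (simp add: op_comp_eq M_op_comp sum_distrib_right mult.assoc)
  finally show "op_comp (op_comp S T) U \<gamma> \<rho> = op_comp S (op_comp T U) \<gamma> \<rho>" .
qed

lemma op_comp_id_right:
  assumes "M_op S"
  shows "op_comp S op_id = S"
proof (intro ext)
  fix \<gamma> \<rho>
  have "op_comp S op_id \<gamma> \<rho> = (\<Sum>\<mu>\<in>D \<rho>. if \<mu> = 0 then S \<gamma> \<rho> else 0)"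
    unfolding op_comp_eq [OF assms op_on_id] by (rule sum.cong) (auto simp: op_id_def)
  also have "\<dots> = S \<gamma> \<rho>"
    using assms D_0I [of \<rho>] M_op_zero [of S \<rho> \<gamma>] by (auto simp: D_notM)
  finally show "op_comp S op_id \<gamma> \<rho> = S \<gamma> \<rho>" .
qed

lemma op_comp_id_left:
  assumes "M_op S"
  shows "op_comp op_id S = S"
proof (intro ext)
  fix \<gamma> \<rho>
  have "op_comp op_id S \<gamma> \<rho> = (\<Sum>\<mu>\<in>D \<rho>. if \<mu> = \<rho> then S \<gamma> \<rho> else 0)"
    unfolding op_comp_eq [OF op_on_id assms] by (rule sum.cong) (auto simp: op_id_def)
  also have "\<dots> = S \<gamma> \<rho>"
    using assms D_selfI [of \<rho>] M_op_zero [of S \<rho> \<gamma>] by (auto simp: D_notM)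
  finally show "op_comp op_id S \<gamma> \<rho> = S \<gamma> \<rho>" .
qed

lemma multiplicative_iff:
  assumes "M_op T"
  shows "multiplicative T \<longleftrightarrow>
    (\<forall>\<gamma> \<delta> \<rho>. T (\<gamma> + \<delta>) \<rho> = (\<Sum>\<mu>\<in>D \<rho>. T \<gamma> \<mu> * T \<delta> (\<rho> - \<mu>)))"
  unfolding multiplicative_def using M_opD [OF assms] by (simp add: Sum_any_D)

lemma multiplicative_comp:
  assumes "M_op S" "M_op T" "multiplicative S" "multiplicative T"
  shows "multiplicative (op_comp S T)"
proof -
  have S: "S (\<gamma> + \<delta>) \<rho> = (\<Sum>\<mu>\<in>D \<rho>. S \<gamma> \<mu> * S \<delta> (\<rho> - \<mu>))"
    and T: "T (\<gamma> + \<delta>) \<rho> = (\<Sum>\<mu>\<in>D \<rho>. T \<gamma> \<mu> * T \<delta> (\<rho> - \<mu>))" for \<gamma> \<delta> \<rho>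
    using assms by (simp_all add: multiplicative_iff)
  have "op_comp S T (\<gamma> + \<delta>) \<rho> = (\<Sum>\<mu>\<in>D \<rho>. op_comp S T \<gamma> \<mu> * op_comp S T \<delta> (\<rho> - \<mu>))" for \<gamma> \<delta> \<rho>
  proof -
    have "op_comp S T (\<gamma> + \<delta>) \<rho>
        = (\<Sum>\<mu>\<in>D \<rho>. \<Sum>a\<in>D \<mu>. T \<gamma> a * T \<delta> (\<mu> - a) * S ((\<gamma> + a) + (\<delta> + (\<mu> - a))) (\<rho> - \<mu>))"
      unfolding op_comp_eq [OF assms(1,2)] T sum_distrib_right
      by (intro sum.cong refl) (simp add: algebra_simps)
    also have "\<dots> = (\<Sum>\<mu>\<in>D \<rho>. \<Sum>a\<in>D \<mu>. \<Sum>b\<in>D (\<rho> - \<mu>).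
        T \<gamma> a * T \<delta> (\<mu> - a) * (S (\<gamma> + a) b * S (\<delta> + (\<mu> - a)) (\<rho> - \<mu> - b)))"
      unfolding S [of "\<gamma> + x" "\<delta> + y" for x y] sum_distrib_left ..
    also have "\<dots> = (\<Sum>\<sigma>\<in>D \<rho>. \<Sum>a\<in>D \<sigma>. \<Sum>c\<in>D (\<rho> - \<sigma>).
        T \<gamma> a * T \<delta> c * (S (\<gamma> + a) (\<sigma> - a) * S (\<delta> + c) (\<rho> - \<sigma> - c)))"
      by (rule conv_exchange)
    also have "\<dots> = (\<Sum>\<mu>\<in>D \<rho>. op_comp S T \<gamma> \<mu> * op_comp S T \<delta> (\<rho> - \<mu>))"
      using assms by (simp add: op_comp_eq sum_product algebra_simps)
    finally show ?thesis .
  qed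
  then show ?thesis
    using assms by (simp add: multiplicative_iff M_op_comp)
qed

lemma op_comp_0:
  assumes "M_op S" "M_op T"
  shows "op_comp S T \<gamma> 0 = T \<gamma> 0 * S \<gamma> 0"
  using assms by (simp add: op_comp_eq)

lemma auts_M_op: "T \<in> auts A \<Longrightarrow> A \<subseteq> M \<Longrightarrow> M_op T"
  by (auto simp: auts_def intro: op_on_mono)

lemma auts_comp_graded:
  assumes "S \<in> auts A" "T \<in> auts A" "A \<subseteq> M" "add_closed A"
  shows "op_comp S T \<in> auts A"
  using assms auts_M_op [of S A] auts_M_op [of T A]
  by (simp add: auts_def op_on_comp op_comp_0 multiplicative_comp)

lemma auts_id_graded: "(op_id :: 'n oper) \<in> auts A"
proof -
  have "(\<Sum>\<mu>\<in>D \<rho>. op_id \<gamma> \<mu> * op_id \<delta> (\<rho> - \<mu>)) = op_id (\<gamma> + \<delta>) \<rho>" for \<gamma> \<delta> \<rho> :: "int ^ 'n"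
  proof -
    have "(\<Sum>\<mu>\<in>D \<rho>. op_id \<gamma> \<mu> * op_id \<delta> (\<rho> - \<mu>)) = (\<Sum>\<mu>\<in>D \<rho>. if \<mu> = 0 then op_id (\<gamma> + \<delta>) \<rho> else 0)"
      by (rule sum.cong) (auto simp: op_id_def)
    also have "\<dots> = op_id (\<gamma> + \<delta>) \<rho>"
      using D_0I [of \<rho>] by (auto simp: op_id_def)
    finally show ?thesis .
  qed
  then have "multiplicative (op_id :: 'n oper)"
    by (subst multiplicative_iff) simp_all
  then show ?thesis
    by (simp add: auts_def op_id_def op_on_def)
qed

text \<open>\<open>T\<close> maps the series 1 to an idempotent with constant term 1. A further
  non-zero coefficient \<open>c\<close> of least degree would satisfy
  \<open>c = 2 * c\<close>.\<close>

lemma auts_zero: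
  assumes "T \<in> auts A" "A \<subseteq> M"
  shows "T 0 = op_id 0"
proof -
  have T: "M_op T" "T 0 0 = 1"
    using assms auts_M_op by (auto simp: auts_def)
  have mult: "T 0 \<rho> = (\<Sum>\<mu>\<in>D \<rho>. T 0 \<mu> * T 0 (\<rho> - \<mu>))" for \<rho>
    using assms(1) multiplicative_iff [OF T(1)] unfolding auts_def mem_Collect_eq
    by (metis add_0)
  have "T 0 \<rho> = 0" if "\<rho> \<in> M" "\<rho> \<noteq> 0" for \<rho>
    using that
  proof (induction "nat (d \<rho>)" arbitrary: \<rho> rule: less_induct)
    case less
    have "T 0 \<mu> * T 0 (\<rho> - \<mu>) = 0" if "\<mu> \<in> D \<rho> - {0, \<rho>}" for \<mu>
    proof -
      have "\<mu> \<in> M" "\<mu> \<noteq> 0" "d \<mu> < d \<rho>" "1 \<le> d \<mu>"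
        using that D_deg' [of \<mu> \<rho>] d_pos [of \<mu>] by (auto simp: D_def)
      then have "T 0 \<mu> = 0"
        using less.hyps [of \<mu>] by simp
      then show ?thesis
        by simp
    qed
    then have "T 0 \<rho> = (\<Sum>\<mu>\<in>{0, \<rho>}. T 0 \<mu> * T 0 (\<rho> - \<mu>))"
      using less.prems by (subst mult, intro sum.mono_neutral_right) (auto intro: D_0I D_selfI)
    then show ?case
      using less.prems T by simp
  qed
  then show ?thesis
    using T M_op_zero [OF T(1)] by (auto simp: fun_eq_iff op_id_def)
qed

end

subsection \<open>Exponentials\<close>

lemma vf_op_add: "vf_op \<xi> (\<gamma> + \<delta>) \<mu> = vf_op \<xi> \<gamma> \<mu> + vf_op \<xi> \<delta> \<mu>"
  by (simp add: vf_op_def algebra_simps sum.distrib)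

lemma vf_op_zero: "\<xi> \<mu> = 0 \<Longrightarrow> vf_op \<xi> \<gamma> \<mu> = 0"
  by (simp add: vf_op_def)

section \<open>Divided powers of a derivation and the exponential\<close>

definition vpow :: "'n::finite vfield \<Rightarrow> nat \<Rightarrow> 'n oper" where
  "vpow \<xi> k = (op_comp (vf_op \<xi>) ^^ k) op_id"

lemma vpow_0 [simp]: "vpow \<xi> 0 = op_id"
  by (simp add: vpow_def)

lemma vpow_Suc: "vpow \<xi> (Suc k) = op_comp (vf_op \<xi>) (vpow \<xi> k)"
  by (simp add: vpow_def)

lemma lie_on_mono: "\<xi> \<in> lie_on A \<Longrightarrow> A \<subseteq> B \<Longrightarrow> \<xi> \<in> lie_on B"
  by (auto simp: lie_on_def)

lemma lie_on_uminus: "\<xi> \<in> lie_on A \<Longrightarrow> (\<lambda>\<gamma>. - \<xi> \<gamma>) \<in> lie_on A"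
  by (auto simp: lie_on_def)

lemma lie_on_restrict: "(\<lambda>\<mu>. if \<mu> \<in> B then \<xi> \<mu> else 0) \<in> lie_on B"
  by (auto simp: lie_on_def)

lemma op_on_vpow: "add_closed A \<Longrightarrow> \<xi> \<in> lie_on A \<Longrightarrow> op_on A (vpow \<xi> k)"
  by (induction k) (simp_all add: vpow_Suc op_on_comp op_on_vf_op)

text \<open>Multiplying two truncated exponential series gives a square of indices, collecting by
  total power a triangle; the terms in between will vanish for reasons of degree.\<close>

lemma sum_square_triangle:
  fixes F :: "nat \<Rightarrow> nat \<Rightarrow> 'a::comm_monoid_add"
  assumes "\<And>i j. n < i + j \<Longrightarrow> F i j = 0"
  shows "(\<Sum>i\<le>n. \<Sum>j\<le>n. F i j) = (\<Sum>k\<le>n. \<Sum>i\<le>k. F i (k - i))"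
proof -
  have "(\<Sum>i\<le>n. \<Sum>j\<le>n. F i j) = (\<Sum>(i, j)\<in>{..n} \<times> {..n}. F i j)"
    by (simp add: sum.cartesian_product)
  also have "\<dots> = (\<Sum>(i, j)\<in>{(i, j). i + j \<le> n}. F i j)"
    by (rule sum.mono_neutral_right) (use assms in \<open>force simp: not_le\<close>)+
  also have "\<dots> = (\<Sum>k\<le>n. \<Sum>i\<le>k. F i (k - i))"
    by (rule sum.triangle_reindex_eq)
  finally show ?thesis .
qed

lemma auts_outside: "T \<in> auts A \<Longrightarrow> \<mu> \<notin> A \<Longrightarrow> \<mu> \<noteq> 0 \<Longrightarrow> T \<gamma> \<mu> = 0"
  unfolding auts_def op_on_def by blast

context grading
begin

definition graded :: "(int ^ 'n) set \<Rightarrow> bool" where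
  "graded A \<longleftrightarrow> add_closed A \<and> A \<subseteq> M - {0}"

lemma graded_M: "graded A \<Longrightarrow> A \<subseteq> M"
  by (auto simp: graded_def)

lemma M_op_vf_op: "\<xi> \<in> lie_on (M - {0}) \<Longrightarrow> M_op (vf_op \<xi>)"
  using op_on_vf_op [of \<xi> M] lie_on_mono by blast

lemma M_op_vpow: "\<xi> \<in> lie_on (M - {0}) \<Longrightarrow> M_op (vpow \<xi> k)"
  by (rule op_on_vpow [OF add_closed_M]) (rule lie_on_mono, auto)

lemma vf_op_0: "\<xi> \<in> lie_on (M - {0}) \<Longrightarrow> vf_op \<xi> \<gamma> 0 = 0"
  by (rule vf_op_zero) (auto simp: lie_on_def)

lemma vpow_Suc_eq:
  "\<xi> \<in> lie_on (M - {0}) \<Longrightarrow>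
    vpow \<xi> (Suc k) \<gamma> \<rho> = (\<Sum>\<mu>\<in>D \<rho>. vpow \<xi> k \<gamma> \<mu> * vf_op \<xi> (\<gamma> + \<mu>) (\<rho> - \<mu>))"
  by (simp add: vpow_Suc op_comp_eq M_op_vf_op M_op_vpow)

lemma vpow_1: "\<xi> \<in> lie_on (M - {0}) \<Longrightarrow> vpow \<xi> (Suc 0) = vf_op \<xi>"
  by (simp add: vpow_Suc op_comp_id_right M_op_vf_op)

text \<open>Each application of the vector field raises the degree by at least one, because it has
  no component at 0.\<close>

lemma vpow_deg:
  assumes \<xi>: "\<xi> \<in> lie_on (M - {0})"
  shows "d \<rho> < int k \<Longrightarrow> vpow \<xi> k \<gamma> \<rho> = 0"
proof (induction k arbitrary: \<rho>)
  case 0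
  then show ?case
    by (auto simp: op_id_def)
next
  case (Suc k)
  have "vpow \<xi> k \<gamma> \<mu> * vf_op \<xi> (\<gamma> + \<mu>) (\<rho> - \<mu>) = 0" if "\<mu> \<in> D \<rho>" for \<mu>
  proof (cases "\<mu> = \<rho>")
    case True
    then show ?thesis
      by (simp add: vf_op_0 [OF \<xi>])
  next
    case False
    then have "d \<mu> < int k"
      using D_deg' [OF that] Suc.prems by simp
    then show ?thesis
      using Suc.IH by simp
  qed
  then show ?case
    unfolding vpow_Suc_eq [OF \<xi>] by (intro sum.neutral) blast
qed

lemma vf_exp_eq:
  assumes \<xi>: "\<xi> \<in> lie_on (M - {0})" and n: "d \<rho> \<le> int n"
  shows "vf_exp \<xi> \<gamma> \<rho> = (\<Sum>k\<le>n. vpow \<xi> k \<gamma> \<rho> / fact k)"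
proof -
  have "vf_exp \<xi> \<gamma> \<rho> = Sum_any (\<lambda>k. vpow \<xi> k \<gamma> \<rho> / fact k)"
    by (simp add: vf_exp_def vpow_def)
  also have "\<dots> = (\<Sum>k\<le>n. vpow \<xi> k \<gamma> \<rho> / fact k)"
  proof (rule Sum_any.expand_superset)
    show "{k. vpow \<xi> k \<gamma> \<rho> / fact k \<noteq> 0} \<subseteq> {..n}"
    proof
      fix k assume "k \<in> {k. vpow \<xi> k \<gamma> \<rho> / fact k \<noteq> 0}"
      then have "\<not> d \<rho> < int k"
        using vpow_deg [OF \<xi>] by auto
      then show "k \<in> {..n}"
        using n by simp
    qed
  qed simp
  finally show ?thesis .
qed

text \<open>The Leibniz rule for the divided powers of \<xi>. In the induction step \<xi> raises
  either the left or the right index, so the product with indices \<open>i\<close> and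
  \<open>k + 1 - i\<close> is met with weights \<open>i\<close> and \<open>k + 1 - i\<close>, which
  add up to \<open>k + 1\<close>.\<close>

lemma vpow_leibniz:
  fixes k :: nat
  assumes \<xi>: "\<xi> \<in> lie_on (M - {0})"
  defines "Y \<equiv> \<lambda>k \<gamma> \<rho>. vpow \<xi> k \<gamma> \<rho> / fact k"
  shows "Y k (\<gamma> + \<delta>) \<rho> = (\<Sum>i\<le>k. \<Sum>\<mu>\<in>D \<rho>. Y i \<gamma> \<mu> * Y (k - i) \<delta> (\<rho> - \<mu>))"
proof (induction k arbitrary: \<rho>)
  case 0
  have "multiplicative (op_id :: 'n oper)" "M_op (op_id :: 'n oper)"
    using auts_id_graded [of M] by (simp_all add: auts_def)
  then show ?case
    by (simp add: Y_def multiplicative_iff)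
next
  case (Suc k)
  define P where "P i j = (\<Sum>\<mu>\<in>D \<rho>. Y i \<gamma> \<mu> * Y j \<delta> (\<rho> - \<mu>))" for i j
  have Y_Suc: "(\<Sum>\<mu>\<in>D \<rho>. Y j \<gamma> \<mu> * vf_op \<xi> (\<gamma> + \<mu>) (\<rho> - \<mu>)) = of_nat (Suc j) * Y (Suc j) \<gamma> \<rho>" for j \<gamma> \<rho>
  proof -
    have "of_nat (Suc j) * (z / fact (Suc j)) = z / fact j" for z :: complex
      by (simp add: fact_Suc del: of_nat_Suc)
    note this [of "\<Sum>\<mu>\<in>D \<rho>. vpow \<xi> j \<gamma> \<mu> * vf_op \<xi> (\<gamma> + \<mu>) (\<rho> - \<mu>)"]
    then show ?thesis
      unfolding Y_def vpow_Suc_eq [OF \<xi>] by (simp only: sum_divide_distrib times_divide_eq_left)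
  qed
  have 1: "(\<Sum>\<kappa>\<in>D \<rho>. \<Sum>\<mu>\<in>D \<kappa>. Y i \<gamma> \<mu> * Y j \<delta> (\<kappa> - \<mu>) * vf_op \<xi> (\<gamma> + \<mu>) (\<rho> - \<kappa>))
      = of_nat (Suc i) * P (Suc i) j" for i j
  proof -
    have "(\<Sum>\<kappa>\<in>D \<rho>. \<Sum>\<mu>\<in>D \<kappa>. Y i \<gamma> \<mu> * Y j \<delta> (\<kappa> - \<mu>) * vf_op \<xi> (\<gamma> + \<mu>) (\<rho> - \<kappa>))
        = (\<Sum>\<sigma>\<in>D \<rho>. \<Sum>\<mu>\<in>D \<sigma>. Y i \<gamma> \<mu> * Y j \<delta> (\<rho> - \<sigma>) * vf_op \<xi> (\<gamma> + \<mu>) (\<sigma> - \<mu>))"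
      by (rule conv_swap)
    also have "\<dots> = (\<Sum>\<sigma>\<in>D \<rho>. (\<Sum>\<mu>\<in>D \<sigma>. Y i \<gamma> \<mu> * vf_op \<xi> (\<gamma> + \<mu>) (\<sigma> - \<mu>)) * Y j \<delta> (\<rho> - \<sigma>))"
      by (simp add: sum_distrib_left sum_distrib_right mult_ac)
    also have "\<dots> = of_nat (Suc i) * P (Suc i) j"
      unfolding Y_Suc P_def sum_distrib_left by (simp only: mult.assoc)
    finally show ?thesis .
  qed
  have 2: "(\<Sum>\<kappa>\<in>D \<rho>. \<Sum>\<mu>\<in>D \<kappa>. Y i \<gamma> \<mu> * Y j \<delta> (\<kappa> - \<mu>) * vf_op \<xi> (\<delta> + (\<kappa> - \<mu>)) (\<rho> - \<kappa>))
      = of_nat (Suc j) * P i (Suc j)" for i j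
  proof -
    have "(\<Sum>\<kappa>\<in>D \<rho>. \<Sum>\<mu>\<in>D \<kappa>. Y i \<gamma> \<mu> * Y j \<delta> (\<kappa> - \<mu>) * vf_op \<xi> (\<delta> + (\<kappa> - \<mu>)) (\<rho> - \<kappa>))
        = (\<Sum>\<mu>\<in>D \<rho>. \<Sum>\<nu>\<in>D (\<rho> - \<mu>). Y i \<gamma> \<mu> * Y j \<delta> \<nu> * vf_op \<xi> (\<delta> + \<nu>) (\<rho> - \<mu> - \<nu>))"
      by (rule conv_assoc)
    also have "\<dots> = (\<Sum>\<mu>\<in>D \<rho>. Y i \<gamma> \<mu> * (\<Sum>\<nu>\<in>D (\<rho> - \<mu>). Y j \<delta> \<nu> * vf_op \<xi> (\<delta> + \<nu>) (\<rho> - \<mu> - \<nu>)))"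
      by (simp add: sum_distrib_left mult.assoc)
    also have "\<dots> = of_nat (Suc j) * P i (Suc j)"
      unfolding Y_Suc P_def sum_distrib_left by (simp only: mult_ac)
    finally show ?thesis .
  qed
  have "of_nat (Suc k) * Y (Suc k) (\<gamma> + \<delta>) \<rho>
      = (\<Sum>\<kappa>\<in>D \<rho>. Y k (\<gamma> + \<delta>) \<kappa> * vf_op \<xi> (\<gamma> + \<delta> + \<kappa>) (\<rho> - \<kappa>))"
    by (rule Y_Suc [symmetric])
  also have "\<dots> = (\<Sum>\<kappa>\<in>D \<rho>. \<Sum>i\<le>k. \<Sum>\<mu>\<in>D \<kappa>. Y i \<gamma> \<mu> * Y (k - i) \<delta> (\<kappa> - \<mu>) *
      (vf_op \<xi> (\<gamma> + \<mu>) (\<rho> - \<kappa>) + vf_op \<xi> (\<delta> + (\<kappa> - \<mu>)) (\<rho> - \<kappa>)))"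
    unfolding Suc.IH vf_op_add [symmetric] sum_distrib_right
    by (intro sum.cong refl arg_cong2 [where f = "(*)"] arg_cong2 [where f = "vf_op \<xi>"])
       (simp add: algebra_simps)
  also have "\<dots> = (\<Sum>i\<le>k. (\<Sum>\<kappa>\<in>D \<rho>. \<Sum>\<mu>\<in>D \<kappa>. Y i \<gamma> \<mu> * Y (k - i) \<delta> (\<kappa> - \<mu>) * vf_op \<xi> (\<gamma> + \<mu>) (\<rho> - \<kappa>))
      + (\<Sum>\<kappa>\<in>D \<rho>. \<Sum>\<mu>\<in>D \<kappa>. Y i \<gamma> \<mu> * Y (k - i) \<delta> (\<kappa> - \<mu>) * vf_op \<xi> (\<delta> + (\<kappa> - \<mu>)) (\<rho> - \<kappa>)))"
    by (subst sum.swap) (simp only: distrib_left sum.distrib)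
  also have "\<dots> = (\<Sum>i\<le>k. of_nat (Suc i) * P (Suc i) (k - i)) + (\<Sum>i\<le>k. of_nat (Suc (k - i)) * P i (Suc (k - i)))"
    by (simp only: 1 2 sum.distrib)
  also have "(\<Sum>i\<le>k. of_nat (Suc i) * P (Suc i) (k - i)) = (\<Sum>i\<le>Suc k. of_nat i * P i (Suc k - i))"
    by (subst sum.atMost_Suc_shift) simp
  also have "(\<Sum>i\<le>k. of_nat (Suc (k - i)) * P i (Suc (k - i))) = (\<Sum>i\<le>Suc k. of_nat (Suc k - i) * P i (Suc k - i))"
    by (simp add: Suc_diff_le add_diff_eq)
  also have "(\<Sum>i\<le>Suc k. of_nat i * P i (Suc k - i)) + (\<Sum>i\<le>Suc k. of_nat (Suc k - i) * P i (Suc k - i))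
      = of_nat (Suc k) * (\<Sum>i\<le>Suc k. P i (Suc k - i))"
    unfolding sum.distrib [symmetric] sum_distrib_left
    by (intro sum.cong refl) (simp add: of_nat_diff algebra_simps)
  finally have "of_nat (Suc k) * Y (Suc k) (\<gamma> + \<delta>) \<rho> = of_nat (Suc k) * (\<Sum>i\<le>Suc k. P i (Suc k - i))" .
  then show ?case
    unfolding P_def by (subst (asm) mult_cancel_left) (auto simp del: of_nat_Suc)
qed

lemma vf_exp_auts:
  assumes A: "graded A" and \<xi>: "\<xi> \<in> lie_on A"
  shows "vf_exp \<xi> \<in> auts A"
proof -
  have \<xi>': "\<xi> \<in> lie_on (M - {0})"
    using A \<xi> by (auto simp: graded_def intro: lie_on_mono)
  have op: "op_on A (vf_exp \<xi>)"
    unfolding op_on_def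
  proof (intro allI impI)
    fix \<gamma> \<rho> assume "vf_exp \<xi> \<gamma> \<rho> \<noteq> 0"
    then obtain k where "vpow \<xi> k \<gamma> \<rho> / fact k \<noteq> 0"
      unfolding vf_exp_def vpow_def by (rule Sum_any.not_neutral_obtains_not_neutral)
    then show "\<rho> \<in> insert 0 A"
      using op_on_vpow [of A \<xi> k] A \<xi> by (auto simp: op_on_def graded_def)
  qed
  have M: "M_op (vf_exp \<xi>)"
    by (rule op_on_mono [OF op graded_M [OF A]])
  have "vf_exp \<xi> (\<gamma> + \<delta>) \<rho> = (\<Sum>\<mu>\<in>D \<rho>. vf_exp \<xi> \<gamma> \<mu> * vf_exp \<xi> \<delta> (\<rho> - \<mu>))" for \<gamma> \<delta> \<rho>
  proof -
    define Y where "Y k \<gamma> \<rho> = vpow \<xi> k \<gamma> \<rho> / fact k" for k \<gamma> \<rho>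
    define n where "n = nat (d \<rho>)"
    have exp_eq: "vf_exp \<xi> \<gamma> \<mu> = (\<Sum>k\<le>n. Y k \<gamma> \<mu>)" if "d \<mu> \<le> d \<rho>" for \<gamma> \<mu>
      unfolding Y_def using that by (intro vf_exp_eq [OF \<xi>']) (simp add: n_def)
    \<comment> \<open>If \<open>i + j\<close> exceeds the degree of \<rho>, one of the two powers
      exceeds the degree of its own argument.\<close>
    have zero: "(\<Sum>\<mu>\<in>D \<rho>. Y i \<gamma> \<mu> * Y j \<delta> (\<rho> - \<mu>)) = 0" if "n < i + j" for i j
    proof (rule sum.neutral, rule ballI)
      fix \<mu> assume "\<mu> \<in> D \<rho>"
      then have "d \<mu> < int i \<or> d (\<rho> - \<mu>) < int j"
        using that D_M [of \<mu> \<rho>] d_nonneg [of \<rho>] by (simp add: n_def deg_diff) linarith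
      then show "Y i \<gamma> \<mu> * Y j \<delta> (\<rho> - \<mu>) = 0"
        using vpow_deg [OF \<xi>'] by (auto simp: Y_def)
    qed
    have "vf_exp \<xi> (\<gamma> + \<delta>) \<rho> = (\<Sum>k\<le>n. \<Sum>i\<le>k. \<Sum>\<mu>\<in>D \<rho>. Y i \<gamma> \<mu> * Y (k - i) \<delta> (\<rho> - \<mu>))"
      unfolding exp_eq [OF order_refl] by (intro sum.cong refl) (unfold Y_def, rule vpow_leibniz [OF \<xi>'])
    also have "\<dots> = (\<Sum>i\<le>n. \<Sum>j\<le>n. \<Sum>\<mu>\<in>D \<rho>. Y i \<gamma> \<mu> * Y j \<delta> (\<rho> - \<mu>))"
      by (rule sum_square_triangle [symmetric]) (rule zero)
    also have "\<dots> = (\<Sum>i\<le>n. \<Sum>\<mu>\<in>D \<rho>. Y i \<gamma> \<mu> * vf_exp \<xi> \<delta> (\<rho> - \<mu>))"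
    proof (rule sum.cong [OF refl])
      fix i
      have "(\<Sum>j\<le>n. \<Sum>\<mu>\<in>D \<rho>. Y i \<gamma> \<mu> * Y j \<delta> (\<rho> - \<mu>)) = (\<Sum>\<mu>\<in>D \<rho>. Y i \<gamma> \<mu> * (\<Sum>j\<le>n. Y j \<delta> (\<rho> - \<mu>)))"
        by (subst sum.swap) (simp add: sum_distrib_left)
      also have "\<dots> = (\<Sum>\<mu>\<in>D \<rho>. Y i \<gamma> \<mu> * vf_exp \<xi> \<delta> (\<rho> - \<mu>))"
        by (intro sum.cong refl arg_cong2 [where f = "(*)"] exp_eq [symmetric])
           (auto simp: D_def deg_diff intro: d_nonneg)
      finally show "(\<Sum>j\<le>n. \<Sum>\<mu>\<in>D \<rho>. Y i \<gamma> \<mu> * Y j \<delta> (\<rho> - \<mu>)) = (\<Sum>\<mu>\<in>D \<rho>. Y i \<gamma> \<mu> * vf_exp \<xi> \<delta> (\<rho> - \<mu>))" .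
    qed
    also have "\<dots> = (\<Sum>\<mu>\<in>D \<rho>. (\<Sum>i\<le>n. Y i \<gamma> \<mu>) * vf_exp \<xi> \<delta> (\<rho> - \<mu>))"
      by (subst sum.swap) (simp add: sum_distrib_right)
    also have "\<dots> = (\<Sum>\<mu>\<in>D \<rho>. vf_exp \<xi> \<gamma> \<mu> * vf_exp \<xi> \<delta> (\<rho> - \<mu>))"
      by (intro sum.cong refl arg_cong2 [where f = "(*)"] exp_eq [symmetric] D_deg)
    finally show ?thesis .
  qed
  moreover have "vf_exp \<xi> \<gamma> 0 = 1" for \<gamma>
    by (subst vf_exp_eq [OF \<xi>', of _ 0]) (simp_all add: op_id_def)
  ultimately show ?thesis
    using op M by (simp add: auts_def multiplicative_iff)
qed

lemma vpow_add:
  assumes "\<xi> \<in> lie_on (M - {0})"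
  shows "op_comp (vpow \<xi> i) (vpow \<xi> j) = vpow \<xi> (i + j)"
proof (induction i)
  case 0
  then show ?case
    using assms by (simp add: op_comp_id_left M_op_vpow)
next
  case (Suc i)
  then show ?case
    using assms by (simp add: vpow_Suc op_comp_assoc M_op_vf_op M_op_vpow)
qed

lemma vpow_uminus:
  assumes \<xi>: "\<xi> \<in> lie_on (M - {0})"
  shows "vpow (\<lambda>\<gamma>. - \<xi> \<gamma>) k \<gamma> \<rho> = (- 1) ^ k * vpow \<xi> k \<gamma> \<rho>"
proof (induction k arbitrary: \<rho>)
  case (Suc k)
  have "vf_op (\<lambda>\<gamma>. - \<xi> \<gamma>) \<gamma> \<mu> = - vf_op \<xi> \<gamma> \<mu>" for \<gamma> \<mu>
    by (simp add: vf_op_def sum_negf)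
  then show ?case
    using Suc by (simp add: vpow_Suc_eq \<xi> lie_on_uminus sum_negf sum_distrib_left mult.assoc)
qed simp

text \<open>In total power \<open>k\<close> the coefficients add up to
  \<open>(1 - 1)^k / k!\<close>, so only \<open>k = 0\<close> survives.\<close>

lemma vf_exp_uminus:
  assumes \<xi>: "\<xi> \<in> lie_on (M - {0})" and A: "graded (M - {0})"
  shows "op_comp (vf_exp \<xi>) (vf_exp (\<lambda>\<gamma>. - \<xi> \<gamma>)) = op_id"
proof (intro ext)
  fix \<gamma> \<rho>
  define n where "n = nat (d \<rho>)"
  have op: "M_op (vf_exp \<xi>)" "M_op (vf_exp (\<lambda>\<gamma>. - \<xi> \<gamma>))"
    using vf_exp_auts [OF A] \<xi> lie_on_uminus by (blast intro: auts_M_op)+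
  have "op_comp (vf_exp \<xi>) (vf_exp (\<lambda>\<gamma>. - \<xi> \<gamma>)) \<gamma> \<rho>
      = (\<Sum>\<mu>\<in>D \<rho>. vf_exp (\<lambda>\<gamma>. - \<xi> \<gamma>) \<gamma> \<mu> * vf_exp \<xi> (\<gamma> + \<mu>) (\<rho> - \<mu>))"
    by (rule op_comp_eq [OF op])
  also have "\<dots> = (\<Sum>\<mu>\<in>D \<rho>. (\<Sum>j\<le>n. (- 1) ^ j * vpow \<xi> j \<gamma> \<mu> / fact j) *
      (\<Sum>i\<le>n. vpow \<xi> i (\<gamma> + \<mu>) (\<rho> - \<mu>) / fact i))"
  proof (intro sum.cong refl arg_cong2 [where f = "(*)"])
    fix \<mu> assume \<mu>: "\<mu> \<in> D \<rho>"
    then have "d \<mu> \<le> int n" "d (\<rho> - \<mu>) \<le> int n"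
      using D_deg [OF \<mu>] d_nonneg [of \<mu>] d_nonneg [of \<rho>] D_M [OF \<mu>] by (auto simp: n_def D_def deg_diff)
    then show "vf_exp (\<lambda>\<gamma>. - \<xi> \<gamma>) \<gamma> \<mu> = (\<Sum>j\<le>n. (- 1) ^ j * vpow \<xi> j \<gamma> \<mu> / fact j)"
      and "vf_exp \<xi> (\<gamma> + \<mu>) (\<rho> - \<mu>) = (\<Sum>i\<le>n. vpow \<xi> i (\<gamma> + \<mu>) (\<rho> - \<mu>) / fact i)"
      using vf_exp_eq [OF lie_on_uminus [OF \<xi>]] vf_exp_eq [OF \<xi>] by (simp_all add: vpow_uminus [OF \<xi>])
  qed
  also have "\<dots> = (\<Sum>\<mu>\<in>D \<rho>. \<Sum>j\<le>n. \<Sum>i\<le>n. (- 1) ^ j / (fact i * fact j) *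
      (vpow \<xi> j \<gamma> \<mu> * vpow \<xi> i (\<gamma> + \<mu>) (\<rho> - \<mu>)))"
    unfolding sum_product by (intro sum.cong refl) (simp add: field_simps)
  also have "\<dots> = (\<Sum>j\<le>n. \<Sum>i\<le>n. (- 1) ^ j / (fact i * fact j) *
      (\<Sum>\<mu>\<in>D \<rho>. vpow \<xi> j \<gamma> \<mu> * vpow \<xi> i (\<gamma> + \<mu>) (\<rho> - \<mu>)))"
    unfolding sum_distrib_left by (subst sum.swap, rule sum.cong [OF refl], rule sum.swap)
  also have "\<dots> = (\<Sum>j\<le>n. \<Sum>i\<le>n. (- 1) ^ j / (fact i * fact j) * vpow \<xi> (i + j) \<gamma> \<rho>)"
    using \<xi> by (simp add: vpow_add op_comp_eq M_op_vpow flip: op_comp_eq)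
  also have "\<dots> = (\<Sum>k\<le>n. \<Sum>j\<le>k. (- 1) ^ j / (fact (k - j) * fact j) * vpow \<xi> (k - j + j) \<gamma> \<rho>)"
    by (rule sum_square_triangle) (auto simp: n_def intro!: vpow_deg [OF \<xi>])
  also have "\<dots> = (\<Sum>k\<le>n. (\<Sum>j\<le>k. of_nat (k choose j) * (- 1) ^ j) / fact k * vpow \<xi> k \<gamma> \<rho>)"
    by (intro sum.cong refl)
       (simp add: sum_distrib_left sum_distrib_right sum_divide_distrib binomial_fact field_simps)
  also have "\<dots> = (\<Sum>k\<le>n. if k = 0 then op_id \<gamma> \<rho> else 0)"
  proof (intro sum.cong refl)
    fix k
    have "(\<Sum>j\<le>k. of_nat (k choose j) * (- 1) ^ j) = (0 :: complex) ^ k"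
      using binomial_ring [of "- 1 :: complex" 1 k] by simp
    then show "(\<Sum>j\<le>k. of_nat (k choose j) * (- 1) ^ j) / fact k * vpow \<xi> k \<gamma> \<rho>
        = (if k = 0 then op_id \<gamma> \<rho> else 0)"
      by simp
  qed
  also have "\<dots> = op_id \<gamma> \<rho>"
    by simp
  finally show "op_comp (vf_exp \<xi>) (vf_exp (\<lambda>\<gamma>. - \<xi> \<gamma>)) \<gamma> \<rho> = op_id \<gamma> \<rho>" .
qed

section \<open>Triangularity of the exponential with respect to the degree\<close>

lemma vpow_cong_below:
  assumes \<xi>: "\<xi> \<in> lie_on (M - {0})" "\<xi>' \<in> lie_on (M - {0})"
    and eq: "\<And>\<nu>. d \<nu> < N \<Longrightarrow> \<xi> \<nu> = \<xi>' \<nu>" and \<rho>: "d \<rho> < N"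
  shows "vpow \<xi> k \<gamma> \<rho> = vpow \<xi>' k \<gamma> \<rho>"
  using \<rho>
proof (induction k arbitrary: \<rho>)
  case (Suc k)
  have "vpow \<xi> k \<gamma> \<mu> * vf_op \<xi> (\<gamma> + \<mu>) (\<rho> - \<mu>) = vpow \<xi>' k \<gamma> \<mu> * vf_op \<xi>' (\<gamma> + \<mu>) (\<rho> - \<mu>)"
    if "\<mu> \<in> D \<rho>" for \<mu>
  proof -
    have "d \<mu> < N" "d (\<rho> - \<mu>) < N"
      using that Suc.prems D_deg [OF that] d_nonneg [of \<mu>] by (auto simp: D_def deg_diff)
    then show ?thesis
      by (simp add: Suc.IH eq vf_op_def)
  qed
  then show ?case
    by (simp add: vpow_Suc_eq \<xi>)
qed simp

text \<open>With at least two factors, each of positive degree, the coefficient at \<rho> involves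
  only components of smaller degree.\<close>

lemma vpow_cong_top:
  assumes \<xi>: "\<xi> \<in> lie_on (M - {0})" "\<xi>' \<in> lie_on (M - {0})"
    and eq: "\<And>\<nu>. d \<nu> < d \<rho> \<Longrightarrow> \<xi> \<nu> = \<xi>' \<nu>"
  shows "vpow \<xi> (Suc (Suc k)) \<gamma> \<rho> = vpow \<xi>' (Suc (Suc k)) \<gamma> \<rho>"
proof -
  have "vpow \<xi> (Suc k) \<gamma> \<mu> * vf_op \<xi> (\<gamma> + \<mu>) (\<rho> - \<mu>)
      = vpow \<xi>' (Suc k) \<gamma> \<mu> * vf_op \<xi>' (\<gamma> + \<mu>) (\<rho> - \<mu>)" if "\<mu> \<in> D \<rho>" for \<mu>
  proof (cases "\<mu> = 0 \<or> \<mu> = \<rho>")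
    case True
    then show ?thesis
      using vpow_deg [OF \<xi>(1), of 0 "Suc k"] vpow_deg [OF \<xi>(2), of 0 "Suc k"]
      by (auto simp: vf_op_0 \<xi>)
  next
    case False
    then have "d \<mu> < d \<rho>" "d (\<rho> - \<mu>) < d \<rho>"
      using D_deg' [OF that] d_pos [of \<mu>] that by (auto simp: D_def deg_diff)
    then show ?thesis
      using vpow_cong_below [OF \<xi> eq] by (simp add: eq vf_op_def)
  qed
  then show ?thesis
    by (simp add: vpow_Suc_eq \<xi> del: vpow_0)
qed

text \<open>Only the first power sees the component of top degree: modulo lower degrees the
  exponential is the vector field itself.\<close>

lemma vf_exp_triangular:
  assumes \<xi>: "\<xi> \<in> lie_on (M - {0})" "\<xi>' \<in> lie_on (M - {0})"
    and eq: "\<And>\<nu>. d \<nu> < d \<rho> \<Longrightarrow> \<xi> \<nu> = \<xi>' \<nu>"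
  shows "vf_exp \<xi> \<gamma> \<rho> - vf_exp \<xi>' \<gamma> \<rho> = vf_op \<xi> \<gamma> \<rho> - vf_op \<xi>' \<gamma> \<rho>"
proof -
  define n where "n = nat (d \<rho>)"
  have n: "d \<rho> \<le> int (Suc n)"
    by (simp add: n_def)
  have "vf_exp \<zeta> \<gamma> \<rho> = op_id \<gamma> \<rho> + vf_op \<zeta> \<gamma> \<rho> + (\<Sum>k<n. vpow \<zeta> (Suc (Suc k)) \<gamma> \<rho> / fact (Suc (Suc k)))"
    if "\<zeta> \<in> lie_on (M - {0})" for \<zeta>
    unfolding vf_exp_eq [OF that n]
    by (subst sum.atMost_Suc_shift, simp only: atMost_Suc_eq_insert_0 lessThan_Suc_atMost [symmetric],
        subst sum.lessThan_Suc_shift) (simp add: vpow_1 that)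
  then show ?thesis
    using vpow_cong_top [OF \<xi> eq] by (simp add: \<xi>)
qed

text \<open>In the multiplicativity at \<rho> the mixed terms involve only lower degrees and cancel
  in the difference. The two extreme terms are additive because constant terms are 1. So two
  automorphisms first differ by a derivation.\<close>

lemma auts_diff_additive:
  assumes T: "T \<in> auts (M - {0})" and S: "S \<in> auts (M - {0})" and \<rho>: "\<rho> \<noteq> 0"
    and eq: "\<And>\<gamma> \<mu>. d \<mu> < d \<rho> \<Longrightarrow> T \<gamma> \<mu> = S \<gamma> \<mu>"
  shows "T (\<gamma> + \<delta>) \<rho> - S (\<gamma> + \<delta>) \<rho> = (T \<gamma> \<rho> - S \<gamma> \<rho>) + (T \<delta> \<rho> - S \<delta> \<rho>)"
proof (cases "\<rho> \<in> M")
  case False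
  then show ?thesis
    using M_op_zero [of T \<rho>] M_op_zero [of S \<rho>] auts_M_op [OF T] auts_M_op [OF S] by simp
next
  case True
  have split: "U (\<gamma> + \<delta>) \<rho> = U \<gamma> \<rho> + U \<delta> \<rho> + (\<Sum>\<mu>\<in>D \<rho> - {0, \<rho>}. U \<gamma> \<mu> * U \<delta> (\<rho> - \<mu>))"
    if U: "U \<in> auts (M - {0})" for U
  proof -
    have "U (\<gamma> + \<delta>) \<rho> = (\<Sum>\<mu>\<in>D \<rho>. U \<gamma> \<mu> * U \<delta> (\<rho> - \<mu>))"
      using U multiplicative_iff [OF auts_M_op [OF U]] by (auto simp: auts_def)
    also have "\<dots> = (\<Sum>\<mu>\<in>{0, \<rho>}. U \<gamma> \<mu> * U \<delta> (\<rho> - \<mu>)) + (\<Sum>\<mu>\<in>D \<rho> - {0, \<rho>}. U \<gamma> \<mu> * U \<delta> (\<rho> - \<mu>))"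
      by (subst sum.subset_diff [of "{0, \<rho>}"]) (use True in \<open>auto simp: D_0I D_selfI\<close>)
    finally show ?thesis
      using \<rho> U by (simp add: auts_def)
  qed
  have "(\<Sum>\<mu>\<in>D \<rho> - {0, \<rho>}. T \<gamma> \<mu> * T \<delta> (\<rho> - \<mu>)) = (\<Sum>\<mu>\<in>D \<rho> - {0, \<rho>}. S \<gamma> \<mu> * S \<delta> (\<rho> - \<mu>))"
  proof (rule sum.cong [OF refl])
    fix \<mu> assume \<mu>: "\<mu> \<in> D \<rho> - {0, \<rho>}"
    then have "d \<mu> < d \<rho>" "d (\<rho> - \<mu>) < d \<rho>"
      using D_deg' [of \<mu> \<rho>] d_pos [of \<mu>] by (auto simp: D_def deg_diff)
    then show "T \<gamma> \<mu> * T \<delta> (\<rho> - \<mu>) = S \<gamma> \<mu> * S \<delta> (\<rho> - \<mu>)"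
      by (simp add: eq)
  qed
  then show ?thesis
    unfolding split [OF T] split [OF S] by simp
qed

text \<open>To leading order the group law is addition: the mixed terms of both composites agree by
  hypothesis.\<close>

lemma op_comp_diff:
  assumes T: "T \<in> auts (M - {0})" "T' \<in> auts (M - {0})"
    and S: "S \<in> auts (M - {0})" "S' \<in> auts (M - {0})"
    and eqT: "\<And>\<gamma> \<mu>. d \<mu> < d \<rho> \<Longrightarrow> T \<gamma> \<mu> = T' \<gamma> \<mu>"
    and eqS: "\<And>\<gamma> \<mu>. d \<mu> < d \<rho> \<Longrightarrow> S \<gamma> \<mu> = S' \<gamma> \<mu>"
  shows "op_comp S T \<gamma> \<rho> - op_comp S' T' \<gamma> \<rho> = (S \<gamma> \<rho> - S' \<gamma> \<rho>) + (T \<gamma> \<rho> - T' \<gamma> \<rho>)"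
proof -
  have op: "M_op T" "M_op T'" "M_op S" "M_op S'"
    using S T auts_M_op by blast+
  consider "\<rho> \<notin> M" | "\<rho> = 0" | "\<rho> \<in> M" "\<rho> \<noteq> 0"
    by blast
  then show ?thesis
  proof cases
    case 1
    then show ?thesis
      using op M_op_zero [OF op(1) 1] M_op_zero [OF op(2) 1] M_op_zero [OF op(3) 1] M_op_zero [OF op(4) 1]
      by (simp add: op_comp_eq D_notM)
  next
    case 2
    then show ?thesis
      using op S T by (simp add: op_comp_0 auts_def)
  next
    case 3
    have split: "op_comp U V \<gamma> \<rho> = U \<gamma> \<rho> + V \<gamma> \<rho> + (\<Sum>\<mu>\<in>D \<rho> - {0, \<rho>}. V \<gamma> \<mu> * U (\<gamma> + \<mu>) (\<rho> - \<mu>))"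
      if UV: "U \<in> auts (M - {0})" "V \<in> auts (M - {0})" for U V
    proof -
      have "op_comp U V \<gamma> \<rho> = (\<Sum>\<mu>\<in>D \<rho>. V \<gamma> \<mu> * U (\<gamma> + \<mu>) (\<rho> - \<mu>))"
        using UV auts_M_op by (simp add: op_comp_eq)
      also have "\<dots> = (\<Sum>\<mu>\<in>{0, \<rho>}. V \<gamma> \<mu> * U (\<gamma> + \<mu>) (\<rho> - \<mu>)) +
          (\<Sum>\<mu>\<in>D \<rho> - {0, \<rho>}. V \<gamma> \<mu> * U (\<gamma> + \<mu>) (\<rho> - \<mu>))"
        by (subst sum.subset_diff [of "{0, \<rho>}"]) (use 3 in \<open>auto simp: D_0I D_selfI\<close>)
      finally show ?thesis
        using 3 UV by (simp add: auts_def)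
    qed
    have "(\<Sum>\<mu>\<in>D \<rho> - {0, \<rho>}. T \<gamma> \<mu> * S (\<gamma> + \<mu>) (\<rho> - \<mu>))
        = (\<Sum>\<mu>\<in>D \<rho> - {0, \<rho>}. T' \<gamma> \<mu> * S' (\<gamma> + \<mu>) (\<rho> - \<mu>))"
    proof (rule sum.cong [OF refl])
      fix \<mu> assume \<mu>: "\<mu> \<in> D \<rho> - {0, \<rho>}"
      then have "d \<mu> < d \<rho>" "d (\<rho> - \<mu>) < d \<rho>"
        using D_deg' [of \<mu> \<rho>] d_pos [of \<mu>] by (auto simp: D_def deg_diff)
      then show "T \<gamma> \<mu> * S (\<gamma> + \<mu>) (\<rho> - \<mu>) = T' \<gamma> \<mu> * S' (\<gamma> + \<mu>) (\<rho> - \<mu>)"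
        by (simp add: eqS eqT)
    qed
    then show ?thesis
      unfolding split [OF S(1) T(1)] split [OF S(2) T(2)] by simp
  qed
qed

text \<open>The vector field is found degree by degree: at each degree the defect is additive in \<open>\<gamma>\<close>.\<close>

lemma triangular_surj:
  fixes \<Phi> :: "'n vfield \<Rightarrow> 'n oper"
  assumes A: "graded A"
    and \<Phi>: "\<And>\<xi>. \<xi> \<in> lie_on A \<Longrightarrow> \<Phi> \<xi> \<in> auts A"
    and tri: "\<And>\<xi> \<xi>' \<gamma> \<rho>. \<xi> \<in> lie_on A \<Longrightarrow> \<xi>' \<in> lie_on A \<Longrightarrow> (\<And>\<nu>. d \<nu> < d \<rho> \<Longrightarrow> \<xi> \<nu> = \<xi>' \<nu>) \<Longrightarrow>
      \<Phi> \<xi> \<gamma> \<rho> - \<Phi> \<xi>' \<gamma> \<rho> = vf_op \<xi> \<gamma> \<rho> - vf_op \<xi>' \<gamma> \<rho>"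
    and T: "T \<in> auts A"
  shows "\<exists>\<xi>\<in>lie_on A. \<Phi> \<xi> = T"
proof -
  have AM: "A \<subseteq> M - {0}"
    using A by (simp add: graded_def)
  \<comment> \<open>The defect in degree \<open>n\<close>, read off at the basis vectors. These
    values determine it, since it is additive once all lower degrees agree.\<close>
  define corr where "corr \<xi> n \<mu> =
    (if d \<mu> = int n \<and> \<mu> \<in> A then \<chi> i. T (axis i 1) \<mu> - \<Phi> \<xi> (axis i 1) \<mu> else 0)" for \<xi> n \<mu>
  define X where "X = rec_nat (\<lambda>_. 0) (\<lambda>n \<xi> \<mu>. \<xi> \<mu> + corr \<xi> (Suc n) \<mu>)"
  have X0: "X 0 = (\<lambda>_. 0)" and XS: "X (Suc n) \<mu> = X n \<mu> + corr (X n) (Suc n) \<mu>" for n \<mu>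
    by (simp_all add: X_def)
  have lie: "X n \<in> lie_on A" for n
  proof (induction n)
    case (Suc n)
    show ?case
      unfolding lie_on_def
    proof (intro CollectI allI impI)
      fix \<mu> assume "X (Suc n) \<mu> \<noteq> 0"
      then have "X n \<mu> \<noteq> 0 \<or> corr (X n) (Suc n) \<mu> \<noteq> 0"
        by (auto simp: XS)
      then show "\<mu> \<in> A"
        using Suc by (auto simp: lie_on_def corr_def split: if_splits)
    qed
  qed (simp add: X0 lie_on_def)
  have stable: "X m \<nu> = X n \<nu>" if "n \<le> m" "d \<nu> \<le> int n" for m n \<nu>
    using that by (induction rule: dec_induct) (simp_all add: XS corr_def)
  have inv: "\<Phi> (X n) \<gamma> \<rho> = T \<gamma> \<rho>" if "d \<rho> \<le> int n" for n \<gamma> \<rho>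
    using that
  proof (induction n arbitrary: \<gamma> \<rho>)
    case 0
    show ?case
    proof (cases "\<rho> = 0")
      case True
      then show ?thesis
        using T \<Phi> [OF lie] by (simp add: auts_def)
    next
      case False
      then have "\<rho> \<notin> M"
        using 0 d_pos [of \<rho>] by auto
      then show ?thesis
        using auts_outside [OF T] auts_outside [OF \<Phi> [OF lie]] graded_M [OF A] False by (metis subsetD)
    qed
  next
    case (Suc n)
    show ?case
    proof (cases "d \<rho> \<le> int n")
      case True
      have "\<Phi> (X (Suc n)) \<gamma> \<rho> - \<Phi> (X n) \<gamma> \<rho> = vf_op (X (Suc n)) \<gamma> \<rho> - vf_op (X n) \<gamma> \<rho>"
        using True by (intro tri lie stable) auto
      also have "\<dots> = 0"
        using stable [of n "Suc n" \<rho>] True by (simp add: vf_op_def)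
      finally show ?thesis
        using Suc.IH [OF True] by simp
    next
      case False
      then have dr: "d \<rho> = int (Suc n)"
        using Suc.prems by simp
      then have \<rho>0: "\<rho> \<noteq> 0"
        by auto
      show ?thesis
      proof (cases "\<rho> \<in> A")
        case False
        then show ?thesis
          using auts_outside [OF T] auts_outside [OF \<Phi> [OF lie]] \<rho>0 by simp
      next
        case True
        define \<Delta> where "\<Delta> \<gamma> = T \<gamma> \<rho> - \<Phi> (X n) \<gamma> \<rho>" for \<gamma>
        have "\<Delta> (\<gamma> + \<delta>) = \<Delta> \<gamma> + \<Delta> \<delta>" for \<gamma> \<delta>
          unfolding \<Delta>_def
        proof (rule auts_diff_additive [OF _ _ \<rho>0])
          show "T \<in> auts (M - {0})" "\<Phi> (X n) \<in> auts (M - {0})"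
            using T \<Phi> [OF lie] auts_mono [OF AM] by blast+
          show "T \<gamma> \<mu> = \<Phi> (X n) \<gamma> \<mu>" if "d \<mu> < d \<rho>" for \<gamma> \<mu>
            using Suc.IH [of \<mu> \<gamma>] that dr by simp
        qed
        then have \<Delta>: "\<Delta> \<gamma> = (\<Sum>i\<in>UNIV. \<Delta> (axis i 1) * of_int (\<gamma> $ i))"
          by (rule additive_int_vec)
        have "\<Phi> (X (Suc n)) \<gamma> \<rho> - \<Phi> (X n) \<gamma> \<rho> = vf_op (X (Suc n)) \<gamma> \<rho> - vf_op (X n) \<gamma> \<rho>"
          using dr by (intro tri lie stable) auto
        also have "\<dots> = \<Delta> \<gamma>"
          unfolding \<Delta> using True dr
          by (simp add: vf_op_def XS corr_def \<Delta>_def sum_subtractf [symmetric] algebra_simps)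
        finally show ?thesis
          by (simp add: \<Delta>_def)
      qed
    qed
  qed
  \<comment> \<open>The limit of the approximations: \<open>X n\<close> no longer changes in degrees
    up to \<open>n\<close>.\<close>
  define \<xi> where "\<xi> \<mu> = X (nat (d \<mu>)) \<mu>" for \<mu>
  have \<xi>_eq: "\<xi> \<nu> = X n \<nu>" if "d \<nu> \<le> int n" for n \<nu>
    unfolding \<xi>_def using that by (intro stable [symmetric]) auto
  have \<xi>: "\<xi> \<in> lie_on A"
    using lie by (auto simp: \<xi>_def lie_on_def)
  have "\<Phi> \<xi> \<gamma> \<rho> = T \<gamma> \<rho>" for \<gamma> \<rho>
  proof -
    define n where "n = nat (d \<rho>)"
    have "\<Phi> \<xi> \<gamma> \<rho> - \<Phi> (X n) \<gamma> \<rho> = vf_op \<xi> \<gamma> \<rho> - vf_op (X n) \<gamma> \<rho>"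
      by (intro tri \<xi> lie \<xi>_eq) (simp add: n_def)
    also have "\<dots> = 0"
      using \<xi>_eq [of \<rho> n] by (simp add: vf_op_def n_def)
    finally show ?thesis
      using inv [of \<rho> n \<gamma>] by (simp add: n_def)
  qed
  then show ?thesis
    using \<xi> by blast
qed

lemma graded_M0: "graded (M - {0})"
proof -
  have "a + b \<noteq> 0" if "a \<in> M - {0}" "b \<in> M - {0}" for a b
  proof
    assume "a + b = 0"
    then have "d a + d b = 0"
      by (metis deg_0 deg_add)
    then show False
      using that d_pos [of a] d_pos [of b] by simp
  qed
  then show ?thesis
    by (auto simp: graded_def add_closed_def M_add)
qed

lemma lie_on_graded: "graded A \<Longrightarrow> \<xi> \<in> lie_on A \<Longrightarrow> \<xi> \<in> lie_on (M - {0})"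
  by (auto simp: graded_def intro: lie_on_mono)

lemma auts_eq_graded:
  assumes A: "graded A"
  shows "auts A = vf_exp ` lie_on A"
proof
  show "vf_exp ` lie_on A \<subseteq> auts A"
    using vf_exp_auts [OF A] by blast
  show "auts A \<subseteq> vf_exp ` lie_on A"
  proof
    fix T assume "T \<in> auts A"
    have "\<exists>\<xi>\<in>lie_on A. vf_exp \<xi> = T"
    proof (rule triangular_surj [OF A vf_exp_auts [OF A] vf_exp_triangular \<open>T \<in> auts A\<close>])
    qed (use lie_on_graded [OF A] in auto)
    then show "T \<in> vf_exp ` lie_on A"
      by blast
  qed
qed

text \<open>Sending \<xi> to the product of the exponentials of its restrictions to
  \<open>A1\<close> and \<open>A2\<close> is triangular with the same leading term as the
  exponential, hence onto.\<close>

lemma factor_exists_graded: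
  assumes A: "graded A" "graded A1" "graded A2" "A = A1 \<union> A2" "A1 \<inter> A2 = {}"
    and T: "T \<in> auts A"
  shows "\<exists>a\<in>auts A1. \<exists>b\<in>auts A2. T = op_comp a b"
proof -
  define R where "R B \<xi> = (\<lambda>\<mu>. if \<mu> \<in> B then \<xi> \<mu> else 0)" for B and \<xi> :: "'n vfield"
  have R: "R B \<xi> \<in> lie_on B" for B \<xi>
    unfolding R_def by (rule lie_on_restrict)
  have R': "R A1 \<xi> \<in> lie_on (M - {0})" "R A2 \<xi> \<in> lie_on (M - {0})" for \<xi>
    using R A lie_on_graded by blast+
  have E: "vf_exp (R A1 \<xi>) \<in> auts A1" "vf_exp (R A2 \<xi>) \<in> auts A2" for \<xi>
    using R A vf_exp_auts by blast+
  have sub: "auts A1 \<subseteq> auts A" "auts A2 \<subseteq> auts A" "auts A \<subseteq> auts (M - {0})"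
    using A by (intro auts_mono; auto simp: graded_def)+
  have "\<exists>\<xi>\<in>lie_on A. op_comp (vf_exp (R A1 \<xi>)) (vf_exp (R A2 \<xi>)) = T"
  proof (rule triangular_surj [OF A(1) _ _ T])
    fix \<xi> assume "\<xi> \<in> lie_on A"
    show "op_comp (vf_exp (R A1 \<xi>)) (vf_exp (R A2 \<xi>)) \<in> auts A"
      using E sub A(1) by (intro auts_comp_graded) (auto simp: graded_def)
  next
    fix \<xi> \<xi>' \<gamma> \<rho>
    assume lie: "\<xi> \<in> lie_on A" "\<xi>' \<in> lie_on A" and eq: "\<And>\<nu>. d \<nu> < d \<rho> \<Longrightarrow> \<xi> \<nu> = \<xi>' \<nu>"
    have eqR: "R B \<xi> \<nu> = R B \<xi>' \<nu>" if "d \<nu> < d \<rho>" for B \<nu>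
      using eq [OF that] by (simp add: R_def)
    have low: "vf_exp (R A1 \<xi>) \<gamma> \<mu> = vf_exp (R A1 \<xi>') \<gamma> \<mu>" "vf_exp (R A2 \<xi>) \<gamma> \<mu> = vf_exp (R A2 \<xi>') \<gamma> \<mu>"
      if "d \<mu> < d \<rho>" for \<gamma> \<mu>
      using vf_exp_triangular [OF R'(1) R'(1), of \<mu> \<xi> \<xi>' \<gamma>]
        vf_exp_triangular [OF R'(2) R'(2), of \<mu> \<xi> \<xi>' \<gamma>] that eqR by (simp_all add: vf_op_def)
    have "op_comp (vf_exp (R A1 \<xi>)) (vf_exp (R A2 \<xi>)) \<gamma> \<rho> - op_comp (vf_exp (R A1 \<xi>')) (vf_exp (R A2 \<xi>')) \<gamma> \<rho>
        = (vf_exp (R A1 \<xi>) \<gamma> \<rho> - vf_exp (R A1 \<xi>') \<gamma> \<rho>) + (vf_exp (R A2 \<xi>) \<gamma> \<rho> - vf_exp (R A2 \<xi>') \<gamma> \<rho>)"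
      by (rule op_comp_diff) (use E sub low in blast)+
    also have "\<dots> = (vf_op (R A1 \<xi>) \<gamma> \<rho> - vf_op (R A1 \<xi>') \<gamma> \<rho>) + (vf_op (R A2 \<xi>) \<gamma> \<rho> - vf_op (R A2 \<xi>') \<gamma> \<rho>)"
      using vf_exp_triangular [OF R'(1) R'(1) eqR] vf_exp_triangular [OF R'(2) R'(2) eqR] by simp
    also have "\<dots> = vf_op \<xi> \<gamma> \<rho> - vf_op \<xi>' \<gamma> \<rho>"
    proof -
      have "vf_op \<zeta> \<gamma> \<rho> = vf_op (R A1 \<zeta>) \<gamma> \<rho> + vf_op (R A2 \<zeta>) \<gamma> \<rho>" if "\<zeta> \<in> lie_on A" for \<zeta>
      proof -
        have "\<zeta> \<rho> = R A1 \<zeta> \<rho> + R A2 \<zeta> \<rho>"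
          using that A(4,5) by (auto simp: R_def lie_on_def)
        then show ?thesis
          by (simp add: vf_op_def sum.distrib algebra_simps)
      qed
      then show ?thesis
        using lie by simp
    qed
    finally show "op_comp (vf_exp (R A1 \<xi>)) (vf_exp (R A2 \<xi>)) \<gamma> \<rho>
        - op_comp (vf_exp (R A1 \<xi>')) (vf_exp (R A2 \<xi>')) \<gamma> \<rho> = vf_op \<xi> \<gamma> \<rho> - vf_op \<xi>' \<gamma> \<rho>" .
  qed
  then show ?thesis
    using E by blast
qed

end

subsection \<open>Groups of automorphisms\<close>

text \<open>The linear form is quantified away, since elements come with varying cones and the group
  laws are to be used without naming it.\<close>

definition tame :: "(int ^ 'n::finite) set \<Rightarrow> bool" where
  "tame A \<longleftrightarrow> add_closed A \<and> (\<exists>l. \<forall>\<mu>\<in>A. \<mu> \<noteq> 0 \<and> l1 \<mu> \<le> deg l \<mu>)"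

lemma tame_graded: "tame A \<longleftrightarrow> (\<exists>l. grading.graded l A)"
  unfolding tame_def grading.graded_def grading.M_def by blast

lemma tame_subset: "tame A \<Longrightarrow> B \<subseteq> A \<Longrightarrow> add_closed B \<Longrightarrow> tame B"
  unfolding tame_def by blast

lemma tame_closed: "tame A \<Longrightarrow> add_closed A"
  unfolding tame_def by blast

lemma tame_Int: "tame A \<Longrightarrow> add_closed B \<Longrightarrow> tame (A \<inter> B)"
  by (rule tame_subset) (auto simp: tame_def add_closed_def)

lemma auts_id [simp]: "op_id \<in> auts A"
  by (rule grading.auts_id_graded)

lemma auts_comp: "tame A \<Longrightarrow> S \<in> auts A \<Longrightarrow> T \<in> auts A \<Longrightarrow> op_comp S T \<in> auts A"
  unfolding tame_graded using grading.auts_comp_graded grading.graded_M grading.graded_def by metis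

lemma auts_assoc:
  "tame A \<Longrightarrow> S \<in> auts A \<Longrightarrow> T \<in> auts A \<Longrightarrow> U \<in> auts A \<Longrightarrow>
    op_comp (op_comp S T) U = op_comp S (op_comp T U)"
  unfolding tame_graded using grading.op_comp_assoc grading.graded_M grading.auts_M_op by metis

lemma auts_id_left: "tame A \<Longrightarrow> T \<in> auts A \<Longrightarrow> op_comp op_id T = T"
  unfolding tame_graded using grading.op_comp_id_left grading.graded_M grading.auts_M_op by metis

lemma auts_id_right: "tame A \<Longrightarrow> T \<in> auts A \<Longrightarrow> op_comp T op_id = T"
  unfolding tame_graded using grading.op_comp_id_right grading.graded_M grading.auts_M_op by metis

lemma auts_eq: "tame A \<Longrightarrow> auts A = vf_exp ` lie_on A"
  unfolding tame_graded using grading.auts_eq_graded by blast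

lemma vf_exp_in_auts: "tame A \<Longrightarrow> \<xi> \<in> lie_on A \<Longrightarrow> vf_exp \<xi> \<in> auts A"
  by (simp add: auts_eq)

lemma vf_exp_inverse_right:
  "tame A \<Longrightarrow> \<xi> \<in> lie_on A \<Longrightarrow> op_comp (vf_exp \<xi>) (vf_exp (\<lambda>\<gamma>. - \<xi> \<gamma>)) = op_id"
  unfolding tame_graded using grading.vf_exp_uminus grading.graded_M0 grading.lie_on_graded by metis

lemma vf_exp_inverse_left:
  assumes "tame A" "\<xi> \<in> lie_on A"
  shows "op_comp (vf_exp (\<lambda>\<gamma>. - \<xi> \<gamma>)) (vf_exp \<xi>) = op_id"
  using vf_exp_inverse_right [OF assms(1) lie_on_uminus [OF assms(2)]] by simp

text \<open>The inverse is chosen without reference to a support, so that one symbol serves in all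
  groups that contain \<open>T\<close>.\<close>

definition op_inv :: "'n::finite oper \<Rightarrow> 'n oper" where
  "op_inv T = (SOME S. \<exists>A. tame A \<and> T \<in> auts A \<and> S \<in> auts A \<and> op_comp S T = op_id \<and> op_comp T S = op_id)"

lemma auts_inverse_exists:
  assumes "tame A" "T \<in> auts A"
  shows "\<exists>S\<in>auts A. op_comp S T = op_id \<and> op_comp T S = op_id"
proof -
  obtain \<xi> where "\<xi> \<in> lie_on A" "T = vf_exp \<xi>"
    using assms by (auto simp: auts_eq)
  then show ?thesis
    using assms(1) vf_exp_inverse_left vf_exp_inverse_right vf_exp_in_auts lie_on_uminus by metis
qed

text \<open>The chosen inverse lies in some \<open>auts B\<close>. As \<open>T\<close> also lies in
  \<open>auts (A \<inter> B)\<close>, it has an inverse there, and by uniqueness of inverses in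
  \<open>auts B\<close> the two coincide; so the chosen one lies in \<open>auts A\<close>.\<close>

lemma op_inv:
  assumes A: "tame A" "T \<in> auts A"
  shows op_inv_auts: "op_inv T \<in> auts A"
    and op_inv_left: "op_comp (op_inv T) T = op_id"
    and op_inv_right: "op_comp T (op_inv T) = op_id"
proof -
  have "\<exists>A. tame A \<and> T \<in> auts A \<and> op_inv T \<in> auts A \<and> op_comp (op_inv T) T = op_id \<and> op_comp T (op_inv T) = op_id"
    unfolding op_inv_def
    by (rule someI_ex [where P = "\<lambda>S. \<exists>A. tame A \<and> T \<in> auts A \<and> S \<in> auts A \<and> op_comp S T = op_id \<and> op_comp T S = op_id"])
       (use auts_inverse_exists [OF A] A in blast)
  then obtain B where B: "tame B" "T \<in> auts B" "op_inv T \<in> auts B"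
    and inv: "op_comp (op_inv T) T = op_id" "op_comp T (op_inv T) = op_id"
    by blast
  have AB: "tame (A \<inter> B)" "T \<in> auts (A \<inter> B)"
    using A B tame_Int tame_closed auts_Int by blast+
  obtain S where S: "S \<in> auts (A \<inter> B)" "op_comp T S = op_id"
    using auts_inverse_exists [OF AB] by blast
  then have S': "S \<in> auts A" "S \<in> auts B"
    by (auto simp flip: auts_Int)
  have "op_inv T = op_comp (op_comp (op_inv T) T) S"
    using B S S' auts_assoc [OF B(1)] auts_id_right by metis
  also have "\<dots> = S"
    using S' B inv by (simp add: auts_id_left)
  finally show "op_inv T \<in> auts A"
    using S' by simp
  show "op_comp (op_inv T) T = op_id" "op_comp T (op_inv T) = op_id"
    by fact+
qed

lemma op_inv_cancel_left:
  "tame A \<Longrightarrow> T \<in> auts A \<Longrightarrow> S \<in> auts A \<Longrightarrow> op_comp (op_inv T) (op_comp T S) = S"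
  using auts_assoc [of A "op_inv T" T S] op_inv [of A T] by (simp add: auts_id_left)

lemma op_inv_cancel_left':
  "tame A \<Longrightarrow> T \<in> auts A \<Longrightarrow> S \<in> auts A \<Longrightarrow> op_comp T (op_comp (op_inv T) S) = S"
  using auts_assoc [of A T "op_inv T" S] op_inv [of A T] by (simp add: auts_id_left)

lemma op_inv_cancel_right:
  "tame A \<Longrightarrow> T \<in> auts A \<Longrightarrow> S \<in> auts A \<Longrightarrow> op_comp (op_comp S T) (op_inv T) = S"
  using auts_assoc [of A S T "op_inv T"] op_inv [of A T] by (simp add: auts_id_right)

lemma vf_exp_uminus_inv:
  assumes t: "tame A" and \<xi>: "\<xi> \<in> lie_on A"
  shows "vf_exp (\<lambda>\<gamma>. - \<xi> \<gamma>) = op_inv (vf_exp \<xi>)"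
proof -
  have e: "vf_exp \<xi> \<in> auts A" "vf_exp (\<lambda>\<gamma>. - \<xi> \<gamma>) \<in> auts A"
    using \<xi> lie_on_uminus [OF \<xi>] by (auto intro: vf_exp_in_auts t)
  have "op_comp (op_inv (vf_exp \<xi>)) (op_comp (vf_exp \<xi>) (vf_exp (\<lambda>\<gamma>. - \<xi> \<gamma>))) = vf_exp (\<lambda>\<gamma>. - \<xi> \<gamma>)"
    by (rule op_inv_cancel_left [OF t e])
  then show ?thesis
    using vf_exp_inverse_right [OF t \<xi>] op_inv_auts [OF t e(1)] by (simp add: auts_id_right [OF t])
qed

lemma op_inv_op_inv: "tame A \<Longrightarrow> T \<in> auts A \<Longrightarrow> op_inv (op_inv T) = T"
  by (metis op_inv_auts op_inv_cancel_left op_inv_left op_inv_right auts_id_right auts_id_left)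

lemma factor_exists:
  assumes "tame A" "add_closed A1" "add_closed A2" "A = A1 \<union> A2" "A1 \<inter> A2 = {}" "T \<in> auts A"
  shows "\<exists>a\<in>auts A1. \<exists>b\<in>auts A2. T = op_comp a b"
proof -
  obtain l where "grading.graded l A"
    using assms(1) by (auto simp: tame_graded)
  then show ?thesis
    using assms by (intro grading.factor_exists_graded [of l A]) (auto simp: grading.graded_def)
qed

text \<open>\<open>a'^-1 a = b' b^-1\<close> is supported in both parts; as they are disjoint, it is
  the identity.\<close>

lemma factor_unique:
  assumes A: "tame A" "add_closed A1" "add_closed A2" "A1 \<subseteq> A" "A2 \<subseteq> A" "A1 \<inter> A2 = {}"
    and a: "a \<in> auts A1" "a' \<in> auts A1" and b: "b \<in> auts A2" "b' \<in> auts A2"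
    and eq: "op_comp a b = op_comp a' b'"
  shows "a = a' \<and> b = b'"
proof -
  have t: "tame A1" "tame A2"
    using A tame_subset by blast+
  have in_A: "a \<in> auts A" "a' \<in> auts A" "b \<in> auts A" "b' \<in> auts A"
    using a b A auts_mono by blast+
  define x where "x = op_comp (op_inv a') a"
  have x1: "x \<in> auts A1"
    unfolding x_def using a t by (simp add: auts_comp op_inv_auts)
  have "op_comp x b = b'"
    unfolding x_def using in_A A(1) eq by (simp add: auts_assoc op_inv_auts op_inv_cancel_left)
  then have "op_comp (op_comp x b) (op_inv b) = op_comp b' (op_inv b)"
    by simp
  then have "x = op_comp b' (op_inv b)"
    using op_inv_cancel_right [OF A(1) in_A(3)] x1 auts_mono [OF A(4)] by auto
  then have "x \<in> auts A2"
    using b t by (simp add: auts_comp op_inv_auts)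
  then have x: "x = op_id"
    using x1 auts_Int [of A1 A2] A(6) by (intro auts_empty) auto
  have "op_comp a' x = a"
    unfolding x_def using in_A A(1) by (simp add: op_inv_cancel_left')
  then have "a = a'"
    using x in_A A(1) by (simp add: auts_id_right)
  moreover have "b = b'"
    using \<open>op_comp x b = b'\<close> x in_A A(1) by (simp add: auts_id_left)
  ultimately show ?thesis ..
qed

subsection \<open>Weighted norms\<close>

context grading
begin

definition Box :: "nat \<Rightarrow> (int ^ 'n) set" where
  "Box n = {\<mu> \<in> M. d \<mu> \<le> int n}"

definition wt :: "real \<Rightarrow> int ^ 'n \<Rightarrow> real" where
  "wt r \<mu> = r ^ nat (d \<mu>)"

text \<open>The partial sum, over degrees up to \<open>n\<close>, of the absolute values at the
  point whose monomials are \<open>r\<close> to the degree. Truncation keeps the norm finite and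
  allows bounds to be proved by induction on \<open>n\<close>.\<close>

definition nrm :: "real \<Rightarrow> nat \<Rightarrow> (int ^ 'n \<Rightarrow> complex) \<Rightarrow> real" where
  "nrm r n f = (\<Sum>\<mu>\<in>Box n. cmod (f \<mu>) * wt r \<mu>)"

lemma finite_Box [simp]: "finite (Box n)"
  unfolding Box_def by (rule finite_box)

lemma Box_0 [simp]: "Box 0 = {0}"
  unfolding Box_def using d_pos by force

lemma zero_in_Box [simp]: "0 \<in> Box n"
  by (simp add: Box_def)

lemma Box_mono: "m \<le> n \<Longrightarrow> Box m \<subseteq> Box n"
  by (auto simp: Box_def)

lemma wt_0 [simp]: "wt r 0 = 1"
  by (simp add: wt_def)

lemma wt_nonneg: "0 \<le> r \<Longrightarrow> 0 \<le> wt r \<mu>"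
  by (simp add: wt_def)

lemma wt_add: "\<mu> \<in> M \<Longrightarrow> \<nu> \<in> M \<Longrightarrow> wt r (\<mu> + \<nu>) = wt r \<mu> * wt r \<nu>"
  by (simp add: wt_def deg_add nat_add_distrib d_nonneg power_add)

lemma wt_mono: "0 \<le> r \<Longrightarrow> r \<le> s \<Longrightarrow> wt r \<mu> \<le> wt s \<mu>"
  by (simp add: wt_def power_mono)

lemma nrm_mono_r: "0 \<le> r \<Longrightarrow> r \<le> s \<Longrightarrow> nrm r n f \<le> nrm s n f"
  unfolding nrm_def by (intro sum_mono mult_left_mono wt_mono) auto

text \<open>Distinct \<open>(\<rho>, \<mu>)\<close> give distinct pairs
  \<open>(\<mu>, \<rho> - \<mu>)\<close>. The freedom in \<open>P\<close> and \<open>Q\<close>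
  matters: where one factor vanishes at 0, the other may be cut off one degree earlier, and this
  closes the later inductions on the degree.\<close>

lemma conv_sum_le:
  fixes F :: "int ^ 'n \<Rightarrow> int ^ 'n \<Rightarrow> real"
  assumes fin: "finite P" "finite Q" and pos: "\<And>\<mu> \<nu>. 0 \<le> F \<mu> \<nu>"
    and supp: "\<And>\<mu> \<nu>. \<mu> \<in> M \<Longrightarrow> \<nu> \<in> M \<Longrightarrow> d \<mu> + d \<nu> \<le> int n \<Longrightarrow> F \<mu> \<nu> \<noteq> 0 \<Longrightarrow> \<mu> \<in> P \<and> \<nu> \<in> Q"
  shows "(\<Sum>\<rho>\<in>Box n. \<Sum>\<mu>\<in>D \<rho>. F \<mu> (\<rho> - \<mu>)) \<le> (\<Sum>\<mu>\<in>P. \<Sum>\<nu>\<in>Q. F \<mu> \<nu>)"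
proof -
  define T where "T = {(\<rho>, \<mu>). \<rho> \<in> Box n \<and> \<mu> \<in> D \<rho> \<and> F \<mu> (\<rho> - \<mu>) \<noteq> 0}"
  have sub: "T \<subseteq> Sigma (Box n) D"
    by (auto simp: T_def)
  have inj: "inj_on (\<lambda>(\<rho>, \<mu>). (\<mu>, \<rho> - \<mu>)) T"
    by (auto simp: inj_on_def)
  have img: "(\<lambda>(\<rho>, \<mu>). (\<mu>, \<rho> - \<mu>)) ` T \<subseteq> P \<times> Q"
  proof
    fix x assume "x \<in> (\<lambda>(\<rho>, \<mu>). (\<mu>, \<rho> - \<mu>)) ` T"
    then obtain \<rho> \<mu> where x: "x = (\<mu>, \<rho> - \<mu>)" "\<rho> \<in> Box n" "\<mu> \<in> D \<rho>" "F \<mu> (\<rho> - \<mu>) \<noteq> 0"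
      by (auto simp: T_def)
    then show "x \<in> P \<times> Q"
      using supp [of \<mu> "\<rho> - \<mu>"] by (auto simp: D_def Box_def deg_diff)
  qed
  have "(\<Sum>\<rho>\<in>Box n. \<Sum>\<mu>\<in>D \<rho>. F \<mu> (\<rho> - \<mu>)) = (\<Sum>(\<rho>, \<mu>)\<in>Sigma (Box n) D. F \<mu> (\<rho> - \<mu>))"
    by (simp add: sum.Sigma)
  also have "\<dots> = (\<Sum>(\<rho>, \<mu>)\<in>T. F \<mu> (\<rho> - \<mu>))"
    by (rule sum.mono_neutral_right [OF _ sub]) (auto simp: T_def)
  also have "\<dots> = (\<Sum>(\<mu>, \<nu>)\<in>(\<lambda>(\<rho>, \<mu>). (\<mu>, \<rho> - \<mu>)) ` T. F \<mu> \<nu>)"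
    by (subst sum.reindex [OF inj]) (simp add: case_prod_unfold o_def)
  also have "\<dots> \<le> (\<Sum>(\<mu>, \<nu>)\<in>P \<times> Q. F \<mu> \<nu>)"
    by (rule sum_mono2 [OF _ img]) (use fin pos in auto)
  also have "\<dots> = (\<Sum>\<mu>\<in>P. \<Sum>\<nu>\<in>Q. F \<mu> \<nu>)"
    by (simp add: sum.cartesian_product)
  finally show ?thesis .
qed

lemma nrm_conv:
  assumes r: "0 \<le> r"
  shows "nrm r n (\<lambda>\<rho>. \<Sum>\<mu>\<in>D \<rho>. f \<mu> * g (\<rho> - \<mu>)) \<le> nrm r n f * nrm r n g"
proof -
  have "nrm r n (\<lambda>\<rho>. \<Sum>\<mu>\<in>D \<rho>. f \<mu> * g (\<rho> - \<mu>))
      \<le> (\<Sum>\<rho>\<in>Box n. \<Sum>\<mu>\<in>D \<rho>. (cmod (f \<mu>) * wt r \<mu>) * (cmod (g (\<rho> - \<mu>)) * wt r (\<rho> - \<mu>)))"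
    unfolding nrm_def
  proof (rule sum_mono)
    fix \<rho>
    have "cmod (\<Sum>\<mu>\<in>D \<rho>. f \<mu> * g (\<rho> - \<mu>)) * wt r \<rho> \<le> (\<Sum>\<mu>\<in>D \<rho>. cmod (f \<mu> * g (\<rho> - \<mu>))) * wt r \<rho>"
      by (intro mult_right_mono norm_sum wt_nonneg r)
    also have "\<dots> = (\<Sum>\<mu>\<in>D \<rho>. (cmod (f \<mu>) * wt r \<mu>) * (cmod (g (\<rho> - \<mu>)) * wt r (\<rho> - \<mu>)))"
      unfolding sum_distrib_right
    proof (rule sum.cong [OF refl])
      fix \<mu> assume "\<mu> \<in> D \<rho>"
      then have "wt r \<rho> = wt r \<mu> * wt r (\<rho> - \<mu>)"
        using wt_add [of \<mu> "\<rho> - \<mu>" r] by (simp add: D_def)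
      then show "cmod (f \<mu> * g (\<rho> - \<mu>)) * wt r \<rho> = (cmod (f \<mu>) * wt r \<mu>) * (cmod (g (\<rho> - \<mu>)) * wt r (\<rho> - \<mu>))"
        by (simp add: norm_mult)
    qed
    finally show "cmod (\<Sum>\<mu>\<in>D \<rho>. f \<mu> * g (\<rho> - \<mu>)) * wt r \<rho> \<le>
        (\<Sum>\<mu>\<in>D \<rho>. (cmod (f \<mu>) * wt r \<mu>) * (cmod (g (\<rho> - \<mu>)) * wt r (\<rho> - \<mu>)))" .
  qed
  also have "\<dots> \<le> (\<Sum>\<mu>\<in>Box n. \<Sum>\<nu>\<in>Box n. (cmod (f \<mu>) * wt r \<mu>) * (cmod (g \<nu>) * wt r \<nu>))"
    by (rule conv_sum_le [where F = "\<lambda>\<mu> \<nu>. (cmod (f \<mu>) * wt r \<mu>) * (cmod (g \<nu>) * wt r \<nu>)"])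
       (use d_nonneg in \<open>force simp: r wt_nonneg Box_def finite_box\<close>)+
  also have "\<dots> = nrm r n f * nrm r n g"
    by (simp add: nrm_def sum_product)
  finally show ?thesis .
qed

text \<open>If \<open>R\<close> bounds all \<open>|x_i|\<close> and \<open>1 / |x_i|\<close>, the
  modulus of a monomial is at least \<open>R\<close> to the power \<open>- l1 \<mu>\<close>, and on
  \<open>M\<close> the number \<open>l1 \<mu>\<close> is at most the degree.\<close>

lemma wt_le_torus:
  fixes x :: "complex ^ 'n"
  assumes "\<And>i. x $ i \<noteq> 0"
  shows "\<exists>r>0. \<forall>\<mu>\<in>M. wt r \<mu> \<le> cmod (torus_monomial x \<mu>)"
proof -
  define R where "R = Max (insert 1 (range (\<lambda>i. max (cmod (x $ i)) (inverse (cmod (x $ i))))))"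
  have R1: "1 \<le> R"
    unfolding R_def by (rule Max_ge) auto
  have R: "cmod (x $ i) \<le> R" "inverse (cmod (x $ i)) \<le> R" for i
  proof -
    have "max (cmod (x $ i)) (inverse (cmod (x $ i))) \<le> R"
      unfolding R_def by (rule Max_ge) auto
    then show "cmod (x $ i) \<le> R" "inverse (cmod (x $ i)) \<le> R"
      by simp_all
  qed
  have low: "inverse R ^ nat \<bar>k\<bar> \<le> cmod (x $ i) powi k" for i k
  proof (cases "0 \<le> k")
    case True
    have "inverse R \<le> inverse (inverse (cmod (x $ i)))"
      using R1 R(2) [of i] assms by (intro le_imp_inverse_le) auto
    then have "inverse R ^ nat k \<le> cmod (x $ i) ^ nat k"
      using R1 by (intro power_mono) auto
    then show ?thesis
      using True by (simp add: power_int_def)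
  next
    case False
    have "inverse R \<le> inverse (cmod (x $ i))"
      using R1 R(1) [of i] assms by (intro le_imp_inverse_le) auto
    then have "inverse R ^ nat (- k) \<le> inverse (cmod (x $ i)) ^ nat (- k)"
      using R1 by (intro power_mono) auto
    then show ?thesis
      using False by (simp add: power_int_def)
  qed
  have "wt (inverse R) \<mu> \<le> cmod (torus_monomial x \<mu>)" if "\<mu> \<in> M" for \<mu>
  proof -
    have "int (\<Sum>i\<in>UNIV. nat \<bar>\<mu> $ i\<bar>) = l1 \<mu>"
      by (simp add: l1_def)
    then have "(\<Sum>i\<in>UNIV. nat \<bar>\<mu> $ i\<bar>) \<le> nat (d \<mu>)"
      using that unfolding M_def mem_Collect_eq by linarith
    then have "wt (inverse R) \<mu> \<le> inverse R ^ (\<Sum>i\<in>UNIV. nat \<bar>\<mu> $ i\<bar>)"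
      unfolding wt_def using R1 by (intro power_decreasing) (auto simp: inverse_le_1_iff)
    also have "\<dots> = (\<Prod>i\<in>UNIV. inverse R ^ nat \<bar>\<mu> $ i\<bar>)"
      by (rule power_sum)
    also have "\<dots> \<le> (\<Prod>i\<in>UNIV. cmod (x $ i) powi (\<mu> $ i))"
      using R1 by (intro prod_mono conjI low) auto
    also have "\<dots> = cmod (torus_monomial x \<mu>)"
      by (simp add: torus_monomial_def prod_norm [symmetric] norm_power_int)
    finally show ?thesis .
  qed
  then show ?thesis
    using R1 by (intro exI [of _ "inverse R"]) auto
qed

lemma torus_eq_wt:
  assumes "0 < r"
  shows "torus_monomial (\<chi> i. complex_of_real r powi (l $ i)) \<mu> = of_real r powi d \<mu>"
proof -
  have "torus_monomial (\<chi> i. complex_of_real r powi (l $ i)) \<mu> = (\<Prod>i\<in>UNIV. of_real r powi (l $ i * \<mu> $ i))"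
    by (simp add: torus_monomial_def power_int_mult)
  also have "\<dots> = of_real r powi (\<Sum>i\<in>UNIV. l $ i * \<mu> $ i)"
  proof -
    have "finite I \<Longrightarrow> (\<Prod>i\<in>I. complex_of_real r powi (l $ i * \<mu> $ i)) = of_real r powi (\<Sum>i\<in>I. l $ i * \<mu> $ i)"
      for I :: "'n set"
      by (induction I rule: finite_induct) (use assms in \<open>simp_all add: power_int_add\<close>)
    then show ?thesis
      by simp
  qed
  finally show ?thesis
    by (simp add: deg_def)
qed

text \<open>On \<open>M\<close>, the monomials at any torus point dominate those at some point with
  coordinates \<open>r powi (l $ i)\<close>, which are powers of \<open>r\<close>. So analyticity
  amounts to a bound at one radius.\<close>

lemma analytic_series_iff:
  assumes supp: "\<And>\<mu>. c \<mu> \<noteq> 0 \<Longrightarrow> \<mu> \<in> M"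
  shows "analytic_series c \<longleftrightarrow> (\<exists>r>0. \<exists>K. \<forall>n. nrm r n c \<le> K)"
proof
  assume "analytic_series c"
  then obtain x :: "complex ^ 'n" where x: "\<And>i. x $ i \<noteq> 0"
    and sm: "(\<lambda>\<mu>. norm (c \<mu> * torus_monomial x \<mu>)) summable_on UNIV"
    by (auto simp: analytic_series_def)
  obtain r where r: "0 < r" "\<And>\<mu>. \<mu> \<in> M \<Longrightarrow> wt r \<mu> \<le> cmod (torus_monomial x \<mu>)"
    using wt_le_torus [OF x] by blast
  have "nrm r n c \<le> infsum (\<lambda>\<mu>. norm (c \<mu> * torus_monomial x \<mu>)) UNIV" for n
  proof -
    have "nrm r n c \<le> (\<Sum>\<mu>\<in>Box n. norm (c \<mu> * torus_monomial x \<mu>))"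
      unfolding nrm_def norm_mult using r by (intro sum_mono mult_left_mono) (auto simp: Box_def)
    also have "\<dots> \<le> infsum (\<lambda>\<mu>. norm (c \<mu> * torus_monomial x \<mu>)) UNIV"
      by (rule finite_sum_le_infsum [OF sm]) auto
    finally show ?thesis .
  qed
  then show "\<exists>r>0. \<exists>K. \<forall>n. nrm r n c \<le> K"
    using r by blast
next
  assume "\<exists>r>0. \<exists>K. \<forall>n. nrm r n c \<le> K"
  then obtain r K where r: "0 < r" and K: "\<And>n. nrm r n c \<le> K"
    by blast
  define x :: "complex ^ 'n" where "x = (\<chi> i. complex_of_real r powi (l $ i))"
  have tm: "norm (c \<mu> * torus_monomial x \<mu>) = cmod (c \<mu>) * wt r \<mu>" for \<mu>
  proof (cases "\<mu> \<in> M")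
    case True
    have "cmod (torus_monomial x \<mu>) = r powi d \<mu>"
      unfolding x_def torus_eq_wt [OF r] using r by (simp add: norm_power_int)
    then show ?thesis
      using d_nonneg [OF True] by (simp add: norm_mult wt_def power_int_def)
  next
    case False
    then show ?thesis
      using supp [of \<mu>] by (cases "c \<mu> = 0") auto
  qed
  have "(\<lambda>\<mu>. norm (c \<mu> * torus_monomial x \<mu>)) summable_on UNIV"
  proof (rule nonneg_bdd_above_summable_on)
    show "bdd_above (sum (\<lambda>\<mu>. norm (c \<mu> * torus_monomial x \<mu>)) ` {F. F \<subseteq> UNIV \<and> finite F})"
    proof (rule bdd_aboveI2)
      fix F :: "(int ^ 'n) set" assume F: "F \<in> {F. F \<subseteq> UNIV \<and> finite F}"
      define n where "n = nat (Max (insert 0 (d ` F)))"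
      have "\<mu> \<in> Box n" if "\<mu> \<in> F" "c \<mu> \<noteq> 0" for \<mu>
      proof -
        have "d \<mu> \<le> Max (insert 0 (d ` F))"
          using F that by (intro Max_ge) auto
        then show ?thesis
          using supp [of \<mu>] that by (auto simp: Box_def n_def)
      qed
      then have sub: "{\<mu> \<in> F. c \<mu> \<noteq> 0} \<subseteq> Box n"
        by auto
      have "(\<Sum>\<mu>\<in>F. norm (c \<mu> * torus_monomial x \<mu>)) = (\<Sum>\<mu>\<in>{\<mu> \<in> F. c \<mu> \<noteq> 0}. norm (c \<mu> * torus_monomial x \<mu>))"
        by (rule sum.mono_neutral_right) (use F in auto)
      also have "\<dots> \<le> nrm r n c"
        unfolding nrm_def tm using r by (intro sum_mono2 sub) (auto simp: wt_nonneg)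
      also have "\<dots> \<le> K"
        by (rule K)
      finally show "(\<Sum>\<mu>\<in>F. norm (c \<mu> * torus_monomial x \<mu>)) \<le> K" .
    qed
  qed simp
  moreover have "\<forall>i. x $ i \<noteq> 0"
    using r by (simp add: x_def)
  ultimately show "analytic_series c"
    unfolding analytic_series_def by blast
qed

lemma analytic_element_iff:
  "T \<in> auts (M - {0}) \<Longrightarrow> analytic_element T \<longleftrightarrow> (\<forall>\<gamma>. \<exists>r>0. \<exists>K. \<forall>n. nrm r n (T \<gamma>) \<le> K)"
  unfolding analytic_element_def
  using analytic_series_iff M_opD [OF auts_M_op [of T "M - {0}"]] by (metis Diff_subset)

section \<open>Bounds uniform in the exponent\<close>

definition unit_vecs :: "(int ^ 'n) set" where
  "unit_vecs = {axis i s | i s. \<bar>s\<bar> = 1}"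

lemma finite_unit_vecs: "finite unit_vecs"
proof -
  have "{s::int. \<bar>s\<bar> = 1} \<subseteq> {-1..1}"
    by auto
  then have "finite {s::int. \<bar>s\<bar> = 1}"
    by (rule finite_subset) simp
  then have "finite ((\<lambda>(i, s). axis i s :: int ^ 'n) ` (UNIV \<times> {s. \<bar>s\<bar> = 1}))"
    by (intro finite_imageI finite_cartesian_product) auto
  moreover have "unit_vecs \<subseteq> (\<lambda>(i, s). axis i s) ` (UNIV \<times> {s. \<bar>s\<bar> = 1})"
    by (auto simp: unit_vecs_def)
  ultimately show ?thesis
    by (rule rev_finite_subset)
qed

lemma axis_in_unit_vecs [simp]: "axis i 1 \<in> unit_vecs"
  unfolding unit_vecs_def by (intro CollectI exI conjI, rule refl) simp

lemma l1_axis [simp]: "l1 (axis i s) = \<bar>s\<bar>"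
proof -
  have "l1 (axis i s) = (\<Sum>j\<in>UNIV. if j = i then \<bar>s\<bar> else 0)"
    unfolding l1_def by (rule sum.cong) (auto simp: axis_def)
  then show ?thesis
    by simp
qed

lemma l1_unit_vecs: "\<gamma> \<in> unit_vecs \<Longrightarrow> l1 \<gamma> = 1"
  by (auto simp: unit_vecs_def)

lemma unit_vec_decomp:
  assumes "\<delta> \<noteq> 0"
  shows "\<exists>e\<in>unit_vecs. l1 (\<delta> - e) = l1 \<delta> - 1"
proof -
  obtain i where i: "\<delta> $ i \<noteq> 0"
    using assms by (auto simp: vec_eq_iff)
  define e :: "int ^ 'n" where "e = axis i (sgn (\<delta> $ i))"
  have "e \<in> unit_vecs"
    unfolding unit_vecs_def e_def by (intro CollectI exI conjI, rule refl) (use i in \<open>simp add: abs_sgn_eq\<close>)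
  moreover have "l1 (\<delta> - e) = l1 \<delta> - 1"
  proof -
    have "l1 (\<delta> - e) = (\<Sum>j\<in>UNIV. \<bar>\<delta> $ j\<bar> - (if j = i then 1 else 0))"
      unfolding l1_def by (rule sum.cong) (use i in \<open>auto simp: e_def axis_def sgn_if\<close>)
    then show ?thesis
      by (simp add: sum_subtractf l1_def)
  qed
  ultimately show ?thesis
    by blast
qed

text \<open>By multiplicativity \<open>T \<delta>\<close> is a convolution of
  \<open>l1 \<delta>\<close> factors \<open>T e\<close> with \<open>e\<close> a signed unit
  vector.\<close>

lemma nrm_power_bound:
  assumes T: "T \<in> auts (M - {0})" and r: "0 \<le> r" and B: "0 \<le> B"
    and unit: "\<And>e. e \<in> unit_vecs \<Longrightarrow> nrm r n (T e) \<le> B"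
  shows "nrm r n (T \<delta>) \<le> B ^ nat (l1 \<delta>)"
proof (induction "nat (l1 \<delta>)" arbitrary: \<delta>)
  case 0
  then have "\<delta> = 0"
    using l1_nonneg [of \<delta>] l1_eq_0 [of \<delta>] by linarith
  moreover have "nrm r n (op_id 0) = 1"
  proof -
    have "nrm r n (op_id 0) = (\<Sum>\<mu>\<in>Box n. if \<mu> = 0 then 1 else 0)"
      unfolding nrm_def by (rule sum.cong) (auto simp: op_id_def)
    then show ?thesis
      by simp
  qed
  ultimately show ?case
    using auts_zero [OF T] by simp
next
  case (Suc k)
  then have "\<delta> \<noteq> 0"
    by auto
  then obtain e where e: "e \<in> unit_vecs" "l1 (\<delta> - e) = l1 \<delta> - 1"
    using unit_vec_decomp by blast
  have k: "k = nat (l1 (\<delta> - e))"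
    using Suc.hyps(2) e by simp
  have "T \<delta> = (\<lambda>\<rho>. \<Sum>\<mu>\<in>D \<rho>. T (\<delta> - e) \<mu> * T e (\<rho> - \<mu>))"
  proof
    fix \<rho>
    have "multiplicative T"
      using T by (simp add: auts_def)
    then have "T (\<delta> - e + e) \<rho> = (\<Sum>\<mu>\<in>D \<rho>. T (\<delta> - e) \<mu> * T e (\<rho> - \<mu>))"
      using multiplicative_iff [OF auts_M_op [OF T]] by blast
    then show "T \<delta> \<rho> = (\<Sum>\<mu>\<in>D \<rho>. T (\<delta> - e) \<mu> * T e (\<rho> - \<mu>))"
      by (simp only: diff_add_cancel)
  qed
  then have "nrm r n (T \<delta>) \<le> nrm r n (T (\<delta> - e)) * nrm r n (T e)"
    using nrm_conv [OF r, of n "T (\<delta> - e)" "T e"] by (rule ssubst [where P = "\<lambda>f. nrm r n f \<le> _"])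
  also have "\<dots> \<le> B ^ k * B"
    using Suc.hyps(1) [OF k] k unit [OF e(1)] B
    by (intro mult_mono) (auto simp: nrm_def intro!: sum_nonneg mult_nonneg_nonneg wt_nonneg r)
  finally show ?case
    unfolding Suc.hyps(2) [symmetric] by (simp add: mult.commute)
qed

text \<open>Analyticity allows a different radius for each \<gamma>. Since finitely many signed unit
  vectors generate the lattice, one radius suffices, and the bound grows only exponentially in
  \<open>l1 \<delta>\<close>.\<close>

lemma analytic_uniform:
  assumes T: "T \<in> auts (M - {0})" and an: "analytic_element T"
  shows "\<exists>r>0. \<exists>B\<ge>1. \<forall>\<delta> n. nrm r n (T \<delta>) \<le> B ^ nat (l1 \<delta>)"
proof -
  have "\<forall>\<gamma>. \<exists>r K. 0 < r \<and> (\<forall>n. nrm r n (T \<gamma>) \<le> K)"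
    using an analytic_element_iff [OF T] by blast
  then obtain \<rho> K where \<rho>: "\<And>\<gamma>. 0 < \<rho> \<gamma>" and K: "\<And>\<gamma> n. nrm (\<rho> \<gamma>) n (T \<gamma>) \<le> K \<gamma>"
    by metis
  define r where "r = Min (insert 1 (\<rho> ` unit_vecs))"
  define B where "B = Max (insert 1 (K ` unit_vecs))"
  have r: "0 < r" "\<And>e. e \<in> unit_vecs \<Longrightarrow> r \<le> \<rho> e"
    unfolding r_def using \<rho> by (auto simp: finite_unit_vecs intro!: Min_le)
  have B: "1 \<le> B" "\<And>e. e \<in> unit_vecs \<Longrightarrow> K e \<le> B"
    unfolding B_def by (auto simp: finite_unit_vecs intro!: Max_ge)
  have "nrm r n (T e) \<le> B" if "e \<in> unit_vecs" for e n
    using nrm_mono_r [of r "\<rho> e" n "T e"] r B K [of e n] that by (meson less_imp_le order_trans)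
  then have "nrm r n (T \<delta>) \<le> B ^ nat (l1 \<delta>)" for \<delta> n
    using r B by (intro nrm_power_bound [OF T]) auto
  then show ?thesis
    using r B by blast
qed

lemma analytic_comp_graded:
  assumes S: "S \<in> auts (M - {0})" "analytic_element S" and T: "T \<in> auts (M - {0})" "analytic_element T"
  shows "analytic_element (op_comp S T)"
proof -
  have op: "M_op S" "M_op T"
    using S T auts_M_op by blast+
  obtain r1 B1 where 1: "0 < r1" "1 \<le> B1" "\<And>\<delta> n. nrm r1 n (S \<delta>) \<le> B1 ^ nat (l1 \<delta>)"
    using analytic_uniform [OF S] by blast
  obtain r2 B2 where 2: "0 < r2" "1 \<le> B2" "\<And>\<delta> n. nrm r2 n (T \<delta>) \<le> B2 ^ nat (l1 \<delta>)"
    using analytic_uniform [OF T] by blast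
  \<comment> \<open>The bound for \<open>S (\<gamma> + \<mu>)\<close> contains
    \<open>B1 ^ nat (d \<mu>)\<close>, which is absorbed into the weight of \<open>T\<close> by
    requiring \<open>r * B1 \<le> r2\<close>.\<close>
  define r where "r = min r1 (r2 / B1)"
  have r: "0 < r" "r \<le> r1" "r * B1 \<le> r2"
    using 1 2 by (auto simp: r_def min_def field_simps)
  have "nrm r n (op_comp S T \<gamma>) \<le> B1 ^ nat (l1 \<gamma>) * B2 ^ nat (l1 \<gamma>)" for \<gamma> n
  proof -
    have "nrm r n (op_comp S T \<gamma>) \<le> (\<Sum>\<rho>\<in>Box n. \<Sum>\<mu>\<in>D \<rho>. (cmod (T \<gamma> \<mu>) * wt r \<mu>) * (cmod (S (\<gamma> + \<mu>) (\<rho> - \<mu>)) * wt r (\<rho> - \<mu>)))"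
      unfolding nrm_def op_comp_eq [OF op]
    proof (rule sum_mono)
      fix \<rho>
      have "cmod (\<Sum>\<mu>\<in>D \<rho>. T \<gamma> \<mu> * S (\<gamma> + \<mu>) (\<rho> - \<mu>)) * wt r \<rho>
          \<le> (\<Sum>\<mu>\<in>D \<rho>. cmod (T \<gamma> \<mu> * S (\<gamma> + \<mu>) (\<rho> - \<mu>))) * wt r \<rho>"
        using r by (intro mult_right_mono norm_sum wt_nonneg) auto
      also have "\<dots> = (\<Sum>\<mu>\<in>D \<rho>. (cmod (T \<gamma> \<mu>) * wt r \<mu>) * (cmod (S (\<gamma> + \<mu>) (\<rho> - \<mu>)) * wt r (\<rho> - \<mu>)))"
        unfolding sum_distrib_right
      proof (rule sum.cong [OF refl])
        fix \<mu> assume "\<mu> \<in> D \<rho>"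
        then have "wt r \<rho> = wt r \<mu> * wt r (\<rho> - \<mu>)"
          using wt_add [of \<mu> "\<rho> - \<mu>" r] by (simp add: D_def)
        then show "cmod (T \<gamma> \<mu> * S (\<gamma> + \<mu>) (\<rho> - \<mu>)) * wt r \<rho>
            = (cmod (T \<gamma> \<mu>) * wt r \<mu>) * (cmod (S (\<gamma> + \<mu>) (\<rho> - \<mu>)) * wt r (\<rho> - \<mu>))"
          by (simp add: norm_mult)
      qed
      finally show "cmod (\<Sum>\<mu>\<in>D \<rho>. T \<gamma> \<mu> * S (\<gamma> + \<mu>) (\<rho> - \<mu>)) * wt r \<rho>
          \<le> (\<Sum>\<mu>\<in>D \<rho>. (cmod (T \<gamma> \<mu>) * wt r \<mu>) * (cmod (S (\<gamma> + \<mu>) (\<rho> - \<mu>)) * wt r (\<rho> - \<mu>)))" .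
    qed
    also have "\<dots> \<le> (\<Sum>\<mu>\<in>Box n. \<Sum>\<nu>\<in>Box n. (cmod (T \<gamma> \<mu>) * wt r \<mu>) * (cmod (S (\<gamma> + \<mu>) \<nu>) * wt r \<nu>))"
      by (rule conv_sum_le [where F = "\<lambda>\<mu> \<nu>. (cmod (T \<gamma> \<mu>) * wt r \<mu>) * (cmod (S (\<gamma> + \<mu>) \<nu>) * wt r \<nu>)"])
         (use d_nonneg r in \<open>force simp: wt_nonneg Box_def finite_box\<close>)+
    also have "\<dots> = (\<Sum>\<mu>\<in>Box n. cmod (T \<gamma> \<mu>) * wt r \<mu> * nrm r n (S (\<gamma> + \<mu>)))"
      by (simp add: nrm_def sum_distrib_left)
    also have "\<dots> \<le> (\<Sum>\<mu>\<in>Box n. cmod (T \<gamma> \<mu>) * wt r \<mu> * (B1 ^ nat (l1 \<gamma>) * B1 ^ nat (d \<mu>)))"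
    proof (intro sum_mono mult_left_mono)
      fix \<mu> assume \<mu>: "\<mu> \<in> Box n"
      have "nat (l1 (\<gamma> + \<mu>)) \<le> nat (l1 \<gamma>) + nat (d \<mu>)"
        using l1_add [of \<gamma> \<mu>] l1_nonneg [of \<gamma>] l1_nonneg [of \<mu>] \<mu> unfolding Box_def M_def mem_Collect_eq by linarith
      then have "B1 ^ nat (l1 (\<gamma> + \<mu>)) \<le> B1 ^ (nat (l1 \<gamma>) + nat (d \<mu>))"
        by (rule power_increasing) (use 1 in auto)
      then show "nrm r n (S (\<gamma> + \<mu>)) \<le> B1 ^ nat (l1 \<gamma>) * B1 ^ nat (d \<mu>)"
        using nrm_mono_r [of r r1 n "S (\<gamma> + \<mu>)"] r 1(3) [of n "\<gamma> + \<mu>"] by (simp add: power_add)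
    qed (use r in \<open>auto simp: wt_nonneg\<close>)
    also have "\<dots> = B1 ^ nat (l1 \<gamma>) * nrm (r * B1) n (T \<gamma>)"
      by (simp add: nrm_def wt_def power_mult_distrib sum_distrib_left mult_ac)
    also have "\<dots> \<le> B1 ^ nat (l1 \<gamma>) * B2 ^ nat (l1 \<gamma>)"
      using nrm_mono_r [of "r * B1" r2 n "T \<gamma>"] r 1 2(3) [of n \<gamma>] by (intro mult_left_mono) auto
    finally show ?thesis .
  qed
  moreover have "op_comp S T \<in> auts (M - {0})"
    using S T graded_M0 by (intro auts_comp_graded) (auto simp: graded_def)
  ultimately show ?thesis
    using r analytic_element_iff by blast
qed

end

subsection \<open>Analyticity of factors\<close>

context grading
begin

text \<open>With \<open>E\<close> the degree derivation, \<open>\<xi> = [E, T] T\<^sup>-\<^sup>1\<close> is the derivative at \<open>s = 1\<close> of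
  \<open>T\<^sub>s T\<^sup>-\<^sup>1\<close>, where \<open>T\<^sub>s\<close> is the conjugate of \<open>T\<close> by the rescaling of the torus.\<close>

lemma degree_derivative_exists:
  assumes A: "graded A" and T: "T \<in> auts A"
  shows "\<exists>\<xi>\<in>lie_on A. \<forall>\<gamma> \<rho>. of_int (d \<rho>) * T \<gamma> \<rho> = (\<Sum>\<mu>\<in>D \<rho>. T \<gamma> \<mu> * vf_op \<xi> (\<gamma> + \<mu>) (\<rho> - \<mu>))"
proof -
  have "tame A"
    using A tame_graded by blast
  then obtain S where S: "S \<in> auts A" and ST: "op_comp S T = op_id" "op_comp T S = op_id"
    using auts_inverse_exists T by blast
  have closed: "add_closed A"
    using A by (simp add: graded_def)
  note AM = graded_M [OF A]
  have opS: "M_op S" and opT: "M_op T" and T0: "\<And>\<gamma>. T \<gamma> 0 = 1" and S0: "\<And>\<gamma>. S \<gamma> 0 = 1"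
    using S T auts_M_op [OF _ AM] by (auto simp: auts_def)
  \<comment> \<open>The commutator of the degree derivation with \<open>T\<close>: the degrees of
    \<open>x^(\<gamma> + \<rho>)\<close> and \<open>x^\<gamma>\<close> differ by
    \<open>d \<rho>\<close>.\<close>
  define L where "L \<gamma> \<rho> = of_int (d \<rho>) * T \<gamma> \<rho>" for \<gamma> \<rho>
  have L: "op_on A L"
    using T by (auto simp: auts_def op_on_def L_def)
  have opL: "M_op L"
    by (rule op_on_mono [OF L AM])
  define X where "X = op_comp L S"
  have "op_on A X"
    unfolding X_def using S by (intro op_on_comp closed L) (simp add: auts_def)
  moreover have "X \<gamma> 0 = 0" for \<gamma>
    unfolding X_def by (simp add: op_comp_0 [OF opL opS]) (simp add: L_def)
  ultimately have XA: "X \<gamma> \<mu> \<noteq> 0 \<Longrightarrow> \<mu> \<in> A" for \<gamma> \<mu>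
    unfolding op_on_def by (metis insert_iff)
  have opX: "M_op X"
    using XA AM by (auto simp: op_on_def)
  have X_eq: "X \<gamma> \<rho> = (\<Sum>\<mu>\<in>D \<rho>. S \<gamma> \<mu> * L (\<gamma> + \<mu>) (\<rho> - \<mu>))" for \<gamma> \<rho>
    unfolding X_def by (rule op_comp_eq [OF opL opS])
  define Ts where "Ts s \<gamma> \<mu> = s ^ nat (d \<mu>) * T \<gamma> \<mu>" for s :: complex and \<gamma> \<mu>
  have Ts: "Ts s \<in> auts A" for s
  proof -
    have op: "op_on A (Ts s)"
      using T by (auto simp: auts_def op_on_def Ts_def)
    have "Ts s (\<gamma> + \<delta>) \<rho> = (\<Sum>\<mu>\<in>D \<rho>. Ts s \<gamma> \<mu> * Ts s \<delta> (\<rho> - \<mu>))" for \<gamma> \<delta> \<rho>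
    proof -
      have "Ts s (\<gamma> + \<delta>) \<rho> = (\<Sum>\<mu>\<in>D \<rho>. s ^ nat (d \<rho>) * (T \<gamma> \<mu> * T \<delta> (\<rho> - \<mu>)))"
        using T multiplicative_iff [OF opT] by (simp add: Ts_def auts_def sum_distrib_left)
      also have "\<dots> = (\<Sum>\<mu>\<in>D \<rho>. Ts s \<gamma> \<mu> * Ts s \<delta> (\<rho> - \<mu>))"
      proof (rule sum.cong [OF refl])
        fix \<mu> assume "\<mu> \<in> D \<rho>"
        then have "nat (d \<rho>) = nat (d \<mu>) + nat (d (\<rho> - \<mu>))"
          using d_nonneg [of \<mu>] d_nonneg [of "\<rho> - \<mu>"] by (simp add: D_def deg_diff flip: nat_add_distrib)
        then show "s ^ nat (d \<rho>) * (T \<gamma> \<mu> * T \<delta> (\<rho> - \<mu>)) = Ts s \<gamma> \<mu> * Ts s \<delta> (\<rho> - \<mu>)"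
          by (simp add: Ts_def power_add)
      qed
      finally show ?thesis .
    qed
    then show ?thesis
      using op op_on_mono [OF op AM] by (simp add: auts_def multiplicative_iff T0) (simp add: Ts_def T0)
  qed
  define U where "U s = op_comp (Ts s) S" for s
  have U: "U s \<in> auts A" for s
    unfolding U_def by (rule auts_comp_graded [OF Ts S AM closed])
  have U1: "U 1 = op_id"
  proof -
    have "Ts 1 = T"
      by (simp add: Ts_def fun_eq_iff)
    then show ?thesis
      by (simp add: U_def ST)
  qed
  have dU: "((\<lambda>s. U s \<gamma> \<rho>) has_field_derivative X \<gamma> \<rho>) (at 1)" for \<gamma> \<rho>
  proof -
    have "U s \<gamma> \<rho> = (\<Sum>\<mu>\<in>D \<rho>. S \<gamma> \<mu> * (s ^ nat (d (\<rho> - \<mu>)) * T (\<gamma> + \<mu>) (\<rho> - \<mu>)))" for s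
      unfolding U_def op_comp_eq [OF auts_M_op [OF Ts AM] opS] by (simp add: Ts_def)
    moreover have "((\<lambda>s. \<Sum>\<mu>\<in>D \<rho>. S \<gamma> \<mu> * (s ^ nat (d (\<rho> - \<mu>)) * T (\<gamma> + \<mu>) (\<rho> - \<mu>)))
        has_field_derivative (\<Sum>\<mu>\<in>D \<rho>. S \<gamma> \<mu> * (of_nat (nat (d (\<rho> - \<mu>))) * T (\<gamma> + \<mu>) (\<rho> - \<mu>)))) (at 1)"
      by (rule derivative_eq_intros refl | simp add: mult_ac)+
    moreover have "(\<Sum>\<mu>\<in>D \<rho>. S \<gamma> \<mu> * (of_nat (nat (d (\<rho> - \<mu>))) * T (\<gamma> + \<mu>) (\<rho> - \<mu>))) = X \<gamma> \<rho>"
      unfolding X_eq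
    proof (rule sum.cong [OF refl])
      fix \<mu> assume "\<mu> \<in> D \<rho>"
      then have "0 \<le> d (\<rho> - \<mu>)"
        using d_nonneg by (simp add: D_def)
      then show "S \<gamma> \<mu> * (of_nat (nat (d (\<rho> - \<mu>))) * T (\<gamma> + \<mu>) (\<rho> - \<mu>)) = S \<gamma> \<mu> * L (\<gamma> + \<mu>) (\<rho> - \<mu>)"
        by (simp add: L_def)
    qed
    ultimately show ?thesis
      by simp
  qed
  \<comment> \<open>Differentiate the multiplicativity of \<open>U s\<close> at
    \<open>s = 1\<close>, where \<open>U s\<close> is the identity: the product rule leaves
    additivity in \<gamma>, so \<open>X\<close> is a vector field.\<close>
  have add: "X (\<gamma> + \<delta>) \<rho> = X \<gamma> \<rho> + X \<delta> \<rho>" for \<gamma> \<delta> \<rho>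
  proof -
    have "U s (\<gamma> + \<delta>) \<rho> = (\<Sum>\<mu>\<in>D \<rho>. U s \<gamma> \<mu> * U s \<delta> (\<rho> - \<mu>))" for s
      using U [of s] multiplicative_iff [OF auts_M_op [OF U AM]] by (auto simp: auts_def)
    moreover have "((\<lambda>s. \<Sum>\<mu>\<in>D \<rho>. U s \<gamma> \<mu> * U s \<delta> (\<rho> - \<mu>)) has_field_derivative
        (\<Sum>\<mu>\<in>D \<rho>. X \<gamma> \<mu> * U 1 \<delta> (\<rho> - \<mu>) + X \<delta> (\<rho> - \<mu>) * U 1 \<gamma> \<mu>)) (at 1)"
      by (intro DERIV_sum DERIV_mult dU)
    ultimately have "X (\<gamma> + \<delta>) \<rho> = (\<Sum>\<mu>\<in>D \<rho>. X \<gamma> \<mu> * op_id \<delta> (\<rho> - \<mu>) + X \<delta> (\<rho> - \<mu>) * op_id \<gamma> \<mu>)"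
      using dU [of "\<gamma> + \<delta>" \<rho>] by (simp add: U1 DERIV_unique)
    also have "\<dots> = (\<Sum>\<mu>\<in>D \<rho>. (if \<mu> = \<rho> then X \<gamma> \<rho> else 0) + (if \<mu> = 0 then X \<delta> \<rho> else 0))"
      by (rule sum.cong) (auto simp: op_id_def)
    also have "\<dots> = X \<gamma> \<rho> + X \<delta> \<rho>"
      using D_0I [of \<rho>] D_selfI [of \<rho>] M_op_zero [OF opX, of \<rho>] by (cases "\<rho> \<in> M") (simp_all add: sum.distrib D_notM)
    finally show ?thesis .
  qed
  define \<xi> where "\<xi> \<rho> = (\<chi> i. X (axis i 1) \<rho>)" for \<rho>
  have X\<xi>: "vf_op \<xi> = X"
  proof (intro ext)
    fix \<gamma> \<mu>
    show "vf_op \<xi> \<gamma> \<mu> = X \<gamma> \<mu>"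
      unfolding vf_op_def \<xi>_def vec_lambda_beta
      by (rule additive_int_vec [of "\<lambda>\<gamma>. X \<gamma> \<mu>", symmetric]) (rule add)
  qed
  have "\<xi> \<in> lie_on A"
    using XA by (auto simp: lie_on_def \<xi>_def vec_eq_iff)
  moreover have "op_comp X T = L"
    unfolding X_def by (simp add: op_comp_assoc opL opS opT ST op_comp_id_right)
  then have "of_int (d \<rho>) * T \<gamma> \<rho> = (\<Sum>\<mu>\<in>D \<rho>. T \<gamma> \<mu> * vf_op \<xi> (\<gamma> + \<mu>) (\<rho> - \<mu>))" for \<gamma> \<rho>
    unfolding X\<xi> op_comp_eq [OF opX opT, symmetric] by (simp add: L_def)
  ultimately show ?thesis
    by blast
qed

section \<open>Estimates for the linear equations of the degree derivation\<close>

definition vf_norm :: "'n vfield \<Rightarrow> int ^ 'n \<Rightarrow> real" where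
  "vf_norm \<xi> \<mu> = (\<Sum>i\<in>UNIV. cmod (\<xi> \<mu> $ i))"

definition vnrm :: "real \<Rightarrow> nat \<Rightarrow> 'n vfield \<Rightarrow> real" where
  "vnrm r n \<xi> = (\<Sum>\<mu>\<in>Box n. vf_norm \<xi> \<mu> * wt r \<mu>)"

text \<open>The norm of the degree derivative of \<open>f\<close>. It controls both \<open>f\<close>
  away from its constant term and one derivative of \<open>f\<close>.\<close>

definition dnrm :: "real \<Rightarrow> nat \<Rightarrow> (int ^ 'n \<Rightarrow> complex) \<Rightarrow> real" where
  "dnrm r n f = (\<Sum>\<mu>\<in>Box n. real_of_int (d \<mu>) * cmod (f \<mu>) * wt r \<mu>)"

lemma vf_norm_nonneg [simp]: "0 \<le> vf_norm \<xi> \<mu>"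
  by (simp add: vf_norm_def sum_nonneg)

lemma vf_norm_zero: "\<xi> \<mu> = 0 \<Longrightarrow> vf_norm \<xi> \<mu> = 0"
  by (simp add: vf_norm_def)

lemma vnrm_nonneg: "0 \<le> r \<Longrightarrow> 0 \<le> vnrm r n \<xi>"
  unfolding vnrm_def by (intro sum_nonneg) (simp add: wt_nonneg)

lemma dnrm_nonneg: "0 \<le> r \<Longrightarrow> 0 \<le> dnrm r n f"
  unfolding dnrm_def by (intro sum_nonneg) (auto simp: wt_nonneg Box_def d_nonneg)

lemma norm_vf_op_le: "cmod (vf_op \<xi> \<delta> \<mu>) \<le> vf_norm \<xi> \<mu> * real_of_int (l1 \<delta>)"
proof -
  have "cmod (vf_op \<xi> \<delta> \<mu>) \<le> (\<Sum>i\<in>UNIV. cmod (\<xi> \<mu> $ i) * real_of_int (l1 \<delta>))"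
    unfolding vf_op_def
  proof (rule sum_norm_le)
    fix i
    have "cmod (of_int (\<delta> $ i)) \<le> real_of_int (l1 \<delta>)"
      using abs_le_l1 [of \<delta> i] by (simp flip: of_int_abs)
    then show "cmod (\<xi> \<mu> $ i * of_int (\<delta> $ i)) \<le> cmod (\<xi> \<mu> $ i) * real_of_int (l1 \<delta>)"
      unfolding norm_mult by (rule mult_left_mono) simp
  qed
  then show ?thesis
    by (simp add: vf_norm_def sum_distrib_right)
qed

lemma l1_le_d: "\<mu> \<in> M \<Longrightarrow> l1 \<mu> \<le> d \<mu>"
  by (simp add: M_def)

lemma sum_Box_split:
  fixes F :: "int ^ 'n \<Rightarrow> real"
  shows "(\<Sum>\<mu>\<in>Box n. F \<mu>) = F 0 + (\<Sum>\<mu>\<in>Box n - {0}. F \<mu>)"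
  by (rule sum.remove) simp_all

lemma nrm_le_dnrm:
  assumes r: "0 \<le> r" and f0: "f 0 = 1"
  shows "nrm r n f \<le> 1 + dnrm r n f"
proof -
  have "(\<Sum>\<mu>\<in>Box n - {0}. cmod (f \<mu>) * wt r \<mu>) \<le> (\<Sum>\<mu>\<in>Box n - {0}. real_of_int (d \<mu>) * cmod (f \<mu>) * wt r \<mu>)"
  proof (rule sum_mono)
    fix \<mu> assume "\<mu> \<in> Box n - {0}"
    then have "1 \<le> d \<mu>"
      using d_pos by (auto simp: Box_def)
    then have "1 * (cmod (f \<mu>) * wt r \<mu>) \<le> real_of_int (d \<mu>) * (cmod (f \<mu>) * wt r \<mu>)"
      by (intro mult_right_mono) (simp_all add: wt_nonneg r)
    then show "cmod (f \<mu>) * wt r \<mu> \<le> real_of_int (d \<mu>) * cmod (f \<mu>) * wt r \<mu>"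
      by (simp add: mult.assoc)
  qed
  then show ?thesis
    unfolding nrm_def dnrm_def by (simp add: sum_Box_split f0)
qed

lemma weighted_tail_le:
  assumes r: "0 \<le> r"
  shows "(\<Sum>\<mu>\<in>Box n - {0}. cmod (f \<mu>) * wt r \<mu> * (1 + real_of_int (l1 \<mu>))) \<le> 2 * dnrm r n f"
proof -
  have "(\<Sum>\<mu>\<in>Box n - {0}. cmod (f \<mu>) * wt r \<mu> * (1 + real_of_int (l1 \<mu>)))
      \<le> (\<Sum>\<mu>\<in>Box n - {0}. 2 * (real_of_int (d \<mu>) * cmod (f \<mu>) * wt r \<mu>))"
  proof (rule sum_mono)
    fix \<mu> assume "\<mu> \<in> Box n - {0}"
    then have "1 \<le> d \<mu>" "l1 \<mu> \<le> d \<mu>"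
      using d_pos l1_le_d by (auto simp: Box_def)
    then have "1 + real_of_int (l1 \<mu>) \<le> 2 * real_of_int (d \<mu>)"
      by linarith
    then have "cmod (f \<mu>) * wt r \<mu> * (1 + real_of_int (l1 \<mu>)) \<le> cmod (f \<mu>) * wt r \<mu> * (2 * real_of_int (d \<mu>))"
      by (intro mult_left_mono) (simp_all add: wt_nonneg r)
    then show "cmod (f \<mu>) * wt r \<mu> * (1 + real_of_int (l1 \<mu>)) \<le> 2 * (real_of_int (d \<mu>) * cmod (f \<mu>) * wt r \<mu>)"
      by (simp add: mult_ac)
  qed
  also have "\<dots> \<le> 2 * dnrm r n f"
    unfolding dnrm_def by (simp add: sum_Box_split sum_distrib_left)
  finally show ?thesis .
qed

lemma wt_split: "\<mu> \<in> D \<rho> \<Longrightarrow> wt r \<rho> = wt r \<mu> * wt r (\<rho> - \<mu>)"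
  using wt_add [of \<mu> "\<rho> - \<mu>" r] by (simp add: D_def)

lemma l1_shift: "\<gamma> \<in> unit_vecs \<Longrightarrow> l1 (\<gamma> + \<mu>) \<le> 1 + l1 \<mu>"
  using l1_add [of \<gamma> \<mu>] l1_unit_vecs by simp

text \<open>Applying \<xi> to \<open>x^(\<gamma> + \<mu>)\<close> costs \<open>1 + l1 \<mu>\<close>;
  for non-zero \<mu> in \<open>M\<close> this is at most \<open>2 * d \<mu>\<close> and is contained
  in \<open>dnrm\<close>. Since \<xi> has no component at 0, the right-hand side needs
  \<open>T \<gamma>\<close> only up to degree \<open>n\<close>.\<close>

lemma flow_bound:
  assumes r: "0 \<le> r" and \<gamma>: "\<gamma> \<in> unit_vecs" and T0: "T \<gamma> 0 = 1" and \<xi>0: "\<xi> 0 = 0"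
    and eq: "\<And>\<rho>. of_int (d \<rho>) * T \<gamma> \<rho> = (\<Sum>\<mu>\<in>D \<rho>. T \<gamma> \<mu> * vf_op \<xi> (\<gamma> + \<mu>) (\<rho> - \<mu>))"
  shows "dnrm r (Suc n) (T \<gamma>) \<le> vnrm r (Suc n) \<xi> * (1 + 2 * dnrm r n (T \<gamma>))"
proof -
  define F where "F \<mu> \<nu> = (cmod (T \<gamma> \<mu>) * wt r \<mu> * (1 + real_of_int (l1 \<mu>))) * (vf_norm \<xi> \<nu> * wt r \<nu>)" for \<mu> \<nu>
  have "dnrm r (Suc n) (T \<gamma>) \<le> (\<Sum>\<rho>\<in>Box (Suc n). \<Sum>\<mu>\<in>D \<rho>. F \<mu> (\<rho> - \<mu>))"
    unfolding dnrm_def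
  proof (rule sum_mono)
    fix \<rho> assume "\<rho> \<in> Box (Suc n)"
    then have "real_of_int (d \<rho>) * cmod (T \<gamma> \<rho>) = cmod (of_int (d \<rho>) * T \<gamma> \<rho>)"
      using d_nonneg [of \<rho>] by (simp add: norm_mult Box_def)
    also have "\<dots> \<le> (\<Sum>\<mu>\<in>D \<rho>. cmod (T \<gamma> \<mu>) * ((1 + real_of_int (l1 \<mu>)) * vf_norm \<xi> (\<rho> - \<mu>)))"
      unfolding eq
    proof (rule sum_norm_le)
      fix \<mu>
      have "cmod (vf_op \<xi> (\<gamma> + \<mu>) (\<rho> - \<mu>)) \<le> vf_norm \<xi> (\<rho> - \<mu>) * real_of_int (l1 (\<gamma> + \<mu>))"
        by (rule norm_vf_op_le)
      also have "\<dots> \<le> vf_norm \<xi> (\<rho> - \<mu>) * (1 + real_of_int (l1 \<mu>))"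
        using l1_shift [OF \<gamma>, of \<mu>] by (intro mult_left_mono) simp_all
      finally show "cmod (T \<gamma> \<mu> * vf_op \<xi> (\<gamma> + \<mu>) (\<rho> - \<mu>))
          \<le> cmod (T \<gamma> \<mu>) * ((1 + real_of_int (l1 \<mu>)) * vf_norm \<xi> (\<rho> - \<mu>))"
        unfolding norm_mult by (intro mult_left_mono) (simp_all add: mult.commute)
    qed
    finally have "real_of_int (d \<rho>) * cmod (T \<gamma> \<rho>) * wt r \<rho>
        \<le> (\<Sum>\<mu>\<in>D \<rho>. cmod (T \<gamma> \<mu>) * ((1 + real_of_int (l1 \<mu>)) * vf_norm \<xi> (\<rho> - \<mu>))) * wt r \<rho>"
      by (rule mult_right_mono) (simp add: wt_nonneg r)
    also have "\<dots> = (\<Sum>\<mu>\<in>D \<rho>. F \<mu> (\<rho> - \<mu>))"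
      unfolding sum_distrib_right
      by (intro sum.cong refl) (subst wt_split, assumption, simp add: F_def mult_ac)
    finally show "real_of_int (d \<rho>) * cmod (T \<gamma> \<rho>) * wt r \<rho> \<le> (\<Sum>\<mu>\<in>D \<rho>. F \<mu> (\<rho> - \<mu>))" .
  qed
  also have "\<dots> \<le> (\<Sum>\<mu>\<in>Box n. \<Sum>\<nu>\<in>Box (Suc n). F \<mu> \<nu>)"
  proof (rule conv_sum_le)
    fix \<mu> \<nu>
    show "0 \<le> F \<mu> \<nu>"
      using r l1_nonneg [of \<mu>] by (simp add: F_def wt_nonneg)
    assume \<mu>\<nu>: "\<mu> \<in> M" "\<nu> \<in> M" "d \<mu> + d \<nu> \<le> int (Suc n)" "F \<mu> \<nu> \<noteq> 0"
    then have "\<nu> \<noteq> 0"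
      by (auto simp: F_def vf_norm_zero \<xi>0)
    then show "\<mu> \<in> Box n \<and> \<nu> \<in> Box (Suc n)"
      using \<mu>\<nu> d_pos [of \<nu>] d_nonneg [of \<mu>] by (simp add: Box_def)
  qed simp_all
  also have "\<dots> = vnrm r (Suc n) \<xi> * (\<Sum>\<mu>\<in>Box n. cmod (T \<gamma> \<mu>) * wt r \<mu> * (1 + real_of_int (l1 \<mu>)))"
    unfolding F_def vnrm_def sum_product [symmetric] by (rule mult.commute)
  also have "\<dots> \<le> vnrm r (Suc n) \<xi> * (1 + 2 * dnrm r n (T \<gamma>))"
    using weighted_tail_le [OF r, where n = n and f = "T \<gamma>"] vnrm_nonneg [OF r]
    by (intro mult_left_mono) (simp_all add: sum_Box_split T0)
  finally show ?thesis .
qed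

text \<open>The equation is solved for its term at \<mu> = 0, which is
  \<open>vf_op Y \<gamma> \<rho>\<close>. The other terms have non-zero \<mu> and so involve
  \<open>Y\<close> only up to degree \<open>n\<close>. Likewise the factor \<open>d \<mu>\<close>
  removes \<mu> = 0 on the right, so \<open>c\<close> is needed only up to degree
  \<open>n\<close>.\<close>

lemma source_bound:
  assumes r: "0 \<le> r" and B: "0 \<le> B" and \<gamma>: "\<gamma> \<in> unit_vecs"
    and c: "\<And>\<delta>. nrm r n (c \<delta>) \<le> B ^ nat (l1 \<delta>)" and B1: "1 \<le> B"
    and b0: "b \<gamma> 0 = 1" and Y0: "Y 0 = 0"
    and eq: "\<And>\<rho>. (\<Sum>\<mu>\<in>D \<rho>. b \<gamma> \<mu> * vf_op Y (\<gamma> + \<mu>) (\<rho> - \<mu>))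
      = (\<Sum>\<mu>\<in>D \<rho>. of_int (d \<mu>) * g \<gamma> \<mu> * c (\<gamma> + \<mu>) (\<rho> - \<mu>))"
  shows "(\<Sum>\<rho>\<in>Box (Suc n). cmod (vf_op Y \<gamma> \<rho>) * wt r \<rho>)
    \<le> (\<Sum>\<mu>\<in>Box (Suc n). real_of_int (d \<mu>) * cmod (g \<gamma> \<mu>) * wt r \<mu> * B ^ Suc (nat (d \<mu>)))
      + 2 * dnrm r n (b \<gamma>) * vnrm r n Y"
proof -
  define F where "F \<mu> \<nu> = (real_of_int (d \<mu>) * cmod (g \<gamma> \<mu>) * wt r \<mu>) * (cmod (c (\<gamma> + \<mu>) \<nu>) * wt r \<nu>)" for \<mu> \<nu>
  define G where "G \<mu> \<nu> = (if \<mu> = 0 then 0 else cmod (b \<gamma> \<mu>) * wt r \<mu> * (1 + real_of_int (l1 \<mu>)))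
      * (vf_norm Y \<nu> * wt r \<nu>)" for \<mu> \<nu>
  define F' where "F' \<mu> \<nu> = (if \<mu> \<in> M then F \<mu> \<nu> else 0)" for \<mu> \<nu>
  have "(\<Sum>\<rho>\<in>Box (Suc n). cmod (vf_op Y \<gamma> \<rho>) * wt r \<rho>)
      \<le> (\<Sum>\<rho>\<in>Box (Suc n). (\<Sum>\<mu>\<in>D \<rho>. F' \<mu> (\<rho> - \<mu>)) + (\<Sum>\<mu>\<in>D \<rho>. G \<mu> (\<rho> - \<mu>)))"
  proof (rule sum_mono)
    fix \<rho> assume "\<rho> \<in> Box (Suc n)"
    then have \<rho>: "\<rho> \<in> M"
      by (simp add: Box_def)
    have "(\<Sum>\<mu>\<in>D \<rho>. b \<gamma> \<mu> * vf_op Y (\<gamma> + \<mu>) (\<rho> - \<mu>))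
        = vf_op Y \<gamma> \<rho> + (\<Sum>\<mu>\<in>D \<rho> - {0}. b \<gamma> \<mu> * vf_op Y (\<gamma> + \<mu>) (\<rho> - \<mu>))"
      using \<rho> b0 by (simp add: sum.remove [of "D \<rho>" 0] D_0I)
    then have "vf_op Y \<gamma> \<rho> = (\<Sum>\<mu>\<in>D \<rho>. of_int (d \<mu>) * g \<gamma> \<mu> * c (\<gamma> + \<mu>) (\<rho> - \<mu>))
        - (\<Sum>\<mu>\<in>D \<rho> - {0}. b \<gamma> \<mu> * vf_op Y (\<gamma> + \<mu>) (\<rho> - \<mu>))"
      by (simp add: eq)
    then have "cmod (vf_op Y \<gamma> \<rho>) \<le> cmod (\<Sum>\<mu>\<in>D \<rho>. of_int (d \<mu>) * g \<gamma> \<mu> * c (\<gamma> + \<mu>) (\<rho> - \<mu>))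
        + cmod (\<Sum>\<mu>\<in>D \<rho> - {0}. b \<gamma> \<mu> * vf_op Y (\<gamma> + \<mu>) (\<rho> - \<mu>))"
      by (simp add: norm_triangle_ineq4)
    also have "\<dots> \<le> (\<Sum>\<mu>\<in>D \<rho>. real_of_int (d \<mu>) * cmod (g \<gamma> \<mu>) * cmod (c (\<gamma> + \<mu>) (\<rho> - \<mu>)))
        + (\<Sum>\<mu>\<in>D \<rho> - {0}. cmod (b \<gamma> \<mu>) * ((1 + real_of_int (l1 \<mu>)) * vf_norm Y (\<rho> - \<mu>)))"
    proof (rule add_mono; rule sum_norm_le)
      fix \<mu> assume "\<mu> \<in> D \<rho>"
      then show "cmod (of_int (d \<mu>) * g \<gamma> \<mu> * c (\<gamma> + \<mu>) (\<rho> - \<mu>))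
          \<le> real_of_int (d \<mu>) * cmod (g \<gamma> \<mu>) * cmod (c (\<gamma> + \<mu>) (\<rho> - \<mu>))"
        using d_nonneg [of \<mu>] by (simp add: norm_mult D_def)
    next
      fix \<mu>
      have "cmod (vf_op Y (\<gamma> + \<mu>) (\<rho> - \<mu>)) \<le> vf_norm Y (\<rho> - \<mu>) * real_of_int (l1 (\<gamma> + \<mu>))"
        by (rule norm_vf_op_le)
      also have "\<dots> \<le> vf_norm Y (\<rho> - \<mu>) * (1 + real_of_int (l1 \<mu>))"
        using l1_shift [OF \<gamma>, of \<mu>] by (intro mult_left_mono) simp_all
      finally show "cmod (b \<gamma> \<mu> * vf_op Y (\<gamma> + \<mu>) (\<rho> - \<mu>))
          \<le> cmod (b \<gamma> \<mu>) * ((1 + real_of_int (l1 \<mu>)) * vf_norm Y (\<rho> - \<mu>))"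
        unfolding norm_mult by (intro mult_left_mono) (simp_all add: mult.commute)
    qed
    finally have "cmod (vf_op Y \<gamma> \<rho>) * wt r \<rho>
        \<le> ((\<Sum>\<mu>\<in>D \<rho>. real_of_int (d \<mu>) * cmod (g \<gamma> \<mu>) * cmod (c (\<gamma> + \<mu>) (\<rho> - \<mu>)))
        + (\<Sum>\<mu>\<in>D \<rho> - {0}. cmod (b \<gamma> \<mu>) * ((1 + real_of_int (l1 \<mu>)) * vf_norm Y (\<rho> - \<mu>)))) * wt r \<rho>"
      by (rule mult_right_mono) (simp add: wt_nonneg r)
    also have "\<dots> = (\<Sum>\<mu>\<in>D \<rho>. real_of_int (d \<mu>) * cmod (g \<gamma> \<mu>) * cmod (c (\<gamma> + \<mu>) (\<rho> - \<mu>)) * wt r \<rho>)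
        + (\<Sum>\<mu>\<in>D \<rho> - {0}. cmod (b \<gamma> \<mu>) * ((1 + real_of_int (l1 \<mu>)) * vf_norm Y (\<rho> - \<mu>)) * wt r \<rho>)"
      by (simp add: distrib_right sum_distrib_right)
    also have "(\<Sum>\<mu>\<in>D \<rho>. real_of_int (d \<mu>) * cmod (g \<gamma> \<mu>) * cmod (c (\<gamma> + \<mu>) (\<rho> - \<mu>)) * wt r \<rho>)
        = (\<Sum>\<mu>\<in>D \<rho>. F' \<mu> (\<rho> - \<mu>))"
    proof (rule sum.cong [OF refl])
      fix \<mu> assume "\<mu> \<in> D \<rho>"
      then show "real_of_int (d \<mu>) * cmod (g \<gamma> \<mu>) * cmod (c (\<gamma> + \<mu>) (\<rho> - \<mu>)) * wt r \<rho> = F' \<mu> (\<rho> - \<mu>)"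
        using wt_split [of \<mu> \<rho> r] by (simp add: F'_def F_def D_def mult_ac)
    qed
    also have "(\<Sum>\<mu>\<in>D \<rho> - {0}. cmod (b \<gamma> \<mu>) * ((1 + real_of_int (l1 \<mu>)) * vf_norm Y (\<rho> - \<mu>)) * wt r \<rho>)
        = (\<Sum>\<mu>\<in>D \<rho> - {0}. G \<mu> (\<rho> - \<mu>))"
    proof (rule sum.cong [OF refl])
      fix \<mu> assume "\<mu> \<in> D \<rho> - {0}"
      then show "cmod (b \<gamma> \<mu>) * ((1 + real_of_int (l1 \<mu>)) * vf_norm Y (\<rho> - \<mu>)) * wt r \<rho> = G \<mu> (\<rho> - \<mu>)"
        using wt_split [of \<mu> \<rho> r] by (simp add: G_def mult_ac)
    qed
    also have "(\<Sum>\<mu>\<in>D \<rho> - {0}. G \<mu> (\<rho> - \<mu>)) = (\<Sum>\<mu>\<in>D \<rho>. G \<mu> (\<rho> - \<mu>))"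
      by (rule sum.mono_neutral_left) (auto simp: G_def)
    finally show "cmod (vf_op Y \<gamma> \<rho>) * wt r \<rho> \<le> (\<Sum>\<mu>\<in>D \<rho>. F' \<mu> (\<rho> - \<mu>)) + (\<Sum>\<mu>\<in>D \<rho>. G \<mu> (\<rho> - \<mu>))" .
  qed
  also have "\<dots> = (\<Sum>\<rho>\<in>Box (Suc n). \<Sum>\<mu>\<in>D \<rho>. F' \<mu> (\<rho> - \<mu>)) + (\<Sum>\<rho>\<in>Box (Suc n). \<Sum>\<mu>\<in>D \<rho>. G \<mu> (\<rho> - \<mu>))"
    by (rule sum.distrib)
  also have "(\<Sum>\<rho>\<in>Box (Suc n). \<Sum>\<mu>\<in>D \<rho>. F' \<mu> (\<rho> - \<mu>)) \<le> (\<Sum>\<mu>\<in>Box (Suc n). \<Sum>\<nu>\<in>Box n. F' \<mu> \<nu>)"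
  proof (rule conv_sum_le)
    fix \<mu> \<nu>
    show "0 \<le> F' \<mu> \<nu>"
      using r d_nonneg [of \<mu>] by (simp add: F'_def F_def wt_nonneg)
    assume \<mu>\<nu>: "\<mu> \<in> M" "\<nu> \<in> M" "d \<mu> + d \<nu> \<le> int (Suc n)" "F' \<mu> \<nu> \<noteq> 0"
    then have "\<mu> \<noteq> 0"
      by (auto simp: F'_def F_def)
    then show "\<mu> \<in> Box (Suc n) \<and> \<nu> \<in> Box n"
      using \<mu>\<nu> d_pos [of \<mu>] d_nonneg [of \<nu>] by (simp add: Box_def)
  qed simp_all
  also have "(\<Sum>\<mu>\<in>Box (Suc n). \<Sum>\<nu>\<in>Box n. F' \<mu> \<nu>)
      = (\<Sum>\<mu>\<in>Box (Suc n). real_of_int (d \<mu>) * cmod (g \<gamma> \<mu>) * wt r \<mu> * nrm r n (c (\<gamma> + \<mu>)))"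
    by (intro sum.cong refl) (simp add: F'_def F_def nrm_def sum_distrib_left Box_def)
  also have "\<dots> \<le> (\<Sum>\<mu>\<in>Box (Suc n). real_of_int (d \<mu>) * cmod (g \<gamma> \<mu>) * wt r \<mu> * B ^ Suc (nat (d \<mu>)))"
  proof (intro sum_mono mult_left_mono)
    fix \<mu> assume "\<mu> \<in> Box (Suc n)"
    then have \<mu>: "\<mu> \<in> M"
      by (simp add: Box_def)
    have "nrm r n (c (\<gamma> + \<mu>)) \<le> B ^ nat (l1 (\<gamma> + \<mu>))"
      by (rule c)
    also have "\<dots> \<le> B ^ Suc (nat (d \<mu>))"
      using l1_shift [OF \<gamma>, of \<mu>] l1_le_d [OF \<mu>] d_nonneg [OF \<mu>] by (intro power_increasing B1) linarith
    finally show "nrm r n (c (\<gamma> + \<mu>)) \<le> B ^ Suc (nat (d \<mu>))" .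
    show "0 \<le> real_of_int (d \<mu>) * cmod (g \<gamma> \<mu>) * wt r \<mu>"
      using d_nonneg [OF \<mu>] r by (simp add: wt_nonneg)
  qed
  also have "(\<Sum>\<rho>\<in>Box (Suc n). \<Sum>\<mu>\<in>D \<rho>. G \<mu> (\<rho> - \<mu>)) \<le> (\<Sum>\<mu>\<in>Box n - {0}. \<Sum>\<nu>\<in>Box n. G \<mu> \<nu>)"
  proof (rule conv_sum_le)
    fix \<mu> \<nu>
    show "0 \<le> G \<mu> \<nu>"
      using r l1_nonneg [of \<mu>] by (simp add: G_def wt_nonneg)
    assume \<mu>\<nu>: "\<mu> \<in> M" "\<nu> \<in> M" "d \<mu> + d \<nu> \<le> int (Suc n)" "G \<mu> \<nu> \<noteq> 0"
    then have "\<mu> \<noteq> 0" "\<nu> \<noteq> 0"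
      by (auto simp: G_def vf_norm_zero Y0)
    then show "\<mu> \<in> Box n - {0} \<and> \<nu> \<in> Box n"
      using \<mu>\<nu> d_pos [of \<mu>] d_pos [of \<nu>] by (simp add: Box_def)
  qed simp_all
  also have "(\<Sum>\<mu>\<in>Box n - {0}. \<Sum>\<nu>\<in>Box n. G \<mu> \<nu>)
      = (\<Sum>\<mu>\<in>Box n - {0}. cmod (b \<gamma> \<mu>) * wt r \<mu> * (1 + real_of_int (l1 \<mu>))) * vnrm r n Y"
    by (simp add: G_def vnrm_def sum_product)
  also have "\<dots> \<le> 2 * dnrm r n (b \<gamma>) * vnrm r n Y"
    by (intro mult_right_mono weighted_tail_le r vnrm_nonneg)
  finally show ?thesis
    by simp
qed

text \<open>The factor \<open>d \<mu>\<close> kills the constant term, so the sum tends to 0 with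
  \<open>r\<close>, uniformly in \<open>n\<close>. The powers of 2 anticipate the bound
  \<open>2 ^ nat (l1 \<delta>)\<close> for the unknown factor in
  \<open>analytic_left_factor\<close>.\<close>

lemma small_radius:
  fixes \<epsilon> :: real
  assumes g: "g \<in> auts (M - {0})" "analytic_element g" and \<epsilon>: "0 < \<epsilon>"
  shows "\<exists>r>0. \<forall>\<gamma>\<in>unit_vecs. \<forall>n.
    (\<Sum>\<mu>\<in>Box n. real_of_int (d \<mu>) * cmod (g \<gamma> \<mu>) * wt r \<mu> * 2 ^ Suc (nat (d \<mu>))) \<le> \<epsilon>"
proof -
  obtain r0 K where r0: "0 < r0" and K: "1 \<le> K" and bound: "\<And>\<delta> n. nrm r0 n (g \<delta>) \<le> K ^ nat (l1 \<delta>)"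
    using analytic_uniform [OF g] by blast
  \<comment> \<open>Chosen from \<open>k * s^k * 2^(k+1) \<le> 2 * (4 * s)^k \<le> 8 * s\<close> for
    \<open>k \<ge> 1\<close>, where \<open>k \<le> 2^k\<close> and \<open>4 * s \<le> 1\<close> are
    used.\<close>
  define s where "s = min (1 / 4) (\<epsilon> / (8 * K))"
  have s: "0 < s" "4 * s \<le> 1" "8 * s * K \<le> \<epsilon>"
    using K \<epsilon> by (auto simp: s_def min_def field_simps)
  have "(\<Sum>\<mu>\<in>Box n. real_of_int (d \<mu>) * cmod (g \<gamma> \<mu>) * wt (r0 * s) \<mu> * 2 ^ Suc (nat (d \<mu>))) \<le> \<epsilon>"
    if \<gamma>: "\<gamma> \<in> unit_vecs" for \<gamma> n
  proof -
    have "(\<Sum>\<mu>\<in>Box n. real_of_int (d \<mu>) * cmod (g \<gamma> \<mu>) * wt (r0 * s) \<mu> * 2 ^ Suc (nat (d \<mu>)))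
        \<le> (\<Sum>\<mu>\<in>Box n. 8 * s * (cmod (g \<gamma> \<mu>) * wt r0 \<mu>))"
    proof (rule sum_mono)
      fix \<mu> assume \<mu>: "\<mu> \<in> Box n"
      show "real_of_int (d \<mu>) * cmod (g \<gamma> \<mu>) * wt (r0 * s) \<mu> * 2 ^ Suc (nat (d \<mu>))
          \<le> 8 * s * (cmod (g \<gamma> \<mu>) * wt r0 \<mu>)"
      proof (cases "\<mu> = 0")
        case True
        then show ?thesis
          using s by simp
      next
        case False
        define k where "k = nat (d \<mu>)"
        have k: "real_of_int (d \<mu>) = real k" "1 \<le> k"
          using d_pos [of \<mu>] \<mu> False by (auto simp: k_def Box_def)
        have "real k \<le> 2 ^ k"
          using of_nat_less_two_power [of k, where ?'a = real] by simp
        then have "real k * s ^ k * 2 ^ Suc k \<le> 2 ^ k * s ^ k * 2 ^ Suc k"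
          using s by (intro mult_right_mono) auto
        also have "\<dots> = 2 * (4 * s) ^ k"
          by (simp add: power_mult_distrib flip: power_mult_distrib [of 2 2 k])
        also have "\<dots> \<le> 2 * (4 * s) ^ 1"
          using s k by (intro mult_left_mono power_decreasing) auto
        finally have *: "real k * s ^ k * 2 ^ Suc k \<le> 8 * s"
          by simp
        have "real_of_int (d \<mu>) * cmod (g \<gamma> \<mu>) * wt (r0 * s) \<mu> * 2 ^ Suc (nat (d \<mu>))
            = (real k * s ^ k * 2 ^ Suc k) * (cmod (g \<gamma> \<mu>) * wt r0 \<mu>)"
          unfolding k(1) by (simp add: wt_def k_def power_mult_distrib)
        also have "\<dots> \<le> 8 * s * (cmod (g \<gamma> \<mu>) * wt r0 \<mu>)"
          using r0 by (intro mult_right_mono *) (simp add: wt_nonneg)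
        finally show ?thesis .
      qed
    qed
    also have "\<dots> = 8 * s * nrm r0 n (g \<gamma>)"
      by (simp add: nrm_def sum_distrib_left)
    also have "\<dots> \<le> 8 * s * K"
      using bound [of n \<gamma>] l1_unit_vecs [OF \<gamma>] s by (intro mult_left_mono) auto
    also have "\<dots> \<le> \<epsilon>"
      by (rule s)
    finally show ?thesis .
  qed
  then show ?thesis
    using r0 s by (intro exI [of _ "r0 * s"]) auto
qed

text \<open>
  With \<open>c = a\<^sup>-\<^sup>1\<close>, \<open>b = c g\<close> and \<open>[E, c] = \<alpha> c\<close>, \<open>[E, b] = \<beta> b\<close>, one has \<open>(\<beta> - \<alpha>) b = c [E, g]\<close>.
  As \<open>\<alpha>\<close> and \<open>\<beta>\<close> have disjoint supports, this bounds both of them, and the division by the degree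
  in \<open>[E, c] = \<alpha> c\<close> compensates the derivative that is lost by applying \<open>\<alpha>\<close>.
\<close>

lemma analytic_left_factor:
  assumes A: "graded A1" "graded A2" "A1 \<inter> A2 = {}"
    and c: "c \<in> auts A1" and b: "b \<in> auts A2" and g: "g \<in> auts (M - {0})" "analytic_element g"
    and bcg: "b = op_comp c g"
  shows "analytic_element c"
proof -
  have sub: "auts A1 \<subseteq> auts (M - {0})" "auts A2 \<subseteq> auts (M - {0})"
    using A by (intro auts_mono; auto simp: graded_def)+
  have cM: "c \<in> auts (M - {0})" and bM: "b \<in> auts (M - {0})"
    using sub b c by auto
  have opc: "M_op c" and opg: "M_op g" and opb: "M_op b"
    using cM bM g auts_M_op by blast+
  obtain \<alpha> where \<alpha>: "\<alpha> \<in> lie_on A1"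
    and ceq: "\<And>\<gamma> \<rho>. of_int (d \<rho>) * c \<gamma> \<rho> = (\<Sum>\<mu>\<in>D \<rho>. c \<gamma> \<mu> * vf_op \<alpha> (\<gamma> + \<mu>) (\<rho> - \<mu>))"
    using degree_derivative_exists [OF A(1) c] by blast
  obtain \<beta> where \<beta>: "\<beta> \<in> lie_on A2"
    and beq: "\<And>\<gamma> \<rho>. of_int (d \<rho>) * b \<gamma> \<rho> = (\<Sum>\<mu>\<in>D \<rho>. b \<gamma> \<mu> * vf_op \<beta> (\<gamma> + \<mu>) (\<rho> - \<mu>))"
    using degree_derivative_exists [OF A(2) b] by blast
  have \<alpha>M: "\<alpha> \<in> lie_on (M - {0})" and \<beta>M: "\<beta> \<in> lie_on (M - {0})"
    using \<alpha> \<beta> A lie_on_graded by blast+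
  have op\<alpha>: "M_op (vf_op \<alpha>)"
    using \<alpha>M by (rule M_op_vf_op)
  define Y where "Y \<mu> = \<beta> \<mu> - \<alpha> \<mu>" for \<mu>
  have \<alpha>0: "\<alpha> 0 = 0" and \<beta>0: "\<beta> 0 = 0"
    using \<alpha>M \<beta>M by (auto simp: lie_on_def)
  then have Y0: "Y 0 = 0"
    by (simp add: Y_def)
  \<comment> \<open>There is no cancellation in \<open>Y\<close>: at each \<mu> one of \<alpha> and
    \<beta> vanishes.\<close>
  have norms: "vf_norm \<alpha> \<mu> \<le> vf_norm Y \<mu>" "vf_norm \<beta> \<mu> \<le> vf_norm Y \<mu>" for \<mu>
  proof -
    have "\<alpha> \<mu> = 0 \<or> \<beta> \<mu> = 0"
      using \<alpha> \<beta> A(3) by (auto simp: lie_on_def)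
    then show "vf_norm \<alpha> \<mu> \<le> vf_norm Y \<mu>" "vf_norm \<beta> \<mu> \<le> vf_norm Y \<mu>"
      by (auto simp: vf_norm_def Y_def sum_nonneg)
  qed
  have Yeq: "(\<Sum>\<mu>\<in>D \<rho>. b \<gamma> \<mu> * vf_op Y (\<gamma> + \<mu>) (\<rho> - \<mu>))
      = (\<Sum>\<mu>\<in>D \<rho>. of_int (d \<mu>) * g \<gamma> \<mu> * c (\<gamma> + \<mu>) (\<rho> - \<mu>))" for \<gamma> \<rho>
  proof -
    have "(\<Sum>\<mu>\<in>D \<rho>. b \<gamma> \<mu> * vf_op \<alpha> (\<gamma> + \<mu>) (\<rho> - \<mu>)) = op_comp (vf_op \<alpha>) (op_comp c g) \<gamma> \<rho>"
      using op_comp_eq [OF op\<alpha> opb, of \<gamma> \<rho>] by (simp add: bcg)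
    also have "\<dots> = op_comp (op_comp (vf_op \<alpha>) c) g \<gamma> \<rho>"
      by (simp add: op_comp_assoc op\<alpha> opc opg)
    also have "\<dots> = (\<Sum>\<mu>\<in>D \<rho>. g \<gamma> \<mu> * (of_int (d (\<rho> - \<mu>)) * c (\<gamma> + \<mu>) (\<rho> - \<mu>)))"
      unfolding op_comp_eq [OF M_op_comp [OF op\<alpha> opc] opg] op_comp_eq [OF op\<alpha> opc] ceq ..
    finally have 1: "(\<Sum>\<mu>\<in>D \<rho>. b \<gamma> \<mu> * vf_op \<alpha> (\<gamma> + \<mu>) (\<rho> - \<mu>))
        = (\<Sum>\<mu>\<in>D \<rho>. g \<gamma> \<mu> * (of_int (d (\<rho> - \<mu>)) * c (\<gamma> + \<mu>) (\<rho> - \<mu>)))" .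
    have "(\<Sum>\<mu>\<in>D \<rho>. b \<gamma> \<mu> * vf_op Y (\<gamma> + \<mu>) (\<rho> - \<mu>))
        = of_int (d \<rho>) * b \<gamma> \<rho> - (\<Sum>\<mu>\<in>D \<rho>. b \<gamma> \<mu> * vf_op \<alpha> (\<gamma> + \<mu>) (\<rho> - \<mu>))"
      unfolding beq by (simp add: Y_def vf_op_def algebra_simps sum_subtractf)
    also have "of_int (d \<rho>) * b \<gamma> \<rho> = (\<Sum>\<mu>\<in>D \<rho>. of_int (d \<rho>) * (g \<gamma> \<mu> * c (\<gamma> + \<mu>) (\<rho> - \<mu>)))"
      by (simp add: bcg op_comp_eq [OF opc opg] sum_distrib_left)
    also have "\<dots> - (\<Sum>\<mu>\<in>D \<rho>. b \<gamma> \<mu> * vf_op \<alpha> (\<gamma> + \<mu>) (\<rho> - \<mu>))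
        = (\<Sum>\<mu>\<in>D \<rho>. of_int (d \<mu>) * g \<gamma> \<mu> * c (\<gamma> + \<mu>) (\<rho> - \<mu>))"
      unfolding 1 sum_subtractf [symmetric]
      by (rule sum.cong) (simp_all add: deg_diff algebra_simps)
    finally show ?thesis .
  qed
  define N where "N = real CARD('n)"
  have N: "1 \<le> N"
    by (simp add: N_def Suc_leI)
  \<comment> \<open>The constants are made to reproduce themselves:
    \<open>1/(16 N^2) + 2 * 1/(4 N) * 1/(8 N) = 1/(8 N^2)\<close>; summed over \<open>N\<close>
    coordinates this is \<open>1/(8 N)\<close>, and \<open>flow_bound\<close> returns at most twice
    that, \<open>1/(4 N)\<close>.\<close>
  obtain r where r: "0 < r" and G: "\<And>\<gamma> n. \<gamma> \<in> unit_vecs \<Longrightarrow>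
      (\<Sum>\<mu>\<in>Box n. real_of_int (d \<mu>) * cmod (g \<gamma> \<mu>) * wt r \<mu> * 2 ^ Suc (nat (d \<mu>))) \<le> 1 / (16 * N\<^sup>2)"
    using small_radius [OF g, of "1 / (16 * N\<^sup>2)"] N by auto
  have c0: "c \<gamma> 0 = 1" and b0: "b \<gamma> 0 = 1" for \<gamma>
    using c b by (simp_all add: auts_def)
  have unit_bound: "nrm r n (c \<gamma>) \<le> 2" if "dnrm r n (c \<gamma>) \<le> 1 / (4 * N)" for n \<gamma>
  proof -
    have "1 / (4 * N) \<le> 1"
      using N by simp
    then show ?thesis
      using nrm_le_dnrm [of r "c \<gamma>" n] r c0 that by simp
  qed
  \<comment> \<open>The bounds in degrees up to \<open>n\<close> give the one for \<open>Y\<close>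
    up to \<open>n + 1\<close>, and this in turn gives those for \<open>c\<close> and
    \<open>b\<close>.\<close>
  have main: "vnrm r n Y \<le> 1 / (8 * N) \<and>
      (\<forall>\<gamma>\<in>unit_vecs. dnrm r n (c \<gamma>) \<le> 1 / (4 * N) \<and> dnrm r n (b \<gamma>) \<le> 1 / (4 * N))" for n
  proof (induction n)
    case 0
    then show ?case
      using N by (simp add: vnrm_def dnrm_def vf_norm_def Y0)
  next
    case (Suc n)
    have c_unit: "nrm r n (c \<delta>) \<le> 2 ^ nat (l1 \<delta>)" for \<delta>
      by (rule nrm_power_bound [OF cM]) (use Suc r unit_bound in auto)
    have "(\<Sum>\<rho>\<in>Box (Suc n). cmod (Y \<rho> $ i) * wt r \<rho>) \<le> 1 / (8 * N\<^sup>2)" for i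
    proof -
      \<comment> \<open>Evaluating at a basis vector reads off one coordinate of
        \<open>Y\<close>.\<close>
      define \<gamma> :: "int ^ 'n" where "\<gamma> = axis i 1"
      have \<gamma>: "\<gamma> \<in> unit_vecs"
        by (simp add: \<gamma>_def)
      have vfY: "vf_op Y \<gamma> \<rho> = Y \<rho> $ i" for \<rho>
      proof -
        have "vf_op Y \<gamma> \<rho> = (\<Sum>j\<in>UNIV. if j = i then Y \<rho> $ j else 0)"
          unfolding vf_op_def \<gamma>_def axis_def by (intro sum.cong) auto
        then show ?thesis
          by simp
      qed
      have "(\<Sum>\<rho>\<in>Box (Suc n). cmod (vf_op Y \<gamma> \<rho>) * wt r \<rho>)
          \<le> (\<Sum>\<mu>\<in>Box (Suc n). real_of_int (d \<mu>) * cmod (g \<gamma> \<mu>) * wt r \<mu> * 2 ^ Suc (nat (d \<mu>)))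
            + 2 * dnrm r n (b \<gamma>) * vnrm r n Y"
        by (rule source_bound [where c = c and b = b and g = g and Y = Y, OF _ _ \<gamma> c_unit _ b0 Y0 Yeq])
           (use r in auto)
      also have "\<dots> \<le> 1 / (16 * N\<^sup>2) + 2 * (1 / (4 * N)) * (1 / (8 * N))"
        using Suc \<gamma> r by (intro add_mono G mult_mono vnrm_nonneg) (auto simp: dnrm_nonneg N_def)
      also have "\<dots> = 1 / (8 * N\<^sup>2)"
        using N by (simp add: field_simps power2_eq_square)
      finally show ?thesis
        by (simp add: vfY)
    qed
    then have "(\<Sum>i\<in>UNIV. \<Sum>\<rho>\<in>Box (Suc n). cmod (Y \<rho> $ i) * wt r \<rho>) \<le> (\<Sum>i\<in>(UNIV :: 'n set). 1 / (8 * N\<^sup>2))"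
      by (intro sum_mono)
    moreover have "vnrm r (Suc n) Y = (\<Sum>i\<in>UNIV. \<Sum>\<rho>\<in>Box (Suc n). cmod (Y \<rho> $ i) * wt r \<rho>)"
      unfolding vnrm_def vf_norm_def sum_distrib_right by (rule sum.swap)
    moreover have "(\<Sum>i\<in>(UNIV :: 'n set). 1 / (8 * N\<^sup>2)) = 1 / (8 * N)"
      using N by (simp add: N_def power2_eq_square)
    ultimately have y: "vnrm r (Suc n) Y \<le> 1 / (8 * N)"
      by simp
    have step: "dnrm r (Suc n) (T \<gamma>) \<le> 1 / (4 * N)"
      if \<gamma>: "\<gamma> \<in> unit_vecs" and "T \<gamma> 0 = 1" "\<xi> 0 = 0"
        and "\<And>\<rho>. of_int (d \<rho>) * T \<gamma> \<rho> = (\<Sum>\<mu>\<in>D \<rho>. T \<gamma> \<mu> * vf_op \<xi> (\<gamma> + \<mu>) (\<rho> - \<mu>))"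
        and le: "\<And>\<mu>. vf_norm \<xi> \<mu> \<le> vf_norm Y \<mu>" and IH: "dnrm r n (T \<gamma>) \<le> 1 / (4 * N)"
      for T \<gamma> \<xi>
    proof -
      have "vnrm r (Suc n) \<xi> \<le> vnrm r (Suc n) Y"
        unfolding vnrm_def using r by (intro sum_mono mult_right_mono le) (simp add: wt_nonneg)
      then have \<xi>: "vnrm r (Suc n) \<xi> \<le> 1 / (8 * N)"
        using y by simp
      have "1 / (4 * N) \<le> 1 / 2"
        using N by (simp add: field_simps)
      then have T: "1 + 2 * dnrm r n (T \<gamma>) \<le> 2"
        using IH by simp
      have "dnrm r (Suc n) (T \<gamma>) \<le> vnrm r (Suc n) \<xi> * (1 + 2 * dnrm r n (T \<gamma>))"
        using that r by (intro flow_bound) auto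
      also have "\<dots> \<le> 1 / (8 * N) * 2"
        using r N by (intro mult_mono \<xi> T) (simp_all add: dnrm_nonneg)
      finally show ?thesis
        by simp
    qed
    show ?case
      using y step [where T = c and \<xi> = \<alpha>] step [where T = b and \<xi> = \<beta>] Suc norms ceq beq c0 b0 \<alpha>0 \<beta>0
      by blast
  qed
  have "nrm r n (c \<delta>) \<le> 2 ^ nat (l1 \<delta>)" for \<delta> n
    by (rule nrm_power_bound [OF cM]) (use main r unit_bound in auto)
  then show ?thesis
    using analytic_element_iff [OF cM] r by blast
qed

end

section \<open>Analyticity of products, inverses and factors without a fixed grading\<close>

lemma graded_empty: "grading.graded l {}"
  by (simp add: grading.graded_def add_closed_def)

lemma analytic_comp:
  assumes "tame A" "S \<in> auts A" "T \<in> auts A" "analytic_element S" "analytic_element T"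
  shows "analytic_element (op_comp S T)"
proof -
  obtain l where "grading.graded l A"
    using assms(1) by (auto simp: tame_graded)
  then have "auts A \<subseteq> auts (grading.M l - {0})"
    by (intro auts_mono) (auto simp: grading.graded_def)
  then show ?thesis
    using assms grading.analytic_comp_graded [of S l T] by blast
qed

text \<open>The case of an empty second part: the identity is the product of \<open>op_inv g\<close>
  and \<open>g\<close>.\<close>

lemma analytic_inv:
  assumes A: "tame A" "g \<in> auts A" and an: "analytic_element g"
  shows "analytic_element (op_inv g)"
proof -
  obtain l where l: "grading.graded l A"
    using A(1) by (auto simp: tame_graded)
  then have "auts A \<subseteq> auts (grading.M l - {0})"
    by (intro auts_mono) (auto simp: grading.graded_def)
  then show ?thesis
    using A an op_inv_left [OF A] op_inv_auts [OF A]
    by (intro grading.analytic_left_factor [OF l graded_empty, of "op_inv g" op_id g]) auto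
qed

text \<open>\<open>analytic_left_factor\<close> yields the inverse of \<open>a\<close>; then
  \<open>a\<close> is analytic as an inverse, and \<open>b\<close> as the product of
  \<open>op_inv a\<close> with \<open>op_comp a b\<close>.\<close>

lemma analytic_factors:
  assumes A: "tame A" "add_closed A1" "add_closed A2" "A1 \<subseteq> A" "A2 \<subseteq> A" "A1 \<inter> A2 = {}"
    and a: "a \<in> auts A1" and b: "b \<in> auts A2" and an: "analytic_element (op_comp a b)"
  shows "analytic_element a" "analytic_element b"
proof -
  obtain l where l: "grading.graded l A"
    using A(1) by (auto simp: tame_graded)
  then have sub: "auts A \<subseteq> auts (grading.M l - {0})"
    by (intro auts_mono) (auto simp: grading.graded_def)
  have l12: "grading.graded l A1" "grading.graded l A2"
    using l A by (auto simp: grading.graded_def)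
  have t: "tame A1"
    using A tame_subset by blast
  have in_A: "a \<in> auts A" "b \<in> auts A" "op_inv a \<in> auts A"
    using a b A auts_mono op_inv_auts by blast+
  define g where "g = op_comp a b"
  have g: "g \<in> auts A"
    using in_A A(1) by (simp add: g_def auts_comp)
  have bg: "op_comp (op_inv a) g = b"
    unfolding g_def using in_A A(1) by (simp add: op_inv_cancel_left)
  have inv_an: "analytic_element (op_inv a)"
    using an a b g sub bg t
    by (intro grading.analytic_left_factor [OF l12 A(6), of "op_inv a" b g])
       (auto simp: op_inv_auts g_def)
  then show "analytic_element a"
    using analytic_inv [OF A(1) in_A(3)] op_inv_op_inv [OF A(1) in_A(1)] by simp
  show "analytic_element b"
    using analytic_comp [OF A(1) in_A(3) g inv_an] an bg by (simp add: g_def)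
qed

subsection \<open>Sectors\<close>

text \<open>The real linear functional that is positive exactly on the open half-plane centred at
  the clockwise angle \<theta>.\<close>

definition hp :: "real \<Rightarrow> complex \<Rightarrow> real" where
  "hp \<theta> z = Re (cis \<theta> * z)"

definition hpi :: "real \<Rightarrow> real set" where
  "hpi \<theta> = {\<theta> - pi / 2<..<\<theta> + pi / 2}"

lemma hp_add: "hp \<theta> (z + w) = hp \<theta> z + hp \<theta> w"
  by (simp add: hp_def algebra_simps)

lemma hp_polar: "hp \<theta> (of_real r * cis (- x)) = r * cos (x - \<theta>)"
  by (simp add: hp_def cos_diff algebra_simps)

lemma cos_minus_half_pi: "cos (x - (y + pi / 2)) = sin (x - y)"
proof -
  have "x - (y + pi / 2) = (x - y) - pi / 2"
    by simp
  then show ?thesis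
    by (simp only: cos_diff [of "x - y" "pi / 2"]) simp
qed

lemma abs_hp_le: "\<bar>hp \<theta> z\<bar> \<le> cmod z"
  using abs_Re_le_cmod [of "cis \<theta> * z"] by (simp add: hp_def norm_mult)

lemma sectorI: "0 < r \<Longrightarrow> x \<in> S \<Longrightarrow> of_real r * cis (- x) \<in> sector S"
  by (auto simp: sector_def)

lemma sectorE:
  assumes "z \<in> sector S"
  obtains r x where "0 < r" "x \<in> S" "z = of_real r * cis (- x)"
  using assms by (auto simp: sector_def)

lemma sector_mono: "S \<subseteq> T \<Longrightarrow> sector S \<subseteq> sector T"
  by (auto simp: sector_def)

lemma sector_Un: "sector (S \<union> T) = sector S \<union> sector T"
  by (auto simp: sector_def)

lemma zero_notin_sector [simp]: "0 \<notin> sector S"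
  by (auto simp: sector_def)

lemma sector_empty [simp]: "sector {} = {}"
  by (auto simp: sector_def)

lemma polar_eq:
  assumes "of_real r * cis (- x) = of_real s * cis (- y)" "0 < r" "0 < s"
  shows "\<exists>k::int. y = x + 2 * pi * of_int k"
proof -
  have "cmod (of_real r * cis (- x)) = cmod (of_real s * cis (- y))"
    using assms by simp
  then have "r = s"
    using assms(2,3) by (simp add: norm_mult)
  then have "cis (- x) = cis (- y)"
    using assms by simp
  then have "cis (- x) * cis y = 1"
    by (simp add: cis_mult)
  then have "cis (y - x) = 1"
    by (simp add: cis_mult add.commute)
  then have "cos (y - x) = 1"
    by (metis cis.sel(1) one_complex.sel(1))
  then obtain k :: int where "y - x = of_int k * 2 * pi"
    using cos_one_2pi_int by blast
  then show ?thesis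
    by (intro exI [of _ k]) (simp add: algebra_simps)
qed

lemma polar_unique:
  assumes "of_real r * cis (- x) = of_real s * cis (- y)" "0 < r" "0 < s" "\<bar>x - y\<bar> < 2 * pi"
  shows "x = y"
proof -
  obtain k :: int where k: "y = x + 2 * pi * of_int k"
    using polar_eq assms by blast
  then have "2 * pi * \<bar>of_int k\<bar> < 2 * pi * 1"
    using assms(4) by (simp add: abs_mult)
  then have "\<bar>of_int k\<bar> < (1::real)"
    by (subst (asm) mult_less_cancel_left_pos) simp_all
  then show ?thesis
    using k by (simp flip: of_int_abs)
qed

lemma cis_shift: "cis (- (x + 2 * pi * of_int k)) = cis (- x)"
proof -
  have "cis (- (x + 2 * pi * of_int k)) = cis (- x) * cis (2 * pi * of_int (- k))"
    by (simp add: cis_mult algebra_simps)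
  also have "cis (2 * pi * of_int (- k)) = 1"
    by (rule cis_multiple_2pi) simp
  finally show ?thesis
    by simp
qed

lemma sector_shift: "sector ((\<lambda>x. x + 2 * pi * of_int k) ` S) = sector S"
proof
  show "sector ((\<lambda>x. x + 2 * pi * of_int k) ` S) \<subseteq> sector S"
  proof
    fix z assume "z \<in> sector ((\<lambda>x. x + 2 * pi * of_int k) ` S)"
    then obtain r x where "0 < r" "x \<in> S" "z = of_real r * cis (- (x + 2 * pi * of_int k))"
      by (auto elim!: sectorE)
    then show "z \<in> sector S"
      unfolding cis_shift by (auto intro: sectorI)
  qed
  show "sector S \<subseteq> sector ((\<lambda>x. x + 2 * pi * of_int k) ` S)"
  proof
    fix z assume "z \<in> sector S"
    then obtain r x where "0 < r" "x \<in> S" "z = of_real r * cis (- x)"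
      by (auto elim!: sectorE)
    then have "0 < r" "x \<in> S" "z = of_real r * cis (- (x + 2 * pi * of_int k))"
      unfolding cis_shift by auto
    then show "z \<in> sector ((\<lambda>x. x + 2 * pi * of_int k) ` S)"
      by (simp only:) (rule sectorI, auto)
  qed
qed

lemma hpi_width: "x \<in> hpi \<theta> \<Longrightarrow> y \<in> hpi \<theta> \<Longrightarrow> \<bar>x - y\<bar> < pi"
  by (simp add: hpi_def abs_less_iff)

text \<open>Angles are unique inside one open half-plane; in general a point determines its angle
  only modulo a full turn.\<close>

lemma sector_Int:
  assumes "S \<subseteq> hpi \<theta>" "T \<subseteq> hpi \<theta>"
  shows "sector S \<inter> sector T = sector (S \<inter> T)"
proof
  show "sector (S \<inter> T) \<subseteq> sector S \<inter> sector T"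
    by (auto simp: sector_def)
  show "sector S \<inter> sector T \<subseteq> sector (S \<inter> T)"
  proof
    fix z assume z: "z \<in> sector S \<inter> sector T"
    then obtain r x where 1: "0 < r" "x \<in> S" "z = of_real r * cis (- x)"
      by (auto elim: sectorE)
    from z obtain s y where 2: "0 < s" "y \<in> T" "z = of_real s * cis (- y)"
      by (auto elim: sectorE)
    have "\<bar>x - y\<bar> < 2 * pi"
      using hpi_width [of x \<theta> y] 1 2 assms pi_gt_zero by (smt (verit) subsetD)
    moreover have "of_real r * cis (- x) = of_real s * cis (- y)"
      using 1 2 by simp
    ultimately have "x = y"
      using polar_unique 1(1) 2(1) by blast
    then show "z \<in> sector (S \<inter> T)"
      using 1 2 by (auto intro: sectorI)
  qed
qed

lemma cos_pos_hpi: "x \<in> hpi \<theta> \<Longrightarrow> 0 < cos (x - \<theta>)"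
  by (rule cos_gt_zero_pi) (auto simp: hpi_def)

lemma half_plane: "sector (hpi \<theta>) = {z. 0 < hp \<theta> z}"
proof
  show "sector (hpi \<theta>) \<subseteq> {z. 0 < hp \<theta> z}"
    by (auto elim!: sectorE simp: hp_polar cos_pos_hpi)
  show "{z. 0 < hp \<theta> z} \<subseteq> sector (hpi \<theta>)"
  proof
    fix z assume "z \<in> {z. 0 < hp \<theta> z}"
    then have pos: "0 < Re (cis \<theta> * z)"
      by (simp add: hp_def)
    define x where "x = \<theta> - Arg (cis \<theta> * z)"
    have "\<bar>Arg (cis \<theta> * z)\<bar> < pi / 2"
      using pos Arg_lt_pi by (intro iffD2 [OF Arg_Re_pos]) auto
    then have "x \<in> hpi \<theta>"
      by (auto simp: x_def hpi_def)
    moreover have nz: "cis \<theta> * z \<noteq> 0"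
      using pos by auto
    have "cis \<theta> * z = of_real (cmod (cis \<theta> * z)) * cis (Arg (cis \<theta> * z))"
      using rcis_cmod_Arg [of "cis \<theta> * z"] by (simp add: rcis_def)
    then have "cis (- \<theta>) * (cis \<theta> * z) = of_real (cmod z) * (cis (- \<theta>) * cis (Arg (cis \<theta> * z)))"
      by (simp add: norm_mult)
    then have "z = of_real (cmod z) * cis (- x)"
      by (simp add: x_def cis_mult mult.assoc [symmetric])
    moreover have "0 < cmod z"
      using nz by simp
    ultimately show "z \<in> sector (hpi \<theta>)"
      by (metis sectorI)
  qed
qed

lemma sector_add:
  assumes S: "is_interval S" "S \<subseteq> hpi \<theta>" and z: "z \<in> sector S" and w: "w \<in> sector S"
  shows "z + w \<in> sector S"
proof -
  have ordered: "z + w \<in> sector S"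
    if "0 < r" "x \<in> S" "z = of_real r * cis (- x)" "0 < s" "y \<in> S" "w = of_real s * cis (- y)" "x \<le> y"
    for r s x y z w
  proof -
    have "z \<in> sector (hpi \<theta>)" "w \<in> sector (hpi \<theta>)"
      using that S(2) by (auto intro!: sectorI)
    then have "z + w \<in> sector (hpi \<theta>)"
      by (simp add: half_plane hp_add)
    then obtain t v where t: "0 < t" "v \<in> hpi \<theta>" "z + w = of_real t * cis (- v)"
      by (elim sectorE)
    have xy: "x \<in> hpi \<theta>" "y \<in> hpi \<theta>"
      using that S(2) by auto
    have rot: "hp \<phi> (z + w) = r * cos (x - \<phi>) + s * cos (y - \<phi>)" for \<phi>
      unfolding hp_add by (simp add: that hp_polar)
    have tv: "t * cos (v - \<phi>) = r * cos (x - \<phi>) + s * cos (y - \<phi>)" for \<phi>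
      using rot [of \<phi>] unfolding t(3) hp_polar .
    \<comment> \<open>Test the sum against the functional that vanishes on the ray at
      \<open>x\<close>: its value is a non-negative multiple of \<open>sin (y - x)\<close>, so the
      angle \<open>v\<close> cannot lie before \<open>x\<close>.\<close>
    have "x \<le> v"
    proof (rule ccontr)
      assume "\<not> x \<le> v"
      then have "sin (x - v) > 0"
        using hpi_width [OF xy(1) t(2)] by (intro sin_gt_zero) auto
      moreover have "sin (y - x) \<ge> 0"
        using hpi_width [OF xy(1) xy(2)] that by (intro sin_ge_zero) auto
      moreover have "t * sin (v - x) = s * sin (y - x)"
        using tv [of "x + pi / 2"] by (simp add: cos_minus_half_pi)
      moreover have "sin (v - x) = - sin (x - v)"
        by (metis minus_diff_eq sin_minus)
      ultimately show False
        using t that by (simp add: mult_nonneg_nonneg) (smt (verit) mult_nonneg_nonneg mult_pos_pos)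
    qed
    moreover have "v \<le> y"
    proof (rule ccontr)
      assume "\<not> v \<le> y"
      then have "sin (v - y) > 0"
        using hpi_width [OF t(2) xy(2)] by (intro sin_gt_zero) auto
      moreover have "sin (y - x) \<ge> 0"
        using hpi_width [OF xy(1) xy(2)] that by (intro sin_ge_zero) auto
      moreover have "t * sin (v - y) = r * sin (x - y)"
        using tv [of "y + pi / 2"] by (simp add: cos_minus_half_pi)
      moreover have "sin (x - y) = - sin (y - x)"
        by (metis minus_diff_eq sin_minus)
      ultimately show False
        using t that by (simp add: mult_nonneg_nonneg) (smt (verit) mult_nonneg_nonneg mult_pos_pos)
    qed
    ultimately have "v \<in> S"
      using S(1) that mem_is_interval_1_I by blast
    then show ?thesis
      using t by (simp add: sectorI)
  qed
  obtain r x s y where "0 < r" "x \<in> S" "z = of_real r * cis (- x)" "0 < s" "y \<in> S" "w = of_real s * cis (- y)"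
    using z w by (auto elim!: sectorE)
  then show ?thesis
    using ordered [of r x z s y w] ordered [of s y w r x z] by (cases "x \<le> y") (auto simp: add.commute)
qed

subsection \<open>Groups attached to sectors\<close>

lemma rvec_add: "rvec (\<gamma> + \<delta>) = rvec \<gamma> + rvec \<delta>"
  by (simp add: rvec_def vec_eq_iff)

lemma rvec_0 [simp]: "rvec 0 = 0"
  by (simp add: rvec_def vec_eq_iff)

lemma linear_charge_real: "linear (charge_real Z)"
  by (rule linearI) (simp_all add: charge_real_def algebra_simps sum.distrib scaleR_conv_of_real [where 'a = complex] sum_distrib_left)

lemma charge_real_add: "charge_real Z (u + v) = charge_real Z u + charge_real Z v"
  using linear_charge_real by (rule linear_add)

lemma charge_real_0 [simp]: "charge_real Z 0 = 0"
  using linear_charge_real by (rule linear_0)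

lemma charge_add: "charge Z (\<gamma> + \<delta>) = charge Z \<gamma> + charge Z \<delta>"
  by (simp add: charge_def rvec_add charge_real_add)

lemma charge_0 [simp]: "charge Z 0 = 0"
  by (simp add: charge_def)

lemma linear_hp: "linear (\<lambda>u. hp \<theta> (charge_real Z u))"
proof -
  have "linear (hp \<theta>)"
    by (rule linearI) (simp_all add: hp_def algebra_simps)
  then show ?thesis
    using linear_compose [OF linear_charge_real, of "hp \<theta>" Z] by (simp add: o_def)
qed

lemma l1_le_norm: "real_of_int (l1 \<gamma>) \<le> real CARD('n) * norm (rvec (\<gamma> :: int ^ 'n::finite))"
proof -
  have "real_of_int (l1 \<gamma>) = (\<Sum>i\<in>UNIV. \<bar>rvec \<gamma> $ i\<bar>)"
    by (simp add: l1_def rvec_def)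
  also have "\<dots> \<le> (\<Sum>i\<in>(UNIV::'n set). norm (rvec \<gamma>))"
    by (intro sum_mono component_le_norm_cart)
  finally show ?thesis
    by simp
qed

text \<open>Round a large multiple \<open>R\<close> of \<phi> to integer coefficients. Rounding
  costs at most \<open>l1 \<gamma>\<close>, so \<open>R\<close> is chosen such that
  \<open>R * \<phi>\<close> is at least twice \<open>l1\<close> on the cone.\<close>

lemma integral_grading_exists:
  fixes \<phi> :: "real ^ 'n::finite \<Rightarrow> real"
  assumes \<phi>: "linear \<phi>" and c: "0 < c"
  shows "\<exists>l. \<forall>\<gamma>. c * norm (rvec \<gamma>) \<le> \<phi> (rvec \<gamma>) \<longrightarrow> l1 \<gamma> \<le> deg l \<gamma>"
proof -
  define R where "R = 2 * real CARD('n) / c"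
  define l :: "int ^ 'n" where "l = (\<chi> i. \<lfloor>R * \<phi> (axis i 1)\<rfloor>)"
  have "l1 \<gamma> \<le> deg l \<gamma>" if \<gamma>: "c * norm (rvec \<gamma>) \<le> \<phi> (rvec \<gamma>)" for \<gamma>
  proof -
    have "rvec \<gamma> = (\<Sum>i\<in>UNIV. real_of_int (\<gamma> $ i) *\<^sub>R axis i 1)"
      using basis_expansion [of "rvec \<gamma>"] by (simp add: rvec_def scalar_mult_eq_scaleR)
    then have \<phi>\<gamma>: "\<phi> (rvec \<gamma>) = (\<Sum>i\<in>UNIV. real_of_int (\<gamma> $ i) * \<phi> (axis i 1))"
      using \<phi> by (simp add: linear_sum linear_cmul)
    have "R * \<phi> (rvec \<gamma>) - real_of_int (deg l \<gamma>)
        = (\<Sum>i\<in>UNIV. (R * \<phi> (axis i 1) - real_of_int (l $ i)) * real_of_int (\<gamma> $ i))"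
      by (simp add: \<phi>\<gamma> deg_def sum_distrib_left sum_subtractf algebra_simps)
    also have "\<dots> \<le> (\<Sum>i\<in>UNIV. 1 * \<bar>real_of_int (\<gamma> $ i)\<bar>)"
    proof (rule sum_mono)
      fix i
      have "\<bar>R * \<phi> (axis i 1) - real_of_int (l $ i)\<bar> \<le> 1"
        by (simp add: l_def) linarith
      then have "\<bar>R * \<phi> (axis i 1) - real_of_int (l $ i)\<bar> * \<bar>real_of_int (\<gamma> $ i)\<bar> \<le> 1 * \<bar>real_of_int (\<gamma> $ i)\<bar>"
        by (intro mult_right_mono) auto
      then show "(R * \<phi> (axis i 1) - real_of_int (l $ i)) * real_of_int (\<gamma> $ i) \<le> 1 * \<bar>real_of_int (\<gamma> $ i)\<bar>"
        by (simp flip: abs_mult)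
    qed
    also have "\<dots> = real_of_int (l1 \<gamma>)"
      by (simp add: l1_def)
    finally have "R * \<phi> (rvec \<gamma>) - real_of_int (l1 \<gamma>) \<le> real_of_int (deg l \<gamma>)"
      by simp
    moreover have "2 * real_of_int (l1 \<gamma>) \<le> R * \<phi> (rvec \<gamma>)"
    proof -
      have "2 * real_of_int (l1 \<gamma>) \<le> R * (c * norm (rvec \<gamma>))"
        using l1_le_norm [of \<gamma>] c by (simp add: R_def)
      also have "\<dots> \<le> R * \<phi> (rvec \<gamma>)"
        using \<gamma> c by (intro mult_left_mono) (auto simp: R_def)
      finally show ?thesis .
    qed
    ultimately show ?thesis
      by linarith
  qed
  then show ?thesis
    by blast
qed

text \<open>For positive \<open>c\<close> the inequality keeps the points away from the kernel of
  the charge and from the boundary of the half-plane centred at \<theta>; this supplies a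
  grading.\<close>

definition pts :: "complex ^ 'n::finite \<Rightarrow> real \<Rightarrow> real \<Rightarrow> real set \<Rightarrow> (int ^ 'n) set" where
  "pts Z \<theta> c S = {\<gamma>. charge Z \<gamma> \<in> sector S \<and> c * norm (rvec \<gamma>) \<le> hp \<theta> (charge Z \<gamma>)}"

definition good :: "real \<Rightarrow> real set \<Rightarrow> bool" where
  "good \<theta> S \<longleftrightarrow> is_interval S \<and> S \<subseteq> hpi \<theta>"

lemma pts_mono: "S \<subseteq> T \<Longrightarrow> c' \<le> c \<Longrightarrow> pts Z \<theta> c S \<subseteq> pts Z \<theta> c' T"
proof
  fix \<gamma> assume "S \<subseteq> T" "c' \<le> c" "\<gamma> \<in> pts Z \<theta> c S"
  then show "\<gamma> \<in> pts Z \<theta> c' T"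
    using sector_mono [of S T] mult_right_mono [of c' c "norm (rvec \<gamma>)"] by (auto simp: pts_def)
qed

lemma add_closed_pts:
  assumes "good \<theta> S" "0 \<le> c"
  shows "add_closed (pts Z \<theta> c S)"
  unfolding add_closed_def
proof (intro ballI)
  fix a b assume a: "a \<in> pts Z \<theta> c S" and b: "b \<in> pts Z \<theta> c S"
  have "charge Z (a + b) \<in> sector S"
    unfolding charge_add using assms a b by (intro sector_add) (auto simp: good_def pts_def)
  moreover have "c * norm (rvec (a + b)) \<le> c * (norm (rvec a) + norm (rvec b))"
    using assms by (intro mult_left_mono) (auto simp: rvec_add norm_triangle_ineq)
  then have "c * norm (rvec (a + b)) \<le> hp \<theta> (charge Z (a + b))"
    using a b by (simp add: pts_def charge_add hp_add algebra_simps)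
  ultimately show "a + b \<in> pts Z \<theta> c S"
    by (simp add: pts_def)
qed

lemma tame_pts:
  assumes "good \<theta> S" "0 < c"
  shows "tame (pts Z \<theta> c S)"
proof -
  obtain l where "\<And>\<gamma>. c * norm (rvec \<gamma>) \<le> hp \<theta> (charge_real Z (rvec \<gamma>)) \<Longrightarrow> l1 \<gamma> \<le> deg l \<gamma>"
    using integral_grading_exists [OF linear_hp assms(2)] by blast
  moreover have "0 \<notin> pts Z \<theta> c S"
    by (simp add: pts_def)
  ultimately have "\<forall>\<mu>\<in>pts Z \<theta> c S. \<mu> \<noteq> 0 \<and> l1 \<mu> \<le> deg l \<mu>"
    by (auto simp: pts_def charge_def)
  then show ?thesis
    using add_closed_pts [OF assms(1), of c Z] assms(2) unfolding tame_def by auto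
qed

text \<open>The angle \<open>\<theta>\<close> is the centre of a half-plane containing \<open>sector S\<close>. As in \<open>G_V\<close>, the supporting
  cone varies, but it is not required to stay away from the boundary rays of the sector.\<close>

definition sgrp :: "complex ^ 'n::finite \<Rightarrow> real \<Rightarrow> real set \<Rightarrow> 'n oper set" where
  "sgrp Z \<theta> S = (\<Union>c\<in>{0<..}. auts (pts Z \<theta> c S))"

lemma sgrp_mono: "S \<subseteq> T \<Longrightarrow> sgrp Z \<theta> S \<subseteq> sgrp Z \<theta> T"
  unfolding sgrp_def by (intro UN_mono auts_mono pts_mono) auto

text \<open>Finitely many elements involve finitely many constants, and the smallest serves all. In
  this way identities in the union \<open>sgrp\<close> are checked inside a single group.\<close>

lemma sgrp_common:
  assumes "finite X" "X \<subseteq> sgrp Z \<theta> S"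
  shows "\<exists>c>0. X \<subseteq> auts (pts Z \<theta> c S)"
  using assms
proof (induction rule: finite_induct)
  case empty
  then show ?case
    by (auto intro: exI [of _ 1])
next
  case (insert x X)
  then obtain c c' where "0 < c" "X \<subseteq> auts (pts Z \<theta> c S)" "0 < c'" "x \<in> auts (pts Z \<theta> c' S)"
    by (auto simp: sgrp_def)
  moreover have "auts (pts Z \<theta> c S) \<subseteq> auts (pts Z \<theta> (min c c') S)"
    "auts (pts Z \<theta> c' S) \<subseteq> auts (pts Z \<theta> (min c c') S)"
    by (intro auts_mono pts_mono; simp)+
  ultimately show ?case
    by (intro exI [of _ "min c c'"]) auto
qed

lemma sgrp_tame:
  assumes "good \<theta> S" "finite X" "X \<subseteq> sgrp Z \<theta> S"
  shows "\<exists>c>0. tame (pts Z \<theta> c S) \<and> X \<subseteq> auts (pts Z \<theta> c S)"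
  using sgrp_common [OF assms(2,3)] tame_pts [OF assms(1)] by blast

lemma sgrpI: "0 < c \<Longrightarrow> T \<in> auts (pts Z \<theta> c S) \<Longrightarrow> T \<in> sgrp Z \<theta> S"
  by (auto simp: sgrp_def)

lemma sgrp_id [simp]: "op_id \<in> sgrp Z \<theta> S"
  by (rule sgrpI [of 1]) simp_all

lemma sgrp_comp:
  assumes "good \<theta> S" "T \<in> sgrp Z \<theta> S" "U \<in> sgrp Z \<theta> S"
  shows "op_comp T U \<in> sgrp Z \<theta> S"
  using sgrp_tame [OF assms(1), of "{T, U}" Z] assms by (auto intro: sgrpI auts_comp)

lemma sgrp_inv:
  assumes "good \<theta> S" "T \<in> sgrp Z \<theta> S"
  shows "op_inv T \<in> sgrp Z \<theta> S"
  using sgrp_tame [OF assms(1), of "{T}" Z] assms by (auto intro: sgrpI op_inv_auts)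

lemma sgrp_id_left:
  assumes "good \<theta> S" "T \<in> sgrp Z \<theta> S"
  shows "op_comp op_id T = T"
  using sgrp_tame [OF assms(1), of "{T}" Z] assms by (auto intro: auts_id_left)

lemma sgrp_id_right:
  assumes "good \<theta> S" "T \<in> sgrp Z \<theta> S"
  shows "op_comp T op_id = T"
  using sgrp_tame [OF assms(1), of "{T}" Z] assms by (auto intro: auts_id_right)

lemma sgrp_analytic_comp:
  assumes "good \<theta> S" "T \<in> sgrp Z \<theta> S" "U \<in> sgrp Z \<theta> S" "analytic_element T" "analytic_element U"
  shows "analytic_element (op_comp T U)"
  using sgrp_tame [OF assms(1), of "{T, U}" Z] assms by (auto intro: analytic_comp)

lemma sgrp_analytic_inv:
  assumes "good \<theta> S" "T \<in> sgrp Z \<theta> S" "analytic_element T"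
  shows "analytic_element (op_inv T)"
  using sgrp_tame [OF assms(1), of "{T}" Z] assms by (auto intro: analytic_inv)

lemma pts_disjoint:
  assumes "S \<subseteq> hpi \<theta>" "T \<subseteq> hpi \<theta>" "S \<inter> T = {}"
  shows "pts Z \<theta> c S \<inter> pts Z \<theta> c' T = {}"
  using sector_Int [OF assms(1,2)] assms(3) by (auto simp: pts_def)

lemma sgrp_analytic_factors:
  assumes I: "good \<theta> I" and S: "is_interval S" "S \<subseteq> I" and T: "is_interval T" "T \<subseteq> I"
    and disj: "S \<inter> T = {}" and a: "a \<in> sgrp Z \<theta> S" and b: "b \<in> sgrp Z \<theta> T"
    and an: "analytic_element (op_comp a b)"
  shows "analytic_element a" "analytic_element b"
proof -
  have g: "good \<theta> S" "good \<theta> T"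
    using I S T by (auto simp: good_def)
  obtain c c' where c: "0 < c" "a \<in> auts (pts Z \<theta> c S)" "0 < c'" "b \<in> auts (pts Z \<theta> c' T)"
    using a b by (auto simp: sgrp_def)
  define e where "e = min c c'"
  have e: "0 < e" "pts Z \<theta> c S \<subseteq> pts Z \<theta> e I" "pts Z \<theta> c' T \<subseteq> pts Z \<theta> e I"
    unfolding e_def using c S T by (simp, intro pts_mono, simp_all)+
  have "pts Z \<theta> c S \<inter> pts Z \<theta> c' T = {}"
    using g disj by (intro pts_disjoint) (auto simp: good_def)
  moreover have "add_closed (pts Z \<theta> c S)" "add_closed (pts Z \<theta> c' T)"
    using add_closed_pts g c by (metis less_imp_le)+
  ultimately show "analytic_element a" "analytic_element b"
    using analytic_factors [OF tame_pts [OF I e(1)] _ _ e(2,3) _ c(2,4) an] by auto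
qed

lemma sgrp_factor_unique:
  assumes I: "good \<theta> I" and S: "is_interval S" "S \<subseteq> I" and T: "is_interval T" "T \<subseteq> I"
    and disj: "S \<inter> T = {}" and a: "a \<in> sgrp Z \<theta> S" "a' \<in> sgrp Z \<theta> S"
    and b: "b \<in> sgrp Z \<theta> T" "b' \<in> sgrp Z \<theta> T" and eq: "op_comp a b = op_comp a' b'"
  shows "a = a' \<and> b = b'"
proof -
  have g: "good \<theta> S" "good \<theta> T"
    using I S T by (auto simp: good_def)
  obtain c c' where c: "0 < c" "{a, a'} \<subseteq> auts (pts Z \<theta> c S)" "0 < c'" "{b, b'} \<subseteq> auts (pts Z \<theta> c' T)"
    using sgrp_common [of "{a, a'}" Z \<theta> S] sgrp_common [of "{b, b'}" Z \<theta> T] a b by auto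
  define e where "e = min c c'"
  have e: "0 < e" "pts Z \<theta> c S \<subseteq> pts Z \<theta> e I" "pts Z \<theta> c' T \<subseteq> pts Z \<theta> e I"
    unfolding e_def using c S T by (simp, intro pts_mono, simp_all)+
  have "pts Z \<theta> c S \<inter> pts Z \<theta> c' T = {}"
    using g disj by (intro pts_disjoint) (auto simp: good_def)
  then show ?thesis
    using c g by (intro factor_unique [OF tame_pts [OF I e(1)] _ _ e(2,3) _ _ _ _ _ eq])
      (auto intro: add_closed_pts)
qed

subsection \<open>Ordered products\<close>

definition ordered_prod :: "('b \<Rightarrow> 'n::finite oper) \<Rightarrow> 'b list \<Rightarrow> 'n oper" where
  "ordered_prod B xs = foldr op_comp (map B xs) op_id"

lemma ordered_prod_Nil [simp]: "ordered_prod B [] = op_id"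
  by (simp add: ordered_prod_def)

lemma ordered_prod_Cons [simp]: "ordered_prod B (x # xs) = op_comp (B x) (ordered_prod B xs)"
  by (simp add: ordered_prod_def)

lemma A_finite_eq: "A_finite \<sigma> F = ordered_prod (A_ray \<sigma>) (sorted_list_of_set F)"
  by (simp add: A_finite_def ordered_prod_def)

lemma ordered_prod_auts:
  "tame A \<Longrightarrow> (\<And>x. x \<in> set xs \<Longrightarrow> B x \<in> auts A) \<Longrightarrow> ordered_prod B xs \<in> auts A"
  by (induction xs) (simp_all add: auts_comp)

lemma ordered_prod_append:
  "tame A \<Longrightarrow> (\<And>x. x \<in> set xs \<union> set ys \<Longrightarrow> B x \<in> auts A) \<Longrightarrow>
    ordered_prod B (xs @ ys) = op_comp (ordered_prod B xs) (ordered_prod B ys)"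
proof (induction xs)
  case Nil
  then show ?case
    using ordered_prod_auts [of A ys B] by (simp add: auts_id_left)
next
  case (Cons x xs)
  have "ordered_prod B xs \<in> auts A" "ordered_prod B ys \<in> auts A" "B x \<in> auts A"
    using Cons.prems by (auto intro: ordered_prod_auts)
  then show ?case
    using Cons by (simp add: auts_assoc)
qed

lemma sorted_list_of_set_filter:
  assumes "finite F"
  shows "filter P (sorted_list_of_set F) = sorted_list_of_set {x \<in> F. P x}"
  by (rule sorted_distinct_set_unique) (use assms in \<open>auto simp: sorted_wrt_filter\<close>)

lemma sorted_list_of_set_union:
  assumes "finite F" "finite G" "\<And>x y. x \<in> F \<Longrightarrow> y \<in> G \<Longrightarrow> x < (y::real)"
  shows "sorted_list_of_set (F \<union> G) = sorted_list_of_set F @ sorted_list_of_set G"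
proof (rule sorted_distinct_set_unique)
  show "sorted (sorted_list_of_set F @ sorted_list_of_set G)"
    using assms by (auto simp: sorted_append less_imp_le)
  have "F \<inter> G = {}"
    using assms(3) by force
  then show "distinct (sorted_list_of_set F @ sorted_list_of_set G)"
    using assms by simp
qed (use assms in auto)

lemma sorted_list_of_set_shift:
  assumes "finite (F :: real set)"
  shows "sorted_list_of_set ((\<lambda>x. x + a) ` F) = map (\<lambda>x. x + a) (sorted_list_of_set F)"
proof (rule sorted_distinct_set_unique)
  show "sorted (map (\<lambda>x. x + a) (sorted_list_of_set F))"
    using sorted_sorted_list_of_set [of F] by (simp add: sorted_wrt_map)
  show "distinct (map (\<lambda>x. x + a) (sorted_list_of_set F))"
    by (simp add: distinct_map inj_on_def)
qed (use assms in auto)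

section \<open>Infinite ordered products as limits in each degree\<close>

context grading
begin

definition eq_upto :: "int \<Rightarrow> 'n oper \<Rightarrow> 'n oper \<Rightarrow> bool" where
  "eq_upto n S T \<longleftrightarrow> (\<forall>\<gamma> \<mu>. d \<mu> \<le> n \<longrightarrow> S \<gamma> \<mu> = T \<gamma> \<mu>)"

lemma eq_upto_refl [simp]: "eq_upto n T T"
  by (simp add: eq_upto_def)

lemma eq_upto_comp:
  assumes op: "M_op S" "M_op S'" "M_op T" "M_op T'" and eq: "eq_upto n S S'" "eq_upto n T T'"
  shows "eq_upto n (op_comp S T) (op_comp S' T')"
  unfolding eq_upto_def
proof (intro allI impI)
  fix \<gamma> \<rho> assume n: "d \<rho> \<le> n"
  have "T \<gamma> \<mu> * S (\<gamma> + \<mu>) (\<rho> - \<mu>) = T' \<gamma> \<mu> * S' (\<gamma> + \<mu>) (\<rho> - \<mu>)" if "\<mu> \<in> D \<rho>" for \<mu>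
  proof -
    have "d \<mu> \<le> n" "d (\<rho> - \<mu>) \<le> n"
      using D_deg [OF that] that d_nonneg [of \<mu>] n by (auto simp: D_def deg_diff)
    then show ?thesis
      using eq by (simp add: eq_upto_def)
  qed
  then show "op_comp S T \<gamma> \<rho> = op_comp S' T' \<gamma> \<rho>"
    by (simp add: op_comp_eq op)
qed

lemma ordered_prod_M_op:
  "(\<And>x. x \<in> set xs \<Longrightarrow> M_op (B x)) \<Longrightarrow> M_op (ordered_prod B xs)"
  by (induction xs) (simp_all add: M_op_comp)

lemma ordered_prod_filter:
  assumes "\<And>x. x \<in> set xs \<Longrightarrow> M_op (B x)" "\<And>x. x \<in> set xs \<Longrightarrow> \<not> P x \<Longrightarrow> eq_upto n (B x) op_id"
  shows "eq_upto n (ordered_prod B xs) (ordered_prod B (filter P xs))"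
  using assms
proof (induction xs)
  case (Cons x xs)
  have op: "M_op (B x)" "M_op (ordered_prod B xs)" "M_op (ordered_prod B (filter P xs))"
    using Cons.prems by (auto intro: ordered_prod_M_op)
  have IH: "eq_upto n (ordered_prod B xs) (ordered_prod B (filter P xs))"
    using Cons by simp
  show ?case
  proof (cases "P x")
    case True
    then show ?thesis
      using eq_upto_comp [OF op(1) op(1) op(2,3) _ IH] by simp
  next
    case False
    then have "eq_upto n (op_comp (B x) (ordered_prod B xs)) (op_comp op_id (ordered_prod B (filter P xs)))"
      using op Cons.prems by (intro eq_upto_comp IH) auto
    then show ?thesis
      using False op by (simp add: op_comp_id_left)
  qed
qed simp

definition rays_upto :: "'n stability_data \<Rightarrow> real set \<Rightarrow> int \<Rightarrow> real set" where
  "rays_upto \<sigma> S n = {\<theta> \<in> S. \<not> eq_upto n (A_ray \<sigma> \<theta>) op_id}"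

definition locally_finite :: "'n stability_data \<Rightarrow> real set \<Rightarrow> bool" where
  "locally_finite \<sigma> S \<longleftrightarrow> (\<forall>\<theta>\<in>S. A_ray \<sigma> \<theta> \<in> auts (M - {0})) \<and> (\<forall>n. finite (rays_upto \<sigma> S n))"

lemma locally_finite_subset: "locally_finite \<sigma> S \<Longrightarrow> T \<subseteq> S \<Longrightarrow> locally_finite \<sigma> T"
  unfolding locally_finite_def rays_upto_def by (auto intro: finite_subset [rotated])

lemma A_finite_stable:
  assumes lf: "locally_finite \<sigma> S" and F: "finite F" "rays_upto \<sigma> S n \<subseteq> F" "F \<subseteq> S"
  shows "eq_upto n (A_finite \<sigma> F) (A_finite \<sigma> (rays_upto \<sigma> S n))"
proof -
  have "eq_upto n (ordered_prod (A_ray \<sigma>) (sorted_list_of_set F))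
      (ordered_prod (A_ray \<sigma>) (filter (\<lambda>\<theta>. \<theta> \<in> rays_upto \<sigma> S n) (sorted_list_of_set F)))"
  proof (rule ordered_prod_filter)
    fix x assume "x \<in> set (sorted_list_of_set F)"
    then have "x \<in> S"
      using F by auto
    then show "M_op (A_ray \<sigma> x)"
      using lf auts_M_op [of "A_ray \<sigma> x" "M - {0}"] by (auto simp: locally_finite_def)
    assume "x \<notin> rays_upto \<sigma> S n"
    then show "eq_upto n (A_ray \<sigma> x) op_id"
      using \<open>x \<in> S\<close> by (simp add: rays_upto_def)
  qed
  moreover have "{x \<in> F. x \<in> rays_upto \<sigma> S n} = rays_upto \<sigma> S n"
    using F by auto
  ultimately show ?thesis
    using F by (simp add: A_finite_eq sorted_list_of_set_filter)
qed

text \<open>In degrees up to \<open>n\<close> the finite products stabilise as soon as they contain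
  the finitely many rays acting non-trivially there; the definite description in
  \<open>A_sector\<close> then denotes the stable value.\<close>

lemma A_sector_eq:
  assumes lf: "locally_finite \<sigma> S" and F: "finite F" "rays_upto \<sigma> S n \<subseteq> F" "F \<subseteq> S" and n: "d \<mu> \<le> n"
  shows "A_sector \<sigma> S \<gamma> \<mu> = A_finite \<sigma> F \<gamma> \<mu>"
proof -
  let ?R = "rays_upto \<sigma> S n"
  have const: "A_finite \<sigma> G \<gamma> \<mu> = A_finite \<sigma> ?R \<gamma> \<mu>" if "finite G" "?R \<subseteq> G" "G \<subseteq> S" for G
    using A_finite_stable [OF lf that] n by (simp add: eq_upto_def)
  have R: "finite ?R" "?R \<subseteq> S"
    using lf by (auto simp: locally_finite_def rays_upto_def)
  have ev: "\<forall>\<^sub>F G in finite_subsets_at_top S. A_finite \<sigma> G \<gamma> \<mu> = A_finite \<sigma> ?R \<gamma> \<mu>"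
    unfolding eventually_finite_subsets_at_top using R const by blast
  have "A_sector \<sigma> S \<gamma> \<mu> = A_finite \<sigma> ?R \<gamma> \<mu>"
    unfolding A_sector_def
  proof (rule the_equality)
    show "\<forall>\<^sub>F G in finite_subsets_at_top S. A_finite \<sigma> G \<gamma> \<mu> = A_finite \<sigma> ?R \<gamma> \<mu>"
      by (rule ev)
    fix c assume "\<forall>\<^sub>F G in finite_subsets_at_top S. A_finite \<sigma> G \<gamma> \<mu> = c"
    then have "\<forall>\<^sub>F G in finite_subsets_at_top S. c = A_finite \<sigma> ?R \<gamma> \<mu>"
      using ev by eventually_elim simp
    then show "c = A_finite \<sigma> ?R \<gamma> \<mu>"
      by (simp add: eventually_const)
  qed
  then show ?thesis
    using const [OF F] by simp
qed

lemma A_sector_auts_graded: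
  assumes A: "graded A" and lf: "locally_finite \<sigma> S" and ray: "\<And>\<theta>. \<theta> \<in> S \<Longrightarrow> A_ray \<sigma> \<theta> \<in> auts A"
  shows "A_sector \<sigma> S \<in> auts A"
proof -
  have t: "tame A"
    using A tame_graded by blast
  let ?R = "rays_upto \<sigma> S"
  have R: "finite (?R n)" "?R n \<subseteq> S" for n
    using lf by (auto simp: locally_finite_def rays_upto_def)
  have eq: "A_sector \<sigma> S \<gamma> \<mu> = A_finite \<sigma> (?R n) \<gamma> \<mu>" if "d \<mu> \<le> n" for \<gamma> \<mu> n
    using A_sector_eq [OF lf R(1) order_refl R(2) that] .
  have fin: "A_finite \<sigma> (?R n) \<in> auts A" for n
    unfolding A_finite_eq by (rule ordered_prod_auts [OF t]) (use R ray in auto)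
  have op: "op_on A (A_sector \<sigma> S)"
    unfolding op_on_def
  proof (intro allI impI)
    fix \<gamma> \<mu> assume "A_sector \<sigma> S \<gamma> \<mu> \<noteq> 0"
    then show "\<mu> \<in> insert 0 A"
      using eq [OF order_refl, of \<gamma> \<mu>] auts_outside [OF fin, of \<mu> "d \<mu>" \<gamma>] by auto
  qed
  have "A_sector \<sigma> S (\<gamma> + \<delta>) \<rho> = (\<Sum>\<mu>\<in>D \<rho>. A_sector \<sigma> S \<gamma> \<mu> * A_sector \<sigma> S \<delta> (\<rho> - \<mu>))" for \<gamma> \<delta> \<rho>
  proof -
    let ?T = "A_finite \<sigma> (?R (d \<rho>))"
    have "A_sector \<sigma> S (\<gamma> + \<delta>) \<rho> = (\<Sum>\<mu>\<in>D \<rho>. ?T \<gamma> \<mu> * ?T \<delta> (\<rho> - \<mu>))"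
      using fin [of "d \<rho>"] multiplicative_iff [OF auts_M_op [OF fin graded_M [OF A]]] eq [OF order_refl]
      by (simp add: auts_def)
    also have "\<dots> = (\<Sum>\<mu>\<in>D \<rho>. A_sector \<sigma> S \<gamma> \<mu> * A_sector \<sigma> S \<delta> (\<rho> - \<mu>))"
    proof (rule sum.cong [OF refl])
      fix \<mu> assume \<mu>: "\<mu> \<in> D \<rho>"
      then have "d \<mu> \<le> d \<rho>" "d (\<rho> - \<mu>) \<le> d \<rho>"
        using D_deg [OF \<mu>] d_nonneg [of \<mu>] by (auto simp: D_def deg_diff)
      then show "?T \<gamma> \<mu> * ?T \<delta> (\<rho> - \<mu>) = A_sector \<sigma> S \<gamma> \<mu> * A_sector \<sigma> S \<delta> (\<rho> - \<mu>)"
        by (simp add: eq)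
    qed
    finally show ?thesis .
  qed
  moreover have "A_sector \<sigma> S \<gamma> 0 = 1" for \<gamma>
    using eq [of 0 0 \<gamma>] fin [of 0] by (simp add: auts_def)
  ultimately show ?thesis
    using op op_on_mono [OF op graded_M [OF A]] by (simp add: auts_def multiplicative_iff)
qed

lemma A_sector_Un_graded:
  assumes lf: "locally_finite \<sigma> (S \<union> T)" and less: "\<And>x y. x \<in> S \<Longrightarrow> y \<in> T \<Longrightarrow> x < y"
  shows "A_sector \<sigma> (S \<union> T) = op_comp (A_sector \<sigma> S) (A_sector \<sigma> T)"
proof (intro ext)
  fix \<gamma> \<rho>
  have lf': "locally_finite \<sigma> S" "locally_finite \<sigma> T"
    using lf locally_finite_subset by blast+
  define F where "F = rays_upto \<sigma> S (d \<rho>)"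
  define G where "G = rays_upto \<sigma> T (d \<rho>)"
  have FG: "finite F" "finite G" "F \<subseteq> S" "G \<subseteq> T" "rays_upto \<sigma> (S \<union> T) (d \<rho>) = F \<union> G"
    using lf' by (auto simp: F_def G_def locally_finite_def rays_upto_def)
  have t: "tame (M - {0})"
    using graded_M0 tame_graded by blast
  have ray: "A_ray \<sigma> x \<in> auts (M - {0})" if "x \<in> S \<union> T" for x
    using lf that by (auto simp: locally_finite_def)
  have AF: "A_finite \<sigma> F \<in> auts (M - {0})" "A_finite \<sigma> G \<in> auts (M - {0})"
    unfolding A_finite_eq by (intro ordered_prod_auts [OF t] ray; use FG in auto)+
  have "A_sector \<sigma> S \<in> auts (M - {0})" "A_sector \<sigma> T \<in> auts (M - {0})"
    by (intro A_sector_auts_graded graded_M0 lf' ray; simp)+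
  then have op: "M_op (A_sector \<sigma> S)" "M_op (A_sector \<sigma> T)" "M_op (A_finite \<sigma> F)" "M_op (A_finite \<sigma> G)"
    using AF auts_M_op by blast+
  have "A_sector \<sigma> (S \<union> T) \<gamma> \<rho> = A_finite \<sigma> (F \<union> G) \<gamma> \<rho>"
    using FG by (intro A_sector_eq [OF lf, of _ "d \<rho>"]) auto
  also have "A_finite \<sigma> (F \<union> G) = op_comp (A_finite \<sigma> F) (A_finite \<sigma> G)"
  proof -
    have "sorted_list_of_set (F \<union> G) = sorted_list_of_set F @ sorted_list_of_set G"
      using FG less by (intro sorted_list_of_set_union) blast+
    then show ?thesis
      unfolding A_finite_eq using FG ray by (simp, intro ordered_prod_append [OF t]) auto
  qed
  also have "op_comp (A_finite \<sigma> F) (A_finite \<sigma> G) \<gamma> \<rho> = op_comp (A_sector \<sigma> S) (A_sector \<sigma> T) \<gamma> \<rho>"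
    unfolding op_comp_eq [OF op(3,4)] op_comp_eq [OF op(1,2)]
  proof (rule sum.cong [OF refl])
    fix \<mu> assume \<mu>: "\<mu> \<in> D \<rho>"
    then have "d \<mu> \<le> d \<rho>" "d (\<rho> - \<mu>) \<le> d \<rho>"
      using D_deg [OF \<mu>] d_nonneg [of \<mu>] by (auto simp: D_def deg_diff)
    then show "A_finite \<sigma> G \<gamma> \<mu> * A_finite \<sigma> F (\<gamma> + \<mu>) (\<rho> - \<mu>)
        = A_sector \<sigma> T \<gamma> \<mu> * A_sector \<sigma> S (\<gamma> + \<mu>) (\<rho> - \<mu>)"
      using A_sector_eq [OF lf'(1) FG(1), of "d \<rho>"] A_sector_eq [OF lf'(2) FG(2), of "d \<rho>"] FG
      by (simp add: F_def G_def)
  qed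
  finally show "A_sector \<sigma> (S \<union> T) \<gamma> \<rho> = op_comp (A_sector \<sigma> S) (A_sector \<sigma> T) \<gamma> \<rho>" .
qed

lemma vf_exp_eq_upto_id:
  assumes "\<xi> \<in> lie_on (M - {0})" "\<And>\<nu>. d \<nu> \<le> n \<Longrightarrow> \<xi> \<nu> = 0"
  shows "eq_upto n (vf_exp \<xi>) op_id"
proof -
  have 0: "(\<lambda>_. 0) \<in> lie_on (M - {0})"
    by (simp add: lie_on_def)
  have "vf_exp (\<lambda>_. 0) \<in> auts ({} :: (int ^ 'n) set)"
    by (rule vf_exp_auts) (auto simp: graded_def add_closed_def lie_on_def)
  then have id: "vf_exp (\<lambda>_. 0) = (op_id :: 'n oper)"
    by (rule auts_empty)
  have "vf_exp \<xi> \<gamma> \<mu> = op_id \<gamma> \<mu>" if "d \<mu> \<le> n" for \<gamma> \<mu>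
  proof -
    have "vf_exp \<xi> \<gamma> \<mu> - vf_exp (\<lambda>_. 0) \<gamma> \<mu> = vf_op \<xi> \<gamma> \<mu> - vf_op (\<lambda>_. 0) \<gamma> \<mu>"
      by (rule vf_exp_triangular [OF assms(1) 0]) (use that assms(2) in auto)
    then show ?thesis
      using that assms(2) by (simp add: id vf_op_def)
  qed
  then show ?thesis
    by (simp add: eq_upto_def)
qed

end

subsection \<open>Factors of stability data\<close>

text \<open>The support property in its metric form, which is the form needed for estimates.\<close>

definition support_bound :: "'n::finite stability_data \<Rightarrow> real \<Rightarrow> bool" where
  "support_bound \<sigma> \<kappa> \<longleftrightarrow> 0 < \<kappa> \<and> (\<forall>\<gamma>. snd \<sigma> \<gamma> \<noteq> 0 \<longrightarrow> \<kappa> * norm (rvec \<gamma>) \<le> cmod (charge (fst \<sigma>) \<gamma>))"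

text \<open>The part of the unit sphere where \<open>Q\<close> is non-negative is compact and avoids
  the kernel of the charge, on which \<open>Q\<close> is negative. So the charge is bounded below
  there, and scaling does the rest.\<close>

lemma Stab_support_bound:
  fixes \<sigma> :: "'n::finite stability_data"
  assumes "\<sigma> \<in> Stab"
  shows "\<exists>\<kappa>. support_bound \<sigma> \<kappa>"
proof -
  obtain Z a where \<sigma>: "\<sigma> = (Z, a)"
    by (cases \<sigma>)
  obtain Q :: "real ^ 'n \<Rightarrow> real" where Q: "quadratic_form Q"
    and neg: "\<And>u. u \<noteq> 0 \<Longrightarrow> charge_real Z u = 0 \<Longrightarrow> Q u < 0"
    and supp: "\<And>\<gamma>. a \<gamma> \<noteq> 0 \<Longrightarrow> 0 \<le> Q (rvec \<gamma>)"
    using assms unfolding Stab_def \<sigma> by blast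
  obtain B where B: "bilinear B" "\<And>u. Q u = B u u"
    using Q by (auto simp: quadratic_form_def)
  have cont: "continuous_on UNIV Q"
    unfolding B(2) by (intro bilinear_continuous_on_compose [OF _ _ B(1)] continuous_on_id)
  have scale: "Q (r *\<^sub>R u) = r\<^sup>2 * Q u" for r u
    using B by (simp add: bilinear_lmul bilinear_rmul power2_eq_square)
  define K where "K = sphere 0 1 \<inter> {u. 0 \<le> Q u}"
  have "closed {u. 0 \<le> Q u}"
    using cont by (intro closed_Collect_le continuous_on_const) auto
  then have K: "compact K"
    unfolding K_def by (intro compact_Int_closed compact_sphere)
  have contZ: "continuous_on K (\<lambda>u. cmod (charge_real Z u))"
    using linear_continuous_on [OF linear_conv_bounded_linear [THEN iffD1, OF linear_charge_real]]
    by (intro continuous_on_norm) auto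
  have "\<exists>\<kappa>>0. \<forall>u\<in>K. \<kappa> \<le> cmod (charge_real Z u)"
  proof (cases "K = {}")
    case False
    obtain u where u: "u \<in> K" "\<And>v. v \<in> K \<Longrightarrow> cmod (charge_real Z u) \<le> cmod (charge_real Z v)"
      using continuous_attains_inf [OF K False contZ] by blast
    have "charge_real Z u \<noteq> 0"
      using u(1) neg [of u] by (cases "u = 0") (auto simp: K_def)
    then show ?thesis
      using u by (intro exI [of _ "cmod (charge_real Z u)"]) auto
  qed (auto intro: exI [of _ 1])
  then obtain \<kappa> where \<kappa>: "0 < \<kappa>" "\<And>u. u \<in> K \<Longrightarrow> \<kappa> \<le> cmod (charge_real Z u)"
    by blast
  have "\<kappa> * norm (rvec \<gamma>) \<le> cmod (charge Z \<gamma>)" if "a \<gamma> \<noteq> 0" for \<gamma>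
  proof (cases "rvec \<gamma> = 0")
    case False
    define n where "n = norm (rvec \<gamma>)"
    define u where "u = (1 / n) *\<^sub>R rvec \<gamma>"
    have n: "0 < n"
      using False by (simp add: n_def)
    have "u \<in> K"
      using n supp [OF that] by (simp add: K_def u_def scale n_def)
    then have "\<kappa> \<le> cmod (charge_real Z u)"
      by (rule \<kappa>)
    also have "charge_real Z u = (1 / n) *\<^sub>R charge Z \<gamma>"
      unfolding u_def charge_def by (rule linear_cmul [OF linear_charge_real])
    finally show ?thesis
      using n by (simp add: n_def field_simps)
  qed simp
  then show ?thesis
    using \<kappa>(1) by (auto simp: support_bound_def \<sigma>)
qed

text \<open>The cosine bound keeps \<open>S\<close> at a positive angle from both ends of the
  half-plane. It converts a lower bound on the modulus of a charge into one on
  \<open>hp \<theta>\<close>.\<close>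

definition well_inside :: "real \<Rightarrow> real set \<Rightarrow> bool" where
  "well_inside \<theta> S \<longleftrightarrow> S \<subseteq> hpi \<theta> \<and> (\<exists>\<delta>>0. \<forall>x\<in>S. \<delta> \<le> cos (x - \<theta>))"

lemma well_inside_subset: "well_inside \<theta> S \<Longrightarrow> T \<subseteq> S \<Longrightarrow> well_inside \<theta> T"
  unfolding well_inside_def by blast

lemma well_inside_Icc:
  assumes "a \<in> hpi \<theta>" "b \<in> hpi \<theta>"
  shows "well_inside \<theta> {a..b}"
proof -
  have sub: "{a..b} \<subseteq> hpi \<theta>"
    using assms by (auto simp: hpi_def)
  have "\<exists>\<delta>>0. \<forall>x\<in>{a..b}. \<delta> \<le> cos (x - \<theta>)"
  proof (cases "a \<le> b")
    case True
    have "continuous_on {a..b} (\<lambda>x. cos (x - \<theta>))"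
      by (intro continuous_intros)
    then obtain x where "x \<in> {a..b}" "\<And>y. y \<in> {a..b} \<Longrightarrow> cos (x - \<theta>) \<le> cos (y - \<theta>)"
      using continuous_attains_inf [of "{a..b}" "\<lambda>x. cos (x - \<theta>)"] True by auto
    then show ?thesis
      using cos_pos_hpi [of x \<theta>] sub by (intro exI [of _ "cos (x - \<theta>)"]) auto
  qed (auto intro: exI [of _ 1])
  then show ?thesis
    using sub by (simp add: well_inside_def)
qed

lemma support_in_pts:
  assumes \<sigma>: "support_bound \<sigma> \<kappa>" and \<delta>: "\<And>x. x \<in> S \<Longrightarrow> \<delta> \<le> cos (x - \<theta>)" "0 < \<delta>"
    and \<gamma>: "snd \<sigma> \<gamma> \<noteq> 0" "charge (fst \<sigma>) \<gamma> \<in> sector S"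
  shows "\<gamma> \<in> pts (fst \<sigma>) \<theta> (\<kappa> * \<delta>) S"
proof -
  obtain r x where r: "0 < r" "x \<in> S" "charge (fst \<sigma>) \<gamma> = of_real r * cis (- x)"
    using \<gamma>(2) by (rule sectorE)
  have "\<kappa> * norm (rvec \<gamma>) \<le> r"
    using \<sigma> \<gamma>(1) r(1) unfolding support_bound_def r(3) by (metis abs_of_pos norm_cis norm_mult norm_of_real mult.right_neutral r(3))
  then have "\<delta> * (\<kappa> * norm (rvec \<gamma>)) \<le> \<delta> * r"
    using \<delta>(2) by (intro mult_left_mono) auto
  also have "\<dots> \<le> r * cos (x - \<theta>)"
    using \<delta>(1) [OF r(2)] r(1) by (simp add: mult.commute)
  finally show ?thesis
    using \<gamma>(2) by (simp add: pts_def r(3) hp_polar mult_ac)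
qed

text \<open>One grading and one constant serve all rays in \<open>I\<close>, so that their infinite
  product can be formed in a single graded group. Local finiteness holds because finitely many
  lattice points have degree up to \<open>n\<close>, and each of them lies over at most one ray in
  \<open>I\<close>.\<close>

lemma A_sector_facts:
  fixes \<sigma> :: "'n::finite stability_data"
  assumes \<sigma>: "\<sigma> \<in> Stab" and I: "well_inside \<theta> I" "is_interval I"
  shows "\<exists>l c. 0 < c \<and> grading.graded l (pts (fst \<sigma>) \<theta> c I) \<and> grading.locally_finite l \<sigma> I
    \<and> (\<forall>S\<subseteq>I. \<forall>x\<in>S. A_ray \<sigma> x \<in> auts (pts (fst \<sigma>) \<theta> c S))"
proof -
  obtain \<kappa> where \<kappa>: "support_bound \<sigma> \<kappa>"
    using Stab_support_bound [OF \<sigma>] by blast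
  obtain \<delta> where \<delta>: "0 < \<delta>" "\<And>x. x \<in> I \<Longrightarrow> \<delta> \<le> cos (x - \<theta>)"
    using I by (auto simp: well_inside_def)
  define c where "c = \<kappa> * \<delta>"
  have c: "0 < c"
    using \<kappa> \<delta> by (simp add: c_def support_bound_def)
  have sub: "I \<subseteq> hpi \<theta>"
    using I by (simp add: well_inside_def)
  obtain l where l: "grading.graded l (pts (fst \<sigma>) \<theta> c I)"
    using tame_pts [of \<theta> I c "fst \<sigma>"] I sub c by (auto simp: good_def tame_graded)
  interpret grading l .
  define \<xi> where "\<xi> x = (\<lambda>\<gamma>. if charge (fst \<sigma>) \<gamma> \<in> sector {x} then snd \<sigma> \<gamma> else 0)" for x
  have A_ray: "A_ray \<sigma> x = vf_exp (\<xi> x)" for x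
    by (simp add: A_ray_def \<xi>_def)
  have \<xi>: "\<xi> x \<in> lie_on (pts (fst \<sigma>) \<theta> c {x})" if "x \<in> I" for x
    using support_in_pts [OF \<kappa>, of "{x}" \<delta> \<theta>] \<delta> that by (auto simp: lie_on_def \<xi>_def c_def)
  have ray: "A_ray \<sigma> x \<in> auts (pts (fst \<sigma>) \<theta> c S)" if "x \<in> S" "S \<subseteq> I" for x S
  proof -
    have "tame (pts (fst \<sigma>) \<theta> c {x})"
      using that sub c is_interval_cc [of x x] by (intro tame_pts) (auto simp: good_def)
    then have "A_ray \<sigma> x \<in> auts (pts (fst \<sigma>) \<theta> c {x})"
      unfolding A_ray using \<xi> that by (intro vf_exp_in_auts) auto
    moreover have "auts (pts (fst \<sigma>) \<theta> c {x}) \<subseteq> auts (pts (fst \<sigma>) \<theta> c S)"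
      using that by (intro auts_mono pts_mono) auto
    ultimately show ?thesis
      by blast
  qed
  have \<xi>M: "\<xi> x \<in> lie_on (M - {0})" if "x \<in> I" for x
    using lie_on_graded [OF l lie_on_mono [OF \<xi> [OF that] pts_mono]] that by auto
  have "finite (rays_upto \<sigma> I n)" for n
  proof -
    have "rays_upto \<sigma> I n \<subseteq> (\<Union>\<gamma>\<in>{\<mu> \<in> M. d \<mu> \<le> n}. {x \<in> I. charge (fst \<sigma>) \<gamma> \<in> sector {x}})"
    proof
      fix x assume x: "x \<in> rays_upto \<sigma> I n"
      then have xI: "x \<in> I"
        by (simp add: rays_upto_def)
      have "\<exists>\<nu>. d \<nu> \<le> n \<and> \<xi> x \<nu> \<noteq> 0"
        using x vf_exp_eq_upto_id [OF \<xi>M [OF xI], of n] by (auto simp: rays_upto_def A_ray)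
      then obtain \<nu> where \<nu>: "d \<nu> \<le> n" "\<xi> x \<nu> \<noteq> 0"
        by blast
      then have "\<nu> \<in> M"
        using \<xi>M [OF xI] by (auto simp: lie_on_def)
      then show "x \<in> (\<Union>\<gamma>\<in>{\<mu> \<in> M. d \<mu> \<le> n}. {x \<in> I. charge (fst \<sigma>) \<gamma> \<in> sector {x}})"
        using \<nu> xI by (auto simp: \<xi>_def split: if_splits)
    qed
    moreover have "finite {x \<in> I. charge (fst \<sigma>) \<gamma> \<in> sector {x}}" for \<gamma>
    proof -
      have "x = y" if "x \<in> I" "y \<in> I" "charge (fst \<sigma>) \<gamma> \<in> sector {x}" "charge (fst \<sigma>) \<gamma> \<in> sector {y}" for x y
        using sector_Int [of "{x}" \<theta> "{y}"] that sub by (cases "x = y") auto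
      then have "{x \<in> I. charge (fst \<sigma>) \<gamma> \<in> sector {x}} \<subseteq> {THE x. x \<in> I \<and> charge (fst \<sigma>) \<gamma> \<in> sector {x}}"
        by (auto intro!: the_equality [symmetric])
      then show ?thesis
        by (rule finite_subset) simp
    qed
    then have "finite (\<Union>\<gamma>\<in>{\<mu> \<in> M. d \<mu> \<le> n}. {x \<in> I. charge (fst \<sigma>) \<gamma> \<in> sector {x}})"
      by (intro finite_UN_I finite_box)
    ultimately show ?thesis
      by (rule finite_subset)
  qed
  moreover have "A_ray \<sigma> x \<in> auts (M - {0})" if "x \<in> I" for x
    using ray [OF that order_refl] auts_mono [of "pts (fst \<sigma>) \<theta> c I" "M - {0}"] l by (auto simp: graded_def)
  ultimately have "locally_finite \<sigma> I"
    by (simp add: locally_finite_def)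
  then show ?thesis
    using c l ray by (intro exI [of _ l] exI [of _ c] conjI) auto
qed

lemma A_sector_sgrp:
  assumes \<sigma>: "\<sigma> \<in> Stab" and I: "well_inside \<theta> I" "is_interval I" and S: "S \<subseteq> I" "is_interval S"
  shows "A_sector \<sigma> S \<in> sgrp (fst \<sigma>) \<theta> S"
proof -
  obtain l c where lc: "0 < c" "grading.graded l (pts (fst \<sigma>) \<theta> c I)" "grading.locally_finite l \<sigma> I"
    "\<And>S x. S \<subseteq> I \<Longrightarrow> x \<in> S \<Longrightarrow> A_ray \<sigma> x \<in> auts (pts (fst \<sigma>) \<theta> c S)"
    using A_sector_facts [OF \<sigma> I] by blast
  interpret grading l .
  have "add_closed (pts (fst \<sigma>) \<theta> c S)"
    using S I lc(1) by (intro add_closed_pts) (auto simp: good_def well_inside_def)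
  moreover have "pts (fst \<sigma>) \<theta> c S \<subseteq> pts (fst \<sigma>) \<theta> c I"
    using S by (intro pts_mono) auto
  ultimately have "graded (pts (fst \<sigma>) \<theta> c S)"
    using lc(2) by (auto simp: graded_def)
  then have "A_sector \<sigma> S \<in> auts (pts (fst \<sigma>) \<theta> c S)"
    using lc S by (intro A_sector_auts_graded locally_finite_subset [OF lc(3)]) auto
  then show ?thesis
    using lc(1) by (rule sgrpI [rotated])
qed

lemma A_sector_Un:
  assumes \<sigma>: "\<sigma> \<in> Stab" and I: "well_inside \<theta> I" "is_interval I" and ST: "S \<subseteq> I" "T \<subseteq> I"
    and less: "\<And>x y. x \<in> S \<Longrightarrow> y \<in> T \<Longrightarrow> x < y"
  shows "A_sector \<sigma> (S \<union> T) = op_comp (A_sector \<sigma> S) (A_sector \<sigma> T)"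
proof -
  obtain l where l: "grading.locally_finite l \<sigma> I"
    using A_sector_facts [OF \<sigma> I] by blast
  interpret grading l .
  show ?thesis
    using ST by (intro A_sector_Un_graded less locally_finite_subset [OF l]) auto
qed

lemma A_sector_empty: "A_sector \<sigma> {} = op_id"
proof (intro ext)
  fix \<gamma> \<mu>
  have "A_finite \<sigma> {} = op_id"
    by (simp add: A_finite_eq)
  then show "A_sector \<sigma> {} \<gamma> \<mu> = op_id \<gamma> \<mu>"
    unfolding A_sector_def by (simp add: finite_subsets_at_top_finite eventually_principal)
qed

text \<open>Rays depend on their angle only modulo a full turn, and a shift preserves the order of
  the factors.\<close>

lemma A_sector_shift:
  fixes k :: int
  shows "A_sector \<sigma> ((\<lambda>x. x + 2 * pi * of_int k) ` S) = A_sector \<sigma> S"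
proof -
  let ?f = "\<lambda>x. x + 2 * pi * of_int k"
  have ray: "A_ray \<sigma> (?f x) = A_ray \<sigma> x" for x
    using sector_shift [of k "{x}"] by (simp add: A_ray_def)
  have fin: "A_finite \<sigma> (?f ` F) = A_finite \<sigma> F" if "finite F" for F
    using that by (simp add: A_finite_def sorted_list_of_set_shift o_def ray)
  have "inj_on ?f S"
    by (simp add: inj_on_def)
  then have filt: "finite_subsets_at_top (?f ` S) = filtermap ((`) ?f) (finite_subsets_at_top S)"
    by (rule filtermap_image_finite_subsets_at_top [symmetric])
  have "(\<forall>\<^sub>F F in finite_subsets_at_top (?f ` S). A_finite \<sigma> F \<gamma> \<mu> = c)
      \<longleftrightarrow> (\<forall>\<^sub>F F in finite_subsets_at_top S. A_finite \<sigma> F \<gamma> \<mu> = c)" for \<gamma> \<mu> c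
  proof -
    have "(\<forall>\<^sub>F F in finite_subsets_at_top S. A_finite \<sigma> (?f ` F) \<gamma> \<mu> = c)
        \<longleftrightarrow> (\<forall>\<^sub>F F in finite_subsets_at_top S. A_finite \<sigma> F \<gamma> \<mu> = c)"
      by (rule eventually_cong [OF eventually_finite_subsets_at_top_weakI [of S finite]]) (simp_all add: fin)
    then show ?thesis
      by (simp add: filt eventually_filtermap)
  qed
  then show ?thesis
    by (simp add: A_sector_def fun_eq_iff)
qed

subsection \<open>Cones over sectors\<close>

text \<open>The functional is positive on the unit vectors of the cone, which form a compact
  set.\<close>

lemma cones_over_bound:
  assumes C: "C \<in> cones_over Z V" and V: "\<And>z. z \<in> V \<Longrightarrow> 0 < hp \<theta> z"
  shows "\<exists>c>0. \<forall>u\<in>C. c * norm u \<le> hp \<theta> (charge_real Z u)"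
proof -
  have cl: "closed C" and cone: "conic C" and img: "\<And>u. u \<in> C \<Longrightarrow> u \<noteq> 0 \<Longrightarrow> charge_real Z u \<in> V"
    using C by (auto simp: cones_over_def strict_closed_cone_def convex_cone_def)
  define K where "K = sphere 0 1 \<inter> C"
  have K: "compact K"
    unfolding K_def using cl by (intro compact_Int_closed compact_sphere)
  have cont: "continuous_on K (\<lambda>u. hp \<theta> (charge_real Z u))"
    using linear_hp by (intro linear_continuous_on) (simp add: linear_conv_bounded_linear)
  have "\<exists>c>0. \<forall>u\<in>K. c \<le> hp \<theta> (charge_real Z u)"
  proof (cases "K = {}")
    case False
    obtain u where u: "u \<in> K" "\<And>v. v \<in> K \<Longrightarrow> hp \<theta> (charge_real Z u) \<le> hp \<theta> (charge_real Z v)"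
      using continuous_attains_inf [OF K False cont] by blast
    moreover have "u \<noteq> 0"
      using u(1) by (auto simp: K_def)
    then have "0 < hp \<theta> (charge_real Z u)"
      using u(1) img V by (auto simp: K_def)
    ultimately show ?thesis
      by blast
  qed (auto intro: exI [of _ 1])
  then obtain c where c: "0 < c" "\<And>u. u \<in> K \<Longrightarrow> c \<le> hp \<theta> (charge_real Z u)"
    by blast
  have "c * norm u \<le> hp \<theta> (charge_real Z u)" if "u \<in> C" for u
  proof (cases "u = 0")
    case False
    have "(1 / norm u) *\<^sub>R u \<in> K"
      using that cone False by (simp add: K_def conic_def)
    then have "c \<le> hp \<theta> (charge_real Z ((1 / norm u) *\<^sub>R u))"
      by (rule c)
    also have "\<dots> = (1 / norm u) *\<^sub>R hp \<theta> (charge_real Z u)"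
      by (rule linear_cmul [OF linear_hp])
    finally show ?thesis
      using False by (simp add: field_simps)
  qed (simp add: hp_def)
  then show ?thesis
    using c(1) by blast
qed

lemma lie_sector_pts:
  assumes \<xi>: "\<xi> \<in> lie_sector Z (sector S)" and S: "S \<subseteq> hpi \<theta>"
  shows "\<exists>c>0. \<xi> \<in> lie_on (pts Z \<theta> c S)"
proof -
  obtain C where C: "C \<in> cones_over Z (sector S)" and \<xi>C: "\<xi> \<in> lie_cone C"
    using \<xi> by (auto simp: lie_sector_def)
  obtain c where c: "0 < c" "\<And>u. u \<in> C \<Longrightarrow> c * norm u \<le> hp \<theta> (charge_real Z u)"
  proof -
    have "0 < hp \<theta> z" if "z \<in> sector S" for z
      using that half_plane [of \<theta>] sector_mono [OF S] by blast
    then show ?thesis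
      using cones_over_bound [OF C] that by blast
  qed
  have "\<gamma> \<in> pts Z \<theta> c S" if "\<xi> \<gamma> \<noteq> 0" for \<gamma>
  proof -
    have \<gamma>: "rvec \<gamma> \<in> C" "\<gamma> \<noteq> 0"
      using \<xi>C that by (auto simp: lie_cone_def)
    then have "rvec \<gamma> \<noteq> 0"
      by (auto simp: rvec_def vec_eq_iff)
    then show ?thesis
      using C c \<gamma> by (auto simp: cones_over_def pts_def charge_def)
  qed
  then show ?thesis
    using c(1) by (auto simp: lie_on_def)
qed

lemma vf_exp_sgrp:
  assumes \<xi>: "\<xi> \<in> lie_sector Z (sector S)" and S: "good \<theta> S"
  shows "vf_exp \<xi> \<in> sgrp Z \<theta> S" "vf_exp (\<lambda>\<gamma>. - \<xi> \<gamma>) = op_inv (vf_exp \<xi>)"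
proof -
  obtain c where c: "0 < c" "\<xi> \<in> lie_on (pts Z \<theta> c S)"
    using lie_sector_pts [OF \<xi>] S by (auto simp: good_def)
  have t: "tame (pts Z \<theta> c S)"
    using tame_pts S c by blast
  show "vf_exp \<xi> \<in> sgrp Z \<theta> S"
    using c by (intro sgrpI [of c] vf_exp_in_auts t)
  show "vf_exp (\<lambda>\<gamma>. - \<xi> \<gamma>) = op_inv (vf_exp \<xi>)"
    by (rule vf_exp_uminus_inv [OF t c(2)])
qed

text \<open>Explicit closed cones through which the lattice sets \<open>pts\<close> are turned back
  into the cones demanded by \<open>group_sector\<close> and \<open>lie_sector\<close>. Two angles
  give a cone over the intersection of two half-planes.\<close>

definition half_cone :: "complex ^ 'n::finite \<Rightarrow> real \<Rightarrow> real set \<Rightarrow> (real ^ 'n) set" where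
  "half_cone Z c \<Theta> = {u. \<forall>\<theta>\<in>\<Theta>. c * norm u \<le> hp \<theta> (charge_real Z u)}"

lemma half_cone_cones_over:
  assumes c: "0 < c" and \<Theta>: "\<Theta> \<noteq> {}" and V: "\<And>z. (\<And>\<theta>. \<theta> \<in> \<Theta> \<Longrightarrow> 0 < hp \<theta> z) \<Longrightarrow> z \<in> V"
  shows "half_cone Z c \<Theta> \<in> cones_over Z V"
proof -
  let ?C = "half_cone Z c \<Theta>"
  have lin: "hp \<theta> (charge_real Z (a *\<^sub>R u + b *\<^sub>R v)) = a * hp \<theta> (charge_real Z u) + b * hp \<theta> (charge_real Z v)"
    for \<theta> a b u v
    using linear_add [OF linear_hp [of \<theta> Z], of "a *\<^sub>R u" "b *\<^sub>R v"]
      linear_cmul [OF linear_hp [of \<theta> Z], of a u] linear_cmul [OF linear_hp [of \<theta> Z], of b v] by simp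
  have "?C = (\<Inter>\<theta>\<in>\<Theta>. {u. c * norm u \<le> hp \<theta> (charge_real Z u)})"
    by (auto simp: half_cone_def)
  moreover have "closed {u. c * norm u \<le> hp \<theta> (charge_real Z u)}" for \<theta>
  proof (rule closed_Collect_le)
    show "continuous_on UNIV (\<lambda>u. hp \<theta> (charge_real Z u))"
      using linear_hp by (intro linear_continuous_on) (simp add: linear_conv_bounded_linear)
  qed (intro continuous_intros)
  ultimately have cl: "closed ?C"
    by auto
  have comb: "a *\<^sub>R u + b *\<^sub>R v \<in> ?C" if "u \<in> ?C" "v \<in> ?C" "0 \<le> a" "0 \<le> b" for a b u v
    unfolding half_cone_def
  proof (intro CollectI ballI)
    fix \<theta> assume \<theta>: "\<theta> \<in> \<Theta>"
    have "norm (a *\<^sub>R u + b *\<^sub>R v) \<le> a * norm u + b * norm v"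
      using norm_triangle_ineq [of "a *\<^sub>R u" "b *\<^sub>R v"] that by simp
    then have "c * norm (a *\<^sub>R u + b *\<^sub>R v) \<le> c * (a * norm u + b * norm v)"
      using c by (intro mult_left_mono) auto
    also have "\<dots> = a * (c * norm u) + b * (c * norm v)"
      by (simp add: algebra_simps)
    also have "\<dots> \<le> a * hp \<theta> (charge_real Z u) + b * hp \<theta> (charge_real Z v)"
      using that \<theta> by (intro add_mono mult_left_mono) (auto simp: half_cone_def)
    finally show "c * norm (a *\<^sub>R u + b *\<^sub>R v) \<le> hp \<theta> (charge_real Z (a *\<^sub>R u + b *\<^sub>R v))"
      by (simp add: lin)
  qed
  have zero: "0 \<in> ?C"
    by (simp add: half_cone_def hp_def)
  have "conic ?C"
    unfolding conic_def using comb [of _ 0 _ 0] zero by auto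
  moreover have "convex ?C"
    unfolding convex_def using comb by blast
  ultimately have cone: "convex_cone ?C"
    using zero by (auto simp: convex_cone_def)
  have noline: False if v: "v \<noteq> 0" and sub: "range (\<lambda>t. u + t *\<^sub>R v) \<subseteq> ?C" for u v
  proof -
    obtain \<theta> where \<theta>: "\<theta> \<in> \<Theta>"
      using \<Theta> by blast
    define h where "h = hp \<theta> (charge_real Z u)"
    \<comment> \<open>At \<open>u + t v\<close> and \<open>u - t v\<close> the values of the
      functional always add up to \<open>2 * h\<close>, while the norms grow with \<open>t\<close>;
      this \<open>t\<close> makes \<open>t * (c * norm v)\<close> exceed \<open>h\<close>.\<close>
    define t where "t = (\<bar>h\<bar> + 1) / (c * norm v)"
    have cv: "0 < c * norm v"
      using c v by simp
    have ut: "c * norm (u + s *\<^sub>R v) \<le> hp \<theta> (charge_real Z (u + s *\<^sub>R v))" for s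
      using sub \<theta> by (auto simp: half_cone_def)
    have eq: "(u + t *\<^sub>R v) - (u + (- t) *\<^sub>R v) = (2 * t) *\<^sub>R v"
      by (simp add: algebra_simps flip: scaleR_2)
    have "norm ((2 * t) *\<^sub>R v) \<le> norm (u + t *\<^sub>R v) + norm (u + (- t) *\<^sub>R v)"
      unfolding eq [symmetric] by (rule norm_triangle_ineq4)
    then have "c * norm ((2 * t) *\<^sub>R v) \<le> c * (norm (u + t *\<^sub>R v) + norm (u + (- t) *\<^sub>R v))"
      using c by (intro mult_left_mono) auto
    also have "\<dots> \<le> hp \<theta> (charge_real Z (u + t *\<^sub>R v)) + hp \<theta> (charge_real Z (u + (- t) *\<^sub>R v))"
      using ut [of t] ut [of "- t"] by (simp add: distrib_left)
    also have "\<dots> = 2 * h"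
      using lin [of \<theta> 1 u t v] lin [of \<theta> 1 u "- t" v] by (simp add: h_def)
    finally have "2 * (t * (c * norm v)) \<le> 2 * h"
      using c v by (simp add: t_def abs_mult)
    moreover have "t * (c * norm v) = \<bar>h\<bar> + 1"
      using c v by (simp add: t_def)
    ultimately show False
      by linarith
  qed
  have pos: "0 < hp \<theta> (charge_real Z u)" if "u \<in> ?C" "u \<noteq> 0" "\<theta> \<in> \<Theta>" for u \<theta>
  proof -
    have "0 < c * norm u"
      using c that by simp
    then show ?thesis
      using that unfolding half_cone_def by force
  qed
  have ker: "charge_real Z u \<noteq> 0" if "u \<in> ?C" "u \<noteq> 0" for u
    using pos [OF that] \<Theta> by (force simp: hp_def)
  have "charge_real Z ` (?C - {0}) \<subseteq> V"
    using pos V by blast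
  moreover have "?C \<inter> {u. charge_real Z u = 0} = {0}"
    using zero ker by auto
  ultimately show ?thesis
    unfolding cones_over_def strict_closed_cone_def using cl cone noline by blast
qed

lemma rvec_eq_0: "rvec \<gamma> = 0 \<longleftrightarrow> \<gamma> = 0"
  by (auto simp: rvec_def vec_eq_iff)

lemma half_cone_lattice:
  fixes Z :: "complex ^ 'n::finite"
  assumes "0 < c" "\<Theta> \<noteq> {}"
  shows "lie_cone (half_cone Z c \<Theta>) = lie_on (\<Inter>\<theta>\<in>\<Theta>. pts Z \<theta> c (hpi \<theta>))"
proof -
  have "(\<gamma> \<noteq> 0 \<and> rvec \<gamma> \<in> half_cone Z c \<Theta>) \<longleftrightarrow> \<gamma> \<in> (\<Inter>\<theta>\<in>\<Theta>. pts Z \<theta> c (hpi \<theta>))" for \<gamma> :: "int ^ 'n"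
  proof
    assume \<gamma>: "\<gamma> \<noteq> 0 \<and> rvec \<gamma> \<in> half_cone Z c \<Theta>"
    then have "0 < c * norm (rvec \<gamma>)"
      using assms by (simp add: rvec_eq_0)
    then show "\<gamma> \<in> (\<Inter>\<theta>\<in>\<Theta>. pts Z \<theta> c (hpi \<theta>))"
      using \<gamma> by (force simp: half_cone_def pts_def half_plane charge_def)
  next
    assume \<gamma>: "\<gamma> \<in> (\<Inter>\<theta>\<in>\<Theta>. pts Z \<theta> c (hpi \<theta>))"
    then have "\<gamma> \<noteq> 0"
      using assms(2) by (auto simp: pts_def)
    then show "\<gamma> \<noteq> 0 \<and> rvec \<gamma> \<in> half_cone Z c \<Theta>"
      using \<gamma> by (auto simp: half_cone_def pts_def charge_def)
  qed
  then show ?thesis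
    unfolding lie_cone_def lie_on_def by blast
qed

lemma op_inv_id: "op_inv op_id = op_id"
proof -
  have t: "tame ({} :: (int ^ 'n) set)"
    by (simp add: tame_def add_closed_def)
  show ?thesis
    by (rule auts_empty) (rule op_inv_auts [OF t auts_id])
qed

subsection \<open>Cuts\<close>

text \<open>A cut just before \<open>t\<close> (for \<open>b\<close> true) or just after it.
  Differences of cuts give both kinds of semiclosed intervals, and cuts of either kind are linearly
  ordered by inclusion.\<close>

definition lower_cut :: "bool \<Rightarrow> real \<Rightarrow> real set" where
  "lower_cut b t = (if b then {..<t} else {..t})"

lemma lower_cut_mono: "s \<le> t \<Longrightarrow> lower_cut b s \<subseteq> lower_cut b t"
  by (auto simp: lower_cut_def)

lemma less_in_lower_cut: "x < t \<Longrightarrow> x \<in> lower_cut b t"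
  by (simp add: lower_cut_def)

lemma greater_notin_lower_cut: "t < x \<Longrightarrow> x \<notin> lower_cut b t"
  by (simp add: lower_cut_def)

lemma lower_cut_less: "x \<in> lower_cut b t \<Longrightarrow> y \<notin> lower_cut b t \<Longrightarrow> x < y"
  by (auto simp: lower_cut_def split: if_splits)

lemma is_interval_lower_cut [simp]: "is_interval (lower_cut b t)"
  by (auto simp: lower_cut_def is_interval_1)

lemma is_interval_minus_lower_cut: "is_interval S \<Longrightarrow> is_interval (S - lower_cut b t)"
  by (auto simp: lower_cut_def is_interval_1)

lemma lower_cut_shift: "lower_cut b (t + a) = (\<lambda>x. x + a) ` lower_cut b t"
proof (intro set_eqI iffI)
  fix x assume "x \<in> lower_cut b (t + a)"
  then have "x - a \<in> lower_cut b t"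
    by (auto simp: lower_cut_def split: if_splits)
  then show "x \<in> (\<lambda>x. x + a) ` lower_cut b t"
    by (rule rev_image_eqI) simp
qed (auto simp: lower_cut_def split: if_splits)

lemma lower_cut_diff_shift: "lower_cut b (t + a) - lower_cut b' (s + a) = (\<lambda>x. x + a) ` (lower_cut b t - lower_cut b' s)"
  unfolding lower_cut_shift by (rule image_set_diff [symmetric]) (simp add: inj_on_def)

text \<open>An element on an overlap is viewed over two half-planes, with centres \<theta> and
  \<theta>' and separate constants. Factoring inside the intersection of the two supports yields
  factors that are valid for both.\<close>

lemma sgrp_split:
  assumes J: "good \<theta> J" "good \<theta>' J" "J = J1 \<union> J2" "J1 \<inter> J2 = {}" "is_interval J1" "is_interval J2"
    and X: "X \<in> sgrp Z \<theta> J \<inter> sgrp Z \<theta>' J"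
  shows "\<exists>a\<in>sgrp Z \<theta> J1 \<inter> sgrp Z \<theta>' J1. \<exists>b\<in>sgrp Z \<theta> J2 \<inter> sgrp Z \<theta>' J2. X = op_comp a b"
proof -
  obtain c c' where c: "0 < c" "0 < c'" "X \<in> auts (pts Z \<theta> c J)" "X \<in> auts (pts Z \<theta>' c' J)"
    using X by (auto simp: sgrp_def)
  define A where "A S = pts Z \<theta> c S \<inter> pts Z \<theta>' c' S" for S
  have g: "good \<theta> J1" "good \<theta>' J1" "good \<theta> J2" "good \<theta>' J2"
    using J by (auto simp: good_def)
  have ac: "add_closed (A S)" if "good \<theta> S" "good \<theta>' S" for S
    using add_closed_pts [OF that(1), of c Z] add_closed_pts [OF that(2), of c' Z] c
    by (simp add: A_def add_closed_def)
  have "tame (A J)"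
    unfolding A_def using c by (intro tame_Int tame_pts J add_closed_pts) auto
  moreover have "X \<in> auts (A J)"
    unfolding A_def using c by (simp flip: auts_Int)
  moreover have "A J = A J1 \<union> A J2"
    using sector_Un [of J1 J2] J(3) by (auto simp: A_def pts_def)
  moreover have "A J1 \<inter> A J2 = {}"
    using sector_Int [of J1 \<theta> J2] J(4) g by (auto simp: A_def pts_def good_def)
  ultimately obtain a b where ab: "a \<in> auts (A J1)" "b \<in> auts (A J2)" "X = op_comp a b"
    using factor_exists [of "A J" "A J1" "A J2" X] ac g by blast
  have sub: "auts (A S) \<subseteq> sgrp Z \<theta> S \<inter> sgrp Z \<theta>' S" for S
    unfolding A_def auts_Int [symmetric] using c by (auto intro: sgrpI)
  show ?thesis
    using ab sub by blast
qed

section \<open>Propagation of analyticity across one sector\<close>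

lemma auts_rearrange_right:
  assumes P: "tame P" "{h, Q, R, Q', R', A} \<subseteq> auts P"
    and eq: "op_comp h (op_comp Q R) = op_comp (op_comp Q' R') A"
  shows "op_comp (op_inv Q') h = op_comp (op_comp (op_comp R' A) (op_inv R)) (op_inv Q)"
proof -
  note rules = auts_assoc [OF P(1)] auts_comp [OF P(1)] op_inv_auts [OF P(1)] op_inv_cancel_left [OF P(1)]
    op_inv_cancel_left' [OF P(1)] op_inv_right [OF P(1)] op_inv_left [OF P(1)] auts_id_right [OF P(1)]
  have "h = op_comp (op_comp h (op_comp Q R)) (op_comp (op_inv R) (op_inv Q))"
    using P(2) by (simp add: rules)
  also have "\<dots> = op_comp (op_comp (op_comp Q' R') A) (op_comp (op_inv R) (op_inv Q))"
    by (simp only: eq)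
  finally have "op_comp (op_inv Q') h
      = op_comp (op_inv Q') (op_comp (op_comp (op_comp Q' R') A) (op_comp (op_inv R) (op_inv Q)))"
    by simp
  then show ?thesis
    using P(2) by (simp add: rules)
qed

lemma auts_rearrange_left:
  assumes P: "tame P" "{h, x, y, x', y', A} \<subseteq> auts P"
    and eq: "op_comp h (op_comp x y) = op_comp (op_comp x' y') A"
  shows "op_comp h x = op_comp x' (op_comp (op_comp y' A) (op_inv y))"
proof -
  note rules = auts_assoc [OF P(1)] auts_comp [OF P(1)] op_inv_auts [OF P(1)] op_inv_cancel_left [OF P(1)]
    op_inv_cancel_left' [OF P(1)] op_inv_right [OF P(1)] op_inv_left [OF P(1)] auts_id_right [OF P(1)]
  have "op_comp h x = op_comp (op_comp h (op_comp x y)) (op_inv y)"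
    using P(2) by (simp add: rules)
  also have "\<dots> = op_comp (op_comp (op_comp x' y') A) (op_inv y)"
    by (simp only: eq)
  finally show ?thesis
    using P(2) by (simp add: rules)
qed

text \<open>The relation gives \<open>Q'^-1 h = (R' A R^-1) Q^-1\<close>. The left side is analytic
  and the right side is a factorisation along the cut, so \<open>Q^-1\<close> is analytic.\<close>

lemma analytic_step_right:
  assumes I: "good \<theta> I" and L: "is_interval L" "L \<subseteq> I" and U: "is_interval U" "U \<subseteq> I" and disj: "L \<inter> U = {}"
    and Q: "Q \<in> sgrp Z \<theta> U" "Q' \<in> sgrp Z \<theta> U"
    and R: "R \<in> sgrp Z \<theta> L" "R' \<in> sgrp Z \<theta> L" "A \<in> sgrp Z \<theta> L"
    and h: "h \<in> sgrp Z \<theta> I" and eq: "op_comp h (op_comp Q R) = op_comp (op_comp Q' R') A"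
    and an: "analytic_element h" "analytic_element Q'"
  shows "analytic_element Q"
proof -
  have gU: "good \<theta> U" and gL: "good \<theta> L"
    using I U L by (auto simp: good_def)
  have all: "{h, Q, R, Q', R', A} \<subseteq> sgrp Z \<theta> I"
    using Q R h sgrp_mono [OF U(2), of Z \<theta>] sgrp_mono [OF L(2), of Z \<theta>] by auto
  obtain c where c: "tame (pts Z \<theta> c I)" "{h, Q, R, Q', R', A} \<subseteq> auts (pts Z \<theta> c I)"
    using sgrp_tame [OF I _ all] by blast
  have "analytic_element (op_comp (op_inv Q') h)"
    using all an by (intro sgrp_analytic_comp [OF I] sgrp_analytic_inv [OF I] sgrp_inv [OF I]) auto
  then have "analytic_element (op_comp (op_comp (op_comp R' A) (op_inv R)) (op_inv Q))"
    by (simp only: auts_rearrange_right [OF c eq])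
  moreover have "op_comp (op_comp R' A) (op_inv R) \<in> sgrp Z \<theta> L" "op_inv Q \<in> sgrp Z \<theta> U"
    using R Q by (auto intro: sgrp_comp sgrp_inv gU gL)
  ultimately have "analytic_element (op_inv Q)"
    using sgrp_analytic_factors(2) [OF I L U disj] by blast
  then have "analytic_element (op_inv (op_inv Q))"
    by (rule sgrp_analytic_inv [OF gU sgrp_inv [OF gU Q(1)]])
  then show ?thesis
    using op_inv_op_inv [OF c(1)] c(2) by simp
qed

text \<open>Here the relation becomes \<open>h x = x' (y' A y^-1)\<close>, again a factorisation
  along the cut, with the unknown \<open>x'\<close> as its left factor.\<close>

lemma analytic_step_left:
  assumes I: "good \<theta> I" and L: "is_interval L" "L \<subseteq> I" and U: "is_interval U" "U \<subseteq> I" and disj: "L \<inter> U = {}"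
    and x: "x \<in> sgrp Z \<theta> L" "x' \<in> sgrp Z \<theta> L"
    and y: "y \<in> sgrp Z \<theta> U" "y' \<in> sgrp Z \<theta> U" "A \<in> sgrp Z \<theta> U"
    and h: "h \<in> sgrp Z \<theta> I" and eq: "op_comp h (op_comp x y) = op_comp (op_comp x' y') A"
    and an: "analytic_element h" "analytic_element x"
  shows "analytic_element x'"
proof -
  have gU: "good \<theta> U" and gL: "good \<theta> L"
    using I U L by (auto simp: good_def)
  have all: "{h, x, y, x', y', A} \<subseteq> sgrp Z \<theta> I"
    using x y h sgrp_mono [OF U(2), of Z \<theta>] sgrp_mono [OF L(2), of Z \<theta>] by auto
  obtain c where c: "tame (pts Z \<theta> c I)" "{h, x, y, x', y', A} \<subseteq> auts (pts Z \<theta> c I)"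
    using sgrp_tame [OF I _ all] by blast
  have "analytic_element (op_comp h x)"
    using all an by (intro sgrp_analytic_comp [OF I]) auto
  then have "analytic_element (op_comp x' (op_comp (op_comp y' A) (op_inv y)))"
    by (simp only: auts_rearrange_left [OF c eq])
  moreover have "op_comp (op_comp y' A) (op_inv y) \<in> sgrp Z \<theta> U"
    using y by (auto intro: sgrp_comp sgrp_inv gU)
  ultimately show ?thesis
    using sgrp_analytic_factors(1) [OF I L U disj] x by blast
qed

subsection \<open>Cyclic covers\<close>

text \<open>The cover in terms of angles on the universal covering of the circle: admissibility
  becomes a bound on the width, and non-empty intersections become strict overlaps of
  intervals.\<close>

definition lifted_cover :: "nat \<Rightarrow> (int \<Rightarrow> complex set) \<Rightarrow> (int \<Rightarrow> real) \<Rightarrow> (int \<Rightarrow> real) \<Rightarrow> bool" where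
  "lifted_cover m V lo hi \<longleftrightarrow> (\<forall>i. V i = sector {lo i<..<hi i} \<and> hi i \<le> lo i + pi \<and> lo i < hi i
     \<and> lo i \<le> lo (i + 1) \<and> hi i \<le> hi (i + 1) \<and> lo (i + 1) < hi i
     \<and> lo (i + int m) = lo i + 2 * pi \<and> hi (i + int m) = hi i + 2 * pi)"

lemma open_admissible_width:
  assumes "admissible_angles {a<..<b :: real}"
  shows "a < b \<and> b \<le> a + pi"
proof -
  have ab: "a < b"
    using assms by (auto simp: admissible_angles_def)
  consider c e where "{a<..<b} \<subseteq> {c..e}" "e - c < pi" | c where "{a<..<b} = {c<..<c + pi}"
    using assms by (auto simp: admissible_angles_def)
  then have "b \<le> a + pi"
  proof cases
    case 1
    then have "closure {a<..<b} \<subseteq> {c..e}"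
      by (intro closure_minimal) auto
    then have "c \<le> a" "b \<le> e"
      using ab by auto
    then show ?thesis
      using 1 by simp
  next
    case 2
    then have "closure {a<..<b} = closure {c<..<c + pi}"
      by simp
    then have "{a..b} = {c..c + pi}"
      using ab by simp
    then show ?thesis
      using ab by (simp add: Icc_eq_Icc)
  qed
  with ab show ?thesis
    by simp
qed

text \<open>Two angles of the same point differ by a multiple of a full turn, and the width bounds
  make this difference smaller than a full turn.\<close>

lemma sector_inter_lift:
  assumes I: "hi \<le> lo + pi" "lo < hi" and I': "hi' \<le> lo' + pi" and le: "lo \<le> lo'" "lo' \<le> hi" "hi \<le> hi'"
  shows "sector {lo<..<hi} \<inter> sector {lo'<..<hi'} = sector {lo'<..<hi :: real}"
proof
  show "sector {lo'<..<hi} \<subseteq> sector {lo<..<hi} \<inter> sector {lo'<..<hi'}"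
    using le by (intro Int_greatest sector_mono) auto
  show "sector {lo<..<hi} \<inter> sector {lo'<..<hi'} \<subseteq> sector {lo'<..<hi}"
  proof
    fix z assume z: "z \<in> sector {lo<..<hi} \<inter> sector {lo'<..<hi'}"
    then obtain r x where 1: "0 < r" "x \<in> {lo<..<hi}" "z = of_real r * cis (- x)"
      by (auto elim!: sectorE)
    from z obtain s y where 2: "0 < s" "y \<in> {lo'<..<hi'}" "z = of_real s * cis (- y)"
      by (auto elim!: sectorE)
    have "of_real r * cis (- x) = of_real s * cis (- y)"
      using 1 2 by simp
    then obtain k :: int where k: "y = x + 2 * pi * of_int k"
      using polar_eq 1(1) 2(1) by blast
    have "y - x < 2 * pi" "x - y < 2 * pi"
      using 1(2) 2(2) I I' le pi_gt_zero by auto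
    then have "\<bar>2 * pi * of_int k\<bar> < 2 * pi * 1"
      unfolding k by linarith
    then have "\<bar>of_int k\<bar> < (1 :: real)"
      unfolding abs_mult by (simp add: mult_less_cancel_left_pos)
    then have "x = y"
      using k by (simp flip: of_int_abs)
    then show "z \<in> sector {lo'<..<hi}"
      using 1 2 by (auto intro!: sectorI)
  qed
qed

lemma open_cyclic_cover_lifted:
  assumes "open_cyclic_cover m V"
  shows "\<exists>lo hi. lifted_cover m V lo hi"
proof -
  obtain lo hi :: "int \<Rightarrow> real" where *: "\<And>i. V i = sector {lo i<..<hi i} \<and> admissible_angles {lo i<..<hi i} \<and>
        lo i \<le> lo (i + 1) \<and> lo (i + 1) \<le> hi i \<and> hi i \<le> hi (i + 1) \<and>
        lo (i + int m) = lo i + 2 * pi \<and> hi (i + int m) = hi i + 2 * pi"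
    and ne: "\<And>i. V i \<inter> V (i + 1) \<noteq> {}"
    using assms unfolding open_cyclic_cover_def by blast
  have w: "lo i < hi i" "hi i \<le> lo i + pi" for i
    using open_admissible_width * by blast+
  have "lo (i + 1) < hi i" for i
  proof (rule ccontr)
    assume "\<not> lo (i + 1) < hi i"
    then have "V i \<inter> V (i + 1) = sector {}"
      using sector_inter_lift [of "hi i" "lo i" "hi (i + 1)" "lo (i + 1)"] * w by simp
    then show False
      using ne [of i] by simp
  qed
  then show ?thesis
    using * w unfolding lifted_cover_def by blast
qed

lemma lifted_cover_Int:
  "lifted_cover m V lo hi \<Longrightarrow> V i \<inter> V (i + 1) = sector {lo (i + 1)<..<hi i}"
  using sector_inter_lift [of "hi i" "lo i" "hi (i + 1)" "lo (i + 1)"]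
  by (simp add: lifted_cover_def less_imp_le)

lemma sector_closure_ends:
  assumes "{a<..<b :: real} \<subseteq> S" "a < b" "x \<in> {a..b}"
  shows "cis (- x) \<in> closure (sector S) - {0}"
proof -
  have "closure {a<..<b} = {a..b}"
    using assms by simp
  moreover have "(\<lambda>x. cis (- x)) ` closure {a<..<b} \<subseteq> closure ((\<lambda>x. cis (- x)) ` {a<..<b})"
    by (intro continuous_image_closure_subset [of UNIV] continuous_intros) auto
  moreover have "(\<lambda>x. cis (- x)) ` {a<..<b} \<subseteq> sector S"
    using assms(1) sectorI [of 1 _ S] by fastforce
  then have "closure ((\<lambda>x. cis (- x)) ` {a<..<b}) \<subseteq> closure (sector S)"
    by (rule closure_mono)
  ultimately have "cis (- x) \<in> closure (sector S)"
    using assms(3) by blast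
  then show ?thesis
    by simp
qed

text \<open>The cover and the decomposition carry independent lifts of the angles. Each boundary
  \<open>t i\<close> fits the sector \<open>V i\<close> after some number \<open>k i\<close> of full
  turns; consecutive sectors force these numbers to be equal, and one common shift makes the lifts
  agree.\<close>

lemma decomposition_lift:
  assumes V: "lifted_cover m V lo hi" and S: "sector_decomposition m V S"
  shows "\<exists>b t. (\<forall>i. (\<forall>\<sigma>. A_sector \<sigma> (S i) = A_sector \<sigma> (lower_cut b (t (i + 1)) - lower_cut b (t i)))
    \<and> t i < t (i + 1) \<and> t (i + int m) = t i + 2 * pi \<and> lo i < t i \<and> t (i + 1) < hi i)"
proof -
  obtain t :: "int \<Rightarrow> real" where t: "\<And>i. t (i + int m) = t i + 2 * pi"
    and type: "(\<forall>i. S i = {t i..<t (i + 1)}) \<or> (\<forall>i. S i = {t i<..t (i + 1)})"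
    and adm: "\<And>i. admissible_angles (S i)" and cl: "\<And>i. closure (sector (S i)) - {0} \<subseteq> V i"
    using S unfolding sector_decomposition_def by blast
  obtain b where b: "\<And>i. S i = lower_cut b (t (i + 1)) - lower_cut b (t i)"
  proof -
    have "{t i..<t (i + 1)} = lower_cut True (t (i + 1)) - lower_cut True (t i)"
      "{t i<..t (i + 1)} = lower_cut False (t (i + 1)) - lower_cut False (t i)" for i
      by (auto simp: lower_cut_def)
    then show ?thesis
      using type that by metis
  qed
  have lt: "t i < t (i + 1)" for i
    using adm [of i] type by (auto simp: admissible_angles_def)
  have sub: "{t i<..<t (i + 1)} \<subseteq> S i" for i
    using type by auto
  note V = V [unfolded lifted_cover_def, rule_format]
  have lift: "\<exists>k::int. lo i + 2 * pi * of_int k < x \<and> x < hi i + 2 * pi * of_int k" if "x \<in> {t i..t (i + 1)}" for i x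
  proof -
    have "cis (- x) \<in> V i"
      using sector_closure_ends [OF sub lt that] cl by blast
    then have "cis (- x) \<in> sector {lo i<..<hi i}"
      using V by simp
    then obtain r y where y: "0 < r" "y \<in> {lo i<..<hi i}" "cis (- x) = of_real r * cis (- y)"
      by (elim sectorE)
    then have "of_real r * cis (- y) = of_real 1 * cis (- x)"
      by simp
    then obtain k :: int where "x = y + 2 * pi * of_int k"
      using polar_eq y(1) by (metis zero_less_one)
    then show ?thesis
      using y(2) by (intro exI [of _ k]) auto
  qed
  have "\<forall>i. \<exists>k::int. lo i + 2 * pi * of_int k < t i \<and> t i < hi i + 2 * pi * of_int k"
    using lift lt by (meson atLeastAtMost_iff less_imp_le order_refl)
  then obtain k :: "int \<Rightarrow> int" where k: "\<And>i. lo i + 2 * pi * of_int (k i) < t i" "\<And>i. t i < hi i + 2 * pi * of_int (k i)"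
    by metis
  have int_gap: "2 * pi * of_int p + 2 * pi \<le> 2 * pi * of_int q" if "p < q" for p q :: int
  proof -
    have "of_int p + 1 \<le> (of_int q :: real)"
      using that by linarith
    then have "2 * pi * (of_int p + 1) \<le> 2 * pi * of_int q"
      by (intro mult_left_mono) auto
    then show ?thesis
      by (simp add: distrib_left)
  qed
  \<comment> \<open>Otherwise the right end of this lift of \<open>V i\<close> lies between
    \<open>t i\<close> and \<open>t (i + 1)\<close>, hence inside another lift of the same sector.
    That lift starts at least a full turn later, which a width of at most pi rules out.\<close>
  have hi: "t (i + 1) < hi i + 2 * pi * of_int (k i)" for i
  proof (rule ccontr)
    assume "\<not> t (i + 1) < hi i + 2 * pi * of_int (k i)"
    then have "hi i + 2 * pi * of_int (k i) \<in> {t i..t (i + 1)}"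
      using k(2) [of i] by auto
    then obtain j :: int where j: "lo i + 2 * pi * of_int j < hi i + 2 * pi * of_int (k i)"
      "hi i + 2 * pi * of_int (k i) < hi i + 2 * pi * of_int j"
      using lift by blast
    then have "k i < j"
      by simp
    then show False
      using int_gap [of "k i" j] j(1) V [of i] pi_gt_zero by linarith
  qed
  have kSuc: "k (i + 1) = k i" for i
  proof -
    have "\<not> k i < k (i + 1)"
      using int_gap [of "k i" "k (i + 1)"] k(1) [of "i + 1"] hi [of i] V [of i] pi_gt_zero by linarith
    moreover have "\<not> k (i + 1) < k i"
      using int_gap [of "k (i + 1)" "k i"] k [of "i + 1"] k [of i] lt [of i] V [of i] V [of "i + 1"] pi_gt_zero by linarith
    ultimately show ?thesis
      by simp
  qed
  have k0: "k i = k 0" for i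
  proof (induction i rule: int_induct [of _ 0])
    case (step2 i)
    then show ?case
      using kSuc [of "i - 1"] by simp
  qed (simp_all add: kSuc)
  define t' where "t' i = t i - 2 * pi * of_int (k 0)" for i
  have "A_sector \<sigma> (S i) = A_sector \<sigma> (lower_cut b (t' (i + 1)) - lower_cut b (t' i))" for \<sigma> i
  proof -
    have "S i = lower_cut b (t' (i + 1) + 2 * pi * of_int (k 0)) - lower_cut b (t' i + 2 * pi * of_int (k 0))"
      by (simp add: b t'_def)
    then show ?thesis
      unfolding lower_cut_diff_shift by (simp only: A_sector_shift)
  qed
  moreover have "t' i < t' (i + 1) \<and> t' (i + int m) = t' i + 2 * pi \<and> lo i < t' i \<and> t' (i + 1) < hi i" for i
    using lt [of i] t [of i] k(1) [of i] hi [of i] k0 [of i] by (simp add: t'_def)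
  ultimately show ?thesis
    by blast
qed

subsection \<open>Analyticity of the factors of analytic stability data\<close>

lemma analytic_id: "analytic_element op_id"
  unfolding analytic_element_def analytic_series_def
proof
  fix \<gamma> :: "int ^ 'n"
  have "finite {\<mu> \<in> UNIV. norm (op_id \<gamma> \<mu> * torus_monomial (\<chi> i. 1) \<mu>) \<noteq> 0}"
    by (rule finite_subset [of _ "{0}"]) (auto simp: op_id_def)
  then have "(\<lambda>\<mu>. norm (op_id \<gamma> \<mu> * torus_monomial (\<chi> i. 1) \<mu>)) summable_on UNIV"
    by (rule finite_nonzero_values_imp_summable_on)
  then show "\<exists>x :: complex ^ 'n. (\<forall>i. x $ i \<noteq> 0) \<and> (\<lambda>\<mu>. norm (op_id \<gamma> \<mu> * torus_monomial x \<mu>)) summable_on UNIV"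
    by (intro exI [of _ "\<chi> i. 1"]) simp
qed

lemma sgrp_empty: "T \<in> sgrp Z \<theta> {} \<Longrightarrow> T = op_id"
  by (auto simp: sgrp_def pts_def intro: auts_empty)

lemma increasing_int:
  fixes t :: "int \<Rightarrow> real"
  assumes "\<And>i. t i < t (i + 1)" "i \<le> j"
  shows "t i \<le> t j"
  using assms(2)
proof (induction j rule: int_ge_induct)
  case (step j)
  then show ?case
    using assms(1) [of j] by simp
qed simp

lemma A_sector_piece:
  fixes \<sigma> :: "'n::finite stability_data"
  assumes \<sigma>: "\<sigma> \<in> Stab" and st: "s \<in> hpi \<theta>" "t \<in> hpi \<theta>"
  shows "A_sector \<sigma> (lower_cut b t - lower_cut b' s) \<in> sgrp (fst \<sigma>) \<theta> (lower_cut b t - lower_cut b' s)"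
proof (rule A_sector_sgrp [OF \<sigma> well_inside_Icc [OF st]])
  show "is_interval {s..t}"
    by (simp add: is_interval_cc)
  show "lower_cut b t - lower_cut b' s \<subseteq> {s..t}"
    by (auto simp: lower_cut_def split: if_splits)
  show "is_interval (lower_cut b t - lower_cut b' s)"
    by (rule is_interval_minus_lower_cut) simp
qed

text \<open>
  Fix a cut \<open>L\<close> at \<open>t (j + 1)\<close>. The factors \<open>Q i\<close> of \<open>E i = Q i R i\<close> lying beyond \<open>L\<close> are analytic by
  induction on \<open>i \<le> j\<close>, starting where the sector ends before \<open>L\<close>; those of the opposite
  factorisation \<open>E i = x i y i\<close> lying before \<open>L\<close> are analytic by downward induction on \<open>i \<ge> j\<close>.
  For \<open>i = j\<close> the two factorisations combine to \<open>R y\<^sup>-\<^sup>1 = Q\<^sup>-\<^sup>1 x\<close>.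
\<close>

lemma analytic_gauge:
  fixes \<sigma> :: "'n::finite stability_data"
  assumes \<sigma>: "\<sigma> \<in> Stab" and V: "lifted_cover m V lo hi"
    and t: "\<And>i. t i < t (i + 1)" "\<And>i. t (i + int m) = t i + 2 * pi" "\<And>i. lo i < t i" "\<And>i. t (i + 1) < hi i"
    and \<zeta>: "\<And>i. \<zeta> i \<in> lie_sector (fst \<sigma>) (V i \<inter> V (i + 1))"
    and an: "\<And>i. analytic_element (gauge_act \<zeta> (\<lambda>i. A_sector \<sigma> (lower_cut b (t (i + 1)) - lower_cut b (t i))) i)"
  shows "analytic_element (A_sector \<sigma> (lower_cut b (t (j + 1)) - lower_cut b (t j)))"
proof -
  define Z where "Z = fst \<sigma>"
  define \<theta> where "\<theta> i = (lo i + hi i) / 2" for i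
  define I where "I i = {lo i<..<hi i}" for i
  define J where "J i = {lo (i + 1)<..<hi i}" for i
  define S where "S i = lower_cut b (t (i + 1)) - lower_cut b (t i)" for i
  define E where "E i = vf_exp (\<zeta> i)" for i
  define A where "A i = A_sector \<sigma> (S i)" for i
  define h where "h i = gauge_act \<zeta> A i" for i
  note V' = V [unfolded lifted_cover_def, rule_format]
  have gI: "good (\<theta> i) (I i)" for i
    using V' [of i] by (auto simp: good_def \<theta>_def I_def hpi_def is_interval_oo field_simps)
  have JI: "J i \<subseteq> I i" "J i \<subseteq> I (i + 1)" for i
    using V' [of i] by (auto simp: J_def I_def)
  have iJ: "is_interval (J i)" "is_interval (I i)" for i
    by (simp_all add: J_def I_def is_interval_oo)
  have gJ: "good (\<theta> i) (J i)" "good (\<theta> (i + 1)) (J i)" for i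
    using gI JI iJ unfolding good_def by blast+
  have E: "E i \<in> sgrp Z (\<theta> i) (J i)" "E i \<in> sgrp Z (\<theta> (i + 1)) (J i)"
    and E_inv: "vf_exp (\<lambda>\<gamma>. - \<zeta> i \<gamma>) = op_inv (E i)" for i
    using vf_exp_sgrp [OF _ gJ(1), of "\<zeta> i" Z] vf_exp_sgrp [OF _ gJ(2), of "\<zeta> i" Z] \<zeta> [of i]
    unfolding lifted_cover_Int [OF V] by (auto simp: E_def Z_def J_def)
  have SI: "S i \<subseteq> I i" for i
    using t(3) [of i] t(4) [of i] by (auto simp: S_def I_def lower_cut_def split: if_splits)
  have A: "A i \<in> sgrp Z (\<theta> i) (S i)" for i
    unfolding A_def S_def Z_def
  proof (rule A_sector_piece [OF \<sigma>])
    show "t i \<in> hpi (\<theta> i)" "t (i + 1) \<in> hpi (\<theta> i)"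
      using gI [of i] t(1) [of i] t(3) [of i] t(4) [of i] by (auto simp: good_def I_def)
  qed
  have up: "T \<in> sgrp Z (\<theta> i) (I i)" if "T \<in> sgrp Z (\<theta> i) X" "X \<subseteq> I i" for T X i
    using that sgrp_mono by blast
  have EI: "E i \<in> sgrp Z (\<theta> i) (I i)" "E (i - 1) \<in> sgrp Z (\<theta> i) (I i)" for i
    using up [OF E(1) JI(1)] up [of "E (i - 1)" i "J (i - 1)"] E(2) [of "i - 1"] JI(2) [of "i - 1"] by simp_all
  have AI: "A i \<in> sgrp Z (\<theta> i) (I i)" for i
    by (rule up [OF A SI])
  have h_eq: "h i = op_comp (E (i - 1)) (op_comp (A i) (op_inv (E i)))" for i
    by (simp add: h_def gauge_act_def E_def E_inv [unfolded E_def])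
  have hI: "h i \<in> sgrp Z (\<theta> i) (I i)" for i
    unfolding h_eq by (intro sgrp_comp sgrp_inv gI EI AI)
  \<comment> \<open>The gauge action rewritten as a relation between the gauge factors on the two
    overlaps of sector \<open>i\<close>.\<close>
  have hE: "op_comp (h i) (E i) = op_comp (E (i - 1)) (A i)"
    and A_eq: "A i = op_comp (op_inv (E (i - 1))) (op_comp (h i) (E i))" for i
  proof -
    have all: "{E i, E (i - 1), A i} \<subseteq> sgrp Z (\<theta> i) (I i)"
      using EI AI by simp
    obtain c where c: "tame (pts Z (\<theta> i) c (I i))" "{E i, E (i - 1), A i} \<subseteq> auts (pts Z (\<theta> i) c (I i))"
      using sgrp_tame [OF gI _ all] by blast
    note rules = auts_assoc [OF c(1)] auts_comp [OF c(1)] op_inv_auts [OF c(1)] op_inv_cancel_left [OF c(1)]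
      op_inv_left [OF c(1)] auts_id_right [OF c(1)]
    show "op_comp (h i) (E i) = op_comp (E (i - 1)) (A i)"
      using c(2) by (simp add: h_eq rules)
    then show "A i = op_comp (op_inv (E (i - 1))) (op_comp (h i) (E i))"
      using c(2) by (simp add: rules)
  qed
  have an_h: "analytic_element (h i)" for i
    using an [of i] by (simp add: h_def A_def [abs_def] S_def)
  have t_le: "t i \<le> t k" if "i \<le> k" for i k
    by (rule increasing_int [of t, OF t(1) that])
  have an_E: "analytic_element (E j)" for j
  proof -
    define L where "L = lower_cut b (t (j + 1))"
    have iL: "is_interval (X \<inter> L)" "is_interval (X - L)" if "is_interval X" for X
      using that by (auto simp: L_def intro: is_interval_Int is_interval_minus_lower_cut)
    have cover: "J i = (J i - L) \<union> (J i \<inter> L)" "(J i - L) \<inter> (J i \<inter> L) = {}" for i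
      by auto
    have "\<forall>i. \<exists>Q R. Q \<in> sgrp Z (\<theta> i) (J i - L) \<inter> sgrp Z (\<theta> (i + 1)) (J i - L) \<and>
        R \<in> sgrp Z (\<theta> i) (J i \<inter> L) \<inter> sgrp Z (\<theta> (i + 1)) (J i \<inter> L) \<and> E i = op_comp Q R"
      using sgrp_split [OF gJ cover] iL iJ E by blast
    then obtain Q R where
      Q: "\<And>i. Q i \<in> sgrp Z (\<theta> i) (J i - L)" "\<And>i. Q i \<in> sgrp Z (\<theta> (i + 1)) (J i - L)"
      and R: "\<And>i. R i \<in> sgrp Z (\<theta> i) (J i \<inter> L)" "\<And>i. R i \<in> sgrp Z (\<theta> (i + 1)) (J i \<inter> L)"
      and EQR: "\<And>i. E i = op_comp (Q i) (R i)"
      by (metis IntD1 IntD2)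
    have cover': "J i = (J i \<inter> L) \<union> (J i - L)" "(J i \<inter> L) \<inter> (J i - L) = {}" for i
      by auto
    have "\<forall>i. \<exists>x y. x \<in> sgrp Z (\<theta> i) (J i \<inter> L) \<inter> sgrp Z (\<theta> (i + 1)) (J i \<inter> L) \<and>
        y \<in> sgrp Z (\<theta> i) (J i - L) \<inter> sgrp Z (\<theta> (i + 1)) (J i - L) \<and> E i = op_comp x y"
      using sgrp_split [OF gJ cover'] iL iJ E by blast
    then obtain x y where
      x: "\<And>i. x i \<in> sgrp Z (\<theta> i) (J i \<inter> L)" "\<And>i. x i \<in> sgrp Z (\<theta> (i + 1)) (J i \<inter> L)"
      and y: "\<And>i. y i \<in> sgrp Z (\<theta> i) (J i - L)" "\<And>i. y i \<in> sgrp Z (\<theta> (i + 1)) (J i - L)"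
      and Exy: "\<And>i. E i = op_comp (x i) (y i)"
      by (metis IntD1 IntD2)
    have mono: "sgrp Z (\<theta> i) (J i - L) \<subseteq> sgrp Z (\<theta> i) (I i - L)"
      "sgrp Z (\<theta> i) (J i \<inter> L) \<subseteq> sgrp Z (\<theta> i) (I i \<inter> L)"
      "sgrp Z (\<theta> i) (J (i - 1) - L) \<subseteq> sgrp Z (\<theta> i) (I i - L)"
      "sgrp Z (\<theta> i) (J (i - 1) \<inter> L) \<subseteq> sgrp Z (\<theta> i) (I i \<inter> L)" for i
      using JI(1) [of i] JI(2) [of "i - 1"] by (intro sgrp_mono; auto)+
    have Q': "Q i \<in> sgrp Z (\<theta> i) (I i - L)" "Q (i - 1) \<in> sgrp Z (\<theta> i) (I i - L)"
      and R': "R i \<in> sgrp Z (\<theta> i) (I i \<inter> L)" "R (i - 1) \<in> sgrp Z (\<theta> i) (I i \<inter> L)"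
      and x': "x i \<in> sgrp Z (\<theta> i) (I i \<inter> L)" "x (i - 1) \<in> sgrp Z (\<theta> i) (I i \<inter> L)"
      and y': "y i \<in> sgrp Z (\<theta> i) (I i - L)" "y (i - 1) \<in> sgrp Z (\<theta> i) (I i - L)" for i
      using mono [of i] Q(1) [of i] Q(2) [of "i - 1"] R(1) [of i] R(2) [of "i - 1"]
        x(1) [of i] x(2) [of "i - 1"] y(1) [of i] y(2) [of "i - 1"] by auto
    have an_Q: "analytic_element (Q i)" if "j - int m \<le> i" "i \<le> j" for i
      using that
    proof (induction i rule: int_ge_induct)
      \<comment> \<open>One full turn before \<open>j\<close> the overlap lies entirely before the
        cut, so the factor beyond it is trivial.\<close>
      case base
      have "hi (j - int m) \<le> t (j + 1)"
        using V' [of "j - int m"] V' [of j] t(3) [of j] t(1) [of j] by simp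
      then have "J (j - int m) - L = {}"
        by (auto simp: J_def L_def intro!: less_in_lower_cut)
      then have "Q (j - int m) = op_id"
        using Q(1) [of "j - int m"] sgrp_empty by metis
      then show ?case
        by (simp add: analytic_id)
    next
      case (step i)
      have "S (i + 1) \<subseteq> I (i + 1) \<inter> L"
        using SI [of "i + 1"] lower_cut_mono [of "t (i + 1 + 1)" "t (j + 1)" b] t_le step.prems
        by (auto simp: S_def L_def)
      then have A': "A (i + 1) \<in> sgrp Z (\<theta> (i + 1)) (I (i + 1) \<inter> L)"
        using A [of "i + 1"] sgrp_mono by blast
      have eq: "op_comp (h (i + 1)) (op_comp (Q (i + 1)) (R (i + 1)))
          = op_comp (op_comp (Q (i + 1 - 1)) (R (i + 1 - 1))) (A (i + 1))"
        using hE [of "i + 1"] by (simp only: EQR)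
      show ?case
        by (rule analytic_step_right [OF gI iL(1) [OF iJ(2)] _ iL(2) [OF iJ(2)] _ _ Q' R' A' hI eq])
           (use an_h step in auto)
    qed
    have an_x: "analytic_element (x i)" if "i \<le> j + int m" "j \<le> i" for i
      using that
    proof (induction i rule: int_le_induct)
      \<comment> \<open>One full turn after \<open>j\<close> the overlap lies entirely beyond the
        cut, so the factor before it is trivial.\<close>
      case base
      have "t (j + 1) < lo (j + int m + 1)"
        using V' [of "j + 1"] V' [of j] t(4) [of j] pi_gt_zero by (simp add: algebra_simps)
      then have "J (j + int m) \<inter> L = {}"
        using greater_notin_lower_cut [of "t (j + 1)"] by (force simp: J_def L_def)
      then have "x (j + int m) = op_id"
        using x(1) [of "j + int m"] sgrp_empty by metis
      then show ?case
        by (simp add: analytic_id)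
    next
      case (step i)
      have "S i \<subseteq> I i - L"
        using SI [of i] lower_cut_mono [of "t (j + 1)" "t i" b] t_le step.prems
        by (auto simp: S_def L_def)
      then have A': "A i \<in> sgrp Z (\<theta> i) (I i - L)"
        using A [of i] sgrp_mono by blast
      have eq: "op_comp (h i) (op_comp (x i) (y i)) = op_comp (op_comp (x (i - 1)) (y (i - 1))) (A i)"
        using hE [of i] by (simp add: Exy)
      show ?case
        by (rule analytic_step_left [OF gI iL(1) [OF iJ(2)] _ iL(2) [OF iJ(2)] _ _ x' y' A' hI eq])
           (use an_h step in auto)
    qed
    have anQ: "analytic_element (Q j)" and anx: "analytic_element (x j)"
      using an_Q [of j] an_x [of j] by simp_all
    have all: "{Q j, R j, x j, y j} \<subseteq> sgrp Z (\<theta> j) (I j)"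
      by (simp add: up [OF Q'(1)] up [OF R'(1)] up [OF x'(1)] up [OF y'(1)])
    obtain c where c: "tame (pts Z (\<theta> j) c (I j))" "{Q j, R j, x j, y j} \<subseteq> auts (pts Z (\<theta> j) c (I j))"
      using sgrp_tame [OF gI _ all] by blast
    note rules = auts_assoc [OF c(1)] auts_comp [OF c(1)] op_inv_auts [OF c(1)] op_inv_cancel_left [OF c(1)]
      op_inv_left [OF c(1)] op_inv_right [OF c(1)] auts_id_right [OF c(1)]
    have eq: "op_comp (Q j) (R j) = op_comp (x j) (y j)"
      using EQR [of j] Exy [of j] by simp
    have "op_comp (R j) (op_inv (y j)) = op_comp (op_inv (Q j)) (op_comp (op_comp (Q j) (R j)) (op_inv (y j)))"
      using c(2) by (simp add: rules)
    also have "\<dots> = op_comp (op_inv (Q j)) (x j)"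
      unfolding eq using c(2) by (simp add: rules)
    finally have "op_comp (R j) (op_inv (y j)) = op_comp (op_inv (Q j)) (x j)" .
    moreover have "analytic_element (op_comp (op_inv (Q j)) (x j))"
      using all anQ anx by (intro sgrp_analytic_comp [OF gI] sgrp_analytic_inv [OF gI] sgrp_inv [OF gI]) auto
    ultimately have "analytic_element (op_comp (R j) (op_inv (y j)))"
      by simp
    moreover have "op_inv (y j) \<in> sgrp Z (\<theta> j) (I j - L)"
      using y'(1) gI [of j] iL(2) [OF iJ(2)] by (intro sgrp_inv) (auto simp: good_def)
    moreover have "I j \<inter> L \<inter> (I j - L) = {}"
      by auto
    ultimately have "analytic_element (R j)"
      using sgrp_analytic_factors(1) [OF gI iL(1) [OF iJ(2)] _ iL(2) [OF iJ(2)] _ _ R'(1)] by blast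
    then show "analytic_element (E j)"
      unfolding EQR using all anQ by (intro sgrp_analytic_comp [OF gI [of j]]) auto
  qed
  have "analytic_element (A j)"
    unfolding A_eq [of j]
    by (rule sgrp_analytic_comp [OF gI [of j] sgrp_inv [OF gI EI(2)] sgrp_comp [OF gI hI EI(1)]
          sgrp_analytic_inv [OF gI EI(2) an_E] sgrp_analytic_comp [OF gI hI EI(1) an_h an_E]])
  then show ?thesis
    by (simp add: A_def S_def)
qed

text \<open>\<open>S\<close> is cut out of \<open>I\<close> by two factorisations: first the part
  after \<open>S\<close> is split off, then the part before it.\<close>

lemma analytic_A_subsector:
  fixes \<sigma> :: "'n::finite stability_data"
  assumes \<sigma>: "\<sigma> \<in> Stab" and I: "well_inside \<theta> I" "is_interval I" and an: "analytic_element (A_sector \<sigma> I)"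
    and S: "S \<subseteq> I" "is_interval S"
  shows "analytic_element (A_sector \<sigma> S)"
proof (cases "S = {}")
  case True
  then show ?thesis
    by (simp add: A_sector_empty analytic_id)
next
  case False
  then obtain s where s: "s \<in> S"
    by blast
  define B where "B = {x \<in> I. \<forall>y\<in>S. x < y}"
  define C where "C = {x \<in> I. \<forall>y\<in>S. y < x}"
  have BS: "B \<union> S = I \<inter> {x. \<exists>y\<in>S. x \<le> y}"
  proof
    show "B \<union> S \<subseteq> I \<inter> {x. \<exists>y\<in>S. x \<le> y}"
      using S s by (auto simp: B_def intro: less_imp_le)
    show "I \<inter> {x. \<exists>y\<in>S. x \<le> y} \<subseteq> B \<union> S"
    proof
      fix x assume "x \<in> I \<inter> {x. \<exists>y\<in>S. x \<le> y}"
      then obtain y where y: "x \<in> I" "y \<in> S" "x \<le> y"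
        by blast
      show "x \<in> B \<union> S"
      proof (cases "\<exists>z\<in>S. z \<le> x")
        case True
        then show ?thesis
          using y S(2) mem_is_interval_1_I by blast
      next
        case False
        then show ?thesis
          using y(1) by (auto simp: B_def not_le)
      qed
    qed
  qed
  have split: "I = (B \<union> S) \<union> C"
    unfolding BS by (auto simp: C_def not_le)
  have "is_interval {x. \<forall>y\<in>S. x < y}"
    by (auto simp: is_interval_1 intro: le_less_trans)
  moreover have "is_interval {x. \<forall>y\<in>S. y < x}"
    by (auto simp: is_interval_1 intro: less_le_trans)
  moreover have "is_interval {x. \<exists>y\<in>S. x \<le> y}"
    by (auto simp: is_interval_1 intro: order_trans)
  moreover have "B = I \<inter> {x. \<forall>y\<in>S. x < y}" "C = I \<inter> {x. \<forall>y\<in>S. y < x}"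
    by (auto simp: B_def C_def)
  ultimately have int: "is_interval B" "is_interval C" "is_interval (B \<union> S)"
    unfolding BS using I(2) by (simp_all add: is_interval_Int)
  have good: "good \<theta> I"
    using I by (simp add: good_def well_inside_def)
  have sub: "B \<subseteq> I" "C \<subseteq> I" "B \<union> S \<subseteq> I" "S \<subseteq> B \<union> S" "B \<subseteq> B \<union> S"
    using S by (auto simp: B_def C_def)
  have inS: "A_sector \<sigma> X \<in> sgrp (fst \<sigma>) \<theta> X" if "X \<subseteq> I" "is_interval X" for X
    using A_sector_sgrp [OF \<sigma> I that] .
  have "A_sector \<sigma> I = op_comp (A_sector \<sigma> (B \<union> S)) (A_sector \<sigma> C)"
    by (subst split, rule A_sector_Un [OF \<sigma> I]) (use sub s in \<open>auto simp: B_def C_def intro: less_trans\<close>)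
  moreover have disj: "(B \<union> S) \<inter> C = {}" "B \<inter> S = {}"
    using s by (auto simp: B_def C_def dest: less_trans)
  ultimately have "analytic_element (A_sector \<sigma> (B \<union> S))"
    using an sgrp_analytic_factors(1) [OF good int(3) sub(3) int(2) sub(2) _ inS [OF sub(3) int(3)] inS [OF sub(2) int(2)]]
    by simp
  moreover have "A_sector \<sigma> (B \<union> S) = op_comp (A_sector \<sigma> B) (A_sector \<sigma> S)"
    by (rule A_sector_Un [OF \<sigma> I]) (use sub S in \<open>auto simp: B_def\<close>)
  ultimately show ?thesis
    using sgrp_analytic_factors(2) [OF good int(1) sub(1) S(2,1) disj(2) inS [OF sub(1) int(1)] inS [OF S]]
    by simp
qed

text \<open>\<open>S\<close> may straddle several pieces of the decomposition. It is swept through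
  one piece at a time; its intersection with each piece is a subsector of that piece.\<close>

lemma analytic_A_sector:
  fixes \<sigma> :: "'n::finite stability_data"
  assumes \<sigma>: "\<sigma> \<in> Stab" and t: "\<And>i. t i < t (i + 1)" "\<And>i. t (i + int m) = t i + 2 * pi"
    and w: "\<And>i. t (i + 1) < t i + pi"
    and an: "\<And>i. analytic_element (A_sector \<sigma> (lower_cut b (t (i + 1)) - lower_cut b (t i)))"
    and S: "well_inside \<theta> S" "is_interval S"
  shows "analytic_element (A_sector \<sigma> S)"
proof -
  have tk: "t (int m * k) = t 0 + 2 * pi * of_int k" for k
  proof (induction k rule: int_induct [of _ 0])
    case (step1 k)
    then show ?case
      using t(2) [of "int m * k"] by (simp add: algebra_simps)
  next
    case (step2 k)
    then show ?case
      using t(2) [of "int m * (k - 1)"] by (simp add: algebra_simps)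
  qed simp
  have good: "good \<theta> S"
    using S by (simp add: good_def well_inside_def)
  \<comment> \<open>Indices of boundaries on either side of the half-plane containing
    \<open>S\<close>, found by counting full turns.\<close>
  define P where "P = int m * \<lfloor>(\<theta> - pi / 2 - t 0) / (2 * pi)\<rfloor>"
  define N where "N = int m * (\<lfloor>(\<theta> + pi / 2 - t 0) / (2 * pi)\<rfloor> + 1)"
  have P: "t P \<le> \<theta> - pi / 2"
  proof -
    have "2 * pi * of_int \<lfloor>(\<theta> - pi / 2 - t 0) / (2 * pi)\<rfloor> \<le> 2 * pi * ((\<theta> - pi / 2 - t 0) / (2 * pi))"
      by (intro mult_left_mono) auto
    then show ?thesis
      unfolding P_def tk by simp
  qed
  have N: "\<theta> + pi / 2 < t N"
  proof -
    have "2 * pi * ((\<theta> + pi / 2 - t 0) / (2 * pi)) < 2 * pi * of_int (\<lfloor>(\<theta> + pi / 2 - t 0) / (2 * pi)\<rfloor> + 1)"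
      by (intro mult_strict_left_mono) (linarith, simp)
    then show ?thesis
      unfolding N_def tk by simp
  qed
  have PN: "P \<le> N"
  proof (rule ccontr)
    assume "\<not> P \<le> N"
    then have "t N \<le> t P"
      using increasing_int [of t, OF t(1)] by simp
    then show False
      using P N pi_gt_zero by linarith
  qed
  have sub: "S \<subseteq> hpi \<theta>"
    using S by (simp add: well_inside_def)
  have "analytic_element (A_sector \<sigma> (S \<inter> lower_cut b (t k)))" if "P \<le> k" for k
    using that
  proof (induction k rule: int_ge_induct)
    case base
    have "S \<inter> lower_cut b (t P) = {}"
      using sub P by (auto simp: hpi_def lower_cut_def)
    then show ?case
      by (simp add: A_sector_empty analytic_id)
  next
    case (step k)
    define D where "D = lower_cut b (t (k + 1)) - lower_cut b (t k)"
    \<comment> \<open>Each piece is placed in a half-plane of its own, centred at its midpoint; its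
      width is less than pi.\<close>
    define \<phi> where "\<phi> = (t k + t (k + 1)) / 2"
    have "well_inside \<phi> {t k..t (k + 1)}"
      using t(1) [of k] w [of k] by (intro well_inside_Icc) (auto simp: hpi_def \<phi>_def field_simps)
    then have D: "well_inside \<phi> D" "is_interval D"
      unfolding D_def by (auto simp: lower_cut_def intro!: is_interval_minus_lower_cut elim!: well_inside_subset split: if_splits)
        (auto simp: is_interval_1)
    have 1: "analytic_element (A_sector \<sigma> (S \<inter> D))"
      using analytic_A_subsector [OF \<sigma> D an [of k, folded D_def], of "S \<inter> D"] D(2) S(2)
      by (simp add: is_interval_Int)
    have "S \<inter> lower_cut b (t (k + 1)) = (S \<inter> lower_cut b (t k)) \<union> (S \<inter> D)"
      using lower_cut_mono [of "t k" "t (k + 1)" b] t(1) [of k] by (auto simp: D_def)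
    moreover have "A_sector \<sigma> ((S \<inter> lower_cut b (t k)) \<union> (S \<inter> D)) = op_comp (A_sector \<sigma> (S \<inter> lower_cut b (t k))) (A_sector \<sigma> (S \<inter> D))"
      by (rule A_sector_Un [OF \<sigma> S]) (auto simp: D_def intro: lower_cut_less)
    moreover have "A_sector \<sigma> (S \<inter> X) \<in> sgrp (fst \<sigma>) \<theta> S" if "is_interval X" for X
      using A_sector_sgrp [OF \<sigma> S, of "S \<inter> X"] sgrp_mono [of "S \<inter> X" S] S(2) that by (auto simp: is_interval_Int)
    ultimately show ?case
      using 1 step.IH D(2) by (simp add: sgrp_analytic_comp [OF good, where Z = "fst \<sigma>"])
  qed
  moreover have "S \<inter> lower_cut b (t N) = S"
    using sub N by (auto simp: hpi_def intro!: less_in_lower_cut)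
  ultimately show ?thesis
    using PN by metis
qed

subsection \<open>Changing the cuts\<close>

text \<open>The product also factors inside \<open>A\<close>, which is closed under addition and
  split by the two sectors; by uniqueness in the larger group these factors are \<open>a\<close> and
  \<open>b\<close>. So factors inherit the support of their product.\<close>

lemma restrict_factor:
  assumes I: "good \<theta> I" and A: "tame A" "A \<subseteq> pts Z \<theta> c I" "0 < c"
    and S: "is_interval S" "S \<subseteq> I" and T: "is_interval T" "T \<subseteq> I" and ST: "I = S \<union> T" "S \<inter> T = {}"
    and a: "a \<in> sgrp Z \<theta> S" and b: "b \<in> sgrp Z \<theta> T" and ab: "op_comp a b \<in> auts A"
  shows "a \<in> auts {\<gamma> \<in> A. charge Z \<gamma> \<in> sector S}" "b \<in> auts {\<gamma> \<in> A. charge Z \<gamma> \<in> sector T}"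
proof -
  define R where "R X = {\<gamma> \<in> A. charge Z \<gamma> \<in> sector X}" for X
  have closed: "add_closed (R X)" if "is_interval X" "X \<subseteq> I" for X
    using that I tame_closed [OF A(1)] sector_add [of X \<theta>]
    by (auto simp: R_def add_closed_def charge_add good_def)
  have "A = R S \<union> R T"
    using A(2) ST(1) by (auto simp: R_def pts_def sector_Un)
  moreover have "R S \<inter> R T = {}"
    using sector_Int [of S \<theta> T] S T I ST(2) by (auto simp: R_def good_def)
  ultimately obtain a' b' where ab': "a' \<in> auts (R S)" "b' \<in> auts (R T)" "op_comp a b = op_comp a' b'"
    using factor_exists [OF A(1) closed [OF S] closed [OF T] _ _ ab] by blast
  have "R X \<subseteq> pts Z \<theta> c X" for X
    using A(2) by (auto simp: R_def pts_def)
  then have sub: "auts (R X) \<subseteq> sgrp Z \<theta> X" for X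
    using auts_mono [of "R X" "pts Z \<theta> c X"] A(3) by (auto intro: sgrpI)
  then have "a = a' \<and> b = b'"
    using sgrp_factor_unique [OF I S T ST(2) a _ b _ ab'(3)] ab' sub by blast
  then show "a \<in> auts {\<gamma> \<in> A. charge Z \<gamma> \<in> sector S}" "b \<in> auts {\<gamma> \<in> A. charge Z \<gamma> \<in> sector T}"
    using ab' by (simp_all add: R_def)
qed

text \<open>Of the two factors one is always trivial: this is the ordered product over the angles from the
  cut at \<open>t\<close> to the cut at \<open>s\<close>, inverted if \<open>s\<close> comes first.\<close>

definition recut :: "'n::finite stability_data \<Rightarrow> bool \<Rightarrow> real \<Rightarrow> real \<Rightarrow> 'n oper" where
  "recut \<sigma> b t s = op_comp (op_inv (A_sector \<sigma> (lower_cut b t - lower_cut True s)))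
    (A_sector \<sigma> (lower_cut True s - lower_cut b t))"

lemma recut_shift: "recut \<sigma> b (t + 2 * pi) (s + 2 * pi) = recut \<sigma> b t s"
proof -
  have shift: "A_sector \<sigma> (lower_cut b (t + 2 * pi) - lower_cut b' (s + 2 * pi)) = A_sector \<sigma> (lower_cut b t - lower_cut b' s)"
    for b b' t s
    unfolding lower_cut_diff_shift by (rule A_sector_shift [where k = 1, unfolded of_int_1 mult_1_right])
  show ?thesis
    unfolding recut_def shift ..
qed

lemma recut_sgrp:
  assumes \<sigma>: "\<sigma> \<in> Stab" and X: "good \<theta> X" "s \<in> X" "t \<in> X"
  shows "recut \<sigma> b t s \<in> sgrp (fst \<sigma>) \<theta> X"
proof -
  have st: "s \<in> hpi \<theta>" "t \<in> hpi \<theta>"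
    using X by (auto simp: good_def)
  have sub: "lower_cut b1 q - lower_cut b2 p \<subseteq> X" if "p \<in> X" "q \<in> X" for b1 b2 p q
  proof
    fix x assume "x \<in> lower_cut b1 q - lower_cut b2 p"
    then have "p \<le> x" "x \<le> q"
      by (auto simp: lower_cut_def split: if_splits)
    then show "x \<in> X"
      using that X(1) mem_is_interval_1_I [of X p q x] by (simp add: good_def)
  qed
  have "A_sector \<sigma> (lower_cut b t - lower_cut True s) \<in> sgrp (fst \<sigma>) \<theta> X"
    using A_sector_piece [OF \<sigma> st] sgrp_mono [OF sub [OF X(2,3)]] by blast
  moreover have "A_sector \<sigma> (lower_cut True s - lower_cut b t) \<in> sgrp (fst \<sigma>) \<theta> X"
    using A_sector_piece [OF \<sigma> st(2,1)] sgrp_mono [OF sub [OF X(3,2)]] by blast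
  ultimately show ?thesis
    unfolding recut_def by (intro sgrp_comp sgrp_inv X(1))
qed

lemma A_sector_between:
  assumes \<sigma>: "\<sigma> \<in> Stab" and I: "well_inside \<theta> {a..a'}"
    and r: "r \<in> {a..a'}" and s: "s \<in> {a..a'}" and t: "t \<in> {a..a'}"
    and sub: "lower_cut b r \<subseteq> lower_cut b' s" "lower_cut b' s \<subseteq> lower_cut b'' t"
  shows "op_comp (A_sector \<sigma> (lower_cut b' s - lower_cut b r)) (A_sector \<sigma> (lower_cut b'' t - lower_cut b' s))
    = A_sector \<sigma> (lower_cut b'' t - lower_cut b r)"
proof -
  have "lower_cut b'' t - lower_cut b r
      = (lower_cut b' s - lower_cut b r) \<union> (lower_cut b'' t - lower_cut b' s)"
    using sub by auto
  moreover have "A_sector \<sigma> ((lower_cut b' s - lower_cut b r) \<union> (lower_cut b'' t - lower_cut b' s))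
      = op_comp (A_sector \<sigma> (lower_cut b' s - lower_cut b r)) (A_sector \<sigma> (lower_cut b'' t - lower_cut b' s))"
  proof (rule A_sector_Un [OF \<sigma> I])
    show "lower_cut b' s - lower_cut b r \<subseteq> {a..a'}" "lower_cut b'' t - lower_cut b' s \<subseteq> {a..a'}"
      using r s t by (auto simp: lower_cut_def split: if_splits)
  qed (auto simp: is_interval_cc intro: lower_cut_less)
  ultimately show ?thesis
    by simp
qed

lemma lower_cut_linear: "lower_cut b s \<subseteq> lower_cut b' t \<or> lower_cut b' t \<subseteq> lower_cut b s"
  by (auto simp: lower_cut_def)

text \<open>Measured from a common origin \<open>a\<close>, the correction moves the end of an
  ordered product from the cut at \<open>t\<close> to the cut at \<open>s\<close>, whichever of them
  comes first.\<close>

lemma A_sector_recut: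
  assumes \<sigma>: "\<sigma> \<in> Stab" and I: "well_inside \<theta> {a..a'}" and st: "s \<in> {a..a'}" "t \<in> {a..a'}"
  shows "op_comp (A_sector \<sigma> (lower_cut b t - lower_cut True a)) (recut \<sigma> b t s)
    = A_sector \<sigma> (lower_cut True s - lower_cut True a)"
proof -
  have aa: "a \<in> {a..a'}"
    using st by auto
  have low: "lower_cut True a \<subseteq> lower_cut b t" "lower_cut True a \<subseteq> lower_cut True s"
    using st by (auto simp: lower_cut_def)
  have hpi: "{a..a'} \<subseteq> hpi \<theta>" and good: "good \<theta> {a..a'}"
    using I by (auto simp: well_inside_def good_def is_interval_cc)
  have piece: "A_sector \<sigma> (lower_cut b' t' - lower_cut b'' s') \<in> sgrp (fst \<sigma>) \<theta> {a..a'}"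
    if "t' \<in> {a..a'}" "s' \<in> {a..a'}" for b' b'' t' s'
  proof -
    have "lower_cut b' t' - lower_cut b'' s' \<subseteq> {a..a'}"
      using that by (auto simp: lower_cut_def split: if_splits)
    then show ?thesis
      using A_sector_piece [OF \<sigma>, of s' \<theta> t' b' b''] that hpi sgrp_mono by blast
  qed
  show ?thesis
  proof (cases "lower_cut b t \<subseteq> lower_cut True s")
    case True
    then have empty: "lower_cut b t - lower_cut True s = {}"
      by auto
    have "recut \<sigma> b t s = A_sector \<sigma> (lower_cut True s - lower_cut b t)"
      unfolding recut_def empty A_sector_empty op_inv_id by (rule sgrp_id_left [OF good piece [OF st]])
    then show ?thesis
      using A_sector_between [OF \<sigma> I aa st(2,1) low(1) True] by simp
  next
    case False
    then have sub: "lower_cut True s \<subseteq> lower_cut b t"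
      using lower_cut_linear by blast
    then have empty: "lower_cut True s - lower_cut b t = {}"
      by auto
    have re: "recut \<sigma> b t s = op_inv (A_sector \<sigma> (lower_cut b t - lower_cut True s))"
      unfolding recut_def empty A_sector_empty by (rule sgrp_id_right [OF good sgrp_inv [OF good piece [OF st(2,1)]]])
    let ?X = "A_sector \<sigma> (lower_cut True s - lower_cut True a)"
    let ?Y = "A_sector \<sigma> (lower_cut b t - lower_cut True s)"
    have "{?X, ?Y} \<subseteq> sgrp (fst \<sigma>) \<theta> {a..a'}"
      using piece st aa by blast
    then obtain c where "tame (pts (fst \<sigma>) \<theta> c {a..a'})" "{?X, ?Y} \<subseteq> auts (pts (fst \<sigma>) \<theta> c {a..a'})"
      using sgrp_tame [OF good, of "{?X, ?Y}"] by blast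
    then have "op_comp (op_comp ?X ?Y) (op_inv ?Y) = ?X"
      by (intro op_inv_cancel_right) auto
    then show ?thesis
      using A_sector_between [OF \<sigma> I aa st low(2) sub] by (simp add: re)
  qed
qed

text \<open>After multiplication on the left by the product from \<open>a\<close> to
  \<open>t\<close>, both sides become the product from \<open>a\<close> to
  \<open>s'\<close>.\<close>

lemma recut_commute:
  assumes \<sigma>: "\<sigma> \<in> Stab" and I: "well_inside \<theta> {a..a'}"
    and t: "t \<in> {a..a'}" "t' \<in> {a..a'}" "t \<le> t'" and s: "s \<in> {a..a'}" "s' \<in> {a..a'}" "s \<le> s'"
  shows "op_comp (A_sector \<sigma> (lower_cut b t' - lower_cut b t)) (recut \<sigma> b t' s')
    = op_comp (recut \<sigma> b t s) (A_sector \<sigma> (lower_cut True s' - lower_cut True s))"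
proof -
  have aa: "a \<in> {a..a'}"
    using t by auto
  have good: "good \<theta> {a..a'}"
    using I by (auto simp: well_inside_def good_def is_interval_cc)
  have piece: "A_sector \<sigma> (lower_cut b' t' - lower_cut b'' s') \<in> sgrp (fst \<sigma>) \<theta> {a..a'}"
    if "t' \<in> {a..a'}" "s' \<in> {a..a'}" for b' b'' t' s'
  proof -
    have "lower_cut b' t' - lower_cut b'' s' \<subseteq> {a..a'}"
      using that by (auto simp: lower_cut_def split: if_splits)
    then show ?thesis
      using A_sector_piece [OF \<sigma>, of s' \<theta> t' b' b''] that good sgrp_mono unfolding good_def by blast
  qed
  have low: "lower_cut True a \<subseteq> lower_cut b t" "lower_cut True a \<subseteq> lower_cut True s"
    using s t by (auto simp: lower_cut_def)
  let ?\<alpha> = "A_sector \<sigma> (lower_cut b t - lower_cut True a)"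
  let ?S = "A_sector \<sigma> (lower_cut b t' - lower_cut b t)"
  let ?S' = "A_sector \<sigma> (lower_cut True s' - lower_cut True s)"
  let ?F = "{?\<alpha>, ?S, ?S', recut \<sigma> b t s, recut \<sigma> b t' s'}"
  have "?F \<subseteq> sgrp (fst \<sigma>) \<theta> {a..a'}"
    using piece recut_sgrp [OF \<sigma> good] s t aa by blast
  then obtain c where c: "tame (pts (fst \<sigma>) \<theta> c {a..a'})" "?F \<subseteq> auts (pts (fst \<sigma>) \<theta> c {a..a'})"
    using sgrp_tame [OF good, of ?F] by blast
  have "op_comp ?\<alpha> (op_comp ?S (recut \<sigma> b t' s')) = op_comp (op_comp ?\<alpha> ?S) (recut \<sigma> b t' s')"
    using c by (simp add: auts_assoc [OF c(1)])
  also have "op_comp ?\<alpha> ?S = A_sector \<sigma> (lower_cut b t' - lower_cut True a)"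
    by (rule A_sector_between [OF \<sigma> I aa t(1,2) low(1) lower_cut_mono [OF t(3)]])
  also have "op_comp \<dots> (recut \<sigma> b t' s') = A_sector \<sigma> (lower_cut True s' - lower_cut True a)"
    by (rule A_sector_recut [OF \<sigma> I s(2) t(2)])
  also have "\<dots> = op_comp (A_sector \<sigma> (lower_cut True s - lower_cut True a)) ?S'"
    by (rule A_sector_between [OF \<sigma> I aa s(1,2) low(2) lower_cut_mono [OF s(3)], symmetric])
  also have "A_sector \<sigma> (lower_cut True s - lower_cut True a) = op_comp ?\<alpha> (recut \<sigma> b t s)"
    by (rule A_sector_recut [OF \<sigma> I s(1) t(1), symmetric])
  also have "op_comp (op_comp ?\<alpha> (recut \<sigma> b t s)) ?S' = op_comp ?\<alpha> (op_comp (recut \<sigma> b t s) ?S')"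
    using c by (simp add: auts_assoc [OF c(1)])
  finally have "op_comp (op_inv ?\<alpha>) (op_comp ?\<alpha> (op_comp ?S (recut \<sigma> b t' s')))
      = op_comp (op_inv ?\<alpha>) (op_comp ?\<alpha> (op_comp (recut \<sigma> b t s) ?S'))"
    by simp
  then show ?thesis
    using c by (simp add: op_inv_cancel_left [OF c(1)] auts_comp [OF c(1)])
qed

subsection \<open>The cover by four half-planes\<close>

definition ctr :: "int \<Rightarrow> real" where
  "ctr i = of_int i * (pi / 2)"

text \<open>Half-planes centred at the multiples of a right angle. Consecutive ones overlap in a
  quadrant, where their two functionals are proportional to the cosine and the sine of the angle
  measured from \<open>ctr i\<close>.\<close>

definition quad_cover :: "int \<Rightarrow> complex set" where
  "quad_cover i = sector (hpi (ctr i))"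

text \<open>The bisector of the overlap of the sectors \<open>i - 1\<close> and
  \<open>i\<close>.\<close>

definition mid :: "int \<Rightarrow> real" where
  "mid i = ctr i - pi / 4"

lemma ctr_Suc: "ctr (i + 1) = ctr i + pi / 2"
  by (simp add: ctr_def algebra_simps)

lemma ctr_4: "ctr (i + 4) = ctr i + 2 * pi"
  by (simp add: ctr_def algebra_simps)

lemma mid_Suc: "mid (i + 1) = ctr i + pi / 4"
  by (simp add: mid_def ctr_Suc)

lemma mid_4: "mid (i + 4) = mid i + 2 * pi"
  by (simp add: mid_def ctr_4)

lemma hp_ctr_4: "hp (ctr (i + 4)) = hp (ctr i)"
proof -
  have "cis (ctr i + 2 * pi) = cis (ctr i)"
    using cis_shift [of "- ctr i" "- 1"] by (simp add: add.commute)
  then show ?thesis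
    by (simp add: hp_def [abs_def] ctr_4)
qed

lemma quad_cover_eq: "quad_cover i = {z. 0 < hp (ctr i) z}"
  by (simp add: quad_cover_def half_plane)

lemma quad_cover_lifted: "lifted_cover 4 quad_cover (\<lambda>i. ctr i - pi / 2) (\<lambda>i. ctr i + pi / 2)"
  unfolding lifted_cover_def by (simp add: quad_cover_def hpi_def ctr_Suc ctr_4 algebra_simps)

lemma quad_cover_cyclic: "open_cyclic_cover 4 quad_cover"
  unfolding open_cyclic_cover_def
proof (intro conjI)
  show "cyclic_family 4 quad_cover"
    by (simp add: cyclic_family_def quad_cover_eq hp_ctr_4)
  show "(\<Union>i. quad_cover i) = - {0}"
  proof
    show "(\<Union>i. quad_cover i) \<subseteq> - {0}"
      by (auto simp: quad_cover_def)
    show "- {0} \<subseteq> (\<Union>i. quad_cover i)"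
    proof
      fix z :: complex assume "z \<in> - {0}"
      then have "0 < Re z \<or> 0 < - Im z \<or> 0 < - Re z \<or> 0 < Im z"
        by (auto simp: complex_eq_iff)
      moreover have "hp (ctr 0) z = Re z" "hp (ctr 1) z = - Im z" "hp (ctr 2) z = - Re z" "hp (ctr (- 1)) z = Im z"
        by (simp_all add: hp_def ctr_def)
      ultimately have "z \<in> quad_cover 0 \<or> z \<in> quad_cover 1 \<or> z \<in> quad_cover 2 \<or> z \<in> quad_cover (- 1)"
        by (auto simp: quad_cover_eq)
      then show "z \<in> (\<Union>i. quad_cover i)"
        by blast
    qed
  qed
  show "\<forall>i. quad_cover i \<inter> quad_cover (i + 1) \<noteq> {}"
  proof
    fix i
    have "of_real 1 * cis (- (ctr i + pi / 4)) \<in> quad_cover i \<inter> quad_cover (i + 1)"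
      unfolding quad_cover_def by (intro IntI sectorI) (auto simp: hpi_def ctr_Suc)
    then show "quad_cover i \<inter> quad_cover (i + 1) \<noteq> {}"
      by blast
  qed
  have adm: "admissible_angles {ctr i - pi / 2<..<ctr i + pi / 2}" for i
    unfolding admissible_angles_def
    by (intro conjI disjI2 exI [of _ "ctr i - pi / 2"]) (auto simp: algebra_simps not_le pi_gt_zero)
  show "\<exists>lo hi :: int \<Rightarrow> real. \<forall>i. quad_cover i = sector {lo i<..<hi i} \<and> admissible_angles {lo i<..<hi i} \<and>
        lo i \<le> lo (i + 1) \<and> lo (i + 1) \<le> hi i \<and> hi i \<le> hi (i + 1) \<and>
        lo (i + int 4) = lo i + 2 * pi \<and> hi (i + int 4) = hi i + 2 * pi"
    using quad_cover_lifted adm unfolding lifted_cover_def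
    by (intro exI [of _ "\<lambda>i. ctr i - pi / 2"] exI [of _ "\<lambda>i. ctr i + pi / 2"] allI) (auto intro: less_imp_le)
qed simp

lemma cos_pi4_le:
  assumes "\<bar>y\<bar> \<le> pi / 4"
  shows "cos (pi / 4) \<le> cos y"
  using cos_monotone_0_pi_le [of "\<bar>y\<bar>" "pi / 4"] assms by simp

lemma quad_decomposition: "sector_decomposition 4 quad_cover (\<lambda>i. {mid i..<mid (i + 1)})"
  unfolding sector_decomposition_def
proof (intro conjI allI exI [of _ mid] disjI1 refl)
  fix i
  show "mid (i + int 4) = mid i + 2 * pi"
    by (simp add: mid_4)
  have lt: "mid i < mid (i + 1)" "mid (i + 1) - mid i < pi"
    using pi_gt_zero by (simp_all add: mid_def ctr_Suc)
  then show "admissible_angles {mid i..<mid (i + 1)}"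
    unfolding admissible_angles_def by (intro conjI disjI1 exI [of _ "mid i"] exI [of _ "mid (i + 1)"]) auto
  \<comment> \<open>A closed condition on the sector passes to its closure, where it still implies
    positivity away from 0.\<close>
  have "sector {mid i..<mid (i + 1)} \<subseteq> {z. cos (pi / 4) * cmod z \<le> hp (ctr i) z}"
  proof
    fix z assume "z \<in> sector {mid i..<mid (i + 1)}"
    then obtain r x where r: "0 < r" "x \<in> {mid i..<mid (i + 1)}" "z = of_real r * cis (- x)"
      by (elim sectorE)
    have "\<bar>x - ctr i\<bar> \<le> pi / 4"
      using r(2) unfolding mid_def ctr_Suc atLeastLessThan_iff abs_le_iff by simp
    then have "cos (pi / 4) * r \<le> cos (x - ctr i) * r"
      using r(1) by (intro mult_right_mono cos_pi4_le) auto
    then show "z \<in> {z. cos (pi / 4) * cmod z \<le> hp (ctr i) z}"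
      using r(1) by (simp add: r(3) hp_polar norm_mult mult.commute del: cos_45)
  qed
  moreover have "closed {z. cos (pi / 4) * cmod z \<le> hp (ctr i) z}"
    unfolding hp_def by (intro closed_Collect_le continuous_intros)
  ultimately have "closure (sector {mid i..<mid (i + 1)}) \<subseteq> {z. cos (pi / 4) * cmod z \<le> hp (ctr i) z}"
    by (rule closure_minimal)
  moreover have "0 < cos (pi / 4)"
    by (simp add: cos_45)
  ultimately show "closure (sector {mid i..<mid (i + 1)}) - {0} \<subseteq> quad_cover i"
    unfolding quad_cover_eq
  proof (intro subsetI CollectI)
    fix z assume sub: "closure (sector {mid i..<mid (i + 1)}) \<subseteq> {z. cos (pi / 4) * cmod z \<le> hp (ctr i) z}"
      and pos: "0 < cos (pi / 4)" and z: "z \<in> closure (sector {mid i..<mid (i + 1)}) - {0}"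
    have "0 < cos (pi / 4) * cmod z"
      using pos z by (intro mult_pos_pos) auto
    also have "\<dots> \<le> hp (ctr i) z"
      using sub z by blast
    finally show "0 < hp (ctr i) z" .
  qed
qed

text \<open>Before the bisector the functional of the next half-plane is the smaller one, so a lower
  bound for it holds for both. Beyond the bisector the roles are exchanged.\<close>

lemma hp_ctr_Suc_le:
  assumes "z \<in> sector {a..<ctr i + pi / 4}" "ctr i \<le> a"
  shows "hp (ctr (i + 1)) z \<le> hp (ctr i) z"
proof -
  obtain r x where r: "0 < r" "x \<in> {a..<ctr i + pi / 4}" "z = of_real r * cis (- x)"
    using assms(1) by (elim sectorE)
  have "cos (pi / 2 - (x - ctr i)) \<le> cos (x - ctr i)"
    using r(2) assms(2) by (intro cos_monotone_0_pi_le) auto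
  then have "r * sin (x - ctr i) \<le> r * cos (x - ctr i)"
    using r(1) by (simp add: sin_cos_eq)
  then show ?thesis
    by (simp add: r(3) hp_polar ctr_Suc cos_minus_half_pi)
qed

lemma hp_ctr_le_Suc:
  assumes "z \<in> sector {ctr i + pi / 4..<ctr i + pi / 2}"
  shows "hp (ctr i) z \<le> hp (ctr (i + 1)) z"
proof -
  obtain r x where r: "0 < r" "x \<in> {ctr i + pi / 4..<ctr i + pi / 2}" "z = of_real r * cis (- x)"
    using assms(1) by (elim sectorE)
  have "cos (x - ctr i) \<le> cos (pi / 2 - (x - ctr i))"
    using r(2) by (intro cos_monotone_0_pi_le) auto
  then have "r * cos (x - ctr i) \<le> r * sin (x - ctr i)"
    using r(1) by (simp add: sin_cos_eq)
  then show ?thesis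
    by (simp add: r(3) hp_polar ctr_Suc cos_minus_half_pi)
qed

text \<open>The estimate is uniform in the angle and linear in the norm, so that one neighbourhood
  of charges serves all cones with a given constant.\<close>

lemma charge_close:
  fixes Z :: "complex ^ 'n::finite"
  assumes \<epsilon>: "0 < \<epsilon>"
  shows "\<exists>U. open U \<and> Z \<in> U \<and>
    (\<forall>Z'\<in>U. \<forall>\<theta> u. \<bar>hp \<theta> (charge_real Z' u) - hp \<theta> (charge_real Z u)\<bar> \<le> \<epsilon> * norm u)"
proof -
  define N where "N = real CARD('n)"
  have N: "0 < N"
    by (simp add: N_def)
  have "\<bar>hp \<theta> (charge_real Z' u) - hp \<theta> (charge_real Z u)\<bar> \<le> \<epsilon> * norm u" if "Z' \<in> ball Z (\<epsilon> / N)" for Z' \<theta> u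
  proof -
    have dist: "norm (Z' - Z) \<le> \<epsilon> / N"
      using that by (simp add: dist_norm norm_minus_commute)
    have "hp \<theta> (charge_real Z' u) - hp \<theta> (charge_real Z u) = hp \<theta> (charge_real Z' u - charge_real Z u)"
      by (simp add: hp_def algebra_simps)
    then have "\<bar>hp \<theta> (charge_real Z' u) - hp \<theta> (charge_real Z u)\<bar> \<le> cmod (charge_real Z' u - charge_real Z u)"
      by (simp add: abs_hp_le)
    also have "charge_real Z' u - charge_real Z u = (\<Sum>i\<in>UNIV. of_real (u $ i) * (Z' - Z) $ i)"
      by (simp add: charge_real_def sum_subtractf right_diff_distrib)
    also have "cmod \<dots> \<le> (\<Sum>i\<in>(UNIV::'n set). norm u * norm (Z' - Z))"
    proof (rule sum_norm_le)
      fix i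
      show "cmod (of_real (u $ i) * (Z' - Z) $ i) \<le> norm u * norm (Z' - Z)"
        using Finite_Cartesian_Product.norm_nth_le [of "Z' - Z" i] unfolding norm_mult norm_of_real
        by (intro mult_mono component_le_norm_cart) auto
    qed
    also have "\<dots> = N * (norm u * norm (Z' - Z))"
      by (simp add: N_def)
    also have "\<dots> \<le> N * (norm u * (\<epsilon> / N))"
      using N dist by (intro mult_left_mono) auto
    also have "\<dots> = \<epsilon> * norm u"
      using N by simp
    finally show ?thesis .
  qed
  then show ?thesis
    using \<epsilon> N by (intro exI [of _ "ball Z (\<epsilon> / N)"]) auto
qed

subsection \<open>Nearby stability data with the same representative\<close>

definition qcone :: "complex ^ 'n::finite \<Rightarrow> real \<Rightarrow> int \<Rightarrow> (int ^ 'n) set" where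
  "qcone Z c i = pts Z (ctr i) c (hpi (ctr i))"

definition qcone2 :: "complex ^ 'n::finite \<Rightarrow> real \<Rightarrow> int \<Rightarrow> (int ^ 'n) set" where
  "qcone2 Z c i = qcone Z c i \<inter> qcone Z c (i + 1)"

lemma good_hpi: "good \<theta> (hpi \<theta>)"
  by (simp add: good_def hpi_def is_interval_oo)

lemma qcone_iff:
  assumes "0 < c"
  shows "\<gamma> \<in> qcone Z c i \<longleftrightarrow> \<gamma> \<noteq> 0 \<and> c * norm (rvec \<gamma>) \<le> hp (ctr i) (charge Z \<gamma>)"
proof
  assume "\<gamma> \<in> qcone Z c i"
  then show "\<gamma> \<noteq> 0 \<and> c * norm (rvec \<gamma>) \<le> hp (ctr i) (charge Z \<gamma>)"
    by (auto simp: qcone_def pts_def)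
next
  assume \<gamma>: "\<gamma> \<noteq> 0 \<and> c * norm (rvec \<gamma>) \<le> hp (ctr i) (charge Z \<gamma>)"
  then have "0 < c * norm (rvec \<gamma>)"
    using assms by (simp add: rvec_eq_0)
  then show "\<gamma> \<in> qcone Z c i"
    using \<gamma> by (simp add: qcone_def pts_def half_plane)
qed

lemma tame_qcone: "0 < c \<Longrightarrow> tame (qcone Z c i)"
  unfolding qcone_def by (rule tame_pts [OF good_hpi])

lemma tame_qcone2: "0 < c \<Longrightarrow> tame (qcone2 Z c i)"
  unfolding qcone2_def by (intro tame_Int tame_closed tame_qcone)

lemma qcone_4: "qcone Z c (i + 4) = qcone Z c i"
  by (simp add: qcone_def pts_def half_plane hp_ctr_4)

lemma qcone2_4: "qcone2 Z c (i + 4) = qcone2 Z c i"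
  using qcone_4 [of Z c i] qcone_4 [of Z c "i + 1"] by (simp add: qcone2_def add.commute add.left_commute)

lemma qcone_mono: "c' \<le> c \<Longrightarrow> qcone Z c i \<subseteq> qcone Z c' i"
  unfolding qcone_def by (rule pts_mono) auto

lemma qcone2_sub: "qcone2 Z c i \<subseteq> qcone Z c i" "qcone2 Z c (i - 1) \<subseteq> qcone Z c i"
  by (auto simp: qcone2_def)

abbreviation piece :: "'n::finite stability_data \<Rightarrow> int \<Rightarrow> 'n oper" where
  "piece \<sigma> i \<equiv> A_sector \<sigma> {mid i..<mid (i + 1)}"

lemma piece_cut: "{mid i..<mid (i + 1)} = lower_cut True (mid (i + 1)) - lower_cut True (mid i)"
  by (auto simp: lower_cut_def)

lemma mid_hpi: "mid i \<in> hpi (ctr i)" "mid (i + 1) \<in> hpi (ctr i)"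
  using pi_gt_zero unfolding mid_def ctr_Suc hpi_def greaterThanLessThan_iff by linarith+

lemma piece_4: "piece \<sigma> (i + 4) = piece \<sigma> i"
proof -
  have "mid (i + 4 + 1) = mid (i + 1) + 2 * pi"
    using mid_4 [of "i + 1"] by (simp add: add.commute add.left_commute)
  then have "{mid (i + 4)..<mid (i + 4 + 1)} = lower_cut True (mid (i + 1) + 2 * pi) - lower_cut True (mid i + 2 * pi)"
    by (auto simp: lower_cut_def mid_4)
  then have "{mid (i + 4)..<mid (i + 4 + 1)} = (\<lambda>x. x + 2 * pi) ` {mid i..<mid (i + 1)}"
    unfolding lower_cut_diff_shift piece_cut [symmetric] .
  then show ?thesis
    by (simp only: A_sector_shift [where k = 1, unfolded of_int_1 mult_1_right])
qed

lemma piece_sgrp: "\<sigma> \<in> Stab \<Longrightarrow> piece \<sigma> i \<in> sgrp (fst \<sigma>) (ctr i) {mid i..<mid (i + 1)}"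
  unfolding piece_cut by (rule A_sector_piece [OF _ mid_hpi])

lemma cyclic_mod:
  fixes f :: "int \<Rightarrow> 'b"
  assumes "\<And>i. f (i + 4) = f i"
  shows "f i = f (i mod 4)"
proof -
  have "f (j + 4 * k) = f j" for j k
  proof (induction k rule: int_induct [of _ 0])
    case (step1 k)
    then show ?case
      using assms [of "j + 4 * k"] by (simp add: algebra_simps)
  next
    case (step2 k)
    then show ?case
      using assms [of "j + 4 * (k - 1)"] by (simp add: algebra_simps)
  qed simp
  from this [of "i mod 4" "i div 4"] show ?thesis
    by simp
qed

text \<open>Periodicity leaves four pieces, so the smallest of four constants serves all
  indices.\<close>

lemma piece_qcone:
  fixes \<sigma> :: "'n::finite stability_data"
  assumes \<sigma>: "\<sigma> \<in> Stab"
  shows "\<exists>c>0. \<forall>i. piece \<sigma> i \<in> auts (qcone (fst \<sigma>) c i)"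
proof -
  have sub: "{mid i..<mid (i + 1)} \<subseteq> hpi (ctr i)" for i
    using mid_hpi [of i] by (auto simp: hpi_def)
  have "\<exists>c>0. piece \<sigma> i \<in> auts (qcone (fst \<sigma>) c i)" for i
  proof -
    have "piece \<sigma> i \<in> sgrp (fst \<sigma>) (ctr i) (hpi (ctr i))"
      using piece_sgrp [OF \<sigma>] sgrp_mono [OF sub] by blast
    then show ?thesis
      by (auto simp: sgrp_def qcone_def)
  qed
  then obtain e where e: "\<And>i. 0 < e i" "\<And>i. piece \<sigma> i \<in> auts (qcone (fst \<sigma>) (e i) i)"
    by metis
  define c where "c = Min (e ` {0..3})"
  have "0 < c"
    unfolding c_def using e(1) by (subst Min_gr_iff) auto
  moreover have "piece \<sigma> i \<in> auts (qcone (fst \<sigma>) c i)" for i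
  proof -
    have "c \<le> e (i mod 4)"
      unfolding c_def by (rule Min_le) auto
    then have "piece \<sigma> (i mod 4) \<in> auts (qcone (fst \<sigma>) c (i mod 4))"
      using e(2) auts_mono [OF qcone_mono] by blast
    then show ?thesis
      using cyclic_mod [of "\<lambda>i. piece \<sigma> i", OF piece_4] cyclic_mod [of "qcone (fst \<sigma>) c", OF qcone_4] by metis
  qed
  ultimately show ?thesis
    by blast
qed

text \<open>
  \<open>E\<close> is a gauge transformation for the charge \<open>Z'\<close>. Both its factorisations at the angle
  \<open>mid (i + 1)\<close> have an outer factor which is a factor of \<open>g\<close>, and is therefore supported
  in the cone of \<open>g\<close>; on each side of \<open>mid (i + 1)\<close>, that cone lies over a quadrant for \<open>Z\<close>.
\<close>

lemma gauge_support:
  fixes Z Z' :: "complex ^ 'n::finite"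
  assumes c: "0 < c"
    and close: "\<And>\<theta> u. \<bar>hp \<theta> (charge_real Z' u) - hp \<theta> (charge_real Z u)\<bar> \<le> (c / 4) * norm u"
    and g: "\<And>i. g i \<in> auts (qcone Z c i)"
    and A: "\<And>i. A i \<in> sgrp Z' (ctr i) {mid i..<mid (i + 1)}"
    and E: "\<And>i. E i \<in> sgrp Z' (ctr i) {ctr i<..<ctr i + pi / 2} \<inter> sgrp Z' (ctr (i + 1)) {ctr i<..<ctr i + pi / 2}"
    and gE: "\<And>i. op_comp (g i) (E i) = op_comp (E (i - 1)) (A i)"
  shows "E i \<in> auts (qcone2 Z (c / 2) i)"
proof -
  have pi: "0 < pi"
    by (rule pi_gt_zero)
  have close': "\<bar>hp \<theta> (charge Z' \<gamma>) - hp \<theta> (charge Z \<gamma>)\<bar> \<le> (c / 4) * norm (rvec \<gamma>)" for \<theta> \<gamma>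
    using close by (simp add: charge_def)
  define JL where "JL i = {ctr i<..<mid (i + 1)}" for i
  define JU where "JU i = {mid (i + 1)..<ctr i + pi / 2}" for i
  define HL where "HL i = {ctr i - pi / 2<..<mid (i + 1)}" for i
  define KL where "KL i = {ctr i - pi / 2<..<mid i}" for i
  define KU where "KU i = {mid i..<ctr i + pi / 2}" for i
  define J where "J i = {ctr i<..<ctr i + pi / 2}" for i
  have J: "J i = JL i \<union> JU i" "J i = JU i \<union> JL i" "JL i \<inter> JU i = {}" "JU i \<inter> JL i = {}" for i
    using pi by (auto simp: J_def JL_def JU_def mid_Suc)
  have ints: "is_interval (J i)" "is_interval (JL i)" "is_interval (JU i)" "is_interval (HL i)"
    "is_interval (KL i)" "is_interval (KU i)" for i
    by (auto simp: J_def JL_def JU_def HL_def KL_def KU_def is_interval_1)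
  have H: "hpi (ctr i) = HL i \<union> JU i" "HL i \<inter> JU i = {}" "HL i \<subseteq> hpi (ctr i)" "JU i \<subseteq> hpi (ctr i)" for i
    using pi by (auto simp: hpi_def HL_def JU_def mid_Suc)
  have K: "hpi (ctr i) = KL i \<union> KU i" "KL i \<inter> KU i = {}" "KL i \<subseteq> hpi (ctr i)" "KU i \<subseteq> hpi (ctr i)" for i
    using pi by (auto simp: hpi_def KL_def KU_def mid_def)
  have Jhpi: "J i \<subseteq> hpi (ctr i)" "J i \<subseteq> hpi (ctr (i + 1))" for i
    using pi by (auto simp: J_def hpi_def ctr_Suc)
  have goodJ: "good (ctr i) (J i)" "good (ctr (i + 1)) (J i)" for i
    using Jhpi ints by (auto simp: good_def)
  have good: "good (ctr i) (HL i)" "good (ctr i) (JU i)" "good (ctr i) (KU i)" "good (ctr i) (JL i)" for i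
  proof -
    have "JL i \<subseteq> hpi (ctr i)"
      using J(1) [of i] Jhpi(1) [of i] by blast
    then show "good (ctr i) (HL i)" "good (ctr i) (JU i)" "good (ctr i) (KU i)" "good (ctr i) (JL i)"
      using H(3,4) [of i] K(4) [of i] by (simp_all add: good_def ints)
  qed
  have E': "E i \<in> sgrp Z' (ctr i) (J i) \<inter> sgrp Z' (ctr (i + 1)) (J i)" for i
    using E by (simp add: J_def)
  obtain x y where xy: "x \<in> sgrp Z' (ctr i) (JL i)" "x \<in> sgrp Z' (ctr (i + 1)) (JL i)"
    "y \<in> sgrp Z' (ctr i) (JU i)" "y \<in> sgrp Z' (ctr (i + 1)) (JU i)" "E i = op_comp x y"
    using sgrp_split [OF goodJ J(1,3) ints(2,3) E'] by blast
  obtain Q R where QR: "Q \<in> sgrp Z' (ctr i) (JU i)" "R \<in> sgrp Z' (ctr i) (JL i)" "E i = op_comp Q R"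
    using sgrp_split [OF goodJ J(2,4) ints(3,2) E'] by blast
  \<comment> \<open>Passing from \<open>Z\<close> to \<open>Z'\<close> costs \<open>c / 4\<close> of
    the constant, so at least \<open>c / 2\<close> is left.\<close>
  have sub': "qcone Z c i \<subseteq> pts Z' (ctr i) (c / 2) (hpi (ctr i))" for i
  proof
    fix \<gamma> assume "\<gamma> \<in> qcone Z c i"
    then have "\<gamma> \<noteq> 0" "c * norm (rvec \<gamma>) \<le> hp (ctr i) (charge Z \<gamma>)"
      by (auto simp: qcone_iff [OF c])
    moreover have "0 \<le> c * norm (rvec \<gamma>)"
      using c by simp
    ultimately have "\<gamma> \<noteq> 0 \<and> c / 2 * norm (rvec \<gamma>) \<le> hp (ctr i) (charge Z' \<gamma>)"
      using close' [of "ctr i" \<gamma>] by (intro conjI) (assumption, linarith)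
    then show "\<gamma> \<in> pts Z' (ctr i) (c / 2) (hpi (ctr i))"
      using qcone_iff [of "c / 2" \<gamma> Z' i] c by (simp add: qcone_def)
  qed
  have gsgrp: "g i \<in> sgrp Z' (ctr i) (hpi (ctr i))" for i
    using g [of i] auts_mono [OF sub'] c by (intro sgrpI [of "c / 2"]) auto
  have mono: "T \<in> sgrp Z' \<theta> Y" if "T \<in> sgrp Z' \<theta> X" "X \<subseteq> Y" for T \<theta> X Y
    using that sgrp_mono by blast
  have x_in: "x \<in> auts (qcone2 Z (c / 2) i)"
  proof -
    let ?i = "i + 1"
    have xK: "x \<in> sgrp Z' (ctr ?i) (KL ?i)"
      by (rule mono [OF xy(2)]) (use pi in \<open>auto simp: JL_def KL_def ctr_Suc\<close>)
    have yK: "y \<in> sgrp Z' (ctr ?i) (KU ?i)"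
      by (rule mono [OF xy(4)]) (use pi in \<open>auto simp: JU_def KU_def ctr_Suc\<close>)
    have AK: "A ?i \<in> sgrp Z' (ctr ?i) (KU ?i)"
      by (rule mono [OF A]) (unfold KU_def mid_Suc, use pi in auto)
    have EK: "E ?i \<in> sgrp Z' (ctr ?i) (KU ?i)"
      by (rule mono [of _ _ "J ?i"]) (use E' [of ?i] pi in \<open>auto simp: J_def KU_def mid_def\<close>)
    let ?F = "{g ?i, E ?i, x, y, A ?i}"
    have "?F \<subseteq> sgrp Z' (ctr ?i) (hpi (ctr ?i))"
      using gsgrp mono [OF xK K(3)] mono [OF yK K(4)] mono [OF AK K(4)] mono [OF EK K(4)] by simp
    then obtain e where e: "tame (pts Z' (ctr ?i) e (hpi (ctr ?i)))" "?F \<subseteq> auts (pts Z' (ctr ?i) e (hpi (ctr ?i)))"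
      using sgrp_tame [OF good_hpi, of ?F] by blast
    \<comment> \<open>\<open>g (i + 1)\<close> is \<open>x\<close> times
      \<open>y (A (i + 1)) (E (i + 1))^-1\<close>: the first factor lies before the bisector, all
      the others lie beyond it.\<close>
    have "g ?i = op_comp (op_comp (g ?i) (E ?i)) (op_inv (E ?i))"
      using e by (simp add: op_inv_cancel_right [OF e(1)])
    also have "\<dots> = op_comp x (op_comp (op_comp y (A ?i)) (op_inv (E ?i)))"
      using gE [of ?i] xy(5) e by (simp add: auts_assoc [OF e(1)] auts_comp [OF e(1)] op_inv_auts [OF e(1)])
    finally have eq: "op_comp x (op_comp (op_comp y (A ?i)) (op_inv (E ?i))) = g ?i"
      by simp
    have rest: "op_comp (op_comp y (A ?i)) (op_inv (E ?i)) \<in> sgrp Z' (ctr ?i) (KU ?i)"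
      by (intro sgrp_comp sgrp_inv good yK AK EK)
    have c2: "0 < c / 2"
      using c by simp
    have "x \<in> auts {\<gamma> \<in> qcone Z c ?i. charge Z' \<gamma> \<in> sector (KL ?i)}"
      by (rule restrict_factor(1) [OF good_hpi tame_qcone [OF c] sub' c2 ints(5) K(3) ints(6) K(4,1,2) xK rest])
         (simp add: eq g)
    then have "x \<in> auts ({\<gamma> \<in> qcone Z c ?i. charge Z' \<gamma> \<in> sector (KL ?i)} \<inter> {\<gamma>. charge Z' \<gamma> \<in> sector (JL i)})"
    proof -
      obtain e' where "x \<in> auts (pts Z' (ctr ?i) e' (JL i))"
        using xy(2) by (auto simp: sgrp_def)
      then have "x \<in> auts {\<gamma>. charge Z' \<gamma> \<in> sector (JL i)}"
        using auts_mono [of "pts Z' (ctr ?i) e' (JL i)" "{\<gamma>. charge Z' \<gamma> \<in> sector (JL i)}"] by (auto simp: pts_def)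
      then show ?thesis
        using \<open>x \<in> auts {\<gamma> \<in> qcone Z c ?i. charge Z' \<gamma> \<in> sector (KL ?i)}\<close> by (auto simp flip: auts_Int)
    qed
    \<comment> \<open>The cone of \<open>g (i + 1)\<close> bounds the functional at
      \<open>ctr (i + 1)\<close>, and before the bisector the one at \<open>ctr i\<close> is larger
      for \<open>Z'\<close>. Going to \<open>Z'\<close> and back costs \<open>c / 4\<close> twice,
      which leaves \<open>c / 2\<close>.\<close>
    moreover have "{\<gamma> \<in> qcone Z c ?i. charge Z' \<gamma> \<in> sector (KL ?i)} \<inter> {\<gamma>. charge Z' \<gamma> \<in> sector (JL i)} \<subseteq> qcone2 Z (c / 2) i"
    proof
      fix \<gamma> assume "\<gamma> \<in> {\<gamma> \<in> qcone Z c ?i. charge Z' \<gamma> \<in> sector (KL ?i)} \<inter> {\<gamma>. charge Z' \<gamma> \<in> sector (JL i)}"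
      then have \<gamma>: "\<gamma> \<noteq> 0" "c * norm (rvec \<gamma>) \<le> hp (ctr ?i) (charge Z \<gamma>)" "charge Z' \<gamma> \<in> sector (JL i)"
        by (auto simp: qcone_iff [OF c])
      have "JL i \<subseteq> {ctr i..<ctr i + pi / 4}"
        by (auto simp: JL_def mid_Suc)
      then have "hp (ctr ?i) (charge Z' \<gamma>) \<le> hp (ctr i) (charge Z' \<gamma>)"
        using \<gamma>(3) sector_mono by (intro hp_ctr_Suc_le [of _ "ctr i"]) blast+
      moreover have "0 \<le> c * norm (rvec \<gamma>)"
        using c by simp
      ultimately show "\<gamma> \<in> qcone2 Z (c / 2) i"
        using \<gamma> close' [of "ctr i" \<gamma>] close' [of "ctr ?i" \<gamma>] c2
        unfolding qcone2_def Int_iff qcone_iff [OF c2] by (intro conjI; (assumption | linarith))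
    qed
    ultimately show ?thesis
      using auts_mono by blast
  qed
  have Qinv_in: "op_inv Q \<in> auts (qcone2 Z (c / 2) i)"
  proof -
    have QH: "Q \<in> sgrp Z' (ctr i) (JU i)"
      by (rule QR(1))
    have RH: "R \<in> sgrp Z' (ctr i) (HL i)"
      by (rule mono [OF QR(2)]) (rule subsetI, unfold JL_def HL_def greaterThanLessThan_iff, use pi in linarith)
    have AH: "A i \<in> sgrp Z' (ctr i) (HL i)"
      by (rule mono [OF A]) (rule subsetI, unfold HL_def mid_def greaterThanLessThan_iff atLeastLessThan_iff, use pi in linarith)
    have EH: "E (i - 1) \<in> sgrp Z' (ctr i) (HL i)"
    proof (rule mono [of _ _ "J (i - 1)"])
      show "E (i - 1) \<in> sgrp Z' (ctr i) (J (i - 1))"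
        using E' [of "i - 1"] by simp
      show "J (i - 1) \<subseteq> HL i"
      proof -
        have "ctr (i - 1) = ctr i - pi / 2"
          using ctr_Suc [of "i - 1"] by simp
        then show ?thesis
          using pi unfolding J_def HL_def mid_Suc by (intro subsetI) (unfold greaterThanLessThan_iff, linarith)
      qed
    qed
    let ?F = "{g i, E (i - 1), Q, R, A i}"
    have "?F \<subseteq> sgrp Z' (ctr i) (hpi (ctr i))"
      using gsgrp mono [OF QH H(4)] mono [OF RH H(3)] mono [OF AH H(3)] mono [OF EH H(3)] by simp
    then obtain e where e: "tame (pts Z' (ctr i) e (hpi (ctr i)))" "?F \<subseteq> auts (pts Z' (ctr i) e (hpi (ctr i)))"
      using sgrp_tame [OF good_hpi, of ?F] by blast
    note rules = auts_assoc [OF e(1)] auts_comp [OF e(1)] op_inv_auts [OF e(1)] op_inv_cancel_left' [OF e(1)]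
      op_inv_right [OF e(1)] auts_id_right [OF e(1)]
    \<comment> \<open>Symmetrically \<open>g i = (E (i - 1) (A i) R^-1) Q^-1\<close>, where only
      \<open>Q^-1\<close> lies beyond the bisector.\<close>
    have "g i = op_comp (op_comp (g i) (op_comp Q R)) (op_comp (op_inv R) (op_inv Q))"
      using e by (simp add: rules)
    also have "op_comp (g i) (op_comp Q R) = op_comp (E (i - 1)) (A i)"
      using gE [of i] QR(3) by simp
    also have "op_comp (op_comp (E (i - 1)) (A i)) (op_comp (op_inv R) (op_inv Q))
        = op_comp (op_comp (op_comp (E (i - 1)) (A i)) (op_inv R)) (op_inv Q)"
      using e by (simp add: rules)
    finally have eq: "op_comp (op_comp (op_comp (E (i - 1)) (A i)) (op_inv R)) (op_inv Q) = g i"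
      by simp
    have rest: "op_comp (op_comp (E (i - 1)) (A i)) (op_inv R) \<in> sgrp Z' (ctr i) (HL i)"
      by (intro sgrp_comp sgrp_inv good EH AH RH)
    have Qi: "op_inv Q \<in> sgrp Z' (ctr i) (JU i)"
      by (intro sgrp_inv good QH)
    have c2: "0 < c / 2"
      using c by simp
    have "op_inv Q \<in> auts {\<gamma> \<in> qcone Z c i. charge Z' \<gamma> \<in> sector (JU i)}"
      by (rule restrict_factor(2) [OF good_hpi tame_qcone [OF c] sub' c2 ints(4) H(3) ints(3) H(4,1,2) rest Qi])
         (simp add: eq g)
    moreover have "{\<gamma> \<in> qcone Z c i. charge Z' \<gamma> \<in> sector (JU i)} \<subseteq> qcone2 Z (c / 2) i"
    proof
      fix \<gamma> assume "\<gamma> \<in> {\<gamma> \<in> qcone Z c i. charge Z' \<gamma> \<in> sector (JU i)}"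
      then have \<gamma>: "\<gamma> \<noteq> 0" "c * norm (rvec \<gamma>) \<le> hp (ctr i) (charge Z \<gamma>)" "charge Z' \<gamma> \<in> sector (JU i)"
        by (auto simp: qcone_iff [OF c])
      have "hp (ctr i) (charge Z' \<gamma>) \<le> hp (ctr (i + 1)) (charge Z' \<gamma>)"
        using \<gamma>(3) by (intro hp_ctr_le_Suc) (simp add: JU_def mid_Suc)
      moreover have "0 \<le> c * norm (rvec \<gamma>)"
        using c by simp
      ultimately show "\<gamma> \<in> qcone2 Z (c / 2) i"
        using \<gamma> close' [of "ctr i" \<gamma>] close' [of "ctr (i + 1)" \<gamma>] c2
        unfolding qcone2_def Int_iff qcone_iff [OF c2] by (intro conjI; (assumption | linarith))
    qed
    ultimately show ?thesis
      using auts_mono by blast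
  qed
  have c2: "0 < c / 2" and c4: "0 < c / 4"
    using c by simp_all
  note t = tame_qcone2 [OF c2, of Z i]
  have J_iff: "sector (J i) = {z. 0 < hp (ctr i) z \<and> 0 < hp (ctr (i + 1)) z}"
    using lifted_cover_Int [OF quad_cover_lifted, of i] by (auto simp: quad_cover_eq J_def ctr_Suc)
  have sub: "qcone2 Z (c / 2) i \<subseteq> pts Z' (ctr i) (c / 4) (J i)"
  proof
    fix \<gamma> assume "\<gamma> \<in> qcone2 Z (c / 2) i"
    then have \<gamma>: "\<gamma> \<noteq> 0" "c / 2 * norm (rvec \<gamma>) \<le> hp (ctr i) (charge Z \<gamma>)"
      "c / 2 * norm (rvec \<gamma>) \<le> hp (ctr (i + 1)) (charge Z \<gamma>)"
      unfolding qcone2_def Int_iff qcone_iff [OF c2] by blast+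
    have "0 < c * norm (rvec \<gamma>)"
      using c \<gamma>(1) by (simp add: rvec_eq_0)
    then show "\<gamma> \<in> pts Z' (ctr i) (c / 4) (J i)"
      using \<gamma> close' [of "ctr i" \<gamma>] close' [of "ctr (i + 1)" \<gamma>]
      unfolding pts_def J_iff mem_Collect_eq by (intro conjI; linarith)
  qed
  have JLU: "JL i \<subseteq> J i" "JU i \<subseteq> J i"
    using J by auto
  let ?F = "{x, y, Q, R}"
  have "?F \<subseteq> sgrp Z' (ctr i) (J i)"
    using mono [OF xy(1) JLU(1)] mono [OF xy(3) JLU(2)] mono [OF QR(1) JLU(2)] mono [OF QR(2) JLU(1)] by simp
  then obtain e where e: "tame (pts Z' (ctr i) e (J i))" "?F \<subseteq> auts (pts Z' (ctr i) e (J i))"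
    using sgrp_tame [OF goodJ(1), of ?F] by blast
  note rules = auts_assoc [OF e(1)] auts_comp [OF e(1)] op_inv_auts [OF e(1)] op_inv_cancel_left [OF e(1)]
    op_inv_right [OF e(1)] auts_id_right [OF e(1)]
  have eq: "op_comp Q R = op_comp x y"
    using xy(5) QR(3) by simp
  \<comment> \<open>The two factorisations of \<open>E i\<close> give
    \<open>R y^-1 = Q^-1 x\<close>, whose support is now known. Factoring it along the bisector
    bounds \<open>R\<close>, and together with \<open>Q\<close> all of \<open>E i\<close>.\<close>
  have "op_comp R (op_inv y) = op_comp (op_inv Q) (op_comp (op_comp Q R) (op_inv y))"
    using e(2) by (simp add: rules)
  also have "\<dots> = op_comp (op_inv Q) x"
    unfolding eq using e(2) by (simp add: rules)
  finally have Ry: "op_comp R (op_inv y) \<in> auts (qcone2 Z (c / 2) i)"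
    using auts_comp [OF t Qinv_in x_in] by simp
  have yi: "op_inv y \<in> sgrp Z' (ctr i) (JU i)"
    by (intro sgrp_inv good xy(3))
  have "R \<in> auts {\<gamma> \<in> qcone2 Z (c / 2) i. charge Z' \<gamma> \<in> sector (JL i)}"
    by (rule restrict_factor(1) [OF goodJ(1) t sub c4 ints(2) JLU(1) ints(3) JLU(2) J(1,3) QR(2) yi Ry])
  then have R_in: "R \<in> auts (qcone2 Z (c / 2) i)"
    using auts_mono [of "{\<gamma> \<in> qcone2 Z (c / 2) i. charge Z' \<gamma> \<in> sector (JL i)}" "qcone2 Z (c / 2) i"] by blast
  have "op_inv (op_inv Q) = Q"
    using op_inv_op_inv [OF e(1)] e(2) by simp
  then have "Q \<in> auts (qcone2 Z (c / 2) i)"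
    using op_inv_auts [OF t Qinv_in] by simp
  then show ?thesis
    unfolding QR(3) using R_in by (rule auts_comp [OF t])
qed

text \<open>The representative that witnesses analyticity may belong to any cover; passing through
  the ordered products over sectors transfers analyticity to the standard pieces.\<close>

lemma piece_analytic:
  fixes \<sigma> :: "'n::finite stability_data"
  assumes "\<sigma> \<in> Stab_an"
  shows "analytic_element (piece \<sigma> i)"
proof -
  have \<sigma>: "\<sigma> \<in> Stab"
    using assms by (simp add: Stab_an_def)
  obtain m W h where W: "open_cyclic_cover m W" and rep: "representative \<sigma> m W h"
    and an: "\<And>i. analytic_element (h i)"
    using assms unfolding Stab_an_def by blast
  obtain S \<zeta> where S: "sector_decomposition m W S" and \<zeta>: "\<And>i. \<zeta> i \<in> lie_sector (fst \<sigma>) (W i \<inter> W (i + 1))"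
    and h: "h = gauge_act \<zeta> (\<lambda>i. A_sector \<sigma> (S i))"
    using rep unfolding representative_def by blast
  obtain lo hi where L: "lifted_cover m W lo hi"
    using open_cyclic_cover_lifted [OF W] by blast
  obtain b t where bt: "\<And>i. A_sector \<sigma> (S i) = A_sector \<sigma> (lower_cut b (t (i + 1)) - lower_cut b (t i))"
    and t: "\<And>i. t i < t (i + 1)" "\<And>i. t (i + int m) = t i + 2 * pi" "\<And>i. lo i < t i" "\<And>i. t (i + 1) < hi i"
    using decomposition_lift [OF L S] by blast
  have "analytic_element (gauge_act \<zeta> (\<lambda>i. A_sector \<sigma> (lower_cut b (t (i + 1)) - lower_cut b (t i))) i)" for i
    using an [of i] by (simp add: h bt)
  then have "analytic_element (A_sector \<sigma> (lower_cut b (t (j + 1)) - lower_cut b (t j)))" for j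
    by (rule analytic_gauge [OF \<sigma> L t \<zeta>])
  moreover have "t (i + 1) < t i + pi" for i
  proof -
    have "hi i \<le> lo i + pi"
      using L by (simp add: lifted_cover_def)
    then show ?thesis
      using t(3,4) [of i] by linarith
  qed
  moreover have "well_inside (ctr i) {mid i..<mid (i + 1)}"
    by (rule well_inside_subset [OF well_inside_Icc [OF mid_hpi]]) auto
  moreover have "is_interval {mid i..<mid (i + 1)}"
    by (auto simp: is_interval_1)
  ultimately show ?thesis
    using analytic_A_sector [of \<sigma> t m b, OF \<sigma> t(1,2)] by blast
qed

section \<open>Cones over the four half-planes and gauge transformations between them\<close>

lemma half_cone_qcone: "0 < c \<Longrightarrow> lie_cone (half_cone Z c {ctr i}) = lie_on (qcone Z c i)"
  by (simp add: half_cone_lattice qcone_def)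

lemma half_cone_qcone2: "0 < c \<Longrightarrow> lie_cone (half_cone Z c {ctr i, ctr (i + 1)}) = lie_on (qcone2 Z c i)"
  by (simp add: half_cone_lattice qcone_def qcone2_def)

lemma group_cone_qcone: "0 < c \<Longrightarrow> group_cone (half_cone Z c {ctr i}) = auts (qcone Z c i)"
  by (simp add: group_cone_def half_cone_qcone auts_eq [OF tame_qcone])

lemma half_cone_over_quad: "0 < c \<Longrightarrow> half_cone Z c {ctr i} \<in> cones_over Z (quad_cover i)"
  by (rule half_cone_cones_over) (auto simp: quad_cover_eq)

lemma half_cone_over_quad2:
  "0 < c \<Longrightarrow> half_cone Z c {ctr i, ctr (i + 1)} \<in> cones_over Z (quad_cover i \<inter> quad_cover (i + 1))"
  by (rule half_cone_cones_over) (auto simp: quad_cover_eq)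

text \<open>The constant \<open>c\<close> for \<open>Z\<close> leaves a margin that a perturbation
  by \<open>c / 4\<close> cannot exhaust. This is what makes the set of nearby data with a common
  representative a basic open set.\<close>

lemma half_cone_over_nearby:
  assumes c: "0 < c"
    and close: "\<And>\<theta> u. \<bar>hp \<theta> (charge_real Z' u) - hp \<theta> (charge_real Z u)\<bar> \<le> (c / 4) * norm u"
  shows "half_cone Z c {ctr i} \<in> cones_over Z' (quad_cover i)"
proof -
  let ?C = "half_cone Z c {ctr i}"
  have strict: "strict_closed_cone ?C" and zero: "0 \<in> ?C"
    using half_cone_over_quad [OF c, of Z i] by (auto simp: cones_over_def)
  have pos: "0 < hp (ctr i) (charge_real Z' u)" if "u \<in> ?C" "u \<noteq> 0" for u
  proof -
    have "0 < c * norm u"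
      using c that by simp
    moreover have "c * norm u \<le> hp (ctr i) (charge_real Z u)"
      using that by (simp add: half_cone_def)
    ultimately show ?thesis
      using close [of "ctr i" u] by linarith
  qed
  then have "charge_real Z' ` (?C - {0}) \<subseteq> quad_cover i"
    by (auto simp: quad_cover_eq)
  moreover have "?C \<inter> {u. charge_real Z' u = 0} = {0}"
    using pos zero by (force simp: hp_def)
  ultimately show ?thesis
    using strict by (simp add: cones_over_def)
qed

text \<open>A representative is tied to a decomposition with arbitrary boundaries and of either
  semiclosed kind. Composing its gauge factors with \<open>recut\<close> moves the boundaries to the
  bisectors.\<close>

lemma quad_gauge_exists:
  fixes \<tau> :: "'n::finite stability_data"
  assumes \<tau>: "\<tau> \<in> Stab" and rep: "representative \<tau> 4 quad_cover g"
  shows "\<exists>E. (\<forall>i. E (i + 4) = E i) \<and>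
    (\<forall>i. E i \<in> sgrp (fst \<tau>) (ctr i) {ctr i<..<ctr i + pi / 2} \<inter> sgrp (fst \<tau>) (ctr (i + 1)) {ctr i<..<ctr i + pi / 2}) \<and>
    (\<forall>i. op_comp (g i) (E i) = op_comp (E (i - 1)) (piece \<tau> i))"
proof -
  obtain S \<eta> where S: "sector_decomposition 4 quad_cover S" and cyc: "cyclic_family 4 \<eta>"
    and \<eta>: "\<And>i. \<eta> i \<in> lie_sector (fst \<tau>) (quad_cover i \<inter> quad_cover (i + 1))"
    and g: "g = gauge_act \<eta> (\<lambda>i. A_sector \<tau> (S i))"
    using rep unfolding representative_def by blast
  obtain b t where bt: "\<And>i. A_sector \<tau> (S i) = A_sector \<tau> (lower_cut b (t (i + 1)) - lower_cut b (t i))"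
    and t: "\<And>i. t i < t (i + 1)" "\<And>i. t (i + int 4) = t i + 2 * pi"
      "\<And>i. ctr i - pi / 2 < t i" "\<And>i. t (i + 1) < ctr i + pi / 2"
    using decomposition_lift [OF quad_cover_lifted S] by blast
  have pi: "0 < pi"
    by (rule pi_gt_zero)
  define J where "J i = {ctr i<..<ctr i + pi / 2}" for i
  define F where "F i = vf_exp (\<eta> i)" for i
  define X where "X i = recut \<tau> b (t i) (mid i)" for i
  define E where "E i = op_comp (F i) (X (i + 1))" for i
  have Jhpi: "J i \<subseteq> hpi (ctr i)" "J i \<subseteq> hpi (ctr (i + 1))" for i
    using pi by (auto simp: J_def hpi_def ctr_Suc)
  have iJ: "is_interval (J i)" for i
    by (auto simp: J_def is_interval_1)
  have goodJ: "good (ctr i) (J i)" "good (ctr (i + 1)) (J i)" for i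
    using Jhpi iJ by (auto simp: good_def)
  have VJ: "quad_cover i \<inter> quad_cover (i + 1) = sector (J i)" for i
    using lifted_cover_Int [OF quad_cover_lifted, of i] by (simp add: J_def ctr_Suc)
  have F: "F i \<in> sgrp (fst \<tau>) (ctr i) (J i)" "F i \<in> sgrp (fst \<tau>) (ctr (i + 1)) (J i)"
    and F_inv: "vf_exp (\<lambda>\<gamma>. - \<eta> i \<gamma>) = op_inv (F i)" for i
    using vf_exp_sgrp [OF \<eta> [of i, unfolded VJ] goodJ(1)] vf_exp_sgrp [OF \<eta> [of i, unfolded VJ] goodJ(2)]
    by (simp_all add: F_def)
  have mt: "mid (i + 1) \<in> J i" "t (i + 1) \<in> J i" for i
  proof -
    show "mid (i + 1) \<in> J i"
      using pi unfolding mid_Suc J_def greaterThanLessThan_iff by linarith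
    show "t (i + 1) \<in> J i"
      using t(3) [of "i + 1"] t(4) [of i] by (simp add: J_def ctr_Suc)
  qed
  have X: "X (i + 1) \<in> sgrp (fst \<tau>) (ctr i) (J i)" "X (i + 1) \<in> sgrp (fst \<tau>) (ctr (i + 1)) (J i)" for i
    unfolding X_def by (intro recut_sgrp [OF \<tau>] goodJ mt)+
  have E: "E i \<in> sgrp (fst \<tau>) (ctr i) (J i)" "E i \<in> sgrp (fst \<tau>) (ctr (i + 1)) (J i)" for i
    unfolding E_def by (intro sgrp_comp goodJ F X)+
  have E4: "E (i + 4) = E i" for i
  proof -
    have "F (i + 4) = F i"
      using cyc by (simp add: F_def cyclic_family_def)
    moreover have "X (i + 1 + 4) = X (i + 1)"
      unfolding X_def mid_4 using t(2) [of "i + 1"] recut_shift by simp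
    ultimately show ?thesis
      by (simp add: E_def add.commute add.left_commute)
  qed
  have gE: "op_comp (g i) (E i) = op_comp (E (i - 1)) (piece \<tau> i)" for i
  proof -
    let ?A = "A_sector \<tau> (lower_cut b (t (i + 1)) - lower_cut b (t i))"
    have J': "J (i - 1) \<subseteq> hpi (ctr i)"
      using Jhpi(2) [of "i - 1"] by simp
    have in1: "T \<in> sgrp (fst \<tau>) (ctr i) (hpi (ctr i))" if "T \<in> sgrp (fst \<tau>) (ctr i) Y" "Y \<subseteq> hpi (ctr i)" for T Y
      using that sgrp_mono by blast
    have ends: "t i \<in> hpi (ctr i)" "t (i + 1) \<in> hpi (ctr i)"
      using mt(2) [of "i - 1"] mt(2) [of i] J' Jhpi(1) [of i] by auto
    have Fi: "F (i - 1) \<in> sgrp (fst \<tau>) (ctr i) (hpi (ctr i))" and Xi: "X i \<in> sgrp (fst \<tau>) (ctr i) (hpi (ctr i))"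
      using F(2) [of "i - 1"] X(2) [of "i - 1"] J' by (simp_all add: in1)
    have "lower_cut b (t (i + 1)) - lower_cut b (t i) \<subseteq> hpi (ctr i)"
      using ends by (auto simp: lower_cut_def hpi_def split: if_splits)
    then have Ai: "?A \<in> sgrp (fst \<tau>) (ctr i) (hpi (ctr i))"
      using A_sector_piece [OF \<tau> ends] in1 by blast
    have "{mid i..<mid (i + 1)} \<subseteq> hpi (ctr i)"
      using mid_hpi [of i] by (auto simp: hpi_def)
    then have Pi: "piece \<tau> i \<in> sgrp (fst \<tau>) (ctr i) (hpi (ctr i))"
      using piece_sgrp [OF \<tau>] in1 by blast
    let ?F = "{F (i - 1), F i, X i, X (i + 1), ?A, piece \<tau> i}"
    have "?F \<subseteq> sgrp (fst \<tau>) (ctr i) (hpi (ctr i))"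
      using Fi Xi Ai Pi in1 [OF F(1) Jhpi(1)] in1 [OF X(1) Jhpi(1)] by simp
    then obtain e where e: "tame (pts (fst \<tau>) (ctr i) e (hpi (ctr i)))" "?F \<subseteq> auts (pts (fst \<tau>) (ctr i) e (hpi (ctr i)))"
      using sgrp_tame [OF good_hpi, of ?F] by blast
    note rules = auts_assoc [OF e(1)] auts_comp [OF e(1)] op_inv_auts [OF e(1)] op_inv_cancel_left [OF e(1)]
    have commute: "op_comp ?A (X (i + 1)) = op_comp (X i) (piece \<tau> i)"
      unfolding X_def piece_cut
    proof (rule recut_commute [OF \<tau>])
      let ?a = "min (t i) (mid i)" and ?a' = "max (t (i + 1)) (mid (i + 1))"
      show "well_inside (ctr i) {?a..?a'}"
        using ends mid_hpi [of i] by (intro well_inside_Icc) (auto simp: min_def max_def)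
      have "mid i \<le> mid (i + 1)"
        using pi unfolding mid_def ctr_Suc by linarith
      then show "t i \<in> {?a..?a'}" "t (i + 1) \<in> {?a..?a'}" "mid i \<in> {?a..?a'}" "mid (i + 1) \<in> {?a..?a'}" "mid i \<le> mid (i + 1)"
        using t(1) [of i] by auto
      show "t i \<le> t (i + 1)"
        using t(1) [of i] by simp
    qed
    have "op_comp (g i) (E i) = op_comp (op_comp (F (i - 1)) (op_comp ?A (op_inv (F i)))) (op_comp (F i) (X (i + 1)))"
      by (simp only: g gauge_act_def bt F_inv E_def) (simp only: F_def)
    also have "\<dots> = op_comp (F (i - 1)) (op_comp ?A (X (i + 1)))"
      using e(2) by (simp add: rules)
    also have "\<dots> = op_comp (op_comp (F (i - 1)) (X i)) (piece \<tau> i)"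
      unfolding commute using e(2) by (simp add: rules)
    also have "\<dots> = op_comp (E (i - 1)) (piece \<tau> i)"
      by (simp add: E_def)
    finally show ?thesis .
  qed
  show ?thesis
    using E E4 gE unfolding J_def by (intro exI [of _ E]) blast
qed

text \<open>Conversely, operators on the overlaps are turned back into the vector fields demanded by
  \<open>gauge_act\<close>; this uses that the exponential is onto.\<close>

lemma quad_representative:
  fixes \<sigma> :: "'n::finite stability_data"
  assumes c: "0 < c" and g: "\<And>i. piece \<sigma> i \<in> auts (qcone (fst \<sigma>) c i)"
    and E: "\<And>i. E i \<in> auts (qcone2 (fst \<sigma>) c i)" "\<And>i. E (i + 4) = E i"
    and A: "\<And>i. op_comp (piece \<sigma> i) (E i) = op_comp (E (i - 1)) (A i)" "\<And>i. A i \<in> auts (qcone (fst \<sigma>) c' i)"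
    and A4: "\<And>i. A (i + 4) = A i" and c': "0 < c'"
  shows "representative \<sigma> 4 quad_cover A"
proof -
  define Z where "Z = fst \<sigma>"
  \<comment> \<open>\<open>gauge_act\<close> has the exponential of \<open>\<eta> (i - 1)\<close> on
    the left, so \<open>\<eta> i\<close> has to be a logarithm of the inverse of \<open>E i\<close>.
    The choice depends only on 4-periodic data, hence is itself 4-periodic.\<close>
  define \<eta> where "\<eta> i = (SOME \<xi>. \<xi> \<in> lie_on (qcone2 Z c i) \<and> vf_exp \<xi> = op_inv (E i))" for i
  have t2: "tame (qcone2 Z c i)" for i
    by (rule tame_qcone2 [OF c])
  have EZ: "E i \<in> auts (qcone2 Z c i)" for i
    using E(1) by (simp add: Z_def)
  have "\<exists>\<xi>. \<xi> \<in> lie_on (qcone2 Z c i) \<and> vf_exp \<xi> = op_inv (E i)" for i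
    using op_inv_auts [OF t2 EZ, of i] unfolding auts_eq [OF t2] by auto
  then have \<eta>: "\<eta> i \<in> lie_on (qcone2 Z c i)" "vf_exp (\<eta> i) = op_inv (E i)" for i
    unfolding \<eta>_def by (metis (mono_tags, lifting) someI_ex)+
  have \<eta>_neg: "vf_exp (\<lambda>\<gamma>. - \<eta> i \<gamma>) = E i" for i
    unfolding vf_exp_uminus_inv [OF t2 \<eta>(1)] \<eta>(2) by (rule op_inv_op_inv [OF t2 EZ])
  have A_eq: "A i = gauge_act \<eta> (\<lambda>i. piece \<sigma> i) i" for i
  proof -
    define e where "e = min c c'"
    have e: "0 < e" "e \<le> c" "e \<le> c'"
      using c c' by (auto simp: e_def)
    have te: "tame (qcone Z e i)"
      by (rule tame_qcone [OF e(1)])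
    have "qcone2 Z c i \<subseteq> qcone Z e i" "qcone2 Z c (i - 1) \<subseteq> qcone Z e i"
      using qcone2_sub [of Z c i] qcone_mono [OF e(2), of Z i] by auto
    then have "E i \<in> auts (qcone Z e i)" "E (i - 1) \<in> auts (qcone Z e i)"
      using EZ auts_mono by blast+
    moreover have "A i \<in> auts (qcone Z e i)"
      using A(2) auts_mono [OF qcone_mono [OF e(3)]] by (auto simp: Z_def)
    ultimately show ?thesis
      by (simp add: gauge_act_def \<eta>(2) \<eta>_neg A(1) op_inv_cancel_left [OF te])
  qed
  show ?thesis
    unfolding representative_def
  proof (intro conjI allI exI)
    show "cyclic_family 4 A"
      by (simp add: cyclic_family_def A4)
    show "A i \<in> group_sector (fst \<sigma>) (quad_cover i)" for i
      using A(2) [of i] half_cone_over_quad [OF c', of "fst \<sigma>" i]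
      unfolding group_sector_def group_cone_qcone [OF c', symmetric] by blast
    show "sector_decomposition 4 quad_cover (\<lambda>i. {mid i..<mid (i + 1)})"
      by (rule quad_decomposition)
    show "cyclic_family 4 \<eta>"
      by (simp add: cyclic_family_def \<eta>_def qcone2_4 E(2))
    show "\<eta> i \<in> lie_sector (fst \<sigma>) (quad_cover i \<inter> quad_cover (i + 1))" for i
      using \<eta>(1) [of i] half_cone_over_quad2 [OF c, of "fst \<sigma>" i]
      unfolding lie_sector_def half_cone_qcone2 [OF c, symmetric] by (auto simp: Z_def)
    show "A = gauge_act \<eta> (\<lambda>i. A_sector \<sigma> {mid i..<mid (i + 1)})"
      by (rule ext) (rule A_eq)
  qed
qed

theorem proposition3p5p2:
  fixes \<sigma> :: "'n::finite stability_data"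
  assumes "\<sigma> \<in> Stab"
    and "\<sigma> \<in> Stab_topology closure_of Stab_an"
  shows "\<sigma> \<in> Stab_an"
proof -
  define Z where "Z = fst \<sigma>"
  obtain c where c: "0 < c" and g: "\<And>i. piece \<sigma> i \<in> auts (qcone Z c i)"
    using piece_qcone [OF assms(1)] unfolding Z_def by blast
  have c2: "0 < c / 2" "0 < c / 4"
    using c by simp_all
  obtain U where U: "open U" "Z \<in> U"
    and close: "\<And>Z' \<theta> u. Z' \<in> U \<Longrightarrow> \<bar>hp \<theta> (charge_real Z' u) - hp \<theta> (charge_real Z u)\<bar> \<le> (c / 4) * norm u"
    using charge_close [OF c2(2), of Z] by blast
  \<comment> \<open>The nearby stability data sharing the representative of \<sigma> that consists
    of its own ordered products.\<close>
  define N where "N = {\<tau> \<in> Stab. fst \<tau> \<in> U \<and> representative \<tau> 4 quad_cover (\<lambda>i. piece \<sigma> i)}"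
  have tq: "tame (qcone2 Z c i)" for i
    by (rule tame_qcone2 [OF c])
  have g4: "cyclic_family 4 (\<lambda>i. piece \<sigma> i)"
    using piece_4 [of \<sigma>] by (simp add: cyclic_family_def)
  have "representative \<sigma> 4 quad_cover (\<lambda>i. piece \<sigma> i)"
  proof (rule quad_representative [where E = "\<lambda>_. op_id" and c = c and c' = c])
    show "op_comp (piece \<sigma> i) op_id = op_comp op_id (piece \<sigma> i)" for i
      using auts_id_left [OF tame_qcone [OF c] g] auts_id_right [OF tame_qcone [OF c] g] by simp
    show "piece \<sigma> (i + 4) = piece \<sigma> i" for i
      by (rule piece_4)
  qed (use c g in \<open>simp_all add: Z_def\<close>)
  then have "\<sigma> \<in> N"
    using assms(1) U by (simp add: N_def Z_def)
  moreover have "openin Stab_topology N"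
    unfolding Stab_topology_def
  proof (rule topology_generated_by_Basis)
    have "cyclic_family 4 (\<lambda>i. half_cone Z c {ctr i})"
      by (simp add: cyclic_family_def half_cone_def hp_ctr_4)
    moreover have "piece \<sigma> i \<in> group_cone (half_cone Z c {ctr i})" for i
      using g by (simp add: group_cone_qcone [OF c])
    moreover have "half_cone Z c {ctr i} \<in> cones_over Z' (quad_cover i)" if "Z' \<in> U" for i Z'
      by (rule half_cone_over_nearby [OF c close [OF that]])
    ultimately have C: "\<exists>C. cyclic_family 4 C \<and> (\<forall>i. piece \<sigma> i \<in> group_cone (C i) \<and> (\<forall>Z'\<in>U. C i \<in> cones_over Z' (quad_cover i)))"
      by blast
    show "N \<in> basic_opens"
      unfolding basic_opens_def
      by (rule CollectI, rule exI, rule exI, rule exI, rule exI, intro conjI, rule N_def)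
         (fact U(1) quad_cover_cyclic g4 C)+
  qed
  ultimately obtain \<tau> where "\<tau> \<in> Stab_an" "\<tau> \<in> N"
    using assms(2) unfolding in_closure_of by blast
  then have \<tau>: "\<tau> \<in> Stab_an" "\<tau> \<in> Stab" "fst \<tau> \<in> U"
    and rep: "representative \<tau> 4 quad_cover (\<lambda>i. piece \<sigma> i)"
    by (simp_all add: N_def)
  obtain E where E4: "\<And>i. E (i + 4) = E i"
    and E: "\<And>i. E i \<in> sgrp (fst \<tau>) (ctr i) {ctr i<..<ctr i + pi / 2} \<inter> sgrp (fst \<tau>) (ctr (i + 1)) {ctr i<..<ctr i + pi / 2}"
    and gE: "\<And>i. op_comp (piece \<sigma> i) (E i) = op_comp (E (i - 1)) (piece \<tau> i)"
    using quad_gauge_exists [OF \<tau>(2) rep] by blast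
  have EZ: "E i \<in> auts (qcone2 Z (c / 2) i)" for i
    by (rule gauge_support [OF c close [OF \<tau>(3)] g piece_sgrp [OF \<tau>(2)] E gE])
  have gZ: "piece \<sigma> i \<in> auts (qcone Z (c / 2) i)" for i
    using g auts_mono [OF qcone_mono [of "c / 2" c]] c by auto
  \<comment> \<open>\<open>piece \<tau> i\<close> equals
    \<open>E (i - 1)^-1 (piece \<sigma> i) (E i)\<close>, and all three factors are supported in
    cones admissible for \<open>Z\<close>.\<close>
  have "piece \<tau> i \<in> auts (qcone Z (c / 2) i)" for i
  proof -
    note t = tame_qcone [OF c2(1), of Z i]
    have Ei: "E i \<in> auts (qcone Z (c / 2) i)" "E (i - 1) \<in> auts (qcone Z (c / 2) i)"
      using EZ [of i] EZ [of "i - 1"] auts_mono [OF qcone2_sub(1)] auts_mono [OF qcone2_sub(2)] by blast+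
    have E': "E (i - 1) \<in> sgrp (fst \<tau>) (ctr i) (hpi (ctr i))"
    proof -
      have "{ctr (i - 1)<..<ctr (i - 1) + pi / 2} \<subseteq> hpi (ctr i)"
        using ctr_Suc [of "i - 1"] pi_gt_zero by (auto simp: hpi_def)
      then show ?thesis
        by (rule subsetD [OF sgrp_mono]) (use E [of "i - 1"] in simp)
    qed
    have "{mid i..<mid (i + 1)} \<subseteq> hpi (ctr i)"
      using mid_hpi [of i] by (auto simp: hpi_def)
    then have P': "piece \<tau> i \<in> sgrp (fst \<tau>) (ctr i) (hpi (ctr i))"
      using piece_sgrp [OF \<tau>(2)] sgrp_mono by blast
    let ?F = "{E (i - 1), piece \<tau> i}"
    obtain e where "tame (pts (fst \<tau>) (ctr i) e (hpi (ctr i)))" "?F \<subseteq> auts (pts (fst \<tau>) (ctr i) e (hpi (ctr i)))"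
      using sgrp_tame [OF good_hpi, of ?F] E' P' by blast
    then have "piece \<tau> i = op_comp (op_inv (E (i - 1))) (op_comp (E (i - 1)) (piece \<tau> i))"
      by (intro op_inv_cancel_left [symmetric]) auto
    then have "piece \<tau> i = op_comp (op_inv (E (i - 1))) (op_comp (piece \<sigma> i) (E i))"
      by (simp only: gE)
    moreover have "op_comp (op_inv (E (i - 1))) (op_comp (piece \<sigma> i) (E i)) \<in> auts (qcone Z (c / 2) i)"
      by (intro auts_comp op_inv_auts t Ei gZ)
    ultimately show ?thesis
      by simp
  qed
  \<comment> \<open>The same \<open>E\<close> leads from the products of \<sigma> to those of
    \<tau>, now as a gauge transformation with respect to the charge of \<sigma>.\<close>
  then have "representative \<sigma> 4 quad_cover (\<lambda>i. piece \<tau> i)"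
    by (intro quad_representative [OF c2(1) gZ [unfolded Z_def] EZ [unfolded Z_def] E4 gE _ piece_4 c2(1)])
       (simp add: Z_def)
  then show ?thesis
    using assms(1) quad_cover_cyclic piece_analytic [OF \<tau>(1)] unfolding Stab_an_def by blast
qed

end
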